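(* For $w\in\mathfrak{S}_n$, the singular locus of the Schubert variety $X_w\subseteq SL_n(\mathbb{C})/B$ is equal to $\bigcup_x X_x$, where $x$ runs over the maximal elements, in Bruhat order, of the set $E_w\subseteq\mathfrak{S}_n$ defined in the context.
   Context: $B$ is the group of upper triangular matrices in $SL_n(\mathbb{C})$, $e_w=wB$ is the torus-fixed point indexed by $w$, and $X_w=\overline{Be_w}$. Bruhat order: $v\le w$ iff $X_v\subseteq X_w$. Permutations are written in one-line notation. For $Z=\{z_1<\cdots<z_k\}\subseteq\{1,\dots,n\}$ and $x\in\mathfrak{S}_n$, $\mathrm{fl}_Z(x)\in\mathfrak{S}_k$ is the permutation whose entries are in the same relative order as $x(z_1),\ldots,x(z_k)$. For $u\in\mathfrak{S}_k$, $\mathrm{unfl}^x_Z(u)\in\mathfrak{S}_n$ is the unique permutation that agrees with $x$ at all positions outside $Z$ and satisfies $\mathrm{fl}_Z(\mathrm{unfl}^x_Z(u))=u$. Write $\mathrm{fl}_{ijkl}$, $\mathrm{unfl}_{ijkl}$ for $Z=\{i<j<k<l\}$. $E_w$ is the set of all $x\in\mathfrak{S}_n$ for which there exist $i<j<k<l$ and $i'<j'<k'<l'$ in $\{1,\dots,n\}$ such that: (1) $\{w(i),w(j),w(k),w(l)\}=\{x(i'),x(j'),x(k'),x(l')\}$ as sets; (2) either (a) $\mathrm{fl}_{ijkl}(w)=3412$ and $\mathrm{fl}_{i'j'k'l'}(x)=1324$, or (b) $\mathrm{fl}_{ijkl}(w)=4231$ and $\mathrm{fl}_{i'j'k'l'}(x)=2143$;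 (3) setting $\underline{w}=\mathrm{unfl}^w_{ijkl}(1324)$ and $\widehat{x}=\mathrm{unfl}^x_{i'j'k'l'}(3412)$ in case (a), and $\underline{w}=\mathrm{unfl}^w_{ijkl}(2143)$ and $\widehat{x}=\mathrm{unfl}^x_{i'j'k'l'}(4231)$ in case (b), one has $\underline{w}\le x\le\widehat{x}\le w$ in Bruhat order. *)

theory Defs
  imports
    "Jordan_Normal_Form.Determinant"
    "HOL-Analysis.Abstract_Topology"
    "HOL-Combinatorics.Permutations"
    "HOL-Library.Extended_Nat"
    "HOL-Algebra.Ring_Divisibility"
    "HOL-Algebra.Left_Coset"
begin

section \<open>Regular local rings\<close>

definition krull_dim :: "('a, 'b) ring_scheme \<Rightarrow> enat" where
  "krull_dim R = Sup {enat k | k. \<exists>P :: nat \<Rightarrow> 'a set.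
      (\<forall>i\<le>k. primeideal (P i) R) \<and> (\<forall>i<k. P i \<subset> P (Suc i))}"

definition regular_local_ring :: "('a, 'b) ring_scheme \<Rightarrow> bool" where
  "regular_local_ring R \<longleftrightarrow>
     cring R \<and> noetherian_ring R \<and> (\<exists>!m. maximalideal m R) \<and>
     (\<exists>m S. maximalideal m R \<and> S \<subseteq> carrier R \<and> finite S \<and>
            m = genideal R S \<and> enat (card S) = krull_dim R)"

section \<open>Varieties as spaces with functions\<close>

text \<open>A variety over the complex numbers is given by its Zariski topology together with, for
  every open set \<open>U\<close>, the set \<open>reg U\<close> of functions that are regular on \<open>U\<close>. Functions are total;
  membership in \<open>reg U\<close> only depends on the values on \<open>U\<close>.\<close>

record 'a fun_space =
  topo :: "'a topology"
  reg :: "'a set \<Rightarrow> ('a \<Rightarrow> complex) set"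

text \<open>On a subspace, the regular functions are those that locally extend to regular functions
  of the ambient space.\<close>

definition sub_space :: "'a fun_space \<Rightarrow> 'a set \<Rightarrow> 'a fun_space" where
  "sub_space S Y = \<lparr>
     topo = subtopology (topo S) Y,
     reg = (\<lambda>U. {f. \<forall>p\<in>U. \<exists>V g. openin (topo S) V \<and> p \<in> V \<and> g \<in> reg S V \<and>
                               (\<forall>q\<in>V \<inter> U. f q = g q)}) \<rparr>"

definition quotient_topology :: "('a \<Rightarrow> 'b) \<Rightarrow> 'a topology \<Rightarrow> 'b topology" where
  "quotient_topology \<pi> T = topology (\<lambda>U. U \<subseteq> \<pi> ` topspace T \<and> openin T {x \<in> topspace T. \<pi> x \<in> U})"

definition quotient_space :: "('a \<Rightarrow> 'b) \<Rightarrow> 'a fun_space \<Rightarrow> 'b fun_space" where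
  "quotient_space \<pi> S = \<lparr>
     topo = quotient_topology \<pi> (topo S),
     reg = (\<lambda>U. {f. f \<circ> \<pi> \<in> reg S {x \<in> topspace (topo S). \<pi> x \<in> U}}) \<rparr>"

text \<open>The local ring at \<open>p\<close>: the functions that are regular near \<open>p\<close>, modulo those that vanish
  near \<open>p\<close>. (A function that is regular on an open \<open>U\<close> is a total function here, so every germ
  has a representative of this kind.)\<close>

definition regular_at :: "'a fun_space \<Rightarrow> 'a \<Rightarrow> ('a \<Rightarrow> complex) ring" where
  "regular_at S p = \<lparr>
     carrier = {f. \<exists>U. openin (topo S) U \<and> p \<in> U \<and> f \<in> reg S U},
     monoid.mult = (\<lambda>f g x. f x * g x),
     one = (\<lambda>x. 1),
     zero = (\<lambda>x. 0),
     add = (\<lambda>f g x. f x + g x) \<rparr>"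

definition vanishing_at :: "'a fun_space \<Rightarrow> 'a \<Rightarrow> ('a \<Rightarrow> complex) set" where
  "vanishing_at S p =
     {f \<in> carrier (regular_at S p). \<exists>U. openin (topo S) U \<and> p \<in> U \<and> (\<forall>x\<in>U. f x = 0)}"

definition local_ring :: "'a fun_space \<Rightarrow> 'a \<Rightarrow> ('a \<Rightarrow> complex) set ring" where
  "local_ring S p = regular_at S p Quot vanishing_at S p"

definition singular_locus :: "'a fun_space \<Rightarrow> 'a set" where
  "singular_locus S = {p \<in> topspace (topo S). \<not> regular_local_ring (local_ring S p)}"

section \<open>The affine space of matrices\<close>

inductive_set poly_fun :: "nat \<Rightarrow> (complex mat \<Rightarrow> complex) set" for n where
  const: "(\<lambda>A. c) \<in> poly_fun n"
| entry: "i < n \<Longrightarrow> j < n \<Longrightarrow> (\<lambda>A. A $$ (i, j)) \<in> poly_fun n"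
| add: "f \<in> poly_fun n \<Longrightarrow> g \<in> poly_fun n \<Longrightarrow> (\<lambda>A. f A + g A) \<in> poly_fun n"
| mult: "f \<in> poly_fun n \<Longrightarrow> g \<in> poly_fun n \<Longrightarrow> (\<lambda>A. f A * g A) \<in> poly_fun n"

definition zariski_topology :: "nat \<Rightarrow> complex mat topology" where
  "zariski_topology n =
     topology (\<lambda>U. \<exists>F \<subseteq> poly_fun n. U = {A \<in> carrier_mat n n. \<exists>f\<in>F. f A \<noteq> 0})"

definition matrix_space :: "nat \<Rightarrow> complex mat fun_space" where
  "matrix_space n = \<lparr>
     topo = zariski_topology n,
     reg = (\<lambda>U. {h. \<forall>A\<in>U. \<exists>V f g. openin (zariski_topology n) V \<and> A \<in> V \<and>
                        f \<in> poly_fun n \<and> g \<in> poly_fun n \<and>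
                        (\<forall>M\<in>V \<inter> U. g M \<noteq> 0 \<and> h M = f M / g M)}) \<rparr>"

section \<open>Flag variety and Schubert varieties\<close>

definition SL :: "nat \<Rightarrow> complex mat monoid" where
  "SL n = \<lparr> carrier = {A \<in> carrier_mat n n. det A = 1}, monoid.mult = (*), one = 1\<^sub>m n \<rparr>"

definition borel_subgroup :: "nat \<Rightarrow> complex mat set" where
  "borel_subgroup n = {A \<in> carrier (SL n). upper_triangular A}"

definition flag_variety :: "nat \<Rightarrow> complex mat set fun_space" where
  "flag_variety n = quotient_space (\<lambda>g. g <#\<^bsub>SL n\<^esub> borel_subgroup n)
                                   (sub_space (matrix_space n) (carrier (SL n)))"

text \<open>Permutations act on \<open>{1..n}\<close>, whereas matrix indices start from \<open>0\<close>. The representative of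
  \<open>w\<close> maps the \<open>j\<close>-th basis vector to the \<open>w j\<close>-th one, except that the first column is multiplied
  by the sign of \<open>w\<close> to obtain determinant \<open>1\<close>; the coset does not depend on how the signs
  are chosen.\<close>

definition perm_matrix :: "nat \<Rightarrow> (nat \<Rightarrow> nat) \<Rightarrow> complex mat" where
  "perm_matrix n w = mat n n (\<lambda>(i, j).
     if Suc i = w (Suc j) then (if j = 0 then of_int (sign w) else 1) else 0)"

definition fixed_point :: "nat \<Rightarrow> (nat \<Rightarrow> nat) \<Rightarrow> complex mat set" where
  "fixed_point n w = perm_matrix n w <#\<^bsub>SL n\<^esub> borel_subgroup n"

definition schubert :: "nat \<Rightarrow> (nat \<Rightarrow> nat) \<Rightarrow> complex mat set set" where
  "schubert n w =
     topo (flag_variety n) closure_of ((\<lambda>b. b <#\<^bsub>SL n\<^esub> fixed_point n w) ` borel_subgroup n)"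

definition schubert_variety :: "nat \<Rightarrow> (nat \<Rightarrow> nat) \<Rightarrow> complex mat set fun_space" where
  "schubert_variety n w = sub_space (flag_variety n) (schubert n w)"

section \<open>Bruhat order and patterns\<close>

definition bruhat_le :: "nat \<Rightarrow> (nat \<Rightarrow> nat) \<Rightarrow> (nat \<Rightarrow> nat) \<Rightarrow> bool" where
  "bruhat_le n v w \<longleftrightarrow> schubert n v \<subseteq> schubert n w"

definition bruhat_maximal :: "nat \<Rightarrow> (nat \<Rightarrow> nat) set \<Rightarrow> (nat \<Rightarrow> nat) set" where
  "bruhat_maximal n E = {x \<in> E. \<forall>y\<in>E. bruhat_le n x y \<longrightarrow> y = x}"

definition one_line :: "nat list \<Rightarrow> nat \<Rightarrow> nat" where
  "one_line xs = (\<lambda>i. if i \<in> {1..length xs} then xs ! (i - 1) else i)"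

text \<open>The \<open>a\<close>-th smallest element of \<open>Z\<close>, counting from \<open>1\<close>.\<close>

definition nth_pos :: "nat set \<Rightarrow> nat \<Rightarrow> nat" where
  "nth_pos Z a = sorted_list_of_set Z ! (a - 1)"

definition is_fl :: "nat set \<Rightarrow> (nat \<Rightarrow> nat) \<Rightarrow> (nat \<Rightarrow> nat) \<Rightarrow> bool" where
  "is_fl Z x u \<longleftrightarrow> u permutes {1..card Z} \<and>
     (\<forall>a\<in>{1..card Z}. \<forall>b\<in>{1..card Z}. u a < u b \<longleftrightarrow> x (nth_pos Z a) < x (nth_pos Z b))"

definition fl :: "nat set \<Rightarrow> (nat \<Rightarrow> nat) \<Rightarrow> nat \<Rightarrow> nat" where
  "fl Z x = (THE u. is_fl Z x u)"

definition unfl :: "nat \<Rightarrow> nat set \<Rightarrow> (nat \<Rightarrow> nat) \<Rightarrow> (nat \<Rightarrow> nat) \<Rightarrow> nat \<Rightarrow> nat" where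
  "unfl n Z x u = (THE y. y permutes {1..n} \<and> (\<forall>i\<in>{1..n} - Z. y i = x i) \<and> fl Z y = u)"

definition E_set :: "nat \<Rightarrow> (nat \<Rightarrow> nat) \<Rightarrow> (nat \<Rightarrow> nat) set" where
  "E_set n w = {x. x permutes {1..n} \<and>
     (\<exists>i j k l i' j' k' l'.
        1 \<le> i \<and> i < j \<and> j < k \<and> k < l \<and> l \<le> n \<and>
        1 \<le> i' \<and> i' < j' \<and> j' < k' \<and> k' < l' \<and> l' \<le> n \<and>
        {w i, w j, w k, w l} = {x i', x j', x k', x l'} \<and>
        (\<exists>(p, q) \<in> {(one_line [3,4,1,2], one_line [1,3,2,4]),
                    (one_line [4,2,3,1], one_line [2,1,4,3])}.
           fl {i,j,k,l} w = p \<and> fl {i',j',k',l'} x = q \<and>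
           bruhat_le n (unfl n {i,j,k,l} w q) x \<and>
           bruhat_le n x (unfl n {i',j',k',l'} x p) \<and>
           bruhat_le n (unfl n {i',j',k',l'} x p) w))}"

section \<open>Well-definedness\<close>

lemma istopology_quotient:
  "istopology (\<lambda>U. U \<subseteq> \<pi> ` topspace T \<and> openin T {x \<in> topspace T. \<pi> x \<in> U})"
  unfolding istopology_def
proof (intro conjI allI impI)
  fix U V
  assume *: "U \<subseteq> \<pi> ` topspace T \<and> openin T {x \<in> topspace T. \<pi> x \<in> U}"
    "V \<subseteq> \<pi> ` topspace T \<and> openin T {x \<in> topspace T. \<pi> x \<in> V}"
  show "U \<inter> V \<subseteq> \<pi> ` topspace T" using * by blast
  have "{x \<in> topspace T. \<pi> x \<in> U \<inter> V}
      = {x \<in> topspace T. \<pi> x \<in> U} \<inter> {x \<in> topspace T. \<pi> x \<in> V}" by blast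
  with * show "openin T {x \<in> topspace T. \<pi> x \<in> U \<inter> V}" by (simp only: openin_Int)
next
  fix \<K>
  assume *: "\<forall>K\<in>\<K>. K \<subseteq> \<pi> ` topspace T \<and> openin T {x \<in> topspace T. \<pi> x \<in> K}"
  show "\<Union>\<K> \<subseteq> \<pi> ` topspace T" using * by blast
  have "{x \<in> topspace T. \<pi> x \<in> \<Union>\<K>} = (\<Union>K\<in>\<K>. {x \<in> topspace T. \<pi> x \<in> K})" by blast
  with * show "openin T {x \<in> topspace T. \<pi> x \<in> \<Union>\<K>}" by auto
qed

lemma openin_quotient_topology:
  "openin (quotient_topology \<pi> T) U \<longleftrightarrow>
     U \<subseteq> \<pi> ` topspace T \<and> openin T {x \<in> topspace T. \<pi> x \<in> U}"
  unfolding quotient_topology_def using istopology_quotient[of \<pi> T]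
  by (simp add: topology_inverse')

lemma istopology_zariski:
  "istopology (\<lambda>U. \<exists>F \<subseteq> poly_fun n. U = {A \<in> carrier_mat n n. \<exists>f\<in>F. f A \<noteq> 0})"
  unfolding istopology_def
proof (intro conjI allI impI)
  fix U V
  assume "\<exists>F \<subseteq> poly_fun n. U = {A \<in> carrier_mat n n. \<exists>f\<in>F. f A \<noteq> 0}"
    and "\<exists>F \<subseteq> poly_fun n. V = {A \<in> carrier_mat n n. \<exists>f\<in>F. f A \<noteq> 0}"
  then obtain F G where F: "F \<subseteq> poly_fun n" "U = {A \<in> carrier_mat n n. \<exists>f\<in>F. f A \<noteq> 0}"
    and G: "G \<subseteq> poly_fun n" "V = {A \<in> carrier_mat n n. \<exists>f\<in>G. f A \<noteq> 0}" by blast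
  let ?H = "{\<lambda>A. f A * g A | f g. f \<in> F \<and> g \<in> G}"
  have "?H \<subseteq> poly_fun n" using F(1) G(1) by (auto intro: poly_fun.mult)
  moreover have "U \<inter> V = {A \<in> carrier_mat n n. \<exists>h\<in>?H. h A \<noteq> 0}"
    unfolding F(2) G(2) by fastforce
  ultimately show "\<exists>F \<subseteq> poly_fun n. U \<inter> V = {A \<in> carrier_mat n n. \<exists>f\<in>F. f A \<noteq> 0}" by blast
next
  fix \<K>
  assume "\<forall>K\<in>\<K>. \<exists>F \<subseteq> poly_fun n. K = {A \<in> carrier_mat n n. \<exists>f\<in>F. f A \<noteq> 0}"
  from bchoice[OF this] obtain F
    where F: "\<forall>K\<in>\<K>. F K \<subseteq> poly_fun n \<and> K = {A \<in> carrier_mat n n. \<exists>f\<in>F K. f A \<noteq> 0}" ..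
  have "A \<in> \<Union>\<K> \<longleftrightarrow> A \<in> {A \<in> carrier_mat n n. \<exists>f\<in>(\<Union>K\<in>\<K>. F K). f A \<noteq> 0}" for A
  proof -
    have "A \<in> K \<longleftrightarrow> A \<in> carrier_mat n n \<and> (\<exists>f\<in>F K. f A \<noteq> 0)" if "K \<in> \<K>" for K
      by (subst bspec[OF F that, THEN conjunct2]) simp
    then show ?thesis by auto
  qed
  then have "\<Union>\<K> = {A \<in> carrier_mat n n. \<exists>f\<in>(\<Union>K\<in>\<K>. F K). f A \<noteq> 0}" by blast
  moreover have "(\<Union>K\<in>\<K>. F K) \<subseteq> poly_fun n" using F by (intro UN_least) simp
  ultimately show "\<exists>F \<subseteq> poly_fun n. \<Union>\<K> = {A \<in> carrier_mat n n. \<exists>f\<in>F. f A \<noteq> 0}"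
    by (intro exI conjI)
qed

lemma openin_zariski_topology:
  "openin (zariski_topology n) U \<longleftrightarrow>
     (\<exists>F \<subseteq> poly_fun n. U = {A \<in> carrier_mat n n. \<exists>f\<in>F. f A \<noteq> 0})"
  unfolding zariski_topology_def using istopology_zariski[of n]
  by (simp add: topology_inverse')

lemma rank_less_iff:
  fixes S :: "nat set"
  assumes "finite S" "a \<in> S" "b \<in> S"
  shows "card {s \<in> S. s \<le> a} < card {s \<in> S. s \<le> b} \<longleftrightarrow> a < b"
proof -
  have *: "card {s \<in> S. s \<le> a} < card {s \<in> S. s \<le> b}" if "a < b" "b \<in> S" for a b
  proof (rule psubset_card_mono)
    have "b \<in> {s \<in> S. s \<le> b} - {s \<in> S. s \<le> a}" using that by simp
    then show "{s \<in> S. s \<le> a} \<subset> {s \<in> S. s \<le> b}" using that by force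
  qed (use assms(1) in simp)
  consider "a < b" | "a = b" | "b < a" by linarith
  then show ?thesis
    using *[of a b] *[of b a] assms by cases auto
qed

lemma rank_via_inj:
  fixes g :: "nat \<Rightarrow> nat"
  assumes "inj_on g A"
  shows "card {s \<in> g ` A. s \<le> g a} = card {b \<in> A. g b \<le> g a}"
proof -
  have "{s \<in> g ` A. s \<le> g a} = g ` {b \<in> A. g b \<le> g a}" by auto
  then show ?thesis using assms by (simp add: card_image inj_on_subset)
qed

lemma same_order_same_image:
  fixes g h :: "nat \<Rightarrow> nat"
  assumes A: "finite A" and g: "inj_on g A" and h: "inj_on h A" and im: "g ` A = h ` A"
    and ord: "\<And>a b. a \<in> A \<Longrightarrow> b \<in> A \<Longrightarrow> g a < g b \<longleftrightarrow> h a < h b"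
    and a: "a \<in> A"
  shows "g a = h a"
proof -
  have "{b \<in> A. g b \<le> g a} = {b \<in> A. h b \<le> h a}"
    using ord a by (auto simp flip: not_less)
  then have "card {s \<in> g ` A. s \<le> g a} = card {s \<in> g ` A. s \<le> h a}"
    using rank_via_inj[OF g, of a] rank_via_inj[OF h, of a] im by simp
  moreover have "g a \<in> g ` A" "h a \<in> g ` A" using a im by auto
  ultimately show ?thesis
    using rank_less_iff[of "g ` A" "g a" "h a"] rank_less_iff[of "g ` A" "h a" "g a"] A by simp
qed

lemma ex1_rank_perm:
  fixes g :: "nat \<Rightarrow> nat"
  assumes g: "inj_on g {1..k}"
  shows "\<exists>!u. u permutes {1..k} \<and> (\<forall>a\<in>{1..k}. \<forall>b\<in>{1..k}. u a < u b \<longleftrightarrow> g a < g b)"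
proof (rule ex_ex1I)
  define u where "u a = (if a \<in> {1..k} then card {s \<in> g ` {1..k}. s \<le> g a} else a)" for a
  have ord: "u a < u b \<longleftrightarrow> g a < g b" if "a \<in> {1..k}" "b \<in> {1..k}" for a b
    using that rank_less_iff[of "g ` {1..k}" "g a" "g b"] unfolding u_def by simp
  have inj: "inj_on u {1..k}"
  proof (rule inj_onI)
    fix a b
    assume ab: "a \<in> {1..k}" "b \<in> {1..k}" "u a = u b"
    then have "g a = g b" using ord[of a b] ord[of b a] by simp
    then show "a = b" using g ab by (simp add: inj_on_eq_iff)
  qed
  have "u a \<in> {1..k}" if "a \<in> {1..k}" for a
  proof -
    have "card {s \<in> g ` {1..k}. s \<le> g a} \<le> card (g ` {1..k})" by (intro card_mono) auto
    also have "\<dots> = k" using g by (simp add: card_image)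
    finally have "card {s \<in> g ` {1..k}. s \<le> g a} \<le> k" .
    moreover have "card {s \<in> g ` {1..k}. s \<le> g a} > 0" using that by (auto simp: card_gt_0_iff)
    ultimately show ?thesis using that unfolding u_def by simp
  qed
  then have "u ` {1..k} = {1..k}" using inj by (intro endo_inj_surj) auto
  then have "u permutes {1..k}"
    using inj by (intro bij_imp_permutes) (auto simp: bij_betw_def u_def)
  then show "\<exists>u. u permutes {1..k} \<and> (\<forall>a\<in>{1..k}. \<forall>b\<in>{1..k}. u a < u b \<longleftrightarrow> g a < g b)"
    using ord by blast
next
  fix u v
  assume u: "u permutes {1..k} \<and> (\<forall>a\<in>{1..k}. \<forall>b\<in>{1..k}. u a < u b \<longleftrightarrow> g a < g b)"
    and v: "v permutes {1..k} \<and> (\<forall>a\<in>{1..k}. \<forall>b\<in>{1..k}. v a < v b \<longleftrightarrow> g a < g b)"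
  have "u a = v a" if "a \<in> {1..k}" for a
    using u v that
    by (intro same_order_same_image[of "{1..k}"])
       (auto simp: permutes_image intro: permutes_inj_on)
  moreover have "u a = v a" if "a \<notin> {1..k}" for a
    using u v that by (simp add: permutes_def)
  ultimately show "u = v" by blast
qed

lemma bij_betw_nth_pos:
  assumes "finite Z"
  shows "bij_betw (nth_pos Z) {1..card Z} Z"
proof -
  have "bij_betw (\<lambda>a. a - 1) {1..card Z} {..<card Z}"
    by (rule bij_betw_byWitness[of _ Suc]) auto
  moreover have "bij_betw ((!) (sorted_list_of_set Z)) {..<card Z} Z"
    using assms by (intro bij_betw_nth) auto
  ultimately have "bij_betw ((!) (sorted_list_of_set Z) \<circ> (\<lambda>a. a - 1)) {1..card Z} Z"
    by (rule bij_betw_trans)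
  then show ?thesis by (simp add: nth_pos_def[abs_def] o_def)
qed

lemma ex1_fl:
  assumes "finite Z" "inj_on x Z"
  shows "\<exists>!u. is_fl Z x u"
proof -
  have "inj_on (x \<circ> nth_pos Z) {1..card Z}"
    using bij_betw_nth_pos[OF assms(1)] assms(2) by (auto simp: bij_betw_def intro: comp_inj_on)
  from ex1_rank_perm[OF this] show ?thesis by (simp add: is_fl_def)
qed

lemma fl_eq_iff:
  assumes "finite Z" "inj_on x Z"
  shows "fl Z x = u \<longleftrightarrow> is_fl Z x u"
  using the1_equality[OF ex1_fl[OF assms]] theI'[OF ex1_fl[OF assms]] unfolding fl_def by blast

lemma ex1_unfl:
  assumes x: "x permutes {1..n}" and Z: "Z \<subseteq> {1..n}" and u: "u permutes {1..card Z}"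
  shows "\<exists>!y. y permutes {1..n} \<and> (\<forall>i\<in>{1..n} - Z. y i = x i) \<and> fl Z y = u"
proof (rule ex_ex1I)
  let ?K = "{1..card Z}"
  let ?S = "x ` Z"
  have fin: "finite Z" using Z finite_subset by blast
  note z = bij_betw_nth_pos[OF fin]
  have cS: "card ?S = card Z" using x by (simp add: card_image permutes_inj_on)
  define pos where "pos = the_inv_into ?K (nth_pos Z)"
  have pos: "bij_betw pos Z ?K" unfolding pos_def by (rule bij_betw_the_inv_into[OF z])
  have pos_z: "pos (nth_pos Z a) = a" if "a \<in> ?K" for a
    unfolding pos_def using z that by (simp add: bij_betw_def the_inv_into_f_f)
  have S: "bij_betw (nth_pos ?S) ?K ?S" using bij_betw_nth_pos[of ?S] fin cS by simp
  define y where "y i = (if i \<in> Z then nth_pos ?S (u (pos i)) else x i)" for i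
  have "bij_betw (nth_pos ?S \<circ> (u \<circ> pos)) Z ?S"
    using pos permutes_imp_bij[OF u] S by (blast intro: bij_betw_trans)
  then have y1: "bij_betw y Z ?S"
    by (subst bij_betw_cong[of _ _ "nth_pos ?S \<circ> (u \<circ> pos)"]) (auto simp: y_def)
  have y2: "bij_betw y ({1..n} - Z) (x ` ({1..n} - Z))"
    using x by (subst bij_betw_cong[of _ _ x]) (auto simp: y_def bij_betw_def permutes_inj_on)
  have "?S \<inter> x ` ({1..n} - Z) = {}"
    using permutes_inj[OF x] by (auto dest: injD)
  from bij_betw_combine[OF y1 y2 this]
  have "bij_betw y (Z \<union> ({1..n} - Z)) (x ` (Z \<union> ({1..n} - Z)))"
    by (simp only: image_Un)
  moreover have "Z \<union> ({1..n} - Z) = {1..n}" using Z by blast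
  ultimately have "bij_betw y {1..n} {1..n}" using permutes_image[OF x] by simp
  then have yp: "y permutes {1..n}"
    using x Z by (intro bij_imp_permutes) (auto simp: y_def permutes_def)
  have mono: "nth_pos ?S a < nth_pos ?S b \<longleftrightarrow> a < b" if "a \<in> ?K" "b \<in> ?K" for a b
  proof -
    have "sorted_wrt (<) (sorted_list_of_set ?S)" by simp
    then have *: "nth_pos ?S a < nth_pos ?S b" if "a < b" "a \<in> ?K" "b \<in> ?K" for a b
      unfolding nth_pos_def using that fin cS by (auto intro: sorted_wrt_nth_less[of "(<)"])
    consider "a < b" | "a = b" | "b < a" by linarith
    then show ?thesis using that *[of a b] *[of b a] by cases auto
  qed
  have "y (nth_pos Z a) = nth_pos ?S (u a)" if "a \<in> ?K" for a
    using that pos_z[OF that] bij_betwE[OF z] by (auto simp: y_def)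
  then have "is_fl Z y u"
    unfolding is_fl_def using u mono permutes_in_image[OF u] by simp
  then have "fl Z y = u" using fl_eq_iff fin yp by (simp add: permutes_inj_on)
  then show "\<exists>y. y permutes {1..n} \<and> (\<forall>i\<in>{1..n} - Z. y i = x i) \<and> fl Z y = u"
    using yp by (intro exI[of _ y]) (auto simp: y_def)
next
  let ?K = "{1..card Z}"
  have fin: "finite Z" using Z finite_subset by blast
  note z = bij_betw_nth_pos[OF fin]
  have im: "y ` Z = x ` Z" if y: "y permutes {1..n}" "\<forall>i\<in>{1..n} - Z. y i = x i" for y
  proof -
    have *: "f ` Z = {1..n} - f ` ({1..n} - Z)" if f: "f permutes {1..n}" for f :: "nat \<Rightarrow> nat"
    proof -
      have "f ` ({1..n} - ({1..n} - Z)) = f ` {1..n} - f ` ({1..n} - Z)"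
        using permutes_inj[OF f] by (rule image_set_diff)
      moreover have "{1..n} - ({1..n} - Z) = Z" using Z by blast
      ultimately show ?thesis using permutes_image[OF f] by simp
    qed
    have "y ` ({1..n} - Z) = x ` ({1..n} - Z)" using y(2) by simp
    then show ?thesis using *[OF y(1)] *[OF x] by simp
  qed
  fix y y'
  assume y: "y permutes {1..n} \<and> (\<forall>i\<in>{1..n} - Z. y i = x i) \<and> fl Z y = u"
    and y': "y' permutes {1..n} \<and> (\<forall>i\<in>{1..n} - Z. y' i = x i) \<and> fl Z y' = u"
  have fl: "is_fl Z y u" "is_fl Z y' u"
    using y y' fl_eq_iff[OF fin] permutes_inj_on by blast+
  have inj: "inj_on (f \<circ> nth_pos Z) ?K" if "f permutes {1..n}" for f
    using z permutes_inj_on[OF that] by (auto simp: bij_betw_def intro: comp_inj_on)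
  have eq: "(y \<circ> nth_pos Z) a = (y' \<circ> nth_pos Z) a" if "a \<in> ?K" for a
  proof (rule same_order_same_image[OF _ _ _ _ _ that])
    have "y ` Z = x ` Z" "y' ` Z = x ` Z" using im y y' by blast+
    then show "(y \<circ> nth_pos Z) ` ?K = (y' \<circ> nth_pos Z) ` ?K"
      using bij_betw_imp_surj_on[OF z] by (simp only: image_comp[symmetric])
    show "inj_on (y \<circ> nth_pos Z) ?K" "inj_on (y' \<circ> nth_pos Z) ?K"
      using inj y y' by blast+
  qed (use fl in \<open>simp_all add: is_fl_def\<close>)
  show "y = y'"
  proof
    fix i
    consider "i \<in> Z" | "i \<in> {1..n} - Z" | "i \<notin> {1..n}" by blast
    then show "y i = y' i"
    proof cases
      case 1
      then have "i \<in> nth_pos Z ` ?K" using bij_betw_imp_surj_on[OF z] by simp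
      then obtain a where "a \<in> ?K" "i = nth_pos Z a" by blast
      then show ?thesis using eq by simp
    next
      case 2
      then show ?thesis using y y' by simp
    next
      case 3
      then show ?thesis using y y' by (auto simp: permutes_def)
    qed
  qed
qed

end

theory Submission
  imports Defs
begin

text \<open>
  Singularity of \<open>X\<^sub>w\<close> is constant along the orbits of the Borel subgroup, so it is decided at the fixed
  points \<open>x \<le> w\<close>. There it is a comparison of two numbers: the local ring of \<open>X\<^sub>w\<close> at \<open>x\<close> is regular if and
  only if the number \<open>ntrans n w x\<close> of transpositions \<open>t\<close> with \<open>x t \<le> w\<close> does not exceed the number
  \<open>len n w\<close> of inversions of \<open>w\<close> (\<open>regular_iff\<close>, \<open>singular_iff\<close>).

  The geometric half proves this criterion. Near \<open>x\<close> the Schubert variety is cut out of the affine space of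
  unipotent lower triangular matrices. If \<open>x t \<le> w\<close>, the coordinate line of \<open>t\<close> lies in it, and
  derivatives along these lines show that the maximal ideal needs at least \<open>ntrans n w x\<close> generators
  (\<open>generators_ge\<close>). If \<open>x t\<close> is not below \<open>w\<close>, a minor that vanishes on \<open>X\<^sub>w\<close> has the coordinate of
  \<open>t\<close> as its linear part (\<open>equation_non_edge\<close>), and by Nakayama's lemma that coordinate is superfluous
  (\<open>nakayama\<close>). The Krull dimension is \<open>len n w\<close>: closures of cells along a saturated chain in the Bruhat
  order, preceded by coordinate subspaces of the smallest one, give a chain of primes (\<open>dimension_ge\<close>); a
  parametrization of the open cell by \<open>len n w\<close> coordinates bounds the transcendence degree and thereby
  every chain (\<open>dimension_le\<close>). The Bruhat decomposition and the description of cell closures by ranks of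
  corner submatrices (\<open>rle_iff_SX\<close>) translate between closures and permutations.

  The combinatorial half finds the permutations \<open>x\<close> with \<open>len n w < ntrans n w x\<close>. Everything is expressed by
  the difference \<open>gap w x\<close> of the rank functions of \<open>w\<close> and \<open>x\<close>, which is nonnegative exactly if \<open>x \<le> w\<close>. A
  transposition \<open>t\<close> that raises \<open>x\<close> inside the interval below \<open>w\<close> is an edge at \<open>x\<close>; it corresponds to a
  rectangle on which the gap is positive. Going from \<open>x\<close> to \<open>x t\<close>, the number \<open>ntrans\<close> drops by the number
  of conflicts of \<open>t\<close> with other edges (\<open>ntrans_sw\<close>): either two disjoint edges whose rectangles share a
  place where the gap is \<open>1\<close>, or two consecutive edges that form a bad path. Since \<open>ntrans\<close> ends at
  \<open>len n w\<close> for \<open>x = w\<close>, the permutation \<open>x\<close> is singular if and only if some conflict occurs at \<open>x\<close> or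
  above it.

  Above a singular permutation there is one all of whose edges lead to nonsingular ones; then
  all edges have the same number of conflicts. The edges of such a permutation form a complete bipartite or a
  tripartite graph, and this forces four values of \<open>w\<close> and bounds for the gap from both sides: \<open>w\<close>
  contains 4231 or 3412, and the gap lies between the indicators of two regions (\<open>msing_wit\<close>). These bounds say
  that \<open>x\<close> lies in \<open>E\<^sub>w\<close> (\<open>E_set_iff\<close>). Conversely the lower bound exhibits a conflict at each element of
  \<open>E\<^sub>w\<close> (\<open>wit_imp_singular\<close>). As singularity passes to smaller permutations, the maximal elements of \<open>E\<^sub>w\<close>
  suffice.\<close>

section \<open>The Bruhat order through rank functions\<close>

abbreviation perm where "perm n x \<equiv> x permutes {1..n :: nat}"

abbreviation Mat where "Mat n \<equiv> carrier_mat n n"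

abbreviation (input) iff' (infixr "<->" 25) where "P <-> Q \<equiv> P = (Q :: bool)"

lemmas assoc_mat = assoc_mult_mat[of _ n n _ n _ n] for n

definition rk :: "(nat => nat) => nat => nat => nat" where
 "rk x p q = card {i. i <= p & q < x i}"

definition rle where "rle x w \<equiv> (ALL p q. rk x p q <= rk w p q)"

definition gap where "gap w x p q = int (rk w p q) - int (rk x p q)"

text \<open>Positions count from \<open>1\<close>, and the graph of \<open>x\<close> is drawn with positions to the right and values upwards.
 Raising \<open>x\<close> by a transposition lowers the gap by \<open>1\<close> on the rectangle spanned by two points of the graph, which
 keeps \<open>x\<close> below \<open>w\<close> exactly if the gap is positive there.\<close>
definition posbox where "posbox w x a b c d \<equiv> (ALL p q. a <= p --> p < b --> c <= q --> q < d --> 0 < gap w x p q)"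

abbreviation sw :: "(nat => nat) => nat => nat => nat => nat" where
 "sw x i j \<equiv> x \<circ> transpose i j"

definition edge where "edge w x i j \<equiv> i < j & x i < x j & posbox w x i j (x i) (x j)"

text \<open>Two disjoint edges are in conflict if applying one of them destroys the other one.\<close>
definition conf where "conf w x i j k l \<equiv> edge w x i j & edge w x k l & {i, j} \<inter> {k, l} = {} &
   (EX p q. i <= p & p < j & x i <= q & q < x j & k <= p & p < l & x k <= q & q < x l
    & gap w x p q = 1)"

text \<open>If neither of the two rectangles next to the middle point is positive, then applying one edge of
 the path destroys the other one, without a replacement.\<close>
definition bad where "bad w x i j k \<equiv> edge w x i j & edge w x j k &
   ~ posbox w x i j (x j) (x k) & ~ posbox w x j k (x i) (x j)"

definition clean where "clean w x \<equiv> (ALL i j k l. ~ conf w x i j k l) & (ALL i j k. ~ bad w x i j k)"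

definition nconf where "nconf w x i j = card {(k, l). conf w x i j k l} + card {k. bad w x i j k} + card {k. bad w x k i j}"

lemma rk_sum: "rk x p q = (SUM i<=p. of_bool (q < x i))"
proof -
 have "{i. i <= p & q < x i} = {i \<in> {..p}. q < x i}" by auto
 thus ?thesis unfolding rk_def by (simp add: sum.If_cases Int_def of_bool_def)
qed

lemma rk_update:
 assumes Z: "finite Z" and eq: "!!i. i \<notin> Z ==> y i = x i"
 shows "int (rk y p q) - int (rk x p q) =
  (SUM z:Z. of_bool (z <= p) * (of_bool (q < y z) - of_bool (q < x z)))"
proof -
 have "int (rk y p q) - int (rk x p q) = (SUM i<=p. of_bool (q < y i) - of_bool (q < x i))"
  by (simp add: rk_sum sum_subtractf)
 also have "\<dots> = (SUM i:{..p} \<inter> Z. of_bool (q < y i) - of_bool (q < x i))"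
  by (rule sum.mono_neutral_right) (auto simp: eq)
 also have "{..p} \<inter> Z = Z \<inter> {..p}" by blast
 also have "(SUM i:Z \<inter> {..p}. of_bool (q < y i) - of_bool (q < x i)) =
   (SUM z:Z. of_bool (z <= p) * (of_bool (q < y z) - of_bool (q < x z) :: int))"
  unfolding sum.inter_restrict[OF Z] by (rule sum.cong) auto
 finally show ?thesis .
qed

lemma sw_simps [simp]: "sw x i j i = x j" "sw x i j j = x i"
 by simp_all

lemma sw_other: "k ~= i ==> k ~= j ==> sw x i j k = x k"
 by (simp add: transpose_apply_other)

lemma sw_sym: "sw x j i = sw x i j" by (simp add: transpose_commute)

lemma rk_sw:
 assumes "i < j" "x i < x j"
 shows "int (rk (sw x i j) p q) = int (rk x p q) + of_bool (i <= p & p < j & x i <= q & q < x j)"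
proof -
 have "int (rk (sw x i j) p q) - int (rk x p q) =
  (SUM z:{i, j}. of_bool (z <= p) * (of_bool (q < sw x i j z) - of_bool (q < x z)))"
  by (rule rk_update) (auto simp: sw_other)
 also have "\<dots> = of_bool (i <= p & p < j & x i <= q & q < x j)"
  using assms by (simp add: of_bool_def)
 finally show ?thesis by linarith
qed

lemma gap_sw:
 assumes "i < j" "x i < x j"
 shows "gap w (sw x i j) p q = gap w x p q - of_bool (i <= p & p < j & x i <= q & q < x j)"
 unfolding gap_def rk_sw[OF assms] by simp

lemma rle_gap: "rle x w <-> (ALL p q. 0 <= gap w x p q)"
 unfolding rle_def gap_def by simp

lemma rle_refl [simp]: "rle x x" by (simp add: rle_def)
lemma rle_trans: "rle x y ==> rle y z ==> rle x z" by (meson rle_def le_trans)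

lemma sw_sw [simp]: "sw (sw x i j) i j = x" by (simp add: comp_assoc)

lemma rle_sw_up: "i < j ==> x i < x j ==> rle x (sw x i j)"
 by (simp add: rle_gap gap_def rk_sw)

lemma rle_sw_down: "i < j ==> x j < x i ==> rle (sw x i j) x"
 using rle_sw_up[of i j "sw x i j"] by simp

lemma rle_sw_iff:
 assumes le: "rle y w" and ij: "i < j" "y i ~= y j"
 shows "rle (sw y i j) w <-> y j < y i | posbox w y i j (y i) (y j)"
proof (cases "y i < y j")
 case True
 have ge: "0 <= gap w y p q" for p q using le by (simp add: rle_gap)
 have *: "(0 <= gap w y p q - of_bool (i <= p & p < j & y i <= q & q < y j)) <->
   (i <= p --> p < j --> y i <= q --> q < y j --> 0 < gap w y p q)" for p q
  using ge[of p q] by auto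
 from True show ?thesis
  by (simp only: rle_gap gap_sw[OF ij(1) True] posbox_def * not_less_iff_gr_or_eq) auto
next
 case False
 with ij have "y j < y i" by simp
 thus ?thesis using rle_sw_down[of i j y] ij le rle_trans by blast
qed

lemma edge_iff:
 assumes "rle y w"
 shows "edge w y i j <-> i < j & y i < y j & rle (sw y i j) w"
 using rle_sw_iff[OF assms, of i j] unfolding edge_def by auto

lemma edge_sw_le: "rle y w ==> edge w y i j ==> rle (sw y i j) w"
 by (simp add: edge_iff)

lemma posbox_splitp: "a <= b ==> b <= c ==> posbox w x a c d e <-> posbox w x a b d e & posbox w x b c d e"
 unfolding posbox_def by (meson le_trans less_le_trans not_le)

lemma posbox_splitq: "d <= b ==> b <= e ==> posbox w x a c d e <-> posbox w x a c d b & posbox w x a c b e"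
 unfolding posbox_def by (meson le_trans less_le_trans not_le)

lemma posbox_mono: "posbox w x a b c d ==> a <= a' ==> b' <= b ==> c <= c' ==> d' <= d ==> posbox w x a' b' c' d'"
 unfolding posbox_def by (meson le_trans less_le_trans)

lemma posbox_sw:
 assumes "i < j" "x i < x j" "b <= i | j <= a | d <= x i | x j <= c"
 shows "posbox w (sw x i j) a b c d <-> posbox w x a b c d"
proof -
 have "gap w (sw x i j) p q = gap w x p q" if "a <= p" "p < b" "c <= q" "q < d" for p q
  using assms that by (auto simp: gap_sw)
 thus ?thesis unfolding posbox_def by metis
qed

definition ntrans where "ntrans n w x = card {(k, l). 1 <= k & k < l & l <= n & rle (sw x k l) w}"

definition len where "len n (w :: nat => nat) = card {(k, l). 1 <= k & k < l & l <= n & w l < w k}"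

lemma not_rle_sw_up: 
 assumes "i < j" "x i < x j" shows "~ rle (sw x i j) x"
proof
 assume "rle (sw x i j) x"
 hence "0 <= gap x (sw x i j) i (x i)" by (simp add: rle_gap)
 thus False using assms by (simp add: gap_sw) (simp add: gap_def)
qed

lemma ntrans_self:
 assumes "perm n w"
 shows "ntrans n w w = len n w"
proof -
 have "rle (sw w k l) w <-> w l < w k" if "k < l" for k l
 by (metis assms nat_neq_iff not_rle_sw_up permutes_def rle_sw_down that)
 hence "{(k, l). 1 <= k & k < l & l <= n & rle (sw w k l) w} = {(k, l). 1 <= k & k < l & l <= n & w l < w k}"
  by auto
 thus ?thesis unfolding ntrans_def len_def by simp
qed

text \<open>The transpositions of \<open>r\<close> with \<open>i\<close> and with \<open>j\<close> have to be counted together, because exchanging the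
 values at \<open>i\<close> and \<open>j\<close> also exchanges their roles. In each relative position of the three points the
 rectangles involved are unions of smaller ones, and the difference is a bad path.\<close>
lemma third_position:
 assumes inj: "inj x" and le: "rle x w" and E: "edge w x i j" and r: "r ~= i" "r ~= j"
 shows "of_bool (rle (sw x i r) w) + of_bool (rle (sw x j r) w) =
   of_bool (rle (sw (sw x i j) i r) w) + of_bool (rle (sw (sw x i j) j r) w)
   + (of_bool (bad w x i j r) + of_bool (bad w x r i j) :: nat)"
proof -
 let ?y = "sw x i j"
 have ij: "i < j" "x i < x j" and box: "posbox w x i j (x i) (x j)" using E by (auto simp: edge_def)
 have ley: "rle ?y w" using edge_sw_le[OF le E] .
 have ne: "x r ~= x i" "x r ~= x j" using inj r by (auto dest: injD)
 have yr: "?y r = x r" using r by (simp add: sw_other)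
 note P = posbox_sw[OF ij]
 have up: "rle (sw x a b) w <-> x b < x a | posbox w x a b (x a) (x b)" if "a < b" "x a ~= x b" for a b
  using rle_sw_iff[OF le that] .
 have upy: "rle (sw ?y a b) w <-> ?y b < ?y a | posbox w ?y a b (?y a) (?y b)" if "a < b" "?y a ~= ?y b" for a b
  using rle_sw_iff[OF ley that] .
 consider "r < i" | "i < r" "r < j" | "j < r" using r by linarith
 thus ?thesis
 proof cases
  case 1
  hence nb: "~ bad w x i j r" using ij by (auto simp: bad_def edge_def)
  have e: "rle (sw x i r) w <-> x i < x r | posbox w x r i (x r) (x i)" "rle (sw x j r) w <-> x j < x r | posbox w x r j (x r) (x j)"
   "rle (sw ?y i r) w <-> x j < x r | posbox w x r i (x r) (x j)" "rle (sw ?y j r) w <-> x i < x r | posbox w x r j (x r) (x i)"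
   using up[of r i] up[of r j] upy[of r i] upy[of r j] P[of i r "x j" "x r" w] P[of j r "x i" "x r" w] 1 ne ij yr by (simp_all add: sw_sym[of _ _ r])
  consider "x r < x i" | "x i < x r" "x r < x j" | "x j < x r" using ne by linarith
  thus ?thesis
  proof cases
   case a: 1
   have b: "bad w x r i j <-> posbox w x r i (x r) (x i) & ~ posbox w x r i (x i) (x j) & ~ posbox w x i j (x r) (x i)"
    unfolding bad_def edge_def using 1 a ij box by auto
   have s1: "posbox w x r j (x r) (x j) <-> (posbox w x r i (x r) (x i) & posbox w x r i (x i) (x j)) & posbox w x i j (x r) (x i)"
    using 1 a ij box posbox_splitp[of r i j w x "x r" "x j"] posbox_splitq[of "x r" "x i" "x j" w x r i]
     posbox_splitq[of "x r" "x i" "x j" w x i j] by auto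
   have s2: "posbox w x r i (x r) (x j) <-> posbox w x r i (x r) (x i) & posbox w x r i (x i) (x j)"
    using a ij posbox_splitq[of "x r" "x i" "x j" w x r i] by auto
   have s3: "posbox w x r j (x r) (x i) <-> posbox w x r i (x r) (x i) & posbox w x i j (x r) (x i)"
    using 1 ij posbox_splitp[of r i j w x "x r" "x i"] by auto
   show ?thesis unfolding e b s1 s2 s3 using nb a ij by auto
  next
   case a: 2
   have b: "~ bad w x r i j" unfolding bad_def edge_def using a by auto
   have s: "posbox w x r j (x r) (x j) <-> posbox w x r i (x r) (x j)"
    using 1 a ij posbox_splitp[of r i j w x "x r" "x j"] posbox_mono[OF box, of i j "x r" "x j"] by auto
   show ?thesis unfolding e using s nb b a by auto
  next
   case a: 3
   have b: "~ bad w x r i j" unfolding bad_def edge_def using a ij by auto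
   show ?thesis unfolding e using a nb b ij by auto
  qed
 next
  case 2
  have nb: "~ bad w x i j r" "~ bad w x r i j" using 2 by (auto simp: bad_def edge_def)
  have e: "rle (sw x i r) w <-> x r < x i | posbox w x i r (x i) (x r)" "rle (sw x j r) w <-> x j < x r | posbox w x r j (x r) (x j)"
   "rle (sw ?y i r) w <-> x r < x j | posbox w x i r (x j) (x r)" "rle (sw ?y j r) w <-> x i < x r | posbox w x r j (x r) (x i)"
   using up[of i r] up[of r j] upy[of i r] upy[of r j] P[of r i "x r" "x j" w] P[of j r "x i" "x r" w] 2 ne ij yr by (simp_all add: sw_sym[of _ j r])
  consider "x r < x i" | "x i < x r" "x r < x j" | "x j < x r" using ne by linarith
  thus ?thesis
  proof cases
   case a: 1
   have s: "posbox w x r j (x r) (x j) <-> posbox w x r j (x r) (x i)"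
    using 2 a ij posbox_splitq[of "x r" "x i" "x j" w x r j] posbox_mono[OF box, of r j "x i" "x j"] by auto
   show ?thesis unfolding e using s nb a ij by auto
  next
   case a: 2
   have s: "posbox w x i r (x i) (x r)" "posbox w x r j (x r) (x j)"
    using 2 a by (auto intro: posbox_mono[OF box])
   show ?thesis unfolding e using s nb a ij by auto
  next
   case a: 3
   have s: "posbox w x i r (x i) (x r) <-> posbox w x i r (x j) (x r)"
    using 2 a ij posbox_splitq[of "x i" "x j" "x r" w x i r] posbox_mono[OF box, of i r "x i" "x j"] by auto
   show ?thesis unfolding e using s nb a ij by auto
  qed
 next
  case 3
  have nb: "~ bad w x r i j" using 3 ij by (auto simp: bad_def edge_def)
  have e: "rle (sw x i r) w <-> x r < x i | posbox w x i r (x i) (x r)" "rle (sw x j r) w <-> x r < x j | posbox w x j r (x j) (x r)"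
   "rle (sw ?y i r) w <-> x r < x j | posbox w x i r (x j) (x r)" "rle (sw ?y j r) w <-> x r < x i | posbox w x j r (x i) (x r)"
   using up[of i r] up[of j r] upy[of i r] upy[of j r] P[of r i "x r" "x j" w] P[of r j "x r" "x i" w] 3 ne ij yr by simp_all
  consider "x r < x i" | "x i < x r" "x r < x j" | "x j < x r" using ne by linarith
  thus ?thesis
  proof cases
   case a: 1
   have b: "~ bad w x i j r" unfolding bad_def edge_def using a ij by auto
   show ?thesis unfolding e using a nb b ij by auto
  next
   case a: 2
   have b: "~ bad w x i j r" unfolding bad_def edge_def using a by auto
   have s: "posbox w x i r (x i) (x r) <-> posbox w x j r (x i) (x r)"
    using 3 a ij posbox_splitp[of i j r w x "x i" "x r"] posbox_mono[OF box, of i j "x i" "x r"] by auto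
   show ?thesis unfolding e using s nb b a by auto
  next
   case a: 3
   have b: "bad w x i j r <-> posbox w x j r (x j) (x r) & ~ posbox w x i j (x j) (x r) & ~ posbox w x j r (x i) (x j)"
    unfolding bad_def edge_def using 3 a ij box by auto
   have s1: "posbox w x i r (x i) (x r) <-> posbox w x j r (x j) (x r) & posbox w x i j (x j) (x r) & posbox w x j r (x i) (x j)"
    using 3 a ij box posbox_splitp[of i j r w x "x i" "x r"] posbox_splitq[of "x i" "x j" "x r" w x i j]
     posbox_splitq[of "x i" "x j" "x r" w x j r] by auto
   have s2: "posbox w x i r (x j) (x r) <-> posbox w x i j (x j) (x r) & posbox w x j r (x j) (x r)"
    using 3 ij posbox_splitp[of i j r w x "x j" "x r"] by auto
   have s3: "posbox w x j r (x i) (x r) <-> posbox w x j r (x i) (x j) & posbox w x j r (x j) (x r)"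
    using a ij posbox_splitq[of "x i" "x j" "x r" w x j r] by auto
   show ?thesis unfolding e b s1 s2 s3 using nb a ij by auto
  qed
 qed
qed

section \<open>Counting transpositions\<close>

lemma perm_in: "x permutes {1..n::nat} ==> 1 <= i ==> i <= n ==> 1 <= x i & x i <= n"
 using permutes_in_image[of x "{1..n}" i] by simp

lemma perm_out: "x permutes {1..n::nat} ==> i = 0 | n < i ==> x i = i"
 by (rule permutes_not_in) auto

lemma sum_of_bool: "finite A ==> (SUM z:A. of_bool (Q z) :: nat) = card {z \<in> A. Q z}"
 by (simp add: of_bool_def sum.If_cases Int_def)

lemma rk_0: "perm n x ==> rk x 0 q = 0"
 unfolding rk_def by (auto simp: permutes_def)

lemma rk_q0:
 assumes "perm n x" shows "rk x p 0 = p"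
proof -
 have A: "0 < x i <-> 0 < i" for i
  using perm_in[OF assms, of i] perm_out[OF assms, of i] by (cases "1 <= i & i <= n") linarith+
 have "{i. i <= p & 0 < x i} = {1..p}" unfolding A by auto
 thus ?thesis by (simp add: rk_def)
qed

lemma rk_n:
 assumes "perm n x" "n <= p" shows "rk x p q = p - q"
proof -
 have px: "x permutes {..p}" using assms by (elim permutes_subset) auto
 have "{q<..p} = x ` {i. i <= p & q < x i}"
  using permutes_image[OF px] permutes_in_image[OF px] by (auto simp: image_iff) (metis atMost_iff imageE)
 hence "card {q<..p} = card {i. i <= p & q < x i}"
  using permutes_inj_on[OF px] by (simp add: card_image)
 thus ?thesis by (simp add: rk_def)
qed

lemma rk_qn:
 assumes "perm n x" "n <= q" shows "rk x p q = p - q"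
proof -
 have A: "q < x i <-> q < i" for i
  using perm_in[OF assms(1), of i] perm_out[OF assms(1), of i] assms(2)
  by (cases "1 <= i & i <= n") linarith+
 have "{i. i <= p & q < x i} = {q<..p}" unfolding A by auto
 thus ?thesis by (simp add: rk_def)
qed

lemma gap_out:
 assumes "perm n w" "perm n x" "p = 0 | q = 0 | n <= p | n <= q"
 shows "gap w x p q = 0"
 using assms by (auto simp: gap_def rk_0 rk_q0 rk_n rk_qn)

lemma edge_range:
 assumes "perm n w" "perm n x" "edge w x i j"
 shows "1 <= i" "j <= n" "i < j" "x i < x j" "1 <= x i" "x j <= n"
proof -
 have ij: "i < j" "x i < x j" and b: "!!p q. i <= p ==> p < j ==> x i <= q ==> q < x j ==> 0 < gap w x p q"
  using assms(3) by (auto simp: edge_def posbox_def)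
 have "0 < gap w x i (x i)" "0 < gap w x (j - 1) (x j - 1)" using ij by (auto intro!: b)
 with gap_out[OF assms(1,2)] have "~ (i = 0 | x i = 0)" "~ (n <= j - 1 | n <= x j - 1)" by fastforce+
 thus "1 <= i" "j <= n" "i < j" "x i < x j" "1 <= x i" "x j <= n" using ij by auto
qed

lemma pair_count:
 fixes P :: "nat => nat => bool"
 assumes "!!k l. P k l = P l k"
 shows "2 * card {(k, l). 1 <= k & k < l & l <= n & P k l} = (SUM k:{1..n}. SUM l:{1..n}. of_bool (k ~= l & P k l))"
proof -
 let ?S = "{(k, l). 1 <= k & k < l & l <= n & P k l}"
 let ?T = "{(k, l). k \<in> {1..n} & l \<in> {1..n} & k ~= l & P k l}"
 have "?S \<subseteq> {1..n} \<times> {1..n}" by auto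
 hence fin: "finite ?S" by (rule finite_subset) auto
 have S': "prod.swap ` ?S = {(l, k). 1 <= k & k < l & l <= n & P k l}" by (auto simp: image_iff)
 have T: "?T = ?S \<union> prod.swap ` ?S" unfolding S' using assms by auto
 have "?S \<inter> prod.swap ` ?S = {}" by auto
 hence "card ?T = card ?S + card (prod.swap ` ?S)" unfolding T using fin by (intro card_Un_disjoint) auto
 also have "card (prod.swap ` ?S) = card ?S" by (intro card_image) auto
 finally have "card ?T = 2 * card ?S" by simp
 moreover have "(SUM k:{1..n}. SUM l:{1..n}. of_bool (k ~= l & P k l)) = card ?T"
 proof -
  have "(SUM k:{1..n}. SUM l:{1..n}. of_bool (k ~= l & P k l)) =
    (SUM z:{1..n}\<times>{1..n}. of_bool (fst z ~= snd z & P (fst z) (snd z)) :: nat)"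
   unfolding sum.cartesian_product by (intro sum.cong) auto
  also have "\<dots> = card {z\<in>{1..n}\<times>{1..n}. fst z ~= snd z & P (fst z) (snd z)}"
   by (rule sum_of_bool) simp
  also have "{z\<in>{1..n}\<times>{1..n}. fst z ~= snd z & P (fst z) (snd z)} = ?T" by auto
  finally show ?thesis .
 qed
 ultimately show ?thesis by simp
qed

lemma double_sum_split:
 fixes f :: "nat => nat => nat"
 assumes I: "finite I" "i \<in> I" "j \<in> I" "i ~= j" and f: "!!k l. f k l = f l k" "!!k. f k k = 0"
 shows "(SUM k:I. SUM l:I. f k l) = 2 * f i j + 2 * (SUM r:I-{i,j}. f i r + f j r)
   + (SUM k:I-{i,j}. SUM l:I-{i,j}. f k l)"
proof -
 have s: "(SUM k:I. g k) = g i + g j + (SUM k:I-{i,j}. g k)" for g :: "nat => nat"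
 proof -
  have "(SUM k:I. g k) = g i + (SUM k:I-{i}. g k)" using I by (intro sum.remove) auto
  also have "(SUM k:I-{i}. g k) = g j + (SUM k:I-{i}-{j}. g k)" using I by (intro sum.remove) auto
  finally show ?thesis by (simp add: Diff_insert[symmetric] insert_commute)
 qed
 have c: "(SUM l:I. f k l) = f i k + f j k + (SUM l:I-{i,j}. f k l)" for k
  unfolding s[of "f k"] f(1)[of k i] f(1)[of k j] ..
 have "(SUM k:I. SUM l:I. f k l) = (SUM k:I. f i k + f j k + (SUM l:I-{i,j}. f k l))" by (simp only: c)
 also have "\<dots> = (f i i + f j i + (SUM r:I-{i,j}. f i r)) + (f i j + f j j + (SUM r:I-{i,j}. f j r))
   + (SUM k:I-{i,j}. f i k + f j k + (SUM l:I-{i,j}. f k l))"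
  unfolding s[of "%k. f i k + f j k + (SUM l:I-{i,j}. f k l)"] f(1)[of i j] by (simp add: f(2))
 finally show ?thesis by (simp add: sum.distrib f(2) f(1)[of j i])
qed

lemma permutes_sw: "perm n x ==> i \<in> {1..n} ==> j \<in> {1..n} ==> perm n (sw x i j)"
 by (intro permutes_compose permutes_swap_id) auto

lemma edge_permutes:
 assumes "perm n w" "perm n x" "edge w x i j"
 shows "perm n (sw x i j)"
 using edge_range[OF assms] by (intro permutes_sw assms) auto

text \<open>A transposition that is disjoint from the edge gets lost exactly in a conflict; those that
 share one position with it are balanced by the previous count, up to bad paths. Summing over ordered
 pairs avoids case distinctions on their order.\<close>
theorem ntrans_sw:
 assumes w: "perm n w" and x: "perm n x" and le: "rle x w" and E: "edge w x i j"
 shows "ntrans n w x = ntrans n w (sw x i j) + nconf w x i j"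
proof -
 let ?y = "sw x i j" and ?I = "{1..n}"
 let ?J = "?I - {i, j}"
 note rg = edge_range[OF w x E]
 have inj: "inj x" using permutes_inj[OF x] .
 have ley: "rle ?y w" using edge_sw_le[OF le E] .
 define f where "f = (%y k l. of_bool (k ~= l & rle (sw y k l) w) :: nat)"
 have fs: "f y k l = f y l k" "f y k k = 0" for y k l
  by (auto simp: f_def sw_sym)
 have N: "2 * ntrans n w y = (SUM k:?I. SUM l:?I. f y k l)" for y
  unfolding ntrans_def f_def by (rule pair_count) (simp add: sw_sym)
 have I: "finite ?I" "i \<in> ?I" "j \<in> ?I" "i ~= j" using rg by auto
 have N2: "2 * ntrans n w y = 2 * f y i j + 2 * (SUM r:?J. f y i r + f y j r) + (SUM k:?J. SUM l:?J. f y k l)" for y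
  unfolding N by (rule double_sum_split[OF I]) (rule fs)+
 have fij: "f x i j = 1" "f ?y i j = 1"
  using rg le ley by (auto simp: f_def simp del: comp_apply)
 have bJ: "bad w x i j r ==> r \<in> ?J" "bad w x r i j ==> r \<in> ?J" for r
  using edge_range[OF w x, of i j] edge_range[OF w x, of j r] edge_range[OF w x, of r i] by (auto simp: bad_def)
 have t: "(SUM r:?J. f x i r + f x j r) = (SUM r:?J. f ?y i r + f ?y j r) + (card {k. bad w x i j k} + card {k. bad w x k i j})"
 proof -
  have "(SUM r:?J. f x i r + f x j r) = (SUM r:?J. (f ?y i r + f ?y j r) + (of_bool (bad w x i j r) + of_bool (bad w x r i j)))"
  proof (rule sum.cong[OF refl])
   fix r assume "r \<in> ?J"
   thus "f x i r + f x j r = (f ?y i r + f ?y j r) + (of_bool (bad w x i j r) + of_bool (bad w x r i j))"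
    using third_position[OF inj le E, of r] by (auto simp: f_def)
  qed
  also have "\<dots> = (SUM r:?J. f ?y i r + f ?y j r) + ((SUM r:?J. of_bool (bad w x i j r)) + (SUM r:?J. of_bool (bad w x r i j)))"
   by (simp only: sum.distrib)
  also have "(SUM r:?J. of_bool (bad w x i j r)) = card {r\<in>?J. bad w x i j r}"
   by (simp add: of_bool_def sum.If_cases Int_def)
  also have "{r\<in>?J. bad w x i j r} = {k. bad w x i j k}" using bJ by blast
  also have "(SUM r:?J. of_bool (bad w x r i j)) = card {r\<in>?J. bad w x r i j}"
   by (simp add: of_bool_def sum.If_cases Int_def)
  also have "{r\<in>?J. bad w x r i j} = {k. bad w x k i j}" using bJ by blast
  finally show ?thesis .
 qed
 let ?c = "%k l. conf w x i j k l | conf w x i j l k"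
 have d: "f x k l = f ?y k l + of_bool (k ~= l & ?c k l)" if "k \<in> ?J" "l \<in> ?J" for k l
 proof -
  have *: "f x k l = f ?y k l + of_bool (k ~= l & ?c k l)" if kl: "k \<in> ?J" "l \<in> ?J" "k < l" for k l
  proof -
   have yk: "?y k = x k" "?y l = x l" using kl by (auto simp: sw_other)
   have ne: "x k ~= x l" using inj kl by (auto dest: injD)
   have nc: "~ conf w x i j l k" using kl by (auto simp: conf_def edge_def)
   have a: "rle (sw x k l) w <-> x l < x k | posbox w x k l (x k) (x l)"
    using rle_sw_iff[OF le kl(3) ne] .
   have b: "rle (sw ?y k l) w <-> x l < x k | posbox w ?y k l (x k) (x l)"
    using rle_sw_iff[OF ley kl(3)] ne yk by simp
   have c: "conf w x i j k l <-> x k < x l & posbox w x k l (x k) (x l) & ~ posbox w ?y k l (x k) (x l)"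
   proof -
    have "posbox w ?y k l (x k) (x l) <-> (ALL p q. k <= p --> p < l --> x k <= q --> q < x l
      --> of_bool (i <= p & p < j & x i <= q & q < x j) < gap w x p q)"
     unfolding posbox_def gap_sw[OF rg(3,4)] by simp
    moreover have "of_bool B < g <-> 0 < g & ~ (B & g = 1)" for B and g :: int by auto
    ultimately show ?thesis using kl E unfolding conf_def edge_def posbox_def by auto
   qed
   have m: "posbox w ?y k l (x k) (x l) ==> posbox w x k l (x k) (x l)"
   proof -
    have "gap w ?y p q <= gap w x p q" for p q unfolding gap_sw[OF rg(3,4)] by simp
    thus "posbox w ?y k l (x k) (x l) ==> posbox w x k l (x k) (x l)"
     unfolding posbox_def by (meson less_le_trans)
   qed
   show ?thesis unfolding f_def a b using c m nc ne kl by auto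
  qed
  consider "k < l" | "k = l" | "l < k" by linarith
  thus ?thesis
  proof cases
   case 1 thus ?thesis using * that by blast
  next
   case 2 thus ?thesis by (simp add: fs)
  next
   case 3 thus ?thesis using *[of l k] that by (simp add: fs(1)[of _ k l] disj_commute)
  qed
 qed
 have "(SUM k:?J. SUM l:?J. f x k l) = (SUM k:?J. SUM l:?J. f ?y k l) + (SUM k:?J. SUM l:?J. of_bool (k ~= l & ?c k l))"
  unfolding sum.distrib[symmetric] by (intro sum.cong refl d)
 also have "(SUM k:?J. SUM l:?J. of_bool (k ~= l & ?c k l)) = (SUM k:?I. SUM l:?I. of_bool (k ~= l & ?c k l) :: nat)"
 proof -
  have z: "of_bool (k ~= l & ?c k l) = (0::nat)" if "k \<in> {i, j} | l \<in> {i, j}" for k l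
   using that by (auto simp: conf_def)
  have "(SUM l:?J. of_bool (k ~= l & ?c k l) :: nat) = (SUM l:?I. of_bool (k ~= l & ?c k l))" for k
   using z by (intro sum.mono_neutral_left) auto
  moreover have "(SUM k:?J. SUM l:?I. of_bool (k ~= l & ?c k l) :: nat) = (SUM k:?I. SUM l:?I. of_bool (k ~= l & ?c k l))"
   using z by (intro sum.mono_neutral_left) (auto intro!: sum.neutral)
  ultimately show ?thesis by simp
 qed
 also have "\<dots> = 2 * card {(k, l). 1 <= k & k < l & l <= n & ?c k l}"
  by (rule pair_count[symmetric]) auto
 also have "{(k, l). 1 <= k & k < l & l <= n & ?c k l} = {(k, l). conf w x i j k l}"
  unfolding conf_def by (auto dest: edge_range[OF w x])
 finally have "(SUM k:?J. SUM l:?J. f x k l) = (SUM k:?J. SUM l:?J. f ?y k l) + 2 * card {(k, l). conf w x i j k l}" .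
 thus ?thesis using N2[of x] N2[of ?y] t fij unfolding nconf_def by linarith
qed

lemma count_box:
 assumes "a <= b" "c <= e"
 shows "int (card {i. a < i & i <= b & c < x i & x i <= e}) = int (rk x b c) - int (rk x b e) - int (rk x a c) + int (rk x a e)"
proof -
 have s: "rk x p c = card {i. i <= p & c < x i & x i <= e} + rk x p e" for p
 proof -
  have "{i. i <= p & c < x i} = {i. i <= p & c < x i & x i <= e} \<union> {i. i <= p & e < x i}" using assms by auto
  thus ?thesis unfolding rk_def by (simp only:) (intro card_Un_disjoint, auto)
 qed
 have "{i. i <= b & c < x i & x i <= e} = {i. a < i & i <= b & c < x i & x i <= e} \<union> {i. i <= a & c < x i & x i <= e}"
  using assms by auto
 hence "card {i. i <= b & c < x i & x i <= e} = card {i. a < i & i <= b & c < x i & x i <= e} + card {i. i <= a & c < x i & x i <= e}"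
  by (simp only:) (intro card_Un_disjoint, auto)
 thus ?thesis using s[of a] s[of b] by linarith
qed

lemma ex_dot:
 assumes "a <= b" "c <= e" "gap w x b c - gap w x b e - gap w x a c + gap w x a e < 0"
 obtains i where "a < i" "i <= b" "c < x i" "x i <= e"
proof -
 have "int (card {i. a < i & i <= b & c < w i & w i <= e}) - int (card {i. a < i & i <= b & c < x i & x i <= e}) < 0"
  unfolding count_box[OF assms(1,2)] using assms(3) unfolding gap_def by linarith
 hence "card {i. a < i & i <= b & c < x i & x i <= e} ~= 0" by linarith
 hence "{i. a < i & i <= b & c < x i & x i <= e} ~= {}" by (metis card.empty)
 thus ?thesis using that by blast
qed

text \<open>Move right from \<open>(p, q)\<close> to the first zero of the gap, then up to the first row with a zero to its
 left. The second difference of the gap over the resulting rectangle is negative, so it contains a point of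
 the graph of \<open>x\<close>.\<close>
lemma NE_dot:
 assumes w: "perm n w" and x: "perm n x" and le: "rle x w" and g: "0 < gap w x p q"
 obtains j where "p < j" "q < x j" "posbox w x p j q (x j)"
proof -
 have ge: "0 <= gap w x p q" for p q using le by (simp add: rle_gap)
 have pn: "p < n" "q < n" using gap_out[OF w x, of p q] g by force+
 define s where "s = (LEAST s. p < s & gap w x s q = 0)"
 have s: "p < s" "gap w x s q = 0"
  using LeastI[of "%s. p < s & gap w x s q = 0" n] pn gap_out[OF w x] unfolding s_def by auto
 have s_least: "0 < gap w x s' q" if "p <= s'" "s' < s" for s'
  using not_less_Least[of s' "%s. p < s & gap w x s q = 0"] that g ge[of s' q] unfolding s_def
  by (cases "s' = p") force+
 define t where "t = (LEAST t. q < t & (EX p'. p <= p' & p' < s & gap w x p' t = 0))"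
 have "q < t & (EX p'. p <= p' & p' < s & gap w x p' t = 0)" unfolding t_def
  by (rule LeastI[of _ n]) (use pn s gap_out[OF w x] in auto)
 then obtain p' where t: "q < t" "p <= p'" "p' < s" "gap w x p' t = 0" by blast
 have t_least: "0 < gap w x p' t'" if "p <= p'" "p' < s" "q <= t'" "t' < t" for p' t'
  using not_less_Least[of t' "%t. q < t & (EX p'. p <= p' & p' < s & gap w x p' t = 0)"] that s_least ge[of p' t'] unfolding t_def
  by (cases "t' = q") force+
 have "gap w x s q - gap w x s t - gap w x p' q + gap w x p' t < 0"
  using s t ge[of s t] s_least[of p'] by linarith
 then obtain j where j: "p' < j" "j <= s" "q < x j" "x j <= t"
  using ex_dot[of p' s q t w x] t s by auto
 show ?thesis
  by (rule that[of j]) (use j t t_least in \<open>auto simp: posbox_def\<close>)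
qed

text \<open>Conjugation by the longest permutation turns graphs by 180 degrees; it halves the case
 distinctions below.\<close>
definition rot where "rot n x i = (if i \<in> {1..n} then Suc n - x (Suc n - i) else i)"

lemma rot_in: "perm n x ==> i \<in> {1..n} ==> rot n x i \<in> {1..n}"
proof -
 assume x: "perm n x" and i: "i \<in> {1..n}"
 hence "1 <= Suc n - i" "Suc n - i <= n" by auto
 from perm_in[OF x this] i show "rot n x i \<in> {1..n}" by (auto simp: rot_def)
qed

lemma rot_permutes:
 assumes x: "perm n x" shows "perm n (rot n x)"
proof (rule bij_imp_permutes)
 have "inj_on (rot n x) {1..n}"
 proof (rule inj_onI)
  fix i j assume ij: "i \<in> {1..n}" "j \<in> {1..n}" "rot n x i = rot n x j"
  have "1 <= Suc n - i" "Suc n - i <= n" "1 <= Suc n - j" "Suc n - j <= n" using ij by auto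
  hence "x (Suc n - i) \<in> {1..n}" "x (Suc n - j) \<in> {1..n}" using perm_in[OF x] by auto
  moreover have "Suc n - x (Suc n - i) = Suc n - x (Suc n - j)" using ij by (simp add: rot_def)
  ultimately have "x (Suc n - i) = x (Suc n - j)" by (simp only: atLeastAtMost_iff) arith
  hence "Suc n - i = Suc n - j" using permutes_inj[OF x] by (auto dest: injD)
  thus "i = j" using ij by auto
 qed
 moreover have "rot n x ` {1..n} \<subseteq> {1..n}" using rot_in[OF x] by auto
 ultimately show "bij_betw (rot n x) {1..n} {1..n}"
  by (simp add: bij_betw_def endo_inj_surj)
qed (metis rot_def)

lemma rot_rot:
 assumes x: "perm n x" shows "rot n (rot n x) = x"
proof
 fix i show "rot n (rot n x) i = x i"
  using perm_in[OF x, of i] perm_out[OF x, of i] by (cases "1 <= i & i <= n") (auto simp: rot_def)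
qed

lemma rk_rot:
 assumes x: "perm n x" and pq: "p <= n" "q <= n"
 shows "int (rk (rot n x) p q) = int p - int q + int (rk x (n - p) (n - q))"
proof -
 let ?f = "%i. Suc n - i"
 have xi: "j \<in> {1..n} ==> x j \<in> {1..n}" for j using permutes_in_image[OF x] by blast
 have "card {i. i <= p & q < rot n x i} = card (?f ` {i. i <= p & q < rot n x i & 1 <= i})"
 proof -
  have "{i. i <= p & q < rot n x i} = {i. i <= p & q < rot n x i & 1 <= i}"
   by (auto simp: rot_def split: if_splits)
  moreover have "inj_on ?f {i. i <= p & q < rot n x i & 1 <= i}" using pq by (auto intro!: inj_onI)
  ultimately show ?thesis by (simp add: card_image)
 qed
 also have "?f ` {i. i <= p & q < rot n x i & 1 <= i} = {j. n - p < j & j <= n & 0 < x j & x j <= n - q}"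
 proof safe
  fix i assume i: "i <= p" "q < rot n x i" "1 <= i"
  have "rot n x i = Suc n - x (Suc n - i)" using i pq by (simp add: rot_def)
  moreover have "1 <= Suc n - i" "Suc n - i <= n" using i pq by auto
  hence "x (Suc n - i) \<in> {1..n}" using perm_in[OF x] by auto
  ultimately show "n - p < Suc n - i" "Suc n - i <= n" "0 < x (Suc n - i)" "x (Suc n - i) <= n - q" using i pq by auto
 next
  fix j assume j: "n - p < j" "j <= n" "0 < x j" "x j <= n - q"
  hence "rot n x (Suc n - j) = Suc n - x j" by (auto simp: rot_def)
  thus "j \<in> ?f ` {i. i <= p & q < rot n x i & 1 <= i}"
   using j pq by (intro image_eqI[of _ _ "Suc n - j"]) auto
 qed
 finally have "int (rk (rot n x) p q) = int (card {j. n - p < j & j <= n & 0 < x j & x j <= n - q})"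
  by (simp add: rk_def)
 also have "\<dots> = int (rk x n 0) - int (rk x n (n - q)) - int (rk x (n-p) 0) + int (rk x (n-p) (n-q))"
  by (rule count_box) auto
 also have "\<dots> = int p - int q + int (rk x (n-p) (n-q))"
  using pq by (simp add: rk_q0[OF x] rk_n[OF x])
 finally show ?thesis .
qed

lemma gap_rot:
 assumes "perm n w" "perm n x" "p <= n" "q <= n"
 shows "gap (rot n w) (rot n x) p q = gap w x (n - p) (n - q)"
 using assms by (simp add: gap_def rk_rot)

section \<open>Minimally singular permutations\<close>

lemma posbox_rot_imp:
 assumes "perm n w" "perm n x" "b <= Suc n" "d <= Suc n"
  and "posbox w x (Suc n - b) (Suc n - a) (Suc n - d) (Suc n - c)"
 shows "posbox (rot n w) (rot n x) a b c d"
 unfolding posbox_def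
proof (intro allI impI)
 fix p q assume *: "a <= p" "p < b" "c <= q" "q < d"
 hence "p <= n" "q <= n" using assms by auto
 hence "gap (rot n w) (rot n x) p q = gap w x (n - p) (n - q)" using gap_rot assms by blast
 moreover have "0 < gap w x (n - p) (n - q)"
  using assms(5) * \<open>p <= n\<close> \<open>q <= n\<close> unfolding posbox_def by auto
 ultimately show "0 < gap (rot n w) (rot n x) p q" by simp
qed

lemma posbox_rot:
 assumes "perm n w" "perm n x" "a <= Suc n" "b <= Suc n" "c <= Suc n" "d <= Suc n"
 shows "posbox (rot n w) (rot n x) a b c d <-> posbox w x (Suc n - b) (Suc n - a) (Suc n - d) (Suc n - c)"
proof
 assume "posbox (rot n w) (rot n x) a b c d"
 hence "posbox (rot n w) (rot n x) (Suc n - (Suc n - a)) (Suc n - (Suc n - b)) (Suc n - (Suc n - c)) (Suc n - (Suc n - d))"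
  using assms by simp
 hence "posbox (rot n (rot n w)) (rot n (rot n x)) (Suc n - b) (Suc n - a) (Suc n - d) (Suc n - c)"
  by (intro posbox_rot_imp[OF rot_permutes[OF assms(1)] rot_permutes[OF assms(2)]]) auto
 thus "posbox w x (Suc n - b) (Suc n - a) (Suc n - d) (Suc n - c)"
  by (simp only: rot_rot[OF assms(1)] rot_rot[OF assms(2)])
qed (intro posbox_rot_imp assms)

lemma rot_app: "1 <= i ==> i <= n ==> rot n x i = Suc n - x (Suc n - i)"
 by (simp add: rot_def)

lemma edge_rot_imp:
 assumes w: "perm n w" and x: "perm n x" and E: "edge w x i j"
 shows "edge (rot n w) (rot n x) (Suc n - j) (Suc n - i)"
proof -
 note r = edge_range[OF w x E]
 have xi: "rot n x (Suc n - i) = Suc n - x i" "rot n x (Suc n - j) = Suc n - x j" using r by (simp_all add: rot_app)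
 have "posbox (rot n w) (rot n x) (Suc n - j) (Suc n - i) (Suc n - x j) (Suc n - x i)"
  using E r by (subst posbox_rot[OF w x]) (auto simp: edge_def)
 thus ?thesis unfolding edge_def xi using r by auto
qed

lemma bad_rot_imp:
 assumes w: "perm n w" and x: "perm n x" and B: "bad w x i j k"
 shows "bad (rot n w) (rot n x) (Suc n - k) (Suc n - j) (Suc n - i)"
proof -
 have E: "edge w x i j" "edge w x j k" using B by (auto simp: bad_def)
 note r = edge_range[OF w x E(1)] edge_range[OF w x E(2)]
 have xi: "rot n x (Suc n - i) = Suc n - x i" "rot n x (Suc n - j) = Suc n - x j" "rot n x (Suc n - k) = Suc n - x k" 
  using r by (simp_all add: rot_app)
 show ?thesis using B edge_rot_imp[OF w x E(1)] edge_rot_imp[OF w x E(2)] r unfolding bad_def xi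
  by (simp add: posbox_rot[OF w x])
qed

lemma confI: "edge w x i j ==> edge w x k l ==> i ~= k ==> i ~= l ==> j ~= k ==> j ~= l ==>
  i <= p ==> p < j ==> k <= p ==> p < l ==> x i <= q ==> q < x j ==> x k <= q ==> q < x l ==> gap w x p q = 1
  ==> conf w x i j k l"
 unfolding conf_def by blast

lemma conf_rot_imp:
 assumes w: "perm n w" and x: "perm n x" and C: "conf w x i j k l"
 shows "conf (rot n w) (rot n x) (Suc n - j) (Suc n - i) (Suc n - l) (Suc n - k)"
proof -
 have E: "edge w x i j" "edge w x k l" and d: "{i, j} \<inter> {k, l} = {}" using C by (auto simp: conf_def)
 note r = edge_range[OF w x E(1)] edge_range[OF w x E(2)]
 have xi: "rot n x (Suc n - i) = Suc n - x i" "rot n x (Suc n - j) = Suc n - x j"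
  "rot n x (Suc n - k) = Suc n - x k" "rot n x (Suc n - l) = Suc n - x l"  
  using r by (simp_all add: rot_app)
 obtain p q where pq: "i <= p" "p < j" "x i <= q" "q < x j" "k <= p" "p < l" "x k <= q" "q < x l" "gap w x p q = 1"
  using C by (auto simp: conf_def)
 have "gap (rot n w) (rot n x) (n - p) (n - q) = 1" using pq r by (subst gap_rot[OF w x]) auto
 moreover have "Suc n - j <= n - p" "n - p < Suc n - i" "Suc n - x j <= n - q" "n - q < Suc n - x i"
   "Suc n - l <= n - p" "n - p < Suc n - k" "Suc n - x l <= n - q" "n - q < Suc n - x k" using pq r by auto
 moreover have neq: "Suc n - a ~= Suc n - b" if "a ~= b" "a <= n" "b <= n" for a b using that by linarith
 moreover have "j ~= l" "j ~= k" "i ~= l" "i ~= k" using d by auto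
 moreover have "i <= n" "j <= n" "k <= n" "l <= n" using r by auto
 ultimately show ?thesis unfolding xi[symmetric]
  by (intro confI[OF edge_rot_imp[OF w x E(1)] edge_rot_imp[OF w x E(2)], of "n - p" "n - q"] neq)
qed

lemma rle_rot:
 assumes w: "perm n w" and x: "perm n x" and le: "rle x w"
 shows "rle (rot n x) (rot n w)"
 unfolding rle_gap
proof (intro allI)
 fix p q
 show "0 <= gap (rot n w) (rot n x) p q"
  using gap_out[OF rot_permutes[OF w] rot_permutes[OF x], of p q] gap_rot[OF w x, of p q] le
  by (cases "p <= n & q <= n") (auto simp: rle_gap)
qed

lemma rot_sw:
 assumes x: "perm n x" and ij: "1 <= i" "i <= n" "1 <= j" "j <= n"
 shows "rot n (sw x i j) = sw (rot n x) (Suc n - i) (Suc n - j)"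
proof
 fix k
 consider "k = Suc n - i" | "k = Suc n - j" | "k ~= Suc n - i" "k ~= Suc n - j" "1 <= k & k <= n" | "k ~= Suc n - i" "k ~= Suc n - j" "~ (1 <= k & k <= n)" by blast
 thus "rot n (sw x i j) k = sw (rot n x) (Suc n - i) (Suc n - j) k"
 proof cases
  case 1 thus ?thesis using ij unfolding 1 sw_simps by (simp add: rot_app)
 next
  case 2 thus ?thesis using ij unfolding 2 sw_simps by (simp add: rot_app)
 next
  case 3
  hence "Suc n - k ~= i" "Suc n - k ~= j" using ij by auto
  thus ?thesis using 3 by (simp add: sw_other[OF 3(1,2)] rot_app sw_other del: comp_apply)
 next
  case 4 thus ?thesis unfolding sw_other[OF 4(1,2)] rot_def by auto
 qed
qed

lemma clean_rot:
 assumes w: "perm n w" and x: "perm n x" and c: "clean w x"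
 shows "clean (rot n w) (rot n x)"
proof -
 note W = rot_permutes[OF w] rot_permutes[OF x]
 show ?thesis unfolding clean_def
  using conf_rot_imp[OF W] bad_rot_imp[OF W] c unfolding rot_rot[OF w] rot_rot[OF x] clean_def by blast
qed

lemma nconf_rot:
 assumes w: "perm n w" and x: "perm n x" and ij: "1 <= i" "i <= n" "1 <= j" "j <= n"
 shows "nconf (rot n w) (rot n x) (Suc n - j) (Suc n - i) = nconf w x i j"
proof -
 let ?f = "%i. Suc n - i"
 note W = rot_permutes[OF w] rot_permutes[OF x]
 have ff: "?f (?f i) = i" if "i <= n" for i using that by simp
 have rc: "1 <= k & k <= n & 1 <= l & l <= n" if "perm n w" "perm n x" "conf w x i j k l" for k l i j w x
  using that edge_range[of w n x k l] by (auto simp: conf_def)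
 have rb: "1 <= i & i <= n & 1 <= k & k <= n" if "perm n w" "perm n x" "bad w x i j k" for k i j w x
  using that edge_range[of w n x j k] edge_range[of w n x i j] by (auto simp: bad_def)
 have c1: "conf w x i j (?f l) (?f k)" if "conf (rot n w) (rot n x) (?f j) (?f i) k l" for k l
  using conf_rot_imp[OF W that] ij by (simp only: rot_rot[OF w] rot_rot[OF x]) simp
 have b1: "bad w x i j (?f k)" if "bad (rot n w) (rot n x) k (?f j) (?f i)" for k
  using bad_rot_imp[OF W that] ij by (simp only: rot_rot[OF w] rot_rot[OF x]) simp
 have b2: "bad w x (?f k) i j" if "bad (rot n w) (rot n x) (?f j) (?f i) k" for k
  using bad_rot_imp[OF W that] ij by (simp only: rot_rot[OF w] rot_rot[OF x]) simp
 have "bij_betw (%(k, l). (?f l, ?f k)) {(k, l). conf w x i j k l} {(k, l). conf (rot n w) (rot n x) (?f j) (?f i) k l}"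
  by (rule bij_betw_byWitness[where f' = "%(k, l). (?f l, ?f k)"])
   (use rc[OF w x] rc[OF W] conf_rot_imp[OF w x] c1 in \<open>fastforce+\<close>)
 hence A: "card {(k, l). conf w x i j k l} = card {(k, l). conf (rot n w) (rot n x) (?f j) (?f i) k l}"
  by (rule bij_betw_same_card)
 have "bij_betw ?f {k. bad w x i j k} {k. bad (rot n w) (rot n x) k (?f j) (?f i)}"
  by (rule bij_betw_byWitness[where f' = ?f])
   (use rb[OF w x] rb[OF W] bad_rot_imp[OF w x] b1 in \<open>fastforce+\<close>)
 hence B: "card {k. bad w x i j k} = card {k. bad (rot n w) (rot n x) k (?f j) (?f i)}" by (rule bij_betw_same_card)
 have "bij_betw ?f {k. bad w x k i j} {k. bad (rot n w) (rot n x) (?f j) (?f i) k}"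
  by (rule bij_betw_byWitness[where f' = ?f])
   (use rb[OF w x] rb[OF W] bad_rot_imp[OF w x] b2 in \<open>fastforce+\<close>)
 hence C: "card {k. bad w x k i j} = card {k. bad (rot n w) (rot n x) (?f j) (?f i) k}" by (rule bij_betw_same_card)
 show ?thesis unfolding nconf_def A B C by simp
qed

lemma SW_dot:
 assumes w: "perm n w" and x: "perm n x" and le: "rle x w" and g: "0 < gap w x p q"
 obtains i where "i <= p" "x i <= q" "posbox w x i (Suc p) (x i) (Suc q)"
proof -
 have pn: "0 < p" "p < n" "0 < q" "q < n" using gap_out[OF w x, of p q] g by force+
 note W = rot_permutes[OF w] rot_permutes[OF x]
 have "0 < gap (rot n w) (rot n x) (n - p) (n - q)" using g pn by (simp add: gap_rot[OF w x])
 from NE_dot[OF W rle_rot[OF w x le] this]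
 obtain j where j: "n - p < j" "n - q < rot n x j" "posbox (rot n w) (rot n x) (n - p) j (n - q) (rot n x j)" .
 have "j <= n"
 proof (rule ccontr)
  assume "~ j <= n"
  hence "0 < gap (rot n w) (rot n x) n (n - q)" using j pn unfolding posbox_def by auto
  thus False using gap_out[OF W, of n "n - q"] by simp
 qed
 hence xj: "rot n x j = Suc n - x (Suc n - j)" "x (Suc n - j) <= n" using j perm_in[OF x, of "Suc n - j"] by (auto simp: rot_app)
 have "1 <= x (Suc n - j)" using perm_in[OF x, of "Suc n - j"] j \<open>j <= n\<close> by auto
 show ?thesis
 proof (rule that[of "Suc n - j"])
  show "Suc n - j <= p" "x (Suc n - j) <= q" using j xj \<open>j <= n\<close> pn by auto
  show "posbox w x (Suc n - j) (Suc p) (x (Suc n - j)) (Suc q)"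
   using j(3) xj \<open>j <= n\<close> pn by (simp add: posbox_rot[OF w x] Suc_diff_le)
 qed
qed

lemma posbox_sw_imp:
 assumes "i < j" "x i < x j" "posbox w (sw x i j) a b c d"
 shows "posbox w x a b c d"
proof -
 have "gap w (sw x i j) p q <= gap w x p q" for p q unfolding gap_sw[OF assms(1,2)] by simp
 thus ?thesis using assms(3) unfolding posbox_def by (meson less_le_trans)
qed

lemma conf_sym: "conf w x i j k l ==> conf w x k l i j"
 unfolding conf_def by blast

lemma conf_edges: "conf w x i j k l ==> edge w x i j" "conf w x i j k l ==> edge w x k l"
 unfolding conf_def by blast+

text \<open>The permutations to be understood are those where conflicts occur although every edge leads to a
 permutation without conflicts. All arguments are of one kind: if the edges at \<open>x\<close> had another
 shape, a conflict would survive after applying a suitable edge.\<close>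
locale msing =
 fixes n :: nat and w x :: "nat => nat" and \<delta> :: nat
 assumes w: "perm n w" and x: "perm n x" and le: "rle x w"
  and cl: "!!i j. edge w x i j ==> clean w (sw x i j)"
  and cnt: "!!i j. edge w x i j ==> nconf w x i j = \<delta>"
  and pos: "0 < \<delta>"
begin

abbreviation "gp \<equiv> gap w x"
abbreviation "bx \<equiv> posbox w x"
abbreviation "ed \<equiv> edge w x"
abbreviation "cf \<equiv> conf w x"
abbreviation "bd \<equiv> bad w x"

lemma msing_rot: "msing n (rot n w) (rot n x) \<delta>"
proof
 note W = rot_permutes[OF w] rot_permutes[OF x]
 show "perm n (rot n w)" "perm n (rot n x)" using W by auto
 show "rle (rot n x) (rot n w)" using rle_rot[OF w x le] .
 fix i j assume E: "edge (rot n w) (rot n x) i j"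
 note r = edge_range[OF W E]
 have E': "ed (Suc n - j) (Suc n - i)" using edge_rot_imp[OF W E] by (simp add: rot_rot[OF w] rot_rot[OF x])
 have "sw x (Suc n - j) (Suc n - i) permutes {1..n}" using edge_permutes[OF w x E'] .
 from clean_rot[OF w this cl[OF E']] 
 show "clean (rot n w) (sw (rot n x) i j)" using r by (simp add: rot_sw[OF x] sw_sym)
 show "nconf (rot n w) (rot n x) i j = \<delta>"
  using cnt[OF E'] nconf_rot[OF w x, of "Suc n - j" "Suc n - i"] r by simp
qed (rule pos)

lemma ge: "0 <= gp p q" using le by (simp add: rle_gap)

lemma x_eq: "x i = x j <-> i = j" using permutes_inj[OF x] by (auto dest: injD)

lemma edge_lt: "ed i j ==> i < j" "ed i j ==> x i < x j" "ed i j ==> bx i j (x i) (x j)"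
 by (auto simp: edge_def)

text \<open>The clean neighbours admit no conflict.\<close>

lemma no_conf:
 assumes E: "ed s t" and a: "edge w (sw x s t) i j" and b: "edge w (sw x s t) k l"
  and d: "i ~= k" "i ~= l" "j ~= k" "j ~= l"
  and p: "i <= p" "p < j" "k <= p" "p < l"
  and q: "sw x s t i <= q" "q < sw x s t j" "sw x s t k <= q" "q < sw x s t l"
  and g: "gp p q = 1" and o: "p < s | t <= p | q < x s | x t <= q"
 shows False
proof -
 have "gap w (sw x s t) p q = 1" using g o by (auto simp: gap_sw[OF edge_lt(1,2)[OF E]])
 hence "conf w (sw x s t) i j k l" unfolding conf_def using a b d p q by blast
 thus False using cl[OF E] by (auto simp: clean_def)
qed

lemma no_bad:
 assumes E: "ed s t" and a: "edge w (sw x s t) i j" and b: "edge w (sw x s t) j k"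
  and "~ bx i j (sw x s t j) (sw x s t k) | (EX p q. i <= p & p < j & sw x s t j <= q & q < sw x s t k &
    gp p q = 1 & s <= p & p < t & x s <= q & q < x t)"
  and "~ bx j k (sw x s t i) (sw x s t j)"
 shows False
proof -
 have "~ posbox w (sw x s t) i j (sw x s t j) (sw x s t k)"
  using assms(4)
 proof
  assume "~ bx i j (sw x s t j) (sw x s t k)"
  thus ?thesis using posbox_sw_imp[OF edge_lt(1,2)[OF E]] by blast
 next
  assume "EX p q. i <= p & p < j & sw x s t j <= q & q < sw x s t k &
    gp p q = 1 & s <= p & p < t & x s <= q & q < x t"
  thus ?thesis unfolding posbox_def gap_sw[OF edge_lt(1,2)[OF E]] by fastforce
 qed
 moreover have "~ posbox w (sw x s t) j k (sw x s t i) (sw x s t j)"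
  using assms(5) posbox_sw_imp[OF edge_lt(1,2)[OF E]] by blast
 ultimately have "bad w (sw x s t) i j k" using a b by (auto simp: bad_def)
 thus False using cl[OF E] by (auto simp: clean_def)
qed

lemma edge_sub: "ed u v ==> u <= a ==> a < b ==> b <= v ==> x u <= x a ==> x a < x b ==> x b <= x v ==> ed a b"
 unfolding edge_def by (auto intro: posbox_mono)

lemma edge_swI:
 assumes E: "ed s t" and "i < j" "c < d" "sw x s t i = c" "sw x s t j = d" "bx i j c d"
  and "j <= s | t <= i | d <= x s | x t <= c"
 shows "edge w (sw x s t) i j"
 unfolding edge_def assms(4,5) using assms posbox_sw[OF edge_lt(1,2)[OF E], of j i d c] by simp

text \<open>If the lower end of one edge were below the lower end of the other, applying the edge between these
 ends would leave a conflict or a bad path.\<close>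
lemma conf_bot_incomp: "cf u v u' v' ==> u < u' ==> x u < x u' ==> False"
proof -
 assume C: "cf u v u' v'" and uu: "u < u'" "x u < x u'"
 have E: "ed u v" "ed u' v'" and d: "u ~= u'" "u ~= v'" "v ~= u'" "v ~= v'" using C by (auto simp: conf_def)
 note l = edge_lt(1,2)[OF E(1)] edge_lt(1,2)[OF E(2)]
 note b = edge_lt(3)[OF E(1)] edge_lt(3)[OF E(2)]
 obtain p q where pq: "u <= p" "p < v" "x u <= q" "q < x v" "u' <= p" "p < v'" "x u' <= q" "q < x v'" "gp p q = 1"
  using C by (auto simp: conf_def)
 have Eu: "ed u u'" by (rule edge_sub[OF E(1)]) (use pq uu in auto)
 have s: "sw x u u' u = x u'" "sw x u u' u' = x u" "sw x u u' v = x v" "sw x u u' v' = x v'"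
  using d l by (auto simp: sw_other simp del: comp_apply)
 have e1: "edge w (sw x u u') u v"
  by (rule edge_swI[OF Eu _ _ s(1,3)]) (use pq uu in \<open>auto intro: posbox_mono[OF b(1)]\<close>)
 have e2: "edge w (sw x u u') u' v"
  by (rule edge_swI[OF Eu _ _ s(2,3)]) (use pq uu in \<open>auto intro: posbox_mono[OF b(1)]\<close>)
 have A: False if "bx u' v' (x u) (x v')"
 proof -
  have "edge w (sw x u u') u' v'" by (rule edge_swI[OF Eu _ _ s(2,4)]) (use that l uu in auto)
  thus False by (rule no_conf[OF Eu e1 _ d _ _ _ _ _ _ _ _ pq(9)]) (use pq s in auto)
 qed
 have B: False if "bx u v' (x u') (x v')"
 proof -
  have "edge w (sw x u u') u v'" by (rule edge_swI[OF Eu _ _ s(1,4)]) (use that l uu in auto)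
  thus False by (rule no_conf[OF Eu _ e2 _ _ _ _ _ _ _ _ _ _ _ _ pq(9)]) (use pq s d in auto)
 qed
 consider "v' < v" | "x v' < x v" | "v < v'" "x v < x v'" using d x_eq[of v v'] by linarith
 thus False
 proof cases
  case 1
  have "bx u' v' (x u) (x v')" 
   using 1 uu l b(2) posbox_splitq[of "x u" "x u'" "x v'" w x u' v'] posbox_mono[OF b(1), of u' v' "x u" "x u'"] pq by auto
  thus ?thesis by (rule A)
 next
  case 2
  have "bx u v' (x u') (x v')"
   using 2 uu l b(2) posbox_splitp[of u u' v' w x "x u'" "x v'"] posbox_mono[OF b(1), of u u' "x u'" "x v'"] pq by auto
  thus ?thesis by (rule B)
 next
  case 3
  have nB: "~ bx u u' (x v) (x v')"
  proof
   assume "bx u u' (x v) (x v')"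
   hence "bx u v' (x u') (x v')"
    using 3 uu l b(2) posbox_splitp[of u u' v' w x "x u'" "x v'"] posbox_splitq[of "x u'" "x v" "x v'" w x u u']
     posbox_mono[OF b(1), of u u' "x u'" "x v"] pq by auto
   thus False by (rule B)
  qed
  have nA: "~ bx v v' (x u) (x u')"
  proof
   assume "bx v v' (x u) (x u')"
   hence "bx u' v' (x u) (x v')"
    using 3 uu l b(2) posbox_splitq[of "x u" "x u'" "x v'" w x u' v'] posbox_splitp[of u' v v' w x "x u" "x u'"]
     posbox_mono[OF b(1), of u' v "x u" "x u'"] pq by auto
   thus False by (rule A)
  qed
  have Ev: "ed u' v" by (rule edge_sub[OF E(1)]) (use pq uu l in auto)
  have s: "sw x u' v u = x u" "sw x u' v u' = x v" "sw x u' v v' = x v'"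
   using d l uu by (auto simp: sw_other simp del: comp_apply)
  have f1: "edge w (sw x u' v) u u'"
   by (rule edge_swI[OF Ev _ _ s(1,2)]) (use pq uu l in \<open>auto intro: posbox_mono[OF b(1)]\<close>)
  have f2: "edge w (sw x u' v) u' v'"
   by (rule edge_swI[OF Ev _ _ s(2,3)]) (use pq uu l 3 in \<open>auto intro: posbox_mono[OF b(2)]\<close>)
  show False
  proof (rule no_bad[OF Ev f1 f2])
   show "~ bx u' v' (sw x u' v u) (sw x u' v u')" unfolding s
    using nA posbox_mono[of w x u' v' "x u" "x v" v v' "x u" "x u'"] pq by auto
  qed (unfold s, use nB in blast)
 qed
qed

lemma conf_incomp_bot:
 assumes "cf u v u' v'" shows "(u < u' & x u' < x u) | (u' < u & x u < x u')"
proof -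
 have "u ~= u'" using assms by (auto simp: conf_def)
 thus ?thesis using conf_bot_incomp[OF assms] conf_bot_incomp[OF conf_sym[OF assms]] x_eq[of u u']
  by (meson linorder_neqE_nat)
qed

text \<open>Otherwise applying the edge from \<open>b\<close> to \<open>m\<close> would keep a conflict with the edge from \<open>a\<close> to \<open>c\<close>.\<close>
lemma conf_exchange:
 assumes C: "cf b d a c" and E: "ed b m" and m: "m ~= a" "m ~= c"
 shows "cf b m a c"
proof (rule ccontr)
 assume nC: "~ cf b m a c"
 have Eb: "ed b d" "ed a c" and dd: "b ~= a" "b ~= c" "d ~= a" "d ~= c" using C by (auto simp: conf_def)
 note l = edge_lt(1,2)[OF Eb(1)] edge_lt(1,2)[OF Eb(2)] edge_lt(1,2)[OF E]
 note bx = edge_lt(3)[OF Eb(1)] edge_lt(3)[OF Eb(2)]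
 obtain p q where pq: "b <= p" "p < d" "x b <= q" "q < x d" "a <= p" "p < c" "x a <= q" "q < x c" "gp p q = 1"
  using C by (auto simp: conf_def)
 have md: "m ~= d" using nC C by auto
 have out: "m <= p | x m <= q"
 proof (rule ccontr)
  assume "~ (m <= p | x m <= q)"
  hence "cf b m a c" by (intro confI[OF E Eb(2) dd(1,2) m _ _ _ _ _ _ _ _ pq(9)]) (use pq in auto)
  thus False using nC by simp
 qed
 have s: "sw x b m b = x m" "sw x b m m = x b" "sw x b m d = x d" "sw x b m a = x a" "sw x b m c = x c"
  using dd m md l by (auto simp: sw_other simp del: comp_apply)
 have ac: "edge w (sw x b m) a c"
 proof -
  have "0 < gap w (sw x b m) p' q'" if "a <= p'" "p' < c" "x a <= q'" "q' < x c" for p' q'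
  proof -
   have g: "0 < gp p' q'" using bx(2) that by (auto simp: posbox_def)
   moreover have "~ (gp p' q' = 1 & b <= p' & p' < m & x b <= q' & q' < x m)"
    using nC E Eb m dd that unfolding conf_def by blast
   ultimately show ?thesis unfolding gap_sw[OF l(5,6)] by auto
  qed
  thus ?thesis using l s unfolding edge_def posbox_def by auto
 qed
 from out show False
 proof
  assume mp: "m <= p"
  have "edge w (sw x b m) m d"
   by (rule edge_swI[OF E _ _ s(2,3)]) (use mp pq l in \<open>auto intro: posbox_mono[OF bx(1)]\<close>)
  thus False
   by (rule no_conf[OF E _ ac _ _ _ _ _ _ _ _ _ _ _ _ pq(9)]) (use mp pq s dd m in auto)
 next
  assume mp: "x m <= q"
  have "edge w (sw x b m) b d"
   by (rule edge_swI[OF E _ _ s(1,3)]) (use mp pq l in \<open>auto intro: posbox_mono[OF bx(1)]\<close>)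
  thus False
   by (rule no_conf[OF E _ ac _ _ _ _ _ _ _ _ _ _ _ _ pq(9)]) (use mp pq s dd m in auto)
 qed
qed

end

section \<open>The bipartite block of a conflict\<close>

lemma conf_unrot:
 assumes w: "perm n w" and x: "perm n x" and C: "conf (rot n w) (rot n x) i j k l"
 shows "conf w x (Suc n - j) (Suc n - i) (Suc n - l) (Suc n - k)"
 using conf_rot_imp[OF rot_permutes[OF w] rot_permutes[OF x] C] by (simp only: rot_rot[OF w] rot_rot[OF x])

context msing
begin

lemma edge_rng: "ed i j ==> 1 <= i & j <= n & i <= n & 1 <= j"
 using edge_range[OF w x, of i j] by auto

lemma conf_exchange_top:
 assumes C: "cf b d a c" and E: "ed m d" and m: "m ~= a" "m ~= c"
 shows "cf m d a c"
proof -
 interpret R: msing n "rot n w" "rot n x" \<delta> by (rule msing_rot)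
 note r = edge_rng[OF conf_edges(1)[OF C]] edge_rng[OF conf_edges(2)[OF C]] edge_rng[OF E]
 have "Suc n - m ~= Suc n - c" "Suc n - m ~= Suc n - a" using r m by linarith+
 from R.conf_exchange[OF conf_rot_imp[OF w x C] edge_rot_imp[OF w x E] this]
 show ?thesis using conf_unrot[OF w x] r by fastforce
qed

lemma conf_incomp_top:
 assumes C: "cf u v u' v'" shows "(v < v' & x v' < x v) | (v' < v & x v < x v')"
proof -
 interpret R: msing n "rot n w" "rot n x" \<delta> by (rule msing_rot)
 note r = edge_range[OF w x conf_edges(1)[OF C]] edge_range[OF w x conf_edges(2)[OF C]]
 have "rot n x (Suc n - v) = Suc n - x v" "rot n x (Suc n - v') = Suc n - x v'" using r by (simp_all add: rot_app)
 moreover have "v <= n" "v' <= n" "x v <= n" "x v' <= n" using r by simp_all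
 ultimately show ?thesis using R.conf_incomp_bot[OF conf_rot_imp[OF w x C]] by auto
qed

lemma conf_dot_free:
 assumes C: "cf u v u' v'" and m: "u < m" "m < v" "x u < x m" "x m < x v"
 shows False
proof -
 have E: "ed u v" using C by (rule conf_edges)
 have em: "ed u m" "ed m v" by (rule edge_sub[OF E]; use m in auto)+
 have "m ~= u'" "m ~= v'" using conf_incomp_bot[OF C] conf_incomp_top[OF C] m by auto
 hence c: "cf u m u' v'" "cf m v u' v'"
  using conf_exchange[OF C em(1)] conf_exchange_top[OF C em(2)] by auto
 from c(1) have "u' < m" "x u' < x m" by (auto simp: conf_def)
 thus False using conf_incomp_bot[OF c(2)] by auto
qed

lemma ex_max_col:
 fixes a b :: nat
 assumes "EX p q. b <= p & p < a & (Q p q :: bool)"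
 obtains p q where "b <= p" "p < a" "Q p q" "!!p' q'. p < p' ==> p' < a ==> ~ Q p' (q' :: nat)"
proof -
 let ?S = "{p. b <= p & p < a & (EX q. Q p q)}"
 have f: "finite ?S" by (rule finite_subset[of _ "{..<a}"]) auto
 have ne: "?S ~= {}" using assms by auto
 have "Max ?S \<in> ?S" using f ne by (rule Max_in)
 then obtain q where q: "b <= Max ?S" "Max ?S < a" "Q (Max ?S) q" by blast
 have "~ Q p' q'" if "Max ?S < p'" "p' < a" for p' q'
 proof
  assume "Q p' q'"
  hence "p' \<in> ?S" using that q by auto
  hence "p' <= Max ?S" using f by simp
  thus False using that by simp
 qed
 thus ?thesis using that[OF q] by blast
qed

text \<open>The upper ends of two conflicting edges can be exchanged. If the corner between them contained
 a zero of the gap, the rightmost one would produce a point \<open>m\<close> of the graph and an edge from \<open>m\<close> that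
 leaves the conflict intact.\<close>
lemma conf_cross_aux:
 assumes C: "cf u v u' v'" and uu: "u < u'"
 shows "cf u v' u' v"
proof -
 have E: "ed u v" "ed u' v'" and d: "u ~= u'" "u ~= v'" "v ~= u'" "v ~= v'" using C by (auto simp: conf_def)
 note l = edge_lt(1,2)[OF E(1)] edge_lt(1,2)[OF E(2)]
 note b = edge_lt(3)[OF E(1)] edge_lt(3)[OF E(2)]
 obtain p q where pq: "u <= p" "p < v" "x u <= q" "q < x v" "u' <= p" "p < v'" "x u' <= q" "q < x v'" "gp p q = 1"
  using C by (auto simp: conf_def)
 have xu: "x u' < x u" using conf_incomp_bot[OF C] uu by auto
 consider "v < v'" "x v' < x v" | "v' < v" "x v < x v'" using conf_incomp_top[OF C] by auto
 thus ?thesis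
 proof cases
  case 1
  have "bx u v' (x u) (x v')"
   using posbox_splitp[of u v v' w x "x u" "x v'"] posbox_mono[OF b(1), of u v "x u" "x v'"]
    posbox_mono[OF b(2), of v v' "x u" "x v'"] 1 l xu uu pq by auto
  hence e1: "ed u v'" unfolding edge_def using uu l xu pq by auto
  have "bx u' v (x u') (x v)"
   using posbox_splitq[of "x u'" "x u" "x v" w x u' v] posbox_mono[OF b(1), of u' v "x u" "x v"]
    posbox_mono[OF b(2), of u' v "x u'" "x u"] 1 l xu uu pq by auto
  hence e2: "ed u' v" unfolding edge_def using uu l xu pq by auto
  show ?thesis by (rule confI[OF e1 e2 _ _ _ _ _ _ _ _ _ _ _ _ pq(9)]) (use d pq l in auto)
 next
  case 2
  have NW: "bx u u' (x v) (x v')"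
  proof (rule ccontr)
   let ?Q = "%p q. x v <= q & q < x v' & gp p q = 0"
   assume "~ bx u u' (x v) (x v')"
   hence "EX p q. u <= p & p < u' & ?Q p q" unfolding posbox_def using ge by (meson antisym not_le)
   then obtain \<alpha> \<beta> where \<alpha>: "u <= \<alpha>" "\<alpha> < u'" "?Q \<alpha> \<beta>" and mx: "!!p' q'. \<alpha> < p' ==> p' < u' ==> ~ ?Q p' q'"
    by (rule ex_max_col) blast
   have "0 < gp p \<beta>" "0 < gp \<alpha> q"
    using b \<alpha> pq l xu 2 uu unfolding posbox_def by auto
   hence "gp p q - gp p \<beta> - gp \<alpha> q + gp \<alpha> \<beta> < 0" using pq(9) \<alpha> by linarith
   then obtain m where m: "\<alpha> < m" "m <= p" "q < x m" "x m <= \<beta>"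
    using ex_dot[of \<alpha> p q \<beta> w x] \<alpha> pq by auto
   have m1: "x v < x m"
   proof (rule ccontr)
    assume "~ ?thesis"
    moreover have "x m ~= x v" using m pq x_eq by auto
    ultimately show False using conf_dot_free[OF C, of m] m \<alpha> pq by auto
   qed
   have m2: "m < u'"
   proof (rule ccontr)
    assume "~ ?thesis"
    moreover have "m ~= u'" using m pq by auto
    ultimately show False using conf_dot_free[OF conf_sym[OF C], of m] m \<alpha> pq by auto
   qed
   have "bx m u' (x m) (x v')" unfolding posbox_def
   proof (intro allI impI)
    fix p q assume h: "m <= p" "p < u'" "x m <= q" "q < x v'"
    hence "~ ?Q p q" using mx m by auto
    thus "0 < gp p q" using h m1 ge[of p q] by auto
   qed
   hence "bx m v' (x m) (x v')"
    using posbox_splitp[of m u' v' w x "x m" "x v'"] posbox_mono[OF b(2), of u' v' "x m" "x v'"] m m1 m2 pq by auto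
   hence Em: "ed m v'" unfolding edge_def using m m1 m2 pq l \<alpha> by auto
   have s: "sw x m v' u' = x u'" "sw x m v' v' = x m" "sw x m v' u = x u" "sw x m v' v = x v"
    using m m1 m2 d l \<alpha> pq by (auto simp: sw_other simp del: comp_apply)
   have f1: "edge w (sw x m v') u' v'"
    by (rule edge_swI[OF Em _ _ s(1,2)]) (use m m1 m2 l pq \<alpha> in \<open>auto intro: posbox_mono[OF b(2)]\<close>)
   have f2: "edge w (sw x m v') u v"
    by (rule edge_swI[OF Em _ _ s(3,4)]) (use m m1 m2 l pq \<alpha> in \<open>auto intro: posbox_mono[OF b(1)]\<close>)
   show False
    by (rule no_conf[OF Em f1 f2 _ _ _ _ _ _ _ _ _ _ _ _ pq(9)]) (use d pq s m m1 m2 in auto)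
  qed
  have box: "bx u v' (x u) (x v')"
   using posbox_splitp[of u u' v' w x "x u" "x v'"] posbox_splitq[of "x u" "x v" "x v'" w x u u'] NW
    posbox_mono[OF b(1), of u u' "x u" "x v"] posbox_mono[OF b(2), of u' v' "x u" "x v'"] 2 l xu uu pq by auto
  hence Eb: "ed u v'" unfolding edge_def using uu l xu pq 2 by auto
  have SE: "bx v' v (x u') (x u)"
  proof (rule ccontr)
   assume nb: "~ ?thesis"
   have s: "sw x u v' u' = x u'" "sw x u v' v' = x u" "sw x u v' v = x v"
    using d l uu 2 by (auto simp: sw_other simp del: comp_apply)
   have f1: "edge w (sw x u v') u' v'"
    by (rule edge_swI[OF Eb _ _ s(1,2)]) (use l pq xu in \<open>auto intro: posbox_mono[OF b(2)]\<close>)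
   have f2: "edge w (sw x u v') v' v"
    by (rule edge_swI[OF Eb _ _ s(2,3)]) (use l pq xu 2 in \<open>auto intro: posbox_mono[OF b(1)]\<close>)
   show False
   proof (rule no_bad[OF Eb f1 f2])
    show "~ bx u' v' (sw x u v' v') (sw x u v' v) | (EX p q. u' <= p & p < v' & sw x u v' v' <= q & q < sw x u v' v &
     gp p q = 1 & u <= p & p < v' & x u <= q & q < x v')"
     unfolding s by (rule disjI2, rule exI[of _ p], rule exI[of _ q]) (use pq in auto)
    show "~ bx v' v (sw x u v' u') (sw x u v' v')" unfolding s by (rule nb)
   qed
  qed
  have "bx u' v (x u') (x v)"
   using posbox_splitp[of u' v' v w x "x u'" "x v"] posbox_splitq[of "x u'" "x u" "x v" w x v' v] SE
    posbox_mono[OF b(2), of u' v' "x u'" "x v"] posbox_mono[OF b(1), of v' v "x u" "x v"] 2 l xu uu pq by auto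
  hence e2: "ed u' v" unfolding edge_def using uu l xu pq 2 by auto
  show ?thesis by (rule confI[OF Eb e2 _ _ _ _ _ _ _ _ _ _ _ _ pq(9)]) (use d pq l in auto)
 qed
qed

lemma conf_cross:
 assumes C: "cf u v u' v'" shows "cf u v' u' v"
 using conf_incomp_bot[OF C] conf_cross_aux[OF C] conf_cross_aux[OF conf_sym[OF C]] conf_sym by blast

text \<open>An edge in conflict with neither part of a conflict or a bad path leaves it intact; this gives
 the next two lemmas.\<close>
lemma conf_edge_persist:
 assumes E: "ed s t" and F: "ed a c" and d: "s ~= a" "s ~= c" "t ~= a" "t ~= c" and nC: "~ cf s t a c"
 shows "edge w (sw x s t) a c"
proof -
 note l = edge_lt[OF E] edge_lt[OF F]
 have s: "sw x s t a = x a" "sw x s t c = x c" using d by (auto simp: sw_other simp del: comp_apply)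
 have "0 < gap w (sw x s t) p' q'" if "a <= p'" "p' < c" "x a <= q'" "q' < x c" for p' q'
 proof -
  have g: "0 < gp p' q'" using l(6) that by (auto simp: posbox_def)
  moreover have "~ (gp p' q' = 1 & s <= p' & p' < t & x s <= q' & q' < x t)"
   using nC E F d that unfolding conf_def by blast
  ultimately show ?thesis unfolding gap_sw[OF l(1,2)] by auto
 qed
 thus ?thesis using l s unfolding edge_def posbox_def by auto
qed

lemma conf_disjoint_edge:
 assumes C: "cf b d a c" and E: "ed k l" and dj: "{k, l} \<inter> {b, d, a, c} = {}"
 shows "cf k l b d | cf k l a c"
proof (rule ccontr)
 assume n: "~ ?thesis"
 have Eb: "ed b d" "ed a c" and dd: "b ~= a" "b ~= c" "d ~= a" "d ~= c" using C by (auto simp: conf_def)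
 obtain p q where pq: "b <= p" "p < d" "x b <= q" "q < x d" "a <= p" "p < c" "x a <= q" "q < x c" "gp p q = 1"
  using C by (auto simp: conf_def)
 have f: "edge w (sw x k l) b d" "edge w (sw x k l) a c"
  using conf_edge_persist[OF E Eb(1)] conf_edge_persist[OF E Eb(2)] n dj by auto
 have s: "sw x k l b = x b" "sw x k l d = x d" "sw x k l a = x a" "sw x k l c = x c"
  using dj by (auto simp: sw_other simp del: comp_apply)
 have "~ (k <= p & p < l & x k <= q & q < x l)"
  using confI[OF E Eb(1) _ _ _ _ _ _ _ _ _ _ _ _ pq(9)] n dj pq by auto
 thus False
  by (intro no_conf[OF E f dd _ _ _ _ _ _ _ _ pq(9)]) (use pq s in auto)
qed

lemma bad_disjoint_edge:
 assumes B: "bd p q r" and E: "ed k l" and dj: "{k, l} \<inter> {p, q, r} = {}"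
 shows "cf k l p q | cf k l q r"
proof (rule ccontr)
 assume n: "~ ?thesis"
 have Eb: "ed p q" "ed q r" and nn: "~ bx p q (x q) (x r)" "~ bx q r (x p) (x q)"
  using B by (auto simp: bad_def)
 have f: "edge w (sw x k l) p q" "edge w (sw x k l) q r"
  using conf_edge_persist[OF E Eb(1)] conf_edge_persist[OF E Eb(2)] n dj by auto
 have s: "sw x k l p = x p" "sw x k l q = x q" "sw x k l r = x r"
  using dj by (auto simp: sw_other simp del: comp_apply)
 show False by (rule no_bad[OF E f]) (unfold s, use nn in auto)
qed

lemma conf_nbr:
 assumes C: "cf u v u' v'" and E: "ed u m"
 shows "ed u' m"
proof -
 consider "m = v" | "m = v'" | "m ~= v" "m ~= v'" by blast
 thus ?thesis
 proof cases
  case 3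
  have "m ~= u'" using edge_lt(1,2)[OF E] conf_incomp_bot[OF C] by auto
  from conf_exchange[OF C E this 3(2)] show ?thesis using conf_cross conf_edges by blast
 qed (use C conf_cross conf_edges in blast)+
qed

lemma conf_nbr_top:
 assumes C: "cf u v u' v'" and E: "ed m v"
 shows "ed m v'"
proof -
 consider "m = u" | "m = u'" | "m ~= u" "m ~= u'" by blast
 thus ?thesis
 proof cases
  case 3
  have "m ~= v'" using edge_lt(1,2)[OF E] conf_incomp_top[OF C] by auto
  from conf_exchange_top[OF C E 3(2) this] show ?thesis using conf_cross conf_edges by blast
 qed (use C conf_cross conf_edges in blast)+
qed

lemma conf_nbr2:
 assumes C: "cf u v u' v'" and E: "ed u m" "ed u m'" and ne: "m ~= m'"
 shows "cf u m u' m'"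
proof -
 have u: "k ~= u'" "k ~= u" if "ed u k" for k
  using edge_lt(1,2)[OF that] conf_incomp_bot[OF C] by auto
 have E': "ed u' m'" using conf_nbr[OF C E(2)] .
 show ?thesis
 proof (cases "m = v'")
  case False
  have "cf u m u' v'" using conf_exchange[OF C E(1)] u[OF E(1)] False by blast
  from conf_exchange[OF conf_sym[OF this] E'] show ?thesis using u[OF E(2)] ne conf_sym by blast
 next
  case True
  have "cf u m u' v" using conf_cross[OF C] True by simp
  from conf_exchange[OF conf_sym[OF this] E'] show ?thesis using u[OF E(2)] ne conf_sym by blast
 qed
qed

lemma conf_nbr2_top:
 assumes C: "cf u v u' v'" and E: "ed m v" "ed m' v" and ne: "m ~= m'"
 shows "cf m v m' v'"
proof -
 have u: "k ~= v'" "k ~= v" if "ed k v" for k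
  using edge_lt(1,2)[OF that] conf_incomp_top[OF C] by auto
 have E': "ed m' v'" using conf_nbr_top[OF C E(2)] .
 show ?thesis
 proof (cases "m = u'")
  case False
  have "cf m v u' v'" using conf_exchange_top[OF C E(1)] u[OF E(1)] False by blast
  from conf_exchange_top[OF conf_sym[OF this] E'] show ?thesis using u[OF E(2)] ne conf_sym by blast
 next
  case True
  have "cf m v u v'" using conf_sym[OF conf_cross[OF C]] True by simp
  from conf_exchange_top[OF conf_sym[OF this] E'] show ?thesis using u[OF E(2)] ne conf_sym by blast
 qed
qed

text \<open>By exchanging ends, a single conflict spreads to all edges between the neighbours of its ends.\<close>
definition block where "block B D \<equiv> (EX b:B. EX b':B. b ~= b') & (EX d:D. EX d':D. d ~= d') &
   (ALL u:B. ALL v. ed u v <-> v \<in> D) & (ALL v:D. ALL u. ed u v <-> u \<in> B) &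
   (ALL u:B. ALL u':B. ALL v:D. ALL v':D. u ~= u' --> v ~= v' --> cf u v u' v')"

lemma conf_block:
 assumes C: "cf b d a c"
 shows "block {u. ed u d} {v. ed b v}"
proof -
 let ?B = "{u. ed u d}" and ?D = "{v. ed b v}"
 have e: "ed b d" "ed a c" "ed b c" "ed a d" using C conf_cross conf_edges by blast+
 have ne: "b ~= a" "d ~= c" using C by (auto simp: conf_def)
 have nb: "ed u v <-> ed b v" if "ed u d" for u v
 proof (cases "u = b")
  case False
  have "cf u d b c" using conf_nbr2_top[OF C that e(1) False] .
  thus ?thesis using conf_nbr conf_sym by blast
 qed simp
 have cf: "cf u v u' v'" if h: "ed u d" "ed u' d" "ed b v" "ed b v'" "u ~= u'" "v ~= v'" for u u' v v'
 proof -
  have "cf u d u' c" using conf_nbr2_top[OF C h(1,2,5)] .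
  thus ?thesis using conf_nbr2 nb h by blast
 qed
 have tp: "ed u v <-> ed u d" if v: "ed b v" for u v
 proof
  assume "ed u d" thus "ed u v" using nb v by blast
 next
  assume h: "ed u v"
  show "ed u d"
  proof (cases "v = d")
   case False
   have "cf b v a d" using cf[of b a v d] e v ne False by blast
   thus ?thesis using conf_nbr_top h by blast
  qed (use h in simp)
 qed
 show ?thesis unfolding block_def
 proof (intro conjI)
  show "EX b:?B. EX b':?B. b ~= b'" using e(1,4) ne(1) by blast
  show "EX d:?D. EX d':?D. d ~= d'" using e(1,3) ne(2) by blast
  show "ALL u:?B. ALL v. ed u v <-> v \<in> ?D" using nb by simp
  show "ALL v:?D. ALL u. ed u v <-> u \<in> ?B" using tp by simp
  show "ALL u:?B. ALL u':?B. ALL v:?D. ALL v':?D. u ~= u' --> v ~= v' --> cf u v u' v'" using cf by simp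
 qed
qed

lemma block_incomp_bot: "block B D ==> u \<in> B ==> u' \<in> B ==> u < u' ==> x u' < x u"
 unfolding block_def using conf_incomp_bot by (metis less_asym less_irrefl)

lemma block_incomp_top: "block B D ==> v \<in> D ==> v' \<in> D ==> v < v' ==> x v' < x v"
 unfolding block_def using conf_incomp_top by (metis less_asym less_irrefl)

lemma block_other_edge:
 assumes bl: "block B D" and b: "b \<in> B" "a \<in> B" "b ~= a" and d: "d \<in> D" "c \<in> D" "d ~= c"
  and E: "ed k l" and k: "k \<notin> B"
 shows "k \<in> {d, c} | l \<in> {b, a}"
proof (rule ccontr)
 assume n: "~ ?thesis"
 have C: "cf b d a c" using bl b d by (auto simp: block_def)
 have lD: "l \<notin> D" using bl E k by (auto simp: block_def)
 have "{k, l} \<inter> {b, d, a, c} = {}" using n lD k b d by auto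
 from conf_disjoint_edge[OF C E this] have "ed k d | ed k c"
  using conf_cross conf_edges by blast
 thus False using bl k d by (auto simp: block_def)
qed

lemma block_disjoint: assumes "block B D" "u \<in> B" shows "u \<notin> D"
proof
 assume u: "u \<in> D"
 obtain d where d: "d \<in> D" "d ~= u" using assms(1) unfolding block_def by metis
 hence "ed u d" using assms by (auto simp: block_def)
 thus False using edge_lt(1,2) block_incomp_top[OF assms(1) u d(1)] by force
qed

text \<open>An edge entering the block from below has to meet every conflict of the block, which leaves room for only
 two lower ends.\<close>
lemma block_in_edge:
 assumes bl: "block B D" and b: "b \<in> B" and E: "ed m b"
 shows "EX a. a ~= b & B = {b, a}" "!!v. v \<in> D ==> bd m b v"
proof -
 obtain a where a: "a \<in> B" "a ~= b" using bl unfolding block_def by metis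
 obtain d c where dc: "d \<in> D" "c \<in> D" "d ~= c" using bl by (auto simp: block_def)
 have mB: "m \<notin> B" using bl b E block_disjoint[OF bl b] by (auto simp: block_def)
 have mD: "m \<notin> D"
 proof
  assume "m \<in> D" hence "ed b m" using bl b by (auto simp: block_def)
  thus False using edge_lt(1)[OF E] edge_lt(1) by fastforce
 qed
 have "u = a" if u: "u \<in> B" "u ~= b" for u
 proof (rule ccontr)
  assume "u ~= a"
  from block_other_edge[OF bl u(1) a(1) this dc E mB] show False using u a dc mD by auto
 qed
 thus "EX a. a ~= b & B = {b, a}" using a b by blast
 fix v assume v: "v \<in> D"
 obtain v' where v': "v' \<in> D" "v' ~= v" using dc by (cases "v = d") auto
 have C: "cf b v a v'" using bl b a v v' by (auto simp: block_def)
 have Eb: "ed b v" "ed a v'" and dd: "b ~= a" "b ~= v'" "v ~= a" "v ~= v'" using C by (auto simp: conf_def)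
 note l = edge_lt(1,2)[OF Eb(1)] edge_lt(1,2)[OF Eb(2)] edge_lt(1,2)[OF E]
 note bx = edge_lt(3)[OF Eb(1)] edge_lt(3)[OF Eb(2)] edge_lt(3)[OF E]
 obtain p q where pq: "b <= p" "p < v" "x b <= q" "q < x v" "a <= p" "p < v'" "x a <= q" "q < x v'" "gp p q = 1"
  using C by (auto simp: conf_def)
 have nc: "~ cf m b a v'"
 proof
  assume "cf m b a v'"
  hence "ed m v'" using conf_cross conf_edges by blast
  thus False using bl v' mB unfolding block_def by blast
 qed
 have mm: "m ~= a" "m ~= v'" "m ~= v" using mB mD a v v' by auto
 have f: "edge w (sw x m b) a v'"
  by (rule conf_edge_persist[OF E Eb(2) _ _ _ _ nc]) (use mm dd in auto)
 have s: "sw x m b m = x b" "sw x m b b = x m" "sw x m b v = x v" "sw x m b a = x a" "sw x m b v' = x v'"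
  using dd mm l by (auto simp: sw_other simp del: comp_apply)
 show "bd m b v"
 proof (rule ccontr)
  assume "~ ?thesis"
  then consider "bx m b (x b) (x v)" | "bx b v (x m) (x b)" using E Eb by (auto simp: bad_def)
  thus False
  proof cases
   case 1
   hence "bx m v (x b) (x v)" using bx(1) posbox_splitp[of m b v w x "x b" "x v"] l by auto
   hence "edge w (sw x m b) m v" by (intro edge_swI[OF E _ _ s(1,3)]) (use l in auto)
   thus False
    by (rule no_conf[OF E _ f _ _ _ _ _ _ _ _ _ _ _ _ pq(9)]) (use pq dd mm l(5,6) in \<open>simp_all only: s\<close>, simp_all)
  next
   case 2
   hence "bx b v (x m) (x v)" using bx(1) posbox_splitq[of "x m" "x b" "x v" w x b v] l by auto
   hence "edge w (sw x m b) b v" by (intro edge_swI[OF E _ _ s(2,3)]) (use l in auto)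
   thus False
    by (rule no_conf[OF E _ f _ _ _ _ _ _ _ _ _ _ _ _ pq(9)]) (use pq dd mm l(5,6) in \<open>simp_all only: s\<close>, simp_all)
  qed
 qed
qed

definition tri where "tri A M D \<equiv> A ~= {} & D ~= {} & (EX m:M. EX m':M. m ~= m') & A \<inter> M = {} & A \<inter> D = {} & M \<inter> D = {} &
   (ALL u v. ed u v <-> u \<in> A & v \<in> M | u \<in> M & v \<in> D) &
   (ALL u:A. ALL m:M. ALL v:D. bd u m v) & 
   (card M = 2 | (EX a d. A = {a} & D = {d}))"

text \<open>Equal numbers of conflicts of the edges from both lower ends yield equally many, hence the same, edges
 into them.\<close>
lemma block_tri:
 assumes bl: "block B D" and b: "b \<in> B" and E: "ed m b"
 shows "tri {u. ed u b} B D"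
proof -
 let ?A = "{u. ed u b}"
 obtain a where a: "a ~= b" "B = {b, a}" using block_in_edge(1)[OF bl b E] by blast
 have aB: "a \<in> B" using a by simp
 obtain d c where dc: "d \<in> D" "c \<in> D" "d ~= c" using bl by (auto simp: block_def)
 have nbr: "ed u v <-> v \<in> D" if "u \<in> B" for u v using bl that by (auto simp: block_def)
 have nbrt: "ed u v <-> u \<in> B" if "v \<in> D" for u v using bl that by (auto simp: block_def)
 have AB: "u \<notin> B" "u \<notin> D" if "ed u v" "v \<in> B" for u v
 proof -
  show "u \<notin> B" using nbr that block_disjoint[OF bl that(2)] by blast
  show "u \<notin> D"
  proof
   assume "u \<in> D" hence "ed v u" using nbr that by blast
   thus False using edge_lt(1)[OF that(1)] edge_lt(1) by fastforce
  qed
 qed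
 have noout: "~ ed v k" if v: "v \<in> D" for v k
 proof
  assume Ev: "ed v k"
  obtain v' where v': "v' \<in> D" "v' ~= v" using dc by (cases "v = d") auto
  have Tb: "bd m b v'" using block_in_edge(2)[OF bl b E v'(1)] .
  have lts: "b < v" "m < b" "v < k" using edge_lt(1) nbr b v E Ev by blast+
  have "k ~= v'" using Ev nbrt[OF v'(1), of v] block_disjoint[OF bl, of v] v by blast
  hence "{v, k} \<inter> {m, b, v'} = {}" using v' lts by auto
  from bad_disjoint_edge[OF Tb Ev this] have "ed v b | ed v v'" using conf_cross conf_edges by blast
  thus False using AB(2) b v nbrt[OF v'(1), of v] block_disjoint[OF bl, of v] by blast
 qed
 have nc: "nconf w x u v = (card D - 1) + card {k. ed k u}" if u: "u \<in> B" and v: "v \<in> D" for u v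
 proof -
  obtain u' where u': "u' ~= u" "B = {u, u'}" using a u by (metis insertE insert_commute singletonD)
  have "cf u v k l <-> k = u' & l \<in> D & l ~= v" for k l
  proof
   assume h: "cf u v k l"
   hence "ed k v" "ed u l" using conf_cross conf_edges by blast+
   hence "k \<in> B" "l \<in> D" using nbr[OF u] nbrt[OF v] by auto
   moreover have "k ~= u" "l ~= v" using h by (auto simp: conf_def)
   ultimately show "k = u' & l \<in> D & l ~= v" using u' by auto
  next
   assume h: "k = u' & l \<in> D & l ~= v"
   have "u' \<in> B" using u' by simp
   thus "cf u v k l" using bl u u' v h unfolding block_def by metis
  qed
  hence "{(k, l). cf u v k l} = {u'} \<times> (D - {v})" by auto
  hence "card {(k, l). cf u v k l} = card (D - {v})" by (simp add: card_cartesian_product_singleton)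
  moreover have "card {k. bd u v k} = 0" using noout[OF v] by (simp add: bad_def)
  moreover have "{k. bd k u v} = {k. ed k u}"
   using block_in_edge(2)[OF bl u _ v] by (auto simp: bad_def)
  moreover have "card (D - {v}) = card D - 1" using v by (rule card_Diff_singleton)
  ultimately show ?thesis unfolding nconf_def by simp
 qed
 have fin: "finite {k. ed k u}" for u
  by (rule finite_subset[of _ "{1..n}"]) (use edge_rng in auto)
 have "nconf w x b d = \<delta>" "nconf w x a d = \<delta>" using cnt nbr b aB dc by blast+
 hence "card {k. ed k a} = card ?A" using nc[OF b dc(1)] nc[OF aB dc(1)] by linarith
 hence "card {k. ed k a} ~= 0" using E fin by auto
 hence ex: "EX k. ed k a" by (metis (no_types, lifting) card.empty empty_Collect_eq)
 have sub: "ed k u'" if h: "ed k u" and u: "B = {u, u'}" "u ~= u'" and ex: "ed k' u'" for k k' u u'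
 proof (rule ccontr)
  assume n: "~ ed k u'"
  hence kk: "k ~= k'" using ex by blast
  have uB: "u \<in> B" "u' \<in> B" using u by auto
  have Tb: "bd k' u' d" using block_in_edge(2)[OF bl uB(2) ex dc(1)] .
  have "{k, u} \<inter> {k', u', d} = {}"
   using kk u AB[OF h uB(1)] AB[OF ex uB(2)] uB dc block_disjoint[OF bl, of u] by auto
  from bad_disjoint_edge[OF Tb h this] have "ed k u' | ed k d" using conf_cross conf_edges by blast
  thus False using n AB[OF h uB(1)] nbrt[OF dc(1)] by blast
 qed
 have same: "ed k a <-> ed k b" for k using sub[of k b a] sub[of k a b] a ex E by blast
 have ed: "ed u v <-> u \<in> ?A & v \<in> B | u \<in> B & v \<in> D" for u v
 proof
  assume h: "ed u v"
  show "u \<in> ?A & v \<in> B | u \<in> B & v \<in> D"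
  proof (cases "u \<in> B")
   case True thus ?thesis using nbr h by blast
  next
   case False
   from block_other_edge[OF bl b aB a(1)[symmetric] dc h False] have "v \<in> {b, a}" using h noout dc by blast
   thus ?thesis using h same a by auto
  qed
 next
  assume "u \<in> ?A & v \<in> B | u \<in> B & v \<in> D" thus "ed u v" using same a nbr by auto
 qed
 have badall: "bd u m v" if "u \<in> ?A" "m \<in> B" "v \<in> D" for u m v
  using block_in_edge(2)[OF bl that(2) _ that(3)] that ed by blast
 show ?thesis unfolding tri_def
 proof (intro conjI)
  show "?A ~= {}" using E by blast
  show "D ~= {}" using dc by blast
  show "EX m:B. EX m':B. m ~= m'" using a b aB by blast
  show "?A \<inter> B = {}" "?A \<inter> D = {}" using AB b by blast+
  show "B \<inter> D = {}" using block_disjoint[OF bl] by blast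
  show "card B = 2 | (EX a d. ?A = {a} & D = {d})" using a by simp
 qed (use ed badall in blast)+
qed

end

section \<open>Bad paths without conflicts\<close>

abbreviation pinv :: "(nat => nat) => nat => nat" where
 "pinv x \<equiv> inv_into UNIV x"

lemma gap_col: "gap w x (Suc p) q = gap w x p q + (of_bool (q < w (Suc p)) - of_bool (q < x (Suc p)))"
 by (simp add: gap_def rk_sum)

lemma gap_col': "0 < p ==> gap w x p q = gap w x (p - 1) q + (of_bool (q < w p) - of_bool (q < x p))"
 using gap_col[of w x "p - 1" q] by simp

lemma rk_row:
 assumes y: "perm n y"
 shows "rk y p q = rk y p (Suc q) + of_bool (pinv y (Suc q) <= p)"
proof -
 have iv: "y (pinv y (Suc q)) = Suc q" using permutes_surj[OF y] by (simp add: surj_f_inv_f)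
 have e: "y i = Suc q <-> i = pinv y (Suc q)" for i using iv permutes_inj[OF y] by (metis injD)
 have "{i. i <= p & q < y i} = {i. i <= p & Suc q < y i} \<union> {i. i <= p & y i = Suc q}" by auto
 hence "rk y p q = rk y p (Suc q) + card {i. i <= p & y i = Suc q}"
  unfolding rk_def by (simp only:) (intro card_Un_disjoint, auto)
 moreover have "{i. i <= p & y i = Suc q} = (if pinv y (Suc q) <= p then {pinv y (Suc q)} else {})" unfolding e by auto
 ultimately show ?thesis by auto
qed

lemma gap_row:
 assumes w: "perm n w" and x: "perm n x"
 shows "gap w x p q = gap w x p (Suc q) + (of_bool (pinv w (Suc q) <= p) - of_bool (pinv x (Suc q) <= p))"
 unfolding gap_def rk_row[OF w, of p q] rk_row[OF x, of p q] by simp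

lemma bad_unrot:
 assumes w: "perm n w" and x: "perm n x" and C: "bad (rot n w) (rot n x) i j k"
 shows "bad w x (Suc n - k) (Suc n - j) (Suc n - i)"
 using bad_rot_imp[OF rot_permutes[OF w] rot_permutes[OF x] C] by (simp only: rot_rot[OF w] rot_rot[OF x])

lemma edge_unrot:
 assumes w: "perm n w" and x: "perm n x" and C: "edge (rot n w) (rot n x) i j"
 shows "edge w x (Suc n - j) (Suc n - i)"
 using edge_rot_imp[OF rot_permutes[OF w] rot_permutes[OF x] C] by (simp only: rot_rot[OF w] rot_rot[OF x])

context msing
begin

lemma pinv_x: "pinv x (x z) = z" using permutes_inj[OF x] by (rule inv_f_f)
lemma pinv_w: "pinv w (w z) = z" using permutes_inj[OF w] by (rule inv_f_f)
lemma x_pinv: "x (pinv x v) = v" using permutes_surj[OF x] by (simp add: surj_f_inv_f)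

lemma bad_edges: "bd p q r ==> ed p q" "bd p q r ==> ed q r"
 by (auto simp: bad_def)

text \<open>A point of the graph inside the first rectangle of a bad path splits it into two edges, and
 applying one or the other of them leaves a bad path.\<close>
lemma bad_dot_free_left:
 assumes B: "bd p q r" and m: "p < m" "m < q" "x p < x m" "x m < x q"
 shows False
proof -
 note E = bad_edges[OF B]
 have nNW: "~ bx p q (x q) (x r)" and nSE: "~ bx q r (x p) (x q)" using B by (auto simp: bad_def)
 note l = edge_lt[OF E(1)] edge_lt[OF E(2)]
 have e1: "ed p m" and e2: "ed m q" by (rule edge_sub[OF E(1)]; use m in auto)+
 have upper: "bx q r (x m) (x q)"
 proof (rule ccontr)
  assume n: "~ ?thesis"
  have s: "sw x p m p = x m" "sw x p m q = x q" "sw x p m r = x r"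
   using m l by (auto simp: sw_other simp del: comp_apply)
  have f1: "edge w (sw x p m) p q"
   by (rule edge_swI[OF e1 _ _ s(1,2)]) (use m l in \<open>auto intro: posbox_mono[OF l(3)]\<close>)
  have f2: "edge w (sw x p m) q r"
   by (rule edge_swI[OF e1 _ _ s(2,3)]) (use m l in auto)
  show False by (rule no_bad[OF e1 f1 f2]) (unfold s, use n nNW in auto)
 qed
 have s: "sw x m q p = x p" "sw x m q q = x m" "sw x m q r = x r"
  using m l by (auto simp: sw_other simp del: comp_apply)
 have f1: "edge w (sw x m q) p q"
  by (rule edge_swI[OF e2 _ _ s(1,2)]) (use m l in \<open>auto intro: posbox_mono[OF l(3)]\<close>)
 have "bx q r (x m) (x r)" using upper l m posbox_splitq[of "x m" "x q" "x r" w x q r] by auto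
 hence f2: "edge w (sw x m q) q r"
  by (intro edge_swI[OF e2 _ _ s(2,3)]) (use m l in auto)
 have "~ bx q r (x p) (x m)" using nSE upper posbox_splitq[of "x p" "x m" "x q" w x q r] m by auto
 moreover have "~ bx p q (x m) (x r)" using nNW posbox_mono[of w x p q "x m" "x r" p q "x q" "x r"] m by auto
 ultimately show False by (intro no_bad[OF e2 f1 f2]) (unfold s, auto)
qed

lemma bad_dot_free_right:
 assumes B: "bd p q r" and m: "q < m" "m < r" "x q < x m" "x m < x r"
 shows False
proof -
 interpret R: msing n "rot n w" "rot n x" \<delta> by (rule msing_rot)
 note r = edge_range[OF w x bad_edges(1)[OF B]] edge_range[OF w x bad_edges(2)[OF B]]
 have "rot n x (Suc n - q) = Suc n - x q" "rot n x (Suc n - m) = Suc n - x m" "rot n x (Suc n - r) = Suc n - x r"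
  using r m by (simp_all add: rot_app)
 moreover have "Suc n - r < Suc n - m" "Suc n - m < Suc n - q" "Suc n - x r < Suc n - x m" "Suc n - x m < Suc n - x q"
  using m r by linarith+
 ultimately show False using R.bad_dot_free_left[OF bad_rot_imp[OF w x B], of "Suc n - m"] by simp
qed

end

text \<open>If there are no conflicts of disjoint edges, each edge lies on a bad path, and every edge touches
 every bad path.\<close>
locale msing_nc = msing +
 assumes nc: "!!i j k l. ~ conf w x i j k l"
begin

lemma msing_nc_rot: "msing_nc n (rot n w) (rot n x) \<delta>"
proof -
 interpret R: msing n "rot n w" "rot n x" \<delta> by (rule msing_rot)
 show ?thesis by unfold_locales (use conf_unrot[OF w x] nc in blast)
qed

lemma in_bad:
 assumes "ed i j" obtains k where "bd i j k | bd k i j"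
proof -
 have "EX k. bd i j k | bd k i j"
 proof (rule ccontr)
  assume "~ ?thesis"
  hence "{k. bd i j k} = {}" "{k. bd k i j} = {}" by blast+
  moreover have "{(k, l). cf i j k l} = {}" using nc by blast
  ultimately have "nconf w x i j = 0" by (simp only: nconf_def card.empty)
  thus False using cnt[OF assms] pos by simp
 qed
 thus ?thesis using that by blast
qed

lemma touch: "bd p q r ==> ed k l ==> k = p | k = q | k = r | l = p | l = q | l = r"
 using bad_disjoint_edge[of p q r k l] nc by blast

lemma bad_no_edge: "bd p q r ==> ~ ed p r"
 using posbox_mono[of w x p r "x p" "x r" p q "x q" "x r"] unfolding bad_def edge_def by auto

lemma bad_lt: "bd p q r ==> p < q & q < r & x p < x q & x q < x r"
 by (auto simp: bad_def edge_def)

lemma out_bad: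
 assumes B: "bd p q r" and E: "ed p m"
 shows "bd p m r"
proof (cases "m = q")
 case False
 have mr: "m ~= r" using E bad_no_edge[OF B] by blast
 obtain z where "bd p m z | bd z p m" using in_bad[OF E] .
 thus ?thesis
 proof
  assume b: "bd p m z"
  from touch[OF B bad_edges(2)[OF b]] have "z = q | z = r"
   using False mr bad_lt[OF b] bad_lt[OF B] by auto
  thus ?thesis
  proof
   assume "z = q"
   thus ?thesis using bad_dot_free_left[OF B, of m] bad_lt[OF b] by auto
  qed (use b in simp)
 next
  assume b: "bd z p m"
  from touch[OF b bad_edges(2)[OF B]] show ?thesis
   using False mr bad_lt[OF b] bad_lt[OF B] by auto
 qed
qed (use B in simp)

lemma in_bad_r:
 assumes B: "bd p q r" and E: "ed m r"
 shows "bd p m r"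
proof -
 interpret R: msing_nc n "rot n w" "rot n x" \<delta> by (rule msing_nc_rot)
 have "bad (rot n w) (rot n x) (Suc n - r) (Suc n - m) (Suc n - p)"
  using R.out_bad[OF bad_rot_imp[OF w x B] edge_rot_imp[OF w x E]] .
 from bad_unrot[OF w x this] show ?thesis using edge_rng[OF E] edge_rng[OF bad_edges(1)[OF B]] by auto
qed

lemma two_mids_tri:
 assumes B: "bd p q r" and E: "ed p m" and m: "m ~= q"
 shows "tri {p} {m. ed p m} {r}"
proof -
 let ?M = "{m. ed p m}"
 have qM: "q \<in> ?M" "m \<in> ?M" using bad_edges[OF B] E by auto
 have allb: "bd p k r" if "k \<in> ?M" for k using out_bad[OF B] that by auto
 have M_r: "k \<in> ?M <-> ed k r" for k
  using allb[of k] in_bad_r[OF B, of k] bad_edges by blast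
 have anti: "~ ed k k'" if "k \<in> ?M" "k' \<in> ?M" for k k'
 proof
  assume "ed k k'"
  thus False using bad_dot_free_left[OF allb[OF that(2)], of k] that edge_lt(1,2)[of k k'] edge_lt(1,2)[of p k] by auto
 qed
 have other: "EX k':?M. k' ~= k" for k using qM m by metis
 have into_p: "~ ed u p" for u
 proof
  assume U: "ed u p"
  obtain z where "bd u p z | bd z u p" using in_bad[OF U] .
  thus False
  proof
   assume b: "bd u p z"
   hence "z \<in> ?M" using bad_edges by blast
   obtain z' where z': "z' \<in> ?M" "z' ~= z" using other by blast
   from touch[OF b bad_edges(2)[OF allb[OF z'(1)]]] show False
    using z' bad_lt[OF b] bad_lt[OF allb[OF z'(1)]] bad_lt[OF allb[OF \<open>z \<in> ?M\<close>]] by auto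
  next
   assume b: "bd z u p"
   from touch[OF B bad_edges(1)[OF b]] show False using bad_lt[OF b] bad_lt[OF B] by auto
  qed
 qed
 have outof_r: "~ ed r v" for v
 proof
  assume V: "ed r v"
  obtain z where "bd r v z | bd z r v" using in_bad[OF V] .
  thus False
  proof
   assume b: "bd z r v"
   hence z: "z \<in> ?M" using bad_edges M_r by blast
   obtain z' where z': "z' \<in> ?M" "z' ~= z" using other by blast
   from touch[OF b bad_edges(1)[OF allb[OF z'(1)]]] show False
    using z' bad_lt[OF b] bad_lt[OF allb[OF z'(1)]] bad_lt[OF allb[OF z]] by auto
  next
   assume b: "bd r v z"
   from touch[OF B bad_edges(2)[OF b]] show False using bad_lt[OF b] bad_lt[OF B] by auto
  qed
 qed
 have ed: "ed u v <-> u \<in> {p} & v \<in> ?M | u \<in> ?M & v \<in> {r}" for u v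
 proof
  assume h: "ed u v"
  show "u \<in> {p} & v \<in> ?M | u \<in> ?M & v \<in> {r}"
  proof (rule ccontr)
   assume n: "~ ?thesis"
   have np: "u ~= p" "v ~= p" "u ~= r" "v ~= r" using n h into_p outof_r M_r by auto
   have "u = k | v = k" if "k \<in> ?M" for k using touch[OF allb[OF that] h] np by auto
   hence "u \<in> ?M & v \<in> ?M" using qM m by metis
   thus False using anti h by blast
  qed
 qed (use M_r in auto)
 have lt: "p < k & k < r" if "k \<in> ?M" for k using bad_lt[OF allb[OF that]] by auto
 show ?thesis unfolding tri_def
 proof (intro conjI)
  show "EX m:?M. EX m':?M. m ~= m'" using qM m by blast
  show "{p} \<inter> ?M = {}" "{p} \<inter> {r} = {}" "?M \<inter> {r} = {}" using lt qM(1) by fastforce+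
  show "card ?M = 2 | (EX a d. {p} = {a} & {r} = {d})" by auto
  show "ALL u v. ed u v <-> u \<in> {p} & v \<in> ?M | u \<in> ?M & v \<in> {r}" using ed by blast
  show "ALL u:{p}. ALL m:?M. ALL v:{r}. bd u m v" using allb by blast
 qed simp_all
qed

text \<open>Suppose that \<open>q\<close> is the only middle point between \<open>p\<close> and \<open>r\<close>. The lowest zeros of the gap in the rectangle
 to the upper left of \<open>q\<close>, and the last one among them, bound a corner. Its two neighbouring points of the graphs
 are forced, and from them arises an edge that can be applied without destroying a bad path.\<close>
lemma lonely_mid_NW:
 assumes B: "bd p q r" and only: "!!m. ed p m ==> m = q" and g: "0 < gp (q - 1) (x q)"
 shows False
proof -
 have only_r: "m = q" if "ed m r" for m using in_bad_r[OF B that] bad_edges only by blast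
 note E = bad_edges[OF B]
 have nNW: "~ bx p q (x q) (x r)" and nSE: "~ bx q r (x p) (x q)" using B by (auto simp: bad_def)
 note l = edge_lt[OF E(1)] edge_lt[OF E(2)]
 have left: "0 < gp p' q'" if "p <= p'" "p' < q" "x p <= q'" "q' < x q" for p' q' using l(3) that by (auto simp: posbox_def)
 have right: "0 < gp p' q'" if "q <= p'" "p' < r" "x q <= q'" "q' < x r" for p' q' using l(6) that by (auto simp: posbox_def)
 \<comment> \<open>the lowest row of zeros, and its last zero\<close>
 define \<beta> where "\<beta> = (LEAST b. x q <= b & b < x r & (EX a. p <= a & a < q & gp a b = 0))"
 have ex: "EX b. x q <= b & b < x r & (EX a. p <= a & a < q & gp a b = 0)"
  using nNW ge unfolding posbox_def by (meson antisym not_le)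
 hence \<beta>: "x q <= \<beta> & \<beta> < x r & (EX a. p <= a & a < q & gp a \<beta> = 0)"
  unfolding \<beta>_def by (rule LeastI_ex)
 have A2: "0 < gp p' q'" if "p <= p'" "p' < q" "x q <= q'" "q' < \<beta>" for p' q'
  using not_less_Least[of q' "%b. x q <= b & b < x r & (EX a. p <= a & a < q & gp a b = 0)"] that \<beta> ge[of p' q']
  unfolding \<beta>_def[symmetric] by force
 have ex2: "EX a b. p <= a & a < q & gp a \<beta> = 0" using \<beta> by blast
 obtain \<alpha> b where \<alpha>: "p <= \<alpha>" "\<alpha> < q" "gp \<alpha> \<beta> = 0" and mx: "!!p' q'. \<alpha> < p' ==> p' < q ==> gp p' \<beta> ~= 0"
  by (rule ex_max_col[OF ex2]) blast
 have A3: "0 < gp p' \<beta>" if "\<alpha> < p'" "p' < q" for p' using mx that ge[of p' \<beta>] by force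
 let ?K = "Suc \<alpha>"
 have low: "0 < gp p' q'" if "p <= p'" "p' < q" "x p <= q'" "q' < \<beta>" for p' q'
  using left[of p' q'] A2[of p' q'] that by fastforce
 have Kq: "?K ~= q | \<beta> ~= x q" using g \<alpha> by auto
 have bpos: "1 <= x p" using edge_range[OF w x E(1)] by simp
 have bn: "\<beta> <= n" "1 <= \<beta>" using \<beta> edge_range[OF w x E(2)] by auto
 have SW: "0 < gp \<alpha> (\<beta> - 1)" using low[of \<alpha> "\<beta> - 1"] \<alpha> \<beta> l bpos by auto
 have NE: "0 < gp ?K \<beta>" using A3[of ?K] right[of ?K \<beta>] \<alpha> \<beta> l by (cases "?K < q") auto
 \<comment> \<open>a dot strictly between p and q in the low strip is a second middle\<close>
 have strip: False if "p < m" "m < q" "x p < x m" "x m <= \<beta>" for m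
 proof -
  have "ed p m" unfolding edge_def posbox_def using that low by auto
  thus False using only that by blast
 qed
 have in_right: False if "q < m" "m < r" "x q < x m" "x m < x r" for m using bad_dot_free_right[OF B that] .
 have nin: False if "ed N v" "p < v" "v < q" "x q < x v" for N v
 proof -
  have "N = p" using touch[OF B that(1)] that l edge_lt(1,2)[OF that(1)] by auto
  thus False using only that by auto
 qed
 note column = gap_col[of w x \<alpha>]
 have "of_bool (\<beta> < w ?K) - of_bool (\<beta> < x ?K) >= (1::int)" using column[of \<beta>] NE \<alpha> by linarith
 hence wK: "\<beta> < w ?K" "x ?K <= \<beta>" by (auto simp: of_bool_def split: if_splits)
 define h where "h = pinv x \<beta>"
 have xh: "x h = \<beta>" unfolding h_def by (rule x_pinv)
 have rowgap: "gp p' (\<beta> - 1) - gp p' \<beta> = of_bool (pinv w \<beta> <= p') - of_bool (h <= p')" for p'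
  using gap_row[OF w x, of p' "\<beta> - 1"] bn unfolding h_def by simp
 have "of_bool (pinv w \<beta> <= \<alpha>) - of_bool (h <= \<alpha>) >= (1::int)" using rowgap[of \<alpha>] SW \<alpha> by linarith
 hence hh: "pinv w \<beta> <= \<alpha>" "\<alpha> < h" by (auto simp: of_bool_def split: if_splits)
 show False
 proof (cases "h = ?K")
  case True
  \<comment> \<open>a dot at the corner\<close>
  have "?K < q" using Kq \<alpha> xh True by (metis Suc_leI le_neq_implies_less)
  thus False using strip[of ?K] \<alpha> True xh \<beta> l by auto
 next
  case False
  hence hK: "?K < h" and gK: "x ?K < \<beta>" using hh wK xh x_eq[of h ?K] by auto
  have e1: "0 < gp ?K (x ?K)" using column[of "x ?K"] wK gK ge[of \<alpha> "x ?K"] by simp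
  show False
  proof (cases "?K = q")
   case Kq': True
   have bq: "x q < \<beta>" using gK Kq' by simp
   have hq: "q < h" using hK Kq' by simp
   have "r < h" using in_right[of h] hq xh \<beta> bq l x_eq[of h r] by (metis le_neq_implies_less linorder_neqE_nat nat_less_le)
   have "pinv w \<beta> <= h - 1" "~ h <= h - 1" using hh hK by linarith+
   hence "0 < gp (h - 1) (\<beta> - 1)" using rowgap[of "h - 1"] ge[of "h - 1" \<beta>] by simp
   from SW_dot[OF w x le this] obtain N where N: "N <= h - 1" "x N <= \<beta> - 1" "bx N (Suc (h - 1)) (x N) (Suc (\<beta> - 1))" .
   have EN: "ed N h" unfolding edge_def using N hK bn xh by auto
   have "N = q" using touch[OF B EN] \<open>r < h\<close> l only[of h] EN xh \<beta> edge_lt(2)[OF EN] by auto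
   hence Eq: "ed q h" using EN by simp
   have s: "sw x q h p = x p" "sw x q h q = \<beta>" "sw x q h r = x r"
    using l \<open>r < h\<close> xh by (auto simp: sw_other simp del: comp_apply) 
   have f1: "edge w (sw x q h) p q"
    by (rule edge_swI[OF Eq _ _ s(1,2)]) (use l \<beta> low in \<open>auto simp: posbox_def\<close>)
   have f2: "edge w (sw x q h) q r"
    by (rule edge_swI[OF Eq _ _ s(2,3)]) (use l \<beta> right xh in \<open>auto simp: posbox_def\<close>)
   have "~ bx p q \<beta> (x r)" using \<alpha> \<beta> by (force simp: posbox_def)
   moreover have "~ bx q r (x p) \<beta>" using nSE \<beta> posbox_mono[of w x q r "x p" \<beta> q r "x p" "x q"] by auto
   ultimately show False by (intro no_bad[OF Eq f1 f2]) (unfold s, auto)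
  next
   case False
   hence Kq': "?K < q" using \<alpha> by simp
   have gp: "x ?K < x p" using strip[of ?K] Kq' \<alpha> gK x_eq[of ?K p] by (metis le_imp_less_Suc less_imp_le linorder_neqE_nat nat_neq_iff)
   from NE_dot[OF w x le e1] obtain N where N: "?K < N" "x ?K < x N" "bx ?K N (x ?K) (x N)" .
   have EN: "ed ?K N" unfolding edge_def using N by auto
   have "N = q" using touch[OF B EN] Kq' \<alpha> l only_r[of ?K] EN edge_lt(1)[OF EN] by auto
   hence EK: "ed ?K q" using EN by simp
   have "EX v. ed q v & bx ?K v \<beta> (x v) & \<beta> < x v & ~ bx q v (x p) (x q)"
   proof (cases "bx ?K q \<beta> (x r)")
    case True
    hence "bx ?K r \<beta> (x r)"
     using posbox_splitp[of ?K q r w x \<beta> "x r"] posbox_mono[OF l(6), of q r \<beta> "x r"] Kq' l \<beta> by auto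
    thus ?thesis using E nSE \<beta> by blast
   next
    case nr: False
    from NE_dot[OF w x le NE] obtain v where v: "?K < v" "\<beta> < x v" "bx ?K v \<beta> (x v)" .
    have "0 < gp (v - 1) (x v - 1)" using v by (auto simp: posbox_def)
    from SW_dot[OF w x le this] obtain N where N: "N <= v - 1" "x N <= x v - 1" "bx N (Suc (v - 1)) (x N) (Suc (x v - 1))" .
    have EN: "ed N v" unfolding edge_def using N v by auto
    have vq: "q < v" 
    proof (rule ccontr)
     assume "~ q < v"
     moreover have "v ~= q" using v \<beta> by auto
     ultimately show False using nin[OF EN] v \<alpha> \<beta> by auto
    qed
    have vr: "x v < x r"
    proof (rule ccontr)
     assume "~ ?thesis"
     hence "bx ?K q \<beta> (x r)" using posbox_mono[OF v(3), of ?K q \<beta> "x r"] vq by auto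
     thus False using nr by simp
    qed
    have rv: "r < v" using in_right[of v] vq v vr \<beta> by (metis le_less_trans less_irrefl linorder_neqE_nat)
    have "N = q" using touch[OF B EN] rv vr l only[of v] EN edge_lt(2)[OF EN] vq by auto
    moreover have "~ bx q v (x p) (x q)" using nSE posbox_mono[of w x q v "x p" "x q" q r "x p" "x q"] rv by auto
    ultimately show ?thesis using EN v by blast
   qed
   then obtain v where v: "ed q v" "bx ?K v \<beta> (x v)" "\<beta> < x v" "~ bx q v (x p) (x q)" by blast
   note lv = edge_lt[OF v(1)]
   have s: "sw x ?K q p = x p" "sw x ?K q ?K = x q" "sw x ?K q v = x v"
    using l \<alpha> Kq' lv by (auto simp: sw_other simp del: comp_apply)
   have f1: "edge w (sw x ?K q) p ?K"
    by (rule edge_swI[OF EK _ _ s(1,2)]) (use l \<alpha> Kq' in \<open>auto intro: posbox_mono[OF l(3)]\<close>)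
   have "bx ?K q (x q) \<beta>" unfolding posbox_def using A2 \<alpha> by auto
   hence "bx ?K v (x q) (x v)"
    using posbox_splitq[of "x q" \<beta> "x v" w x ?K v] posbox_splitp[of ?K q v w x "x q" \<beta>] posbox_mono[OF lv(3), of q v "x q" \<beta>] v \<beta> Kq' lv by auto
   hence f2: "edge w (sw x ?K q) ?K v"
    by (intro edge_swI[OF EK _ _ s(2,3)]) (use lv Kq' in auto)
   have "~ bx p ?K (x q) (x v)" using \<alpha> \<beta> v by (force simp: posbox_def)
   moreover have "~ bx ?K v (x p) (x q)" using v(4) posbox_mono[of w x ?K v "x p" "x q" q v "x p" "x q"] Kq' by auto
   ultimately show False by (intro no_bad[OF EK f1 f2]) (unfold s, auto)
  qed
 qed
qed

text \<open>The gap is positive to the lower left and to the upper right of the point at \<open>q\<close>, so its second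
 difference there leaves one of the two other corners positive; these are symmetric under rotation.\<close>
lemma second_mid:
 assumes B: "bd p q r"
 shows "EX m. ed p m & m ~= q"
proof (rule ccontr)
 assume "~ ?thesis"
 hence only: "m = q" if "ed p m" for m using that by blast
 have only_r: "m = q" if "ed m r" for m using in_bad_r[OF B that] bad_edges only by blast
 note E = bad_edges[OF B]
 note rg = edge_range[OF w x E(1)] edge_range[OF w x E(2)]
 have c: "int (card {i. q - 1 < i & i <= q & x q - 1 < y i & y i <= x q}) = int (rk y q (x q - 1)) - int (rk y q (x q)) - int (rk y (q - 1) (x q - 1)) + int (rk y (q - 1) (x q))" for y
  by (rule count_box) auto
 have "{i. q - 1 < i & i <= q & x q - 1 < x i & x i <= x q} = {q}" using rg by auto
 hence c1: "int (rk x q (x q - 1)) - int (rk x q (x q)) - int (rk x (q - 1) (x q - 1)) + int (rk x (q - 1) (x q)) = 1"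
  using c[of x] by simp
 have c2: "int (rk w q (x q - 1)) - int (rk w q (x q)) - int (rk w (q - 1) (x q - 1)) + int (rk w (q - 1) (x q)) >= 0"
  using c[of w] by linarith
 have "0 < gp (q - 1) (x q - 1)" "0 < gp q (x q)"
  using edge_lt[OF E(1)] edge_lt[OF E(2)] by (auto simp: posbox_def)
 hence "0 < gp (q - 1) (x q) | 0 < gp q (x q - 1)" using c1 c2 unfolding gap_def by linarith
 thus False
 proof
  assume "0 < gp (q - 1) (x q)"
  thus False using lonely_mid_NW[OF B only] by blast
 next
  assume g: "0 < gp q (x q - 1)"
  interpret R: msing_nc n "rot n w" "rot n x" \<delta> by (rule msing_nc_rot)
  have "m = Suc n - q" if "edge (rot n w) (rot n x) (Suc n - r) m" for m
  proof -
   have "ed (Suc n - m) r" using edge_unrot[OF w x that] rg by simp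
   hence "Suc n - m = q" by (rule only_r)
   thus ?thesis using edge_range[OF rot_permutes[OF w] rot_permutes[OF x] that] by simp
  qed
  moreover have "0 < gap (rot n w) (rot n x) (Suc n - q - 1) (rot n x (Suc n - q))"
  proof -
   have "rot n x (Suc n - q) = Suc n - x q" using rg by (simp add: rot_app)
   moreover have "n - (Suc n - q - 1) = q" "n - (Suc n - x q) = x q - 1" using rg by auto
   ultimately show ?thesis using g rg by (simp add: gap_rot[OF w x])
  qed
  ultimately show False using R.lonely_mid_NW[OF bad_rot_imp[OF w x B]] by blast
 qed
qed

lemma nc_tri:
 assumes "ed i j" shows "EX p M r. tri {p} M {r}"
proof -
 obtain k where "bd i j k | bd k i j" using in_bad[OF assms] .
 then obtain p q r where "bd p q r" by blast
 thus ?thesis using second_mid two_mids_tri by blast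
qed

end

lemma ex4I: "P a b c d ==> EX a b c d. P a b c d"
 by blast

section \<open>Regions of the two patterns\<close>

text \<open>The rank functions of a permutation and of its rearrangement in four positions differ by the
 indicator of three adjacent rectangles. For 4231 and 2143 this is the following region, for 3412
 and 1324 the next one.\<close>
definition D4231 where "D4231 i j k l a b c d (p :: nat) (q :: nat) \<equiv> i <= p & p < j & b <= q & q < d | j <= p & p < k & a <= q & q < d | k <= p & p < l & a <= q & q < c"

definition D3412 where "D3412 i j k l a b c d (p :: nat) (q :: nat) \<equiv> i <= p & p < j & a <= q & q < c | j <= p & p < k & a <= q & q < d | k <= p & p < l & b <= q & q < d"

text \<open>Membership in \<open>E\<^sub>w\<close> in terms of the gap: the upper bound says that the rearrangement of \<open>w\<close> lies below \<open>x\<close>, the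
 lower bound that the rearrangement of \<open>x\<close> lies below \<open>w\<close>.\<close>
definition wit4231 where "wit4231 n w x \<equiv> (EX i j k l i' j' k' l' a b c d. 1 <= i & i < j & j < k & k < l & l <= n &
   1 <= i' & i' < j' & j' < k' & k' < l' & l' <= n & a < b & b < c & c < d &
   w i = d & w j = b & w k = c & w l = a & x i' = b & x j' = a & x k' = d & x l' = c &
   (ALL p q. gap w x p q <= of_bool (D4231 i j k l a b c d p q)) &
   (ALL p q. of_bool (D4231 i' j' k' l' a b c d p q) <= gap w x p q))"

definition wit3412 where "wit3412 n w x \<equiv> (EX i j k l i' j' k' l' a b c d. 1 <= i & i < j & j < k & k < l & l <= n &
   1 <= i' & i' < j' & j' < k' & k' < l' & l' <= n & a < b & b < c & c < d &
   w i = c & w j = d & w k = a & w l = b & x i' = a & x j' = c & x k' = b & x l' = d &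
   (ALL p q. gap w x p q <= of_bool (D3412 i j k l a b c d p q)) &
   (ALL p q. of_bool (D3412 i' j' k' l' a b c d p q) <= gap w x p q))"

context msing
begin

lemma col_up: "p <= p' ==> (!!z. p < z ==> z <= p' ==> x z <= w z) ==> gp p q <= gp p' q"
proof (induction rule: dec_induct)
 case (step m)
 hence "x (Suc m) <= w (Suc m)" by simp
 moreover have "gp p q <= gp m q" by (rule step.IH) (simp add: step.prems)
 ultimately show ?case by (auto simp: gap_col of_bool_def)
qed simp

lemma col_down: "p <= p' ==> (!!z. p < z ==> z <= p' ==> w z <= x z) ==> gp p' q <= gp p q"
proof (induction rule: dec_induct)
 case (step m)
 hence "w (Suc m) <= x (Suc m)" by simp
 moreover have "gp m q <= gp p q" by (rule step.IH) (simp add: step.prems)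
 ultimately show ?case by (auto simp: gap_col of_bool_def)
qed simp

lemma row_up: "q <= q' ==> (!!z. q < x z ==> x z <= q' ==> z <= pinv w (x z)) ==> gp p q <= gp p q'"
proof (induction rule: dec_induct)
 case (step m)
 hence "pinv x (Suc m) <= pinv w (Suc m)" using step.prems[of "pinv x (Suc m)"] by (simp add: x_pinv)
 moreover have "gp p q <= gp p m" by (rule step.IH) (simp add: step.prems)
 ultimately show ?case using gap_row[OF w x, of p m] by (auto simp: of_bool_def split: if_splits)
qed simp

lemma row_down: "q <= q' ==> (!!z. q < x z ==> x z <= q' ==> pinv w (x z) <= z) ==> gp p q' <= gp p q"
proof (induction rule: dec_induct)
 case (step m)
 hence "pinv w (Suc m) <= pinv x (Suc m)" using step.prems[of "pinv x (Suc m)"] by (simp add: x_pinv)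
 moreover have "gp p m <= gp p q" by (rule step.IH) (simp add: step.prems)
 ultimately show ?case using gap_row[OF w x, of p m] by (auto simp: of_bool_def split: if_splits)
qed simp

lemma gap_in: assumes "0 < gp (z - 1) (x z - 1)" "0 < z" "0 < x z" shows "EX u. ed u z"
proof -
 from SW_dot[OF w x le assms(1)] obtain i where "i <= z - 1" "x i <= x z - 1" "bx i (Suc (z - 1)) (x i) (Suc (x z - 1))" .
 hence "ed i z" unfolding edge_def using assms by auto
 thus ?thesis by blast
qed

lemma gap_out_edge: assumes "0 < gp z (x z)" shows "EX v. ed z v"
proof -
 from NE_dot[OF w x le assms] obtain j where "z < j" "x z < x j" "bx z j (x z) (x j)" .
 hence "ed z j" unfolding edge_def by auto
 thus ?thesis by blast
qed

lemma pos_x: "0 < z <-> 0 < x z"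
 using perm_in[OF x, of z] perm_out[OF x, of z] by (cases "z = 0 | n < z") auto

text \<open>Without an edge ending in \<open>z\<close>, the gap vanishes to the lower left of the point at \<open>z\<close>. Hence the
 gap can only grow there, as \<open>w\<close> has its points in column \<open>z\<close> and row \<open>x z\<close> further up and further right.\<close>
lemma no_in: assumes "!!u. ~ ed u z" shows "x z <= w z" "z <= pinv w (x z)"
proof -
 have 0: "gp (z - 1) (x z - 1) = 0" if "0 < z" using gap_in[of z] assms that pos_x[of z] ge[of "z - 1" "x z - 1"] by force
 show "x z <= w z"
 proof (rule ccontr)
  assume h: "~ ?thesis"
  hence z: "0 < z" "0 < x z" using pos_x[of z] by auto
  hence "gp z (x z - 1) = gp (z - 1) (x z - 1) - 1"
   using gap_col'[OF z(1), of w x "x z - 1"] h by auto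
  thus False using 0[OF z(1)] ge[of z "x z - 1"] by simp
 qed
 show "z <= pinv w (x z)"
 proof (rule ccontr)
  assume h: "~ ?thesis"
  hence z: "0 < z" "0 < x z" using pos_x[of z] by auto
  have "pinv w (x z) <= z - 1" "~ z <= z - 1" using h by linarith+
  hence "gp (z - 1) (x z - 1) = gp (z - 1) (x z) + 1"
   using gap_row[OF w x, of "z - 1" "x z - 1"] z by (simp add: pinv_x)
  thus False using 0[OF z(1)] ge[of "z - 1" "x z"] by simp
 qed
qed

lemma no_out: assumes "!!v. ~ ed z v" shows "w z <= x z" "pinv w (x z) <= z"
proof -
 have 0: "gp z (x z) = 0" using gap_out_edge[of z] assms ge[of z "x z"] by force
 show "w z <= x z"
 proof (rule ccontr)
  assume h: "~ ?thesis"
  have z: "0 < z" using h perm_out[OF w, of z] perm_out[OF x, of z] by (cases "z = 0") auto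
  hence "gp z (x z) = gp (z - 1) (x z) + 1" using gap_col'[OF z, of w x "x z"] h by auto
  thus False using 0 ge[of "z - 1" "x z"] by simp
 qed
 show "pinv w (x z) <= z"
 proof (rule ccontr)
  assume h: "~ ?thesis"
  have z: "0 < x z"
  proof (rule ccontr)
   assume "~ 0 < x z"
   hence "z = 0" "x z = 0" using pos_x by auto
   moreover have "w 0 = 0" using perm_out[OF w] by simp
   ultimately show False using h pinv_w[of 0] by simp
  qed
  have "gp z (x z - 1) = gp z (x z) - 1"
   using gap_row[OF w x, of z "x z - 1"] z h by (simp add: pinv_x)
  thus False using 0 ge[of z "x z - 1"] by simp
 qed
qed

lemma gap_out': "p = 0 | q = 0 | n <= p | n <= q ==> gp p q = 0"
 by (rule gap_out[OF w x])

text \<open>The gap vanishes outside the range of rows and columns in which it can change sign.\<close>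
lemma gap_zero:
 "(!!z. z <= p ==> w z <= x z) ==> gp p q = 0" "(!!z. p < z ==> x z <= w z) ==> gp p q = 0"
 "(!!z. q < x z ==> z <= pinv w (x z)) ==> gp p q = 0" "(!!z. x z <= q ==> pinv w (x z) <= z) ==> gp p q = 0"
 using col_down[of 0 p q] col_up[of p n q] row_up[of q n p] row_down[of 0 q p] ge[of p q] gap_out'[of 0 q] gap_out'[of n q]
  gap_out'[of p n] gap_out'[of p 0] gap_out'[of p q]
 by (cases "p <= n"; cases "q <= n"; force)+

lemma w_rise:
 assumes "0 < z" "x z < v" "gp (z - 1) (v - 1) < gp z (v - 1)" "gp z v <= gp (z - 1) v" shows "w z = v"
 using assms gap_col'[of z w x v] gap_col'[of z w x "v - 1"] by (auto simp: of_bool_def split: if_splits)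

lemma w_fall:
 assumes "0 < z" "0 < v" "v < x z" "gp z v < gp (z - 1) v" "gp (z - 1) (v - 1) <= gp z (v - 1)" shows "w z = v"
 using assms gap_col'[of z w x v] gap_col'[of z w x "v - 1"] by (auto simp: of_bool_def split: if_splits)

lemma posboxD: "ed i j ==> i <= p ==> p < j ==> x i <= q ==> q < x j ==> 1 <= gp p q"
 unfolding edge_def posbox_def by force

lemma block_two:
 assumes "block B D" shows "EX b:B. EX b':B. b ~= b'" "EX d:D. EX d':D. d ~= d'"
 using assms unfolding block_def by - (elim conjE, assumption)+

lemma triD:
 assumes "tri A M D"
 shows "A ~= {}" "D ~= {}" "EX m:M. EX m':M. m ~= m'" "A \<inter> M = {}" "A \<inter> D = {}" "M \<inter> D = {}"
   "ALL u v. ed u v <-> u \<in> A & v \<in> M | u \<in> M & v \<in> D"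
   "ALL u:A. ALL m:M. ALL v:D. bd u m v" "card M = 2 | (EX a d. A = {a} & D = {d})"
 using assms unfolding tri_def by - (elim conjE, assumption)+

text \<open>Outside the positions of the block all edges are missing, so the gap is monotone between neighbouring
 positions of the block. Starting from a place in the middle where it is \<open>1\<close>, this bounds the gap by \<open>1\<close>
 everywhere and by \<open>0\<close> outside a region, whose corners are then values of \<open>w\<close>.\<close>
lemma block_wit:
 assumes bl: "block B D" and all: "!!u v. ed u v ==> u \<in> B & v \<in> D"
 shows "wit4231 n w x"
proof -
 have ed: "ed u v <-> u \<in> B & v \<in> D" for u v using all bl unfolding block_def by metis
 obtain b b' d d' where bd: "b \<in> B" "b' \<in> B" "b ~= b'" "d \<in> D" "d' \<in> D" "d ~= d'" using block_two[OF bl] by blast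
 have "z \<in> {1..n}" if "z \<in> B" for z using edge_rng[of z d] ed[of z d] that bd by simp
 hence fB: "finite B" by (meson finite_atLeastAtMost finite_subset subsetI)
 have "z \<in> {1..n}" if "z \<in> D" for z using edge_rng[of b z] ed[of b z] that bd by simp
 hence fD: "finite D" by (meson finite_atLeastAtMost finite_subset subsetI)
 have ne: "B ~= {}" "D ~= {}" using bd by auto
 define b1 bk d1 dm where "b1 = Min B" and "bk = Max B" and "d1 = Min D" and "dm = Max D"
 note defs = b1_def bk_def d1_def dm_def
 have mem: "b1 \<in> B" "bk \<in> B" "d1 \<in> D" "dm \<in> D" unfolding defs using fB fD ne by auto
 have bnd: "!!z. z \<in> B ==> b1 <= z & z <= bk" "!!z. z \<in> D ==> d1 <= z & z <= dm" unfolding defs using fB fD by auto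
 have neq: "b1 ~= bk" "d1 ~= dm" using bnd bd by (metis le_antisym)+
 define b2 dl where "b2 = Min (B - {b1})" and "dl = Max (D - {dm})"
 have "B - {b1} ~= {}" "D - {dm} ~= {}" using mem neq by auto
 moreover have "finite (B - {b1})" "finite (D - {dm})" using fB fD by auto
 ultimately have b2: "b2 \<in> B - {b1}" "!!z. z \<in> B - {b1} ==> b2 <= z" and dl: "dl \<in> D - {dm}" "!!z. z \<in> D - {dm} ==> z <= dl"
  unfolding b2_def dl_def by - (rule Min_in Min_le Max_in Max_ge; assumption)+
 have le1: "b1 < b2" "dl < dm" using b2(1) dl(1) bnd by fastforce+
 have le2: "b2 <= bk" "d1 <= dl" using b2 dl mem neq by auto
 note xB = block_incomp_bot[OF bl] and xD = block_incomp_top[OF bl]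
 have xbnd: "!!z. z \<in> B ==> x bk <= x z & x z <= x b1" "!!z. z \<in> D ==> x dm <= x z & x z <= x d1"
  using xB[OF _ mem(2)] xB[OF mem(1)] xD[OF _ mem(4)] xD[OF mem(3)] bnd by (metis le_less order_refl)+
 have "cf b1 d1 bk dm" using bl mem neq unfolding block_def by blast
 then obtain p0 q0 where P: "bk <= p0" "p0 < d1" "x b1 <= q0" "q0 < x dm" "gp p0 q0 = 1" by (auto simp: conf_def)
 have E: "ed b1 d1" "ed b1 dm" "ed bk d1" "ed bk dm" "ed b2 d1" "ed b1 dl"
  using ed mem b2(1) dl(1) by auto
 have noi: "x z <= w z" "z <= pinv w (x z)" if "z \<notin> D" for z using no_in[of z] ed that by blast+
 have noo: "w z <= x z" "pinv w (x z) <= z" if "z \<notin> B" for z using no_out[of z] ed that by blast+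
 have le1g: "gp p q <= 1" for p q
 proof -
  have "gp p q <= gp p0 q"
  proof (cases "p <= p0")
   case True show ?thesis by (rule col_up[OF True], rule noi) (use bnd(2) P in force)
  next
   case False thus ?thesis by (intro col_down noo) (use bnd(1) P in force)+
  qed
  also have "\<dots> <= gp p0 q0"
  proof (cases "q <= q0")
   case True show ?thesis by (rule row_up[OF True], rule noi) (use xbnd(2) P in force)
  next
   case False thus ?thesis by (intro row_down noo) (use xbnd(1) P in force)+
  qed
  finally show ?thesis using P by simp
 qed
 have z1: "gp p q = 0" if "p < b1" for p q by (rule gap_zero(1), rule noo) (use bnd(1) that in force)
 have z2: "gp p q = 0" if "dm <= p" for p q by (rule gap_zero(2), rule noi) (use bnd(2) that in force)
 have z3: "gp p q = 0" if "x d1 <= q" for p q by (rule gap_zero(3), rule noi) (use xbnd(2) that in force)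
 have z4: "gp p q = 0" if "q < x bk" for p q by (rule gap_zero(4), rule noo) (use xbnd(1) that in force)
 have "b1 < bk" "d1 < dm" using bnd(1)[OF mem(1)] bnd(2)[OF mem(3)] neq by auto
 hence xlt: "x bk < x b1" "x dm < x d1" "x b1 < x dm" "b1 < bk" "d1 < dm" "bk < d1" "x b2 < x b1" "x dm < x dl"
  using xB[OF mem(1,2)] xD[OF mem(3,4)] xB[OF mem(1), of b2] xD[OF _ mem(4), of dl] P b2(1) dl(1) le1 by auto
 have pos: "0 < b1" "0 < dm" "0 < b2" "0 < dl" "0 < x bk" "0 < x dm" "0 < x b1" using edge_range[OF w x E(1)] edge_range[OF w x E(4)] le1 le2 xlt by auto
 have wb1: "w b1 = x d1"
  by (rule w_rise) (use posboxD[OF E(1), of b1 "x d1 - 1"] z1[of "b1 - 1"] z3[of "x d1"] pos xlt in force)+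
 have wdm: "w dm = x bk"
  by (rule w_fall) (use posboxD[OF E(4), of "dm - 1" "x bk"] z2[of dm] z4[of "x bk - 1"] pos xlt in force)+
 have nb: "z \<notin> B & z \<notin> D" if "b1 < z" "z < b2" for z using b2(2)[of z] bnd(2)[of z] that le2 xlt by fastforce
 have nd: "z \<notin> B & z \<notin> D" if "dl < z" "z < dm" for z using dl(2)[of z] bnd(1)[of z] that le2 xlt by fastforce
 have cb: "gp p q = gp b1 q" if "b1 <= p" "p < b2" for p q
 proof (rule antisym)
  show "gp p q <= gp b1 q" by (intro col_down noo) (use that nb in force)+
  show "gp b1 q <= gp p q" by (intro col_up noi) (use that nb in force)+
 qed
 have cd: "gp p q = gp (dm - 1) q" if "dl <= p" "p < dm" for p q
 proof (rule antisym)
  show "gp p q <= gp (dm - 1) q" by (intro col_up noi) (use that nd in force)+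
  show "gp (dm - 1) q <= gp p q" by (intro col_down noo) (use that nd in force)+
 qed
 have c1: "gp b1 q = 0" if "q < x b1" for q
  using gap_col'[OF pos(1), of w x q] z1[of "b1 - 1" q] wb1 that xlt pos by simp
 have cm: "gp (dm - 1) q = 0" if "x dm <= q" for q
  using gap_col'[OF pos(2), of w x q] z2[of dm q] wdm that xlt pos by simp
 have "1 <= gp b1 (x b1)" "1 <= gp (dm - 1) (x dm - 1)" using posboxD[OF E(1), of b1 "x b1"] posboxD[OF E(2), of "dm - 1" "x dm - 1"] xlt by auto
 hence "1 <= gp (b2 - 1) (x b1)" "1 <= gp dl (x dm - 1)" using cb[of "b2 - 1"] cd[of dl] le1 by auto
 hence mid: "gp b2 (x b1) <= gp (b2 - 1) (x b1)" "gp (dl - 1) (x dm - 1) <= gp dl (x dm - 1)" using le1g order_trans by blast+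
 have wb2: "w b2 = x b1"
  by (rule w_rise) (use mid posboxD[OF E(5), of b2 "x b1 - 1"] cb[of "b2 - 1"] c1 le1 le2 pos xlt in force)+
 have wdl: "w dl = x dm"
  by (rule w_fall) (use mid posboxD[OF E(6), of "dl - 1" "x dm"] cd[of dl] cm le1 le2 pos xlt in force)+
 have up: "gp p q <= of_bool (D4231 b1 b2 dl dm (x bk) (x b1) (x dm) (x d1) p q)" for p q
 proof -
  have "gp p q = 0" if "~ D4231 b1 b2 dl dm (x bk) (x b1) (x dm) (x d1) p q"
  proof -
   consider "p < b1" | "dm <= p" | "x d1 <= q" | "q < x bk" | "b1 <= p" "p < b2" "q < x b1" | "dl <= p" "p < dm" "x dm <= q"
    using \<open>~ D4231 _ _ _ _ _ _ _ _ _ _\<close> unfolding D4231_def by linarith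
   thus ?thesis
   proof cases
    case 5 show ?thesis unfolding cb[OF 5(1,2)] by (rule c1[OF 5(3)])
   next
    case 6 show ?thesis unfolding cd[OF 6(1,2)] by (rule cm[OF 6(3)])
   qed (use z1 z2 z3 z4 in auto)
  qed
  thus ?thesis using le1g[of p q] by (cases "D4231 b1 b2 dl dm (x bk) (x b1) (x dm) (x d1) p q") auto
 qed
 have low: "of_bool (D4231 b1 bk d1 dm (x bk) (x b1) (x dm) (x d1) p q) <= gp p q" for p q
 proof (cases "D4231 b1 bk d1 dm (x bk) (x b1) (x dm) (x d1) p q")
  case True
  then consider "b1 <= p" "p < d1" "x b1 <= q" "q < x d1" | "bk <= p" "p < d1" "x bk <= q" "q < x d1" | "bk <= p" "p < dm" "x bk <= q" "q < x dm"
   unfolding D4231_def using xlt by linarith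
  hence "1 <= gp p q" using posboxD[OF E(1)] posboxD[OF E(3)] posboxD[OF E(4)] by cases auto
  thus ?thesis by simp
 qed (use ge in simp)
 have rng: "1 <= b1" "dm <= n" using edge_rng[OF E(2)] by auto
 show ?thesis unfolding wit4231_def
  by (rule ex4I[of _ b1 b2 dl dm], rule ex4I[of _ b1 bk d1 dm], rule ex4I[of _ "x bk" "x b1" "x dm" "x d1"])
   (intro conjI allI up low; use wb1 wb2 wdl wdm rng xlt le1 le2 in linarith)
qed

text \<open>The same monotonicity as for a block, with a bad path in place of the conflict: it provides zeros
 of the gap in two opposite corners. Between the outermost middle positions, \<open>w\<close> and \<open>x\<close> agree.\<close>
lemma tri_wit:
 assumes tr: "tri A M D"
 shows "wit3412 n w x"
proof -
 have ed: "ed u v <-> u \<in> A & v \<in> M | u \<in> M & v \<in> D" for u v using triD(7)[OF tr] by blast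
 note dj = triD(4-6)[OF tr] and ne = triD(1,2)[OF tr] and alt = triD(9)[OF tr]
 have bad: "bd u m v" if "u \<in> A" "m \<in> M" "v \<in> D" for u m v using triD(8)[OF tr] that by blast
 obtain m m' where mm: "m \<in> M" "m' \<in> M" "m ~= m'" using triD(3)[OF tr] by blast
 obtain a0 d0 where ad: "a0 \<in> A" "d0 \<in> D" using ne by blast
 have "z \<in> {1..n}" if "z \<in> A" for z using edge_rng[of z m] ed[of z m] that mm by simp
 moreover have "z \<in> {1..n}" if "z \<in> M" for z using edge_rng[of z d0] ed[of z d0] that ad by simp
 moreover have "z \<in> {1..n}" if "z \<in> D" for z using edge_rng[of m z] ed[of m z] that mm by simp
 ultimately have f: "finite A" "finite M" "finite D" by (meson finite_atLeastAtMost finite_subset subsetI)+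
 define a1 al m1 ms d1 dt where "a1 = Min A" and "al = Max A" and "m1 = Min M" and "ms = Max M" and "d1 = Min D" and "dt = Max D"
 note defs = a1_def al_def m1_def ms_def d1_def dt_def
 have neM: "M ~= {}" using mm by auto
 have mem: "a1 \<in> A" "al \<in> A" "m1 \<in> M" "ms \<in> M" "d1 \<in> D" "dt \<in> D" unfolding defs using f ne neM by auto
 have bnd: "!!z. z \<in> A ==> a1 <= z & z <= al" "!!z. z \<in> M ==> m1 <= z & z <= ms" "!!z. z \<in> D ==> d1 <= z & z <= dt"
  unfolding defs using f by auto
 have neq: "m1 ~= ms" using bnd mm by (metis le_antisym)
 have AM: "u < v & x u < x v" if "u \<in> A" "v \<in> M" for u v using ed that edge_lt(1,2) by blast
 have MD: "u < v & x u < x v" if "u \<in> M" "v \<in> D" for u v using ed that edge_lt(1,2) by blast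
 have anti: "x u' < x u" if "ed p r" "p <= u" "x p <= x u" "u' <= r" "x u' <= x r" "u < u'" "~ ed u u'" for p r u u'
  using that edge_sub[of p r u u'] x_eq[of u u'] by (meson less_irrefl linorder_less_linear)
 have xA: "x u' < x u" if "u \<in> A" "u' \<in> A" "u < u'" for u u'
  by (rule anti[of u m]) (use ed that dj mm AM[of u' m] in auto)
 have xM: "x u' < x u" if "u \<in> M" "u' \<in> M" "u < u'" for u u'
  by (rule anti[of a0 u']) (use ed that dj ad AM[of a0 u] in auto)
 have xD: "x u' < x u" if "u \<in> D" "u' \<in> D" "u < u'" for u u'
  by (rule anti[of m u']) (use ed that dj mm MD[of m u] in auto)
 have xbnd: "!!z. z \<in> A ==> x al <= x z & x z <= x a1" "!!z. z \<in> M ==> x ms <= x z & x z <= x m1" "!!z. z \<in> D ==> x dt <= x z & x z <= x d1"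
  using xA[OF _ mem(2)] xA[OF mem(1)] xM[OF _ mem(4)] xM[OF mem(3)] xD[OF _ mem(6)] xD[OF mem(5)] bnd by (metis le_less order_refl)+
 have E: "ed a1 m1" "ed al m1" "ed al ms" "ed a1 ms" "ed m1 d1" "ed m1 dt" "ed ms d1" "ed ms dt"
  using ed mem by auto
 have "m1 < ms" using bnd(2)[OF mem(3)] neq by simp
 hence lt: "a1 <= al" "al < m1" "m1 < ms" "ms < d1" "d1 <= dt" using AM MD mem bnd by auto
 have xlt: "x al <= x a1" "x a1 < x ms" "x ms < x m1" "x m1 < x dt" "x dt <= x d1" using AM MD mem xM xbnd neq lt by (auto simp: le_less)
 have pos: "0 < a1" "0 < x al" using edge_range[OF w x E(1)] edge_range[OF w x E(2)] by auto
 have rng: "1 <= a1" "dt <= n" using edge_rng[OF E(1)] edge_rng[OF E(8)] by auto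
 have noi: "x z <= w z" "z <= pinv w (x z)" if "z \<notin> M" "z \<notin> D" for z using no_in[of z] ed that by blast+
 have noo: "w z <= x z" "pinv w (x z) <= z" if "z \<notin> A" "z \<notin> M" for z using no_out[of z] ed that by blast+
 \<comment> \<open>order constraints in contrapositive form\<close>
 have posA: "z \<notin> A" if "z < a1 | al < z | x z < x al | x a1 < x z" for z using bnd(1)[of z] xbnd(1)[of z] that by auto
 have posM: "z \<notin> M" if "z < m1 | ms < z | x z < x ms | x m1 < x z" for z using bnd(2)[of z] xbnd(2)[of z] that by auto
 have posD: "z \<notin> D" if "z < d1 | dt < z | x z < x dt | x d1 < x z" for z using bnd(3)[of z] xbnd(3)[of z] that by auto
 have z1: "gp p q = 0" if "p < a1" for p q by (rule gap_zero(1), rule noo; rule posA posM) (use that lt in auto)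
 have z2: "gp p q = 0" if "dt <= p" for p q by (rule gap_zero(2), rule noi; rule posM posD) (use that lt in auto)
 have z3: "gp p q = 0" if "x d1 <= q" for p q by (rule gap_zero(3), rule noi; rule posM posD) (use that xlt in auto)
 have z4: "gp p q = 0" if "q < x al" for p q by (rule gap_zero(4), rule noo; rule posA posM) (use that xlt in auto)
 have NW: "gp p q = 0" if "p < m1" "x m1 <= q" for p q
 proof -
  obtain \<alpha> \<beta> where z: "al <= \<alpha>" "\<alpha> < m1" "x m1 <= \<beta>" "\<beta> < x dt" "~ 0 < gp \<alpha> \<beta>"
   using bad[OF mem(2,3,6)] by (auto simp: bad_def posbox_def)
  have "gp p q <= gp p (x m1)" by (intro row_down noo posA posM) (use that xlt in auto)
  also have "\<dots> <= gp (m1 - 1) (x m1)" by (intro col_up noi posM posD) (use that lt in auto)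
  also have "\<dots> <= gp \<alpha> (x m1)" by (intro col_down noo posA posM) (use z lt in auto)
  also have "\<dots> <= gp \<alpha> \<beta>" by (intro row_up noi posM posD) (use z xlt in auto)
  finally show ?thesis using z ge[of p q] by simp
 qed
 have SE: "gp p q = 0" if "ms <= p" "q < x ms" for p q
 proof -
  obtain \<alpha> \<beta> where z: "ms <= \<alpha>" "\<alpha> < d1" "x a1 <= \<beta>" "\<beta> < x ms" "~ 0 < gp \<alpha> \<beta>"
   using bad[OF mem(1,4,5)] by (auto simp: bad_def posbox_def)
  have "gp p q <= gp ms q" by (intro col_down noo posA posM) (use that lt in auto)
  also have "\<dots> <= gp \<alpha> q" by (intro col_up noi posM posD) (use z lt in auto)
  also have "\<dots> <= gp \<alpha> (x ms - 1)" by (intro row_up noi posM posD) (use that xlt in auto)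
  also have "\<dots> <= gp \<alpha> \<beta>" by (intro row_down noo posA posM) (use z xlt in auto)
  finally show ?thesis using z ge[of p q] by simp
 qed
 have ps: "0 < m1" "0 < ms" "0 < dt" "0 < x m1" "0 < x ms" "0 < x d1" using pos lt xlt by auto
 have wa1: "w a1 = x m1"
  by (rule w_rise) (use posboxD[OF E(1), of a1 "x m1 - 1"] z1[of "a1 - 1"] NW[of a1 "x m1"] pos lt xlt in force)+
 have wm1: "w m1 = x d1"
  by (rule w_rise) (use posboxD[OF E(5), of m1 "x d1 - 1"] NW[of "m1 - 1"] z3[of "x d1"] ps lt xlt in force)+
 have wms: "w ms = x al"
  by (rule w_fall) (use posboxD[OF E(3), of "ms - 1" "x al"] SE[of ms "x al"] z4[of "x al - 1"] ps pos lt xlt in force)+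
 have wdt: "w dt = x ms"
  by (rule w_fall) (use posboxD[OF E(8), of "dt - 1" "x ms"] z2[of dt] SE[of "dt - 1" "x ms - 1"] ps lt xlt in force)+
 have off: "w z = x z" if "z \<notin> A" "z \<notin> M" "z \<notin> D" for z using noi(1)[of z] noo(1)[of z] that by auto
 have mid: "bx m1 ms (x ms) (x d1)"
 proof (rule ccontr)
  assume n: "~ ?thesis"
  have s: "sw x al m1 m1 = x al" "sw x al m1 ms = x ms" "sw x al m1 d1 = x d1"
   using lt by (auto simp: sw_other simp del: comp_apply)
  have f1: "edge w (sw x al m1) m1 ms"
   by (rule edge_swI[OF E(2) _ _ s(1,2)]) (use lt xlt in \<open>auto intro: posbox_mono[OF edge_lt(3)[OF E(3)]]\<close>)
  have f2: "edge w (sw x al m1) ms d1"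
   by (rule edge_swI[OF E(2) _ _ s(2,3)]) (use lt xlt edge_lt(3)[OF E(7)] in auto)
  have "~ bx ms d1 (x al) (x ms)" using bad[OF mem(2,4,5)] by (simp add: bad_def)
  thus False by (intro no_bad[OF E(2) f1 f2]) (unfold s, use n in auto)
 qed
 have low: "of_bool (D3412 al m1 ms d1 (x al) (x ms) (x m1) (x d1) p q) <= gp p q" for p q
 proof (cases "D3412 al m1 ms d1 (x al) (x ms) (x m1) (x d1) p q")
  case True
  then consider "al <= p" "p < m1" "x al <= q" "q < x m1" | "al <= p" "p < ms" "x al <= q" "q < x ms"
    | "m1 <= p" "p < ms" "x ms <= q" "q < x d1" | "ms <= p" "p < d1" "x ms <= q" "q < x d1"
   unfolding D3412_def using lt xlt by linarith
  hence "1 <= gp p q"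
  proof cases
   case 3 thus ?thesis using mid unfolding posbox_def by force
  qed (use posboxD[OF E(2)] posboxD[OF E(3)] posboxD[OF E(7)] in auto)
  thus ?thesis by simp
 qed (use ge in simp)
 have W: "w z = x z" if z: "m1 < z" "z < ms" for z
 proof (cases "card M = 2")
  case True
  have "{m1, ms} = M" using mem True neq f by (intro card_subset_eq) auto
  hence "z \<notin> M" using z by auto
  thus ?thesis using off posA posD z lt by auto
 next
  case False
  then obtain a d where "A = {a}" "D = {d}" using alt by blast
  hence A: "A = {a1}" and D: "D = {d1}" and eqs: "al = a1" "dt = d1" using mem by auto
  show ?thesis using z
  proof (induction z rule: less_induct)
   case (less z)
   have colz: "gp (z - 1) q = gp m1 q" for q
   proof (rule antisym)
    show "gp (z - 1) q <= gp m1 q" by (intro col_down) (use less in auto)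
    show "gp m1 q <= gp (z - 1) q" by (intro col_up) (use less in auto)
   qed
   show ?case
   proof (cases "z \<in> M")
    case False thus ?thesis using off posA posD less.prems lt by auto
   next
    case True
    have xz: "x ms < x z" "x z < x m1" using xM True mem less.prems by auto
    have zp: "0 < z" using less.prems by simp
    have g1: "gp m1 (x z - 1) = 1"
    proof -
     have "gp (m1 - 1) (x z - 1) = gp a1 (x z - 1)"
     proof (rule antisym)
      show "gp (m1 - 1) (x z - 1) <= gp a1 (x z - 1)" by (intro col_down noo posA posM) (use lt eqs in auto)
      show "gp a1 (x z - 1) <= gp (m1 - 1) (x z - 1)" by (intro col_up noi posM posD) (use lt eqs in auto)
     qed
     also have "\<dots> = 1" using gap_col'[OF pos(1), of w x "x z - 1"] z1[of "a1 - 1" "x z - 1"] wa1 pos xz xlt by auto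
     finally show ?thesis using gap_col'[OF ps(1), of w x "x z - 1"] wm1 xz xlt by auto
    qed
    have "of_bool (D3412 al m1 ms d1 (x al) (x ms) (x m1) (x d1) z (x z - 1)) <= gp z (x z - 1)" by (rule low)
    moreover have "D3412 al m1 ms d1 (x al) (x ms) (x m1) (x d1) z (x z - 1)"
     unfolding D3412_def using less.prems xz xlt by auto
    ultimately have "1 <= gp z (x z - 1)" by simp
    hence ge': "x z <= w z" using gap_col'[OF zp, of w x "x z - 1"] colz[of "x z - 1"] g1 xz by (auto simp: of_bool_def split: if_splits)
    have "~ x z < w z"
    proof
     assume h: "x z < w z"
     define y where "y = pinv x (w z)"
     have y: "x y = w z" by (simp add: y_def x_pinv)
     have "y ~= z" using y h by auto
     have inj: "w y ~= w z" using \<open>y ~= z\<close> permutes_inj[OF w] by (auto dest: injD)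
     hence V: "y \<in> A | y \<in> M | y \<in> D" using off y by metis
     thus False
     proof (elim disjE)
      assume "y \<in> A" thus False using AM[OF _ True, of y] y h by auto
     next
      assume "y \<in> D"
      hence "w z = w m1" using D wm1 y by auto
      hence "z = m1" using permutes_inj[OF w] by (auto dest: injD)
      thus False using less.prems by simp
     next
      assume yM: "y \<in> M"
      have "y < z" using xM[OF True yM] y h \<open>y ~= z\<close> by (metis less_asym linorder_neqE_nat)
      moreover have "y ~= m1"
      proof
       assume "y = m1"
       hence "w z = w a1" using wa1 y by simp
       hence "z = a1" using permutes_inj[OF w] by (auto dest: injD)
       thus False using less.prems lt by simp
      qed
      ultimately have "w y = x y" using less bnd(2)[OF yM] by auto
      thus False using inj y by simp
     qed
    qed
    thus ?thesis using ge' by simp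
   qed
  qed
 qed
 have left: "gp (m1 - 1) q <= 1" if "q < x m1" for q
 proof (cases "card M = 2")
  case True
  have M: "{m1, ms} = M" using mem True neq f by (intro card_subset_eq) auto
  have "pinv w (x m1) = a1" using pinv_w[of a1] wa1 by simp
  hence "gp (m1 - 1) (x m1 - 1) = gp (m1 - 1) (x m1) + 1"
   using gap_row[OF w x, of "m1 - 1" "x m1 - 1"] ps lt by (simp add: pinv_x of_bool_def) linarith
  hence "gp (m1 - 1) (x m1 - 1) = 1" using NW[of "m1 - 1" "x m1"] ps by simp
  moreover have "gp (m1 - 1) q <= gp (m1 - 1) (x m1 - 1)"
  proof (rule row_up)
   fix z assume z: "q < x z" "x z <= x m1 - 1"
   show "z <= pinv w (x z)"
   proof (cases "z \<in> M")
    case True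
    hence "z = ms" using M z ps by auto
    moreover have "pinv w (x ms) = dt" using pinv_w[of dt] wdt by simp
    ultimately show ?thesis using lt by simp
   next
    case False
    moreover have "z \<notin> D" by (rule posD) (use z ps xlt in auto)
    ultimately show ?thesis by (rule noi)
   qed
  qed (use that in simp)
  ultimately show ?thesis by simp
 next
  case False
  then obtain a d where "A = {a}" "D = {d}" using alt by blast
  hence eqs: "al = a1" using mem by auto
  have "gp (m1 - 1) q <= gp a1 q" by (intro col_down noo posA posM) (use lt eqs in auto)
  moreover have "gp a1 q <= 1" using gap_col'[OF pos(1), of w x q] z1[of "a1 - 1" q] pos by (auto simp: of_bool_def)
  ultimately show ?thesis by simp
 qed
 have b1: "gp p q <= 1" if "p < m1" for p q
 proof (cases "q < x m1")
  case True
  have "gp p q <= gp (m1 - 1) q" by (intro col_up noi posM posD) (use that lt in auto)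
  thus ?thesis using left[OF True] by simp
 qed (use NW that in auto)
 have b2: "gp p q <= 1" if "m1 <= p" "p < ms" for p q
 proof -
  have "gp p q <= gp m1 q" by (intro col_down) (use that W in auto)
  moreover have "gp m1 q <= 1"
  proof (cases "q < x m1")
   case True
   thus ?thesis using gap_col'[OF ps(1), of w x q] wm1 left[OF True] by (auto simp: of_bool_def)
  next
   case False
   thus ?thesis using gap_col'[OF ps(1), of w x q] NW[of "m1 - 1" q] ps by (auto simp: of_bool_def)
  qed
  ultimately show ?thesis by simp
 qed
 have b3: "gp p q <= 1" if "ms <= p" for p q
 proof -
  have "gp p q <= gp ms q" by (intro col_down noo posA posM) (use that lt in auto)
  moreover have "gp ms q <= gp (ms - 1) q" using gap_col'[OF ps(2), of w x q] wms xlt by (auto simp: of_bool_def)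
  moreover have "gp (ms - 1) q <= 1" by (rule b2) (use lt in auto)
  ultimately show ?thesis by simp
 qed
 have up: "gp p q <= of_bool (D3412 a1 m1 ms dt (x al) (x ms) (x m1) (x d1) p q)" for p q
 proof -
  have "gp p q = 0" if h: "~ D3412 a1 m1 ms dt (x al) (x ms) (x m1) (x d1) p q"
  proof -
   consider "p < a1" | "dt <= p" | "x d1 <= q" | "q < x al" | "p < m1" "x m1 <= q" | "ms <= p" "q < x ms"
    using h unfolding D3412_def by linarith
   thus ?thesis by cases (use z1 z2 z3 z4 NW SE in auto)
  qed
  moreover have "gp p q <= 1" using b1[of p q] b2[of p q] b3[of p q] by linarith
  ultimately show ?thesis by (cases "D3412 a1 m1 ms dt (x al) (x ms) (x m1) (x d1) p q") auto
 qed
 show ?thesis unfolding wit3412_def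
  by (rule ex4I[of _ a1 m1 ms dt], rule ex4I[of _ al m1 ms d1], rule ex4I[of _ "x al" "x ms" "x m1" "x d1"])
   (intro conjI allI up low; use wa1 wm1 wms wdt rng lt xlt in linarith)
qed

end

context msing
begin

text \<open>Rotation exchanges the two outer layers of a tripartite configuration.\<close>
lemma tri_rot:
 assumes T: "msing.tri (rot n w) (rot n x) A M D"
 shows "tri {u. Suc n - u \<in> D} {u. Suc n - u \<in> M} {u. Suc n - u \<in> A}"
proof -
 interpret R: msing n "rot n w" "rot n x" \<delta> by (rule msing_rot)
 let ?f = "%u. Suc n - u"
 note t = R.triD[OF T]
 have ed: "ed u v <-> edge (rot n w) (rot n x) (?f v) (?f u)" for u v
  using edge_rot_imp[OF w x, of u v] edge_unrot[OF w x, of "?f v" "?f u"] R.edge_rng[of "?f v" "?f u"] by auto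
 obtain a m d where amd: "a \<in> A" "m \<in> M" "d \<in> D" using t(1-3) by blast
 have rg: "1 <= z & z <= n" if "z \<in> A \<union> M \<union> D" for z
  using that t(7) amd R.edge_rng[of z m] R.edge_rng[of m z] R.edge_rng[of z d] by auto
 hence ff: "?f (?f z) = z" if "z \<in> A \<union> M \<union> D" for z using that by force
 have bk: "?f (?f u) = u" if "?f u \<in> A \<union> M \<union> D" for u using rg[OF that] by arith
 have img: "{u. ?f u \<in> S} = ?f ` S" if S: "S \<subseteq> A \<union> M \<union> D" for S
 proof (rule Set.set_eqI, rule iffI)
  fix u assume "u \<in> {u. ?f u \<in> S}"
  hence s: "?f u \<in> S" by simp
  hence "u = ?f (?f u)" using bk[of u] S by (metis subsetD)
  thus "u \<in> ?f ` S" by (rule image_eqI) (rule s)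
 next
  fix u assume "u \<in> ?f ` S"
  then obtain s where "s \<in> S" "u = ?f s" by blast
  thus "u \<in> {u. ?f u \<in> S}" using ff[of s] S by (metis mem_Collect_eq subsetD)
 qed
 have imgs: "{u. ?f u \<in> A} = ?f ` A" "{u. ?f u \<in> M} = ?f ` M" "{u. ?f u \<in> D} = ?f ` D" by (rule img, blast)+
 have inj: "inj_on ?f (A \<union> M \<union> D)" by (rule inj_on_inverseI) (rule ff)
 show ?thesis unfolding tri_def
 proof (intro conjI)
  show "{u. ?f u \<in> D} ~= {}" "{u. ?f u \<in> A} ~= {}" unfolding imgs using amd by blast+
  obtain k l where kl: "k \<in> M" "l \<in> M" "k ~= l" using t(3) by blast
  hence "?f k ~= ?f l" using inj_onD[OF inj, of k l] by blast
  thus "EX m:{u. ?f u \<in> M}. EX m':{u. ?f u \<in> M}. m ~= m'" unfolding imgs using kl by blast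
  show "ALL u v. ed u v <-> u \<in> {u. ?f u \<in> D} & v \<in> {u. ?f u \<in> M} | u \<in> {u. ?f u \<in> M} & v \<in> {u. ?f u \<in> A}"
   unfolding ed using t(7) by blast
  show "ALL u:{u. ?f u \<in> D}. ALL m:{u. ?f u \<in> M}. ALL v:{u. ?f u \<in> A}. bd u m v"
  proof (intro ballI)
   fix u m v assume h: "u \<in> {u. ?f u \<in> D}" "m \<in> {u. ?f u \<in> M}" "v \<in> {u. ?f u \<in> A}"
   hence "?f (?f u) = u" "?f (?f m) = m" "?f (?f v) = v" using rg[of "?f u"] rg[of "?f m"] rg[of "?f v"] by auto
   thus "bd u m v" using bad_unrot[OF w x, of "?f v" "?f m" "?f u"] t(8) h by simp
  qed
  have "card {u. ?f u \<in> M} = card M" unfolding imgs by (rule card_image) (rule inj_on_subset[OF inj], blast)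
  thus "card {u. ?f u \<in> M} = 2 | (EX a d. {u. ?f u \<in> D} = {a} & {u. ?f u \<in> A} = {d})"
   using t(9) unfolding imgs by (metis image_empty image_insert)
 qed (use t(4-6) in blast)+
qed

text \<open>An edge outside a block either enters it from below or leaves it at the top; rotation reduces
 the second case to the first.\<close>
theorem msing_wit:
 assumes E: "ed i j"
 shows "wit4231 n w x | wit3412 n w x"
proof (cases "EX b d a c. cf b d a c")
 case True
 then obtain b d a c where C: "cf b d a c" by blast
 let ?B = "{u. ed u d}" and ?D = "{v. ed b v}"
 have bl: "block ?B ?D" using conf_block[OF C] .
 have e: "ed b d" "ed a c" "ed b c" "ed a d" using C conf_cross conf_edges by blast+
 have ne: "b ~= a" "d ~= c" using C by (auto simp: conf_def)
 show ?thesis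
 proof (cases "ALL u v. ed u v --> u \<in> ?B & v \<in> ?D")
  case True
  thus ?thesis using block_wit[OF bl] by blast
 next
  case False
  then obtain k l where kl: "ed k l" "k \<notin> ?B | l \<notin> ?D" by blast
  have k: "k \<notin> ?B"
  proof
   assume "k \<in> ?B"
   hence "ed k l <-> l \<in> ?D" using bl unfolding block_def by metis
   thus False using kl \<open>k \<in> ?B\<close> by blast
  qed
  have "k \<in> {d, c} | l \<in> {b, a}" using block_other_edge[OF bl _ _ ne(1) _ _ ne(2) kl(1) k] e by simp
  thus ?thesis
  proof
   assume "l \<in> {b, a}"
   hence "l \<in> ?B" using e by auto
   from tri_wit[OF block_tri[OF bl this kl(1)]] show ?thesis by simp
  next
   assume "k \<in> {d, c}"
   hence kD: "ed b k" using e by auto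
   interpret R: msing n "rot n w" "rot n x" \<delta> by (rule msing_rot)
   note r = edge_rot_imp[OF w x]
   have "R.tri {u. edge (rot n w) (rot n x) u (Suc n - k)} {u. edge (rot n w) (rot n x) u (Suc n - b)} {v. edge (rot n w) (rot n x) (Suc n - d) v}"
    by (rule R.block_tri[OF R.conf_block[OF conf_rot_imp[OF w x C]] _ r[OF kl(1)]]) (simp add: r[OF kD])
   from tri_wit[OF tri_rot[OF this]] show ?thesis by simp
  qed
 qed
next
 case False
 interpret N: msing_nc n w x \<delta> by unfold_locales (use False in blast)
 from N.nc_tri[OF E] tri_wit show ?thesis by blast
qed

end

section \<open>Singular permutations and witnesses\<close>

lemma rle_antisym:
 assumes x: "perm n x" and w: "perm n w" and "rle x w" "rle w x" shows "x = w"
proof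
 fix i
 have z: "gap w x p q = 0" for p q using assms(3,4) unfolding rle_def gap_def by (simp add: le_antisym)
 show "x i = w i"
 proof (cases i)
  case 0 thus ?thesis using perm_out[OF x] perm_out[OF w] by simp
 next
  case (Suc p)
  have "q < w i <-> q < x i" for q using gap_col[of w x p q] z Suc by (auto simp: of_bool_def split: if_splits)
  thus ?thesis by (meson linorder_neqE_nat less_irrefl)
 qed
qed

lemma rle_edge:
 assumes x: "perm n x" and w: "perm n w" and le: "rle x w" and ne: "x ~= w"
 obtains i j where "edge w x i j"
proof -
 have "~ rle w x" using rle_antisym[OF x w le] ne by blast
 then obtain p q where "rk x p q < rk w p q" unfolding rle_def by (meson not_le)
 hence g: "0 < gap w x p q" by (simp add: gap_def)
 from SW_dot[OF w x le g] obtain i where i: "i <= p" "x i <= q" "posbox w x i (Suc p) (x i) (Suc q)" .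
 hence "0 < gap w x i (x i)" by (auto simp: posbox_def)
 from NE_dot[OF w x le this] obtain j where "i < j" "x i < x j" "posbox w x i j (x i) (x j)" .
 thus ?thesis using that by (auto simp: edge_def)
qed

definition depth where "depth n w x = (SUM p<=n. SUM q<=n. nat (gap w x p q))"

lemma depth_sw:
 assumes w: "perm n w" and x: "perm n x" and E: "edge w x i j"
 shows "depth n w (sw x i j) < depth n w x"
proof -
 have l: "i < j" "x i < x j" using E by (auto simp: edge_def)
 have g: "gap w (sw x i j) p q <= gap w x p q" for p q by (simp add: gap_sw[OF l])
 have r: "i <= n" "x i <= n" using edge_range[OF w x E] by auto
 have "0 < gap w x i (x i)" using E by (auto simp: edge_def posbox_def)
 hence s: "nat (gap w (sw x i j) i (x i)) < nat (gap w x i (x i))" using l by (simp add: gap_sw)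
 have "(SUM q<=n. nat (gap w (sw x i j) i q)) < (SUM q<=n. nat (gap w x i q))"
  by (rule sum_strict_mono_ex1) (use g s r in \<open>auto intro!: nat_mono\<close>)
 thus ?thesis unfolding depth_def
  by (intro sum_strict_mono_ex1) (use g r in \<open>auto intro!: nat_mono sum_mono\<close>)
qed

lemma bruhat_induct [consumes 3, case_names base step]:
 assumes x: "perm n x" and w: "perm n w" and le: "rle x w"
  and base: "P w"
  and step: "!!x i j. perm n x ==> rle x w ==> edge w x i j ==> P (sw x i j) ==> P x"
 shows "P x"
 using x le
proof (induction "depth n w x" arbitrary: x rule: less_induct)
 case (less x)
 show ?case
 proof (cases "x = w")
  case False
  obtain i j where E: "edge w x i j" using rle_edge[OF less.prems(1) w less.prems(2) False] .
  have "P (sw x i j)"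
   by (rule less.hyps[OF depth_sw[OF w less.prems(1) E] edge_permutes[OF w less.prems(1) E] edge_sw_le[OF less.prems(2) E]])
  thus ?thesis using step[OF less.prems E] by blast
 qed (use base in simp)
qed

lemma edge_le_trans: "rle y w ==> rle x y ==> edge y x i j ==> edge w x i j"
 using edge_iff[of x y i j] edge_iff[of x w i j] rle_trans by blast

lemma ntrans_antimono:
 assumes x: "perm n x" and y: "perm n y" and w: "perm n w" and le: "rle x y" "rle y w"
 shows "ntrans n w y <= ntrans n w x"
 using x y le(1)
proof (induction rule: bruhat_induct)
 case (step x i j)
 have E: "edge w x i j" using edge_le_trans[OF le(2) step(2,3)] .
 show ?case using ntrans_sw[OF w step(1) _ E] rle_trans[OF step(2) le(2)] step.IH by linarith
qed simp

lemma ntrans_ge_len: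
 assumes x: "perm n x" and w: "perm n w" and le: "rle x w"
 shows "len n w <= ntrans n w x"
 using ntrans_antimono[OF x w w le] ntrans_self[OF w] by simp

text \<open>Apply an edge that takes part in a conflict: the count drops, and it cannot drop below its value
 at \<open>w\<close>.\<close>
lemma not_clean_singular:
 assumes x: "perm n x" and w: "perm n w" and le: "rle x w" and nc: "~ clean w x"
 shows "len n w < ntrans n w x"
proof -
 have rng: "1 <= u & u <= n & 1 <= v & v <= n" if "edge w x u v" for u v using edge_range[OF w x that] by linarith
 have pair: "finite {(k, l). conf w x i j k l}" for i j
  by (rule finite_subset[of _ "{1..n} \<times> {1..n}"]) (auto simp: conf_def dest: rng)
 have tr: "finite {k. bad w x i j k}" for i j
  by (rule finite_subset[of _ "{1..n}"]) (auto simp: bad_def dest: rng)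
 have "EX i j. edge w x i j & 0 < nconf w x i j"
 proof (cases "EX i j k l. conf w x i j k l")
  case True
  then obtain i j k l where c: "conf w x i j k l" by blast
  hence "{(k, l). conf w x i j k l} ~= {}" by blast
  hence "0 < card {(k, l). conf w x i j k l}" using pair by (simp add: card_gt_0_iff)
  thus ?thesis using c unfolding nconf_def conf_def by fastforce
 next
  case False
  then obtain i j k where c: "bad w x i j k" using nc by (auto simp: clean_def)
  hence "{k. bad w x i j k} ~= {}" by blast
  hence "0 < card {k. bad w x i j k}" using tr by (simp add: card_gt_0_iff)
  thus ?thesis using c unfolding nconf_def bad_def by fastforce
 qed
 then obtain i j where E: "edge w x i j" "0 < nconf w x i j" by blast
 have "len n w <= ntrans n w (sw x i j)"
  by (rule ntrans_ge_len[OF edge_permutes[OF w x E(1)] w edge_sw_le[OF le E(1)]])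
 thus ?thesis using ntrans_sw[OF w x le E(1)] E(2) by simp
qed

text \<open>Climb along edges as long as the result is singular.\<close>
theorem singular_imp_wit:
 assumes x: "perm n x" and w: "perm n w" and le: "rle x w" and s: "len n w < ntrans n w x"
 shows "EX z. perm n z & rle x z & rle z w & (wit4231 n w z | wit3412 n w z)"
 using x le s
proof (induction "depth n w x" arbitrary: x rule: less_induct)
 case (less x)
 note x = less.prems(1) and le = less.prems(2)
 show ?case
 proof (cases "EX i j. edge w x i j & len n w < ntrans n w (sw x i j)")
  case True
  then obtain i j where E: "edge w x i j" "len n w < ntrans n w (sw x i j)" by blast
  have "EX z. perm n z & rle (sw x i j) z & rle z w & (wit4231 n w z | wit3412 n w z)"
   by (rule less.hyps[OF depth_sw[OF w x E(1)] edge_permutes[OF w x E(1)] edge_sw_le[OF le E(1)] E(2)])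
  moreover have "rle x (sw x i j)" using E(1) by (intro rle_sw_up) (auto simp: edge_def)
  ultimately show ?thesis using rle_trans by blast
 next
  case False
  have "x ~= w" using less.prems(3) ntrans_self[OF w] by auto
  then obtain i j where E: "edge w x i j" using rle_edge[OF x w le] by blast
  interpret msing n w x "ntrans n w x - len n w"
  proof
   fix i j assume E: "edge w x i j"
   note y = edge_permutes[OF w x E] edge_sw_le[OF le E]
   have "ntrans n w (sw x i j) = len n w" using False E ntrans_ge_len[OF y(1) w y(2)] by (metis le_neq_implies_less)
   thus "nconf w x i j = ntrans n w x - len n w" "clean w (sw x i j)"
    using ntrans_sw[OF w x le E] not_clean_singular[OF y(1) w y(2)] by auto
  qed (use w x le less.prems(3) in auto)
  show ?thesis using msing_wit[OF E] x le by auto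
 qed
qed

text \<open>The lower bound provides the two edges; the upper bound makes the gap \<open>1\<close> where they meet, for 4231,
 and \<open>0\<close> next to the middle point, for 3412.\<close>
theorem wit_imp_singular:
 assumes x: "perm n x" and w: "perm n w" and le: "rle x w" and W: "wit4231 n w x | wit3412 n w x"
 shows "len n w < ntrans n w x"
proof (rule not_clean_singular[OF x w le])
 have ge: "0 <= gap w x p q" for p q using le by (simp add: rle_gap)
 have pinv_x: "pinv x (x z) = z" and pinv_w: "pinv w (w z) = z" for z using permutes_inj[OF x] permutes_inj[OF w] by (auto intro: inv_f_f)
 note row = gap_row[OF w x]
 show "~ clean w x" using W
 proof
  assume "wit4231 n w x"
  then obtain i j k l i' j' k' l' a b c d where "1 <= i" "i < j" "j < k" "k < l" "l <= n"
   "1 <= i'" and h: "i' < j'" "j' < k'" "k' < l'" and "l' <= n" and h2: "a < b" "b < c" "c < d"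
   and "w i = d" "w j = b" "w k = c" "w l = a" and h3: "x i' = b" "x j' = a" "x k' = d" "x l' = c"
   and up: "!!p q. gap w x p q <= of_bool (D4231 i j k l a b c d p q)"
   and low: "!!p q. of_bool (D4231 i' j' k' l' a b c d p q) <= gap w x p q"
   unfolding wit4231_def by auto
  have low': "0 < gap w x p q" if "D4231 i' j' k' l' a b c d p q" for p q using low[of p q] that by simp
  have e1: "edge w x i' k'" unfolding edge_def posbox_def
   using h h2 h3 by (auto intro!: low' simp: D4231_def)
  have e2: "edge w x j' l'" unfolding edge_def posbox_def
   using h h2 h3 by (auto intro!: low' simp: D4231_def)
  have g: "gap w x j' b = 1" using low'[of j' b] up[of j' b] h h2 h3 by (auto simp: D4231_def of_bool_def split: if_splits)
  have "conf w x i' k' j' l'" by (rule confI[OF e1 e2 _ _ _ _ _ _ _ _ _ _ _ _ g]) (use h h2 h3 in auto)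
  thus ?thesis by (auto simp: clean_def)
 next
  assume "wit3412 n w x"
  then obtain i j k l i' j' k' l' a b c d where "1 <= i" and h': "i < j" "j < k" "k < l" and "l <= n"
   "1 <= i'" and h: "i' < j'" "j' < k'" "k' < l'" and "l' <= n" and h2: "a < b" "b < c" "c < d"
   and h4: "w i = c" "w j = d" "w k = a" "w l = b" and h3: "x i' = a" "x j' = c" "x k' = b" "x l' = d"
   and up: "!!p q. gap w x p q <= of_bool (D3412 i j k l a b c d p q)"
   and low: "!!p q. of_bool (D3412 i' j' k' l' a b c d p q) <= gap w x p q"
   unfolding wit3412_def by auto
  have low': "0 < gap w x p q" if "D3412 i' j' k' l' a b c d p q" for p q using low[of p q] that by simp
  have inD: "D3412 i j k l a b c d p q" if "D3412 i' j' k' l' a b c d p q" for p q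
   using low'[OF that] up[of p q] by (cases "D3412 i j k l a b c d p q") auto
  have le1: "gap w x p q <= 1" for p q using up[of p q] by (auto simp: of_bool_def split: if_splits)
  have e1: "edge w x i' j'" unfolding edge_def posbox_def
   using h h2 h3 by (auto intro!: low' simp: D3412_def)
  have e2: "edge w x j' l'" unfolding edge_def posbox_def
   using h h2 h3 by (auto intro!: low' simp: D3412_def)
  have "D3412 i' j' k' l' a b c d i' (c - 1)" using h h2 h3 by (auto simp: D3412_def)
  from inD[OF this] have ii: "i <= i'" using h' by (auto simp: D3412_def)
  have "D3412 i' j' k' l' a b c d k' b" using h h2 h3 by (auto simp: D3412_def)
  from inD[OF this] have kl: "k' < l" using h' by (auto simp: D3412_def)
  have pc: "pinv w c = i" "pinv x c = j'" "pinv w b = l" "pinv x b = k'" using pinv_w[of i] pinv_w[of l] pinv_x[of j'] pinv_x[of k'] h3 h4 by auto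
  have r1: "gap w x i' (c - 1) = gap w x i' c + (of_bool (i <= i') - of_bool (j' <= i'))" using row[of i' "c - 1"] h h2 pc by simp
  have r2: "gap w x k' (b - 1) = gap w x k' b + (of_bool (l <= k') - of_bool (k' <= k'))" using row[of k' "b - 1"] h h2 pc by simp
  have z1: "gap w x i' c <= 0" if "i <= i'" using r1 le1[of i' "c - 1"] that h h2 by simp
  have z2: "gap w x k' (b - 1) <= 0" if "k' < l" using r2 le1[of k' b] that by simp
  have "~ posbox w x i' j' c d" if "i <= i'" using z1[OF that] h h2 unfolding posbox_def by (metis le_refl not_le)
  moreover have "~ posbox w x j' l' a c" if "k' < l"
  proof
   assume "posbox w x j' l' a c"
   hence "0 < gap w x k' (b - 1)" unfolding posbox_def using h h2 h3 by auto
   thus False using z2[OF that] by simp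
  qed
  ultimately have "bad w x i' j' l'" using e1 e2 h3 ii kl by (simp add: bad_def)
  thus ?thesis by (auto simp: clean_def)
 qed
qed

section \<open>The set \<open>E\<^sub>w\<close>\<close>

lemma four: "{1..4::nat} = {1, 2, 3, 4}" by auto

lemma one_line_vals:
 "one_line [a, b, c, d] 1 = a" "one_line [a, b, c, d] 2 = b" "one_line [a, b, c, d] 3 = c" "one_line [a, b, c, d] 4 = d"
 by (simp_all add: one_line_def)

lemma one_line_permutes:
 assumes "distinct [a, b, c, d]" "{a, b, c, d} = {1..4}"
 shows "one_line [a, b, c, d] permutes {1..4}"
proof (rule bij_imp_permutes)
 have "one_line [a, b, c, d] ` {1..4} = {1..4}" unfolding four image_insert image_empty one_line_vals using assms(2) four by simp
 moreover from this have "inj_on (one_line [a, b, c, d]) {1..4}" by (intro eq_card_imp_inj_on) auto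
 ultimately show "bij_betw (one_line [a, b, c, d]) {1..4} {1..4}" by (simp add: bij_betw_def)
qed (auto simp: one_line_def)

lemma pattern_permutes: "one_line [3,4,1,2] permutes {1..4}" "one_line [1,3,2,4] permutes {1..4}"
  "one_line [4,2,3,1] permutes {1..4}" "one_line [2,1,4,3] permutes {1..4}"
 by (rule one_line_permutes; auto simp: four)+

lemma nth_pos4:
 assumes "i < j" "j < k" "k < (l::nat)"
 shows "nth_pos {i, j, k, l} 1 = i" "nth_pos {i, j, k, l} 2 = j" "nth_pos {i, j, k, l} 3 = k" "nth_pos {i, j, k, l} 4 = l"
  and "card {i, j, k, l} = 4"
proof -
 have "sorted_list_of_set (set [i, j, k, l]) = [i, j, k, l]"
  using assms by (intro sorted_list_of_set.idem_if_sorted_distinct) auto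
 hence s: "sorted_list_of_set {i, j, k, l} = [i, j, k, l]" by simp
 show "nth_pos {i, j, k, l} 1 = i" "nth_pos {i, j, k, l} 2 = j" "nth_pos {i, j, k, l} 3 = k" "nth_pos {i, j, k, l} 4 = l"
  by (simp_all add: nth_pos_def s)
 show "card {i, j, k, l} = 4" using assms by auto
qed

lemma fl4:
 assumes r: "i < j" "j < k" "k < l" and x: "inj x"
 shows "fl {i, j, k, l} x = one_line [3,4,1,2] <-> x k < x l & x l < x i & x i < x j" (is ?A)
  "fl {i, j, k, l} x = one_line [1,3,2,4] <-> x i < x k & x k < x j & x j < x l" (is ?B)
  "fl {i, j, k, l} x = one_line [4,2,3,1] <-> x l < x j & x j < x k & x k < x i" (is ?C)
  "fl {i, j, k, l} x = one_line [2,1,4,3] <-> x j < x i & x i < x l & x l < x k" (is ?D)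
proof -
 have fl: "fl {i, j, k, l} x = u <-> (ALL s:{1, 2, 3, 4}. ALL t:{1, 2, 3, 4}. u s < u t
   <-> x (nth_pos {i, j, k, l} s) < x (nth_pos {i, j, k, l} t))" if "u permutes {1..4}" for u
  unfolding fl_eq_iff[OF _ inj_on_subset[OF x], of "{i, j, k, l}", simplified] is_fl_def nth_pos4(5)[OF r]
  using that by (simp only: four simp_thms)
 note ev = fl[OF pattern_permutes(1)] fl[OF pattern_permutes(2)] fl[OF pattern_permutes(3)] fl[OF pattern_permutes(4)]
 show ?A ?B ?C ?D
  unfolding ev ball_simps one_line_vals nth_pos4(1-4)[OF r] by (simp; intro iffI; linarith)+
qed

lemma unfl4:
 assumes x: "perm n x" and r: "1 <= i" "i < j" "j < k" "k < l" "l <= n" and u: "u permutes {1..4}"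
 obtains y where "unfl n {i, j, k, l} x u = y" "perm n y" "ALL z. z \<notin> {i, j, k, l} --> y z = x z" "fl {i, j, k, l} y = u"
  "{y i, y j, y k, y l} = {x i, x j, x k, x l}"
proof -
 let ?Z = "{i, j, k, l}" and ?y = "unfl n {i, j, k, l} x u"
 have "?Z \<subseteq> {1..n}" "u permutes {1..card ?Z}" using r u unfolding nth_pos4(5)[OF r(2-4)] by auto
 from theI'[OF ex1_unfl[OF x this]]
 have y: "perm n ?y" "!!z. z \<in> {1..n} - ?Z ==> ?y z = x z" "fl ?Z ?y = u" unfolding unfl_def by auto
 have off: "?y z = x z" if "z \<notin> ?Z" for z
  using y(1,2) x that by (cases "z \<in> {1..n}") (auto simp: permutes_not_in)
 have "f ` ?Z = - f ` (- ?Z)" if "perm n f" for f :: "nat => nat"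
  using bij_image_Compl_eq[OF permutes_bij[OF that], of ?Z] by simp
 moreover have "?y ` (- ?Z) = x ` (- ?Z)" by (rule image_cong) (use off in auto)
 ultimately have "?y ` ?Z = x ` ?Z" using x y(1) by metis
 thus ?thesis using that[OF refl y(1) _ y(3)] off by simp
qed

lemma gap4:
 assumes "i < j" "j < k" "k < l" and off: "ALL z. z \<notin> {i, j, k, l} --> x z = y z"
 shows "gap x y p q = of_bool (i <= p) * (of_bool (q < x i) - of_bool (q < y i)) + of_bool (j <= p) * (of_bool (q < x j) - of_bool (q < y j))
  + of_bool (k <= p) * (of_bool (q < x k) - of_bool (q < y k)) + of_bool (l <= p) * (of_bool (q < x l) - of_bool (q < y l))"
proof -
 have "int (rk x p q) - int (rk y p q) = (SUM z:{i, j, k, l}. of_bool (z <= p) * (of_bool (q < x z) - of_bool (q < y z)))"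
  by (rule rk_update) (use off in auto)
 thus ?thesis unfolding gap_def using assms(1-3) by (simp del: of_bool_eq_iff add: of_bool_def[symmetric] split del: if_split)
qed

lemma of_bool_steps:
 fixes a b c d i j k l p q :: nat
 assumes "i < j" "j < k" "k < l" "a < c" "a < d" "b < d"
 shows "of_bool (i <= p) * (of_bool (q < c) - of_bool (q < a)) + of_bool (j <= p) * (of_bool (q < d) - of_bool (q < c))
  + of_bool (k <= p) * (of_bool (q < a) - of_bool (q < b)) + of_bool (l <= p) * (of_bool (q < b) - of_bool (q < d))
  = (of_bool (D3412 i j k l a b c d p q) :: int)" (is ?A)
  "of_bool (i <= p) * (of_bool (q < d) - of_bool (q < b)) + of_bool (j <= p) * (of_bool (q < b) - of_bool (q < a))
  + of_bool (k <= p) * (of_bool (q < c) - of_bool (q < d)) + of_bool (l <= p) * (of_bool (q < a) - of_bool (q < c))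
  = (of_bool (D4231 i j k l a b c d p q) :: int)" (is ?B)
proof -
 have dj: "(of_bool (X1 & Y1 | X2 & Y2 | X3 & Y3) :: int) = of_bool X1 * of_bool Y1 + of_bool X2 * of_bool Y2 + of_bool X3 * of_bool Y3"
  if "~ (X1 & X2)" "~ (X1 & X3)" "~ (X2 & X3)" for X1 X2 X3 Y1 Y2 Y3
  using that by auto
 have X: "(of_bool (u <= p & p < v) :: int) = of_bool (u <= p) - of_bool (v <= p)" if "u < v" for u v
  using that by auto
 have Y: "(of_bool (u <= q & q < v) :: int) = of_bool (q < v) - of_bool (q < u)" if "u < v" for u v
  using that by auto
 have split: "(of_bool ((i <= p & p < j) & Y1 | (j <= p & p < k) & Y2 | (k <= p & p < l) & Y3) :: int) =
  (of_bool (i <= p) - of_bool (j <= p)) * of_bool Y1 + (of_bool (j <= p) - of_bool (k <= p)) * of_bool Y2 + (of_bool (k <= p) - of_bool (l <= p)) * of_bool Y3" for Y1 Y2 Y3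
  unfolding X[OF assms(1), symmetric] X[OF assms(2), symmetric] X[OF assms(3), symmetric] by (rule dj) (use assms in auto)
 show ?A ?B
  unfolding D3412_def D4231_def using split[of "a <= q & q < c" "a <= q & q < d" "b <= q & q < d"] split[of "b <= q & q < d" "a <= q & q < d" "a <= q & q < c"]
  unfolding Y[OF assms(4)] Y[OF assms(5)] Y[OF assms(6)] conj_assoc by (simp_all only: ring_distribs)
qed

lemma four_set_sorted:
 fixes a b c d a' b' c' d' :: nat
 assumes "{a, b, c, d} = {a', b', c', d'}" "a < b" "b < c" "c < d" "a' < b'" "b' < c'" "c' < d'"
 shows "a = a'" "b = b'" "c = c'" "d = d'"
proof -
 have "sorted_list_of_set (set [a, b, c, d]) = [a, b, c, d]" "sorted_list_of_set (set [a', b', c', d']) = [a', b', c', d']"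
  using assms by (intro sorted_list_of_set.idem_if_sorted_distinct; auto)+
 thus "a = a'" "b = b'" "c = c'" "d = d'" using assms(1) by simp_all
qed

text \<open>The two rearrangements of four entries change the rank function by the indicator of a
 region that consists of three adjacent rectangles.\<close>
lemma gap_patterns:
 assumes x: "perm n x" and y: "perm n y" and r: "i < j" "j < k" "k < l"
  and off: "ALL z. z \<notin> {i, j, k, l} --> x z = y z" and set: "{x i, x j, x k, x l} = {y i, y j, y k, y l}"
 shows "fl {i, j, k, l} x = one_line [3,4,1,2] ==> fl {i, j, k, l} y = one_line [1,3,2,4] ==>
   y i = x k & y k = x l & y j = x i & y l = x j & gap x y p q = of_bool (D3412 i j k l (x k) (x l) (x i) (x j) p q)"
   (is "_ ==> _ ==> ?A")
  "fl {i, j, k, l} x = one_line [4,2,3,1] ==> fl {i, j, k, l} y = one_line [2,1,4,3] ==>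
   y j = x l & y i = x j & y l = x k & y k = x i & gap x y p q = of_bool (D4231 i j k l (x l) (x j) (x k) (x i) p q)"
   (is "_ ==> _ ==> ?B")
proof -
 note F = fl4[OF r permutes_inj[OF x]] fl4[OF r permutes_inj[OF y]] and g = gap4[OF r off, where p = p and q = q]
 assume "fl {i, j, k, l} x = one_line [3,4,1,2]" "fl {i, j, k, l} y = one_line [1,3,2,4]"
 hence o: "x k < x l" "x l < x i" "x i < x j" "y i < y k" "y k < y j" "y j < y l" unfolding F by auto
 have "{x k, x l, x i, x j} = {y i, y k, y j, y l}" using set by (simp add: insert_commute)
 note e = four_set_sorted[OF this o]
 show ?A
  using of_bool_steps(1)[OF r, of "x k" "x i" "x j" "x l" p q] o unfolding g e by simp
next
 note F = fl4[OF r permutes_inj[OF x]] fl4[OF r permutes_inj[OF y]] and g = gap4[OF r off, where p = p and q = q]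
 assume "fl {i, j, k, l} x = one_line [4,2,3,1]" "fl {i, j, k, l} y = one_line [2,1,4,3]"
 hence o: "x l < x j" "x j < x k" "x k < x i" "y j < y i" "y i < y l" "y l < y k" unfolding F by auto
 have "{x l, x j, x k, x i} = {y j, y i, y l, y k}" using set by (simp add: insert_commute)
 note e = four_set_sorted[OF this o]
 show ?B
  using of_bool_steps(2)[OF r, of "x l" "x k" "x i" "x j" p q] o unfolding g e by simp
qed

text \<open>Bruhat comparisons with the two rearrangements are bounds on the gap, because both gaps involved
 are indicators of a region.\<close>
lemma pattern_conditions:
 assumes w: "perm n w" and z: "perm n z"
  and B: "!!u v. perm n u ==> perm n v ==> bruhat_le n u v <-> rle u v"
  and r: "1 <= i" "i < j" "j < k" "k < l" "l <= n" and r': "1 <= i'" "i' < j'" "j' < k'" "k' < l'" "l' <= n"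
  and pq: "p permutes {1..4}" "q permutes {1..4}" and f: "fl {i,j,k,l} w = p" "fl {i',j',k',l'} z = q"
  and D: "!!y P Q. perm n y ==> (ALL v. v \<notin> {i, j, k, l} --> w v = y v) ==> {w i, w j, w k, w l} = {y i, y j, y k, y l} ==>
    fl {i,j,k,l} y = q ==> gap w y P Q = of_bool (D P Q)"
  and D': "!!y P Q. perm n y ==> (ALL v. v \<notin> {i', j', k', l'} --> y v = z v) ==> {y i', y j', y k', y l'} = {z i', z j', z k', z l'} ==>
    fl {i',j',k',l'} y = p ==> gap y z P Q = of_bool (D' P Q)"
 shows "bruhat_le n (unfl n {i,j,k,l} w q) z & bruhat_le n z (unfl n {i',j',k',l'} z p) & bruhat_le n (unfl n {i',j',k',l'} z p) w <->
  (ALL P Q. gap w z P Q <= of_bool (D P Q)) & (ALL P Q. of_bool (D' P Q) <= gap w z P Q)"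
proof -
 obtain y where y: "unfl n {i,j,k,l} w q = y" "perm n y" "ALL v. v \<notin> {i, j, k, l} --> y v = w v"
  "fl {i,j,k,l} y = q" "{y i, y j, y k, y l} = {w i, w j, w k, w l}" using unfl4[OF w r pq(2)] by metis
 obtain y' where y': "unfl n {i',j',k',l'} z p = y'" "perm n y'" "ALL v. v \<notin> {i', j', k', l'} --> y' v = z v"
  "fl {i',j',k',l'} y' = p" "{y' i', y' j', y' k', y' l'} = {z i', z j', z k', z l'}" using unfl4[OF z r' pq(1)] by metis
 have "ALL v. v \<notin> {i, j, k, l} --> w v = y v" using y(3) by simp
 note G = D[OF y(2) this y(5)[symmetric] y(4)] and G' = D'[OF y'(2,3,5,4)]
 have "rk y P Q <= rk z P Q <-> gap w z P Q <= of_bool (D P Q)" "rk y' P Q <= rk w P Q <-> of_bool (D' P Q) <= gap w z P Q" for P Q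
  using G[of P Q] G'[of P Q] unfolding gap_def by linarith+
 thus ?thesis unfolding y(1) y'(1) B[OF y(2) z] B[OF y'(2) w] B[OF z y'(2)] unfolding rle_gap[of z y'] rle_def[of y] rle_def[of y'] G' by simp
qed

definition E_pattern where "E_pattern n w x p q \<equiv> (EX i j k l i' j' k' l'.
    1 <= i & i < j & j < k & k < l & l <= n & 1 <= i' & i' < j' & j' < k' & k' < l' & l' <= n &
    {w i, w j, w k, w l} = {x i', x j', x k', x l'} & fl {i,j,k,l} w = p & fl {i',j',k',l'} x = q &
    bruhat_le n (unfl n {i,j,k,l} w q) x & bruhat_le n x (unfl n {i',j',k',l'} x p) & bruhat_le n (unfl n {i',j',k',l'} x p) w)"

lemma wit3412_iff:
 assumes w: "perm n w" and z: "perm n z"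
  and B: "!!u v. perm n u ==> perm n v ==> bruhat_le n u v <-> rle u v"
 shows "wit3412 n w z <-> E_pattern n w z (one_line [3,4,1,2]) (one_line [1,3,2,4])" (is "_ = E_pattern n w z ?p ?q")
proof
 note I = permutes_inj[OF w] permutes_inj[OF z]
 {
  fix i j k l i' j' k' l' :: nat
  assume r: "1 <= i" "i < j" "j < k" "k < l" "l <= n" and r': "1 <= i'" "i' < j'" "j' < k'" "k' < l'" "l' <= n"
   and f: "fl {i,j,k,l} w = ?p" "fl {i',j',k',l'} z = ?q"
  have "bruhat_le n (unfl n {i,j,k,l} w ?q) z & bruhat_le n z (unfl n {i',j',k',l'} z ?p) & bruhat_le n (unfl n {i',j',k',l'} z ?p) w <->
   (ALL P Q. gap w z P Q <= of_bool (D3412 i j k l (w k) (w l) (w i) (w j) P Q)) & (ALL P Q. of_bool (D3412 i' j' k' l' (z i') (z k') (z j') (z l') P Q) <= gap w z P Q)"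
  proof (rule pattern_conditions[OF w z _ r r' pattern_permutes(1,2) f], fact B)
   fix y P Q assume y: "perm n y" "ALL v. v \<notin> {i, j, k, l} --> w v = y v" "{w i, w j, w k, w l} = {y i, y j, y k, y l}" "fl {i,j,k,l} y = ?q"
   show "gap w y P Q = of_bool (D3412 i j k l (w k) (w l) (w i) (w j) P Q)" using gap_patterns(1)[OF w y(1) r(2-4) y(2,3) f(1) y(4)] by blast
  next
   fix y P Q assume y: "perm n y" "ALL v. v \<notin> {i', j', k', l'} --> y v = z v" "{y i', y j', y k', y l'} = {z i', z j', z k', z l'}" "fl {i',j',k',l'} y = ?p"
   show "gap y z P Q = of_bool (D3412 i' j' k' l' (z i') (z k') (z j') (z l') P Q)" using gap_patterns(1)[OF y(1) z r'(2-4) y(2-4) f(2)] by simp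
  qed
 }
 note C = this
 {
  assume "wit3412 n w z"
  then obtain i j k l i' j' k' l' a b c d where r: "1 <= i" "i < j" "j < k" "k < l" "l <= n"
   and r': "1 <= i'" "i' < j'" "j' < k'" "k' < l'" "l' <= n" and v: "a < b" "b < c" "c < d"
   and e: "w i = c" "w j = d" "w k = a" "w l = b" and e': "z i' = a" "z j' = c" "z k' = b" "z l' = d"
   and up: "ALL p q. gap w z p q <= of_bool (D3412 i j k l a b c d p q)"
   and low: "ALL p q. of_bool (D3412 i' j' k' l' a b c d p q) <= gap w z p q"
   unfolding wit3412_def by auto
  have f: "fl {i,j,k,l} w = ?p" "fl {i',j',k',l'} z = ?q" 
   unfolding fl4[OF r(2-4) I(1)] fl4[OF r'(2-4) I(2)] e e' using v by auto
  have s: "{w i, w j, w k, w l} = {z i', z j', z k', z l'}" unfolding e e' by auto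
  show "E_pattern n w z ?p ?q" unfolding E_pattern_def
   by (rule ex4I[of _ i j k l], rule ex4I[of _ i' j' k' l'])
    (intro conjI r r' s f; use C[OF r r' f] up low in \<open>simp only: e e' simp_thms\<close>)
 next
  assume "E_pattern n w z ?p ?q"
  then obtain i j k l i' j' k' l' where r: "1 <= i" "i < j" "j < k" "k < l" "l <= n"
   and r': "1 <= i'" "i' < j'" "j' < k'" "k' < l'" "l' <= n" and s: "{w i, w j, w k, w l} = {z i', z j', z k', z l'}"
   and f: "fl {i,j,k,l} w = ?p" "fl {i',j',k',l'} z = ?q"
   and b: "bruhat_le n (unfl n {i,j,k,l} w ?q) z" "bruhat_le n z (unfl n {i',j',k',l'} z ?p)"
    "bruhat_le n (unfl n {i',j',k',l'} z ?p) w" unfolding E_pattern_def by (elim exE conjE)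
  have fw: "w k < w l" "w l < w i" "w i < w j" and fz: "z i' < z k'" "z k' < z j'" "z j' < z l'"
   using f unfolding fl4[OF r(2-4) I(1)] fl4[OF r'(2-4) I(2)] by auto
  have "{w k, w l, w i, w j} = {z i', z k', z j', z l'}" using s by (simp add: insert_commute)
  note e = four_set_sorted[OF this fw fz]
  show "wit3412 n w z" unfolding wit3412_def
   by (rule ex4I[of _ i j k l], rule ex4I[of _ i' j' k' l'], rule ex4I[of _ "w k" "w l" "w i" "w j"])
    (use C[OF r r' f] b r r' fw in \<open>simp only: e simp_thms\<close>)
 }
qed

lemma wit4231_iff:
 assumes w: "perm n w" and z: "perm n z"
  and B: "!!u v. perm n u ==> perm n v ==> bruhat_le n u v <-> rle u v"
 shows "wit4231 n w z <-> E_pattern n w z (one_line [4,2,3,1]) (one_line [2,1,4,3])" (is "_ = E_pattern n w z ?p ?q")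
proof
 note I = permutes_inj[OF w] permutes_inj[OF z]
 {
  fix i j k l i' j' k' l' :: nat
  assume r: "1 <= i" "i < j" "j < k" "k < l" "l <= n" and r': "1 <= i'" "i' < j'" "j' < k'" "k' < l'" "l' <= n"
   and f: "fl {i,j,k,l} w = ?p" "fl {i',j',k',l'} z = ?q"
  have "bruhat_le n (unfl n {i,j,k,l} w ?q) z & bruhat_le n z (unfl n {i',j',k',l'} z ?p) & bruhat_le n (unfl n {i',j',k',l'} z ?p) w <->
   (ALL P Q. gap w z P Q <= of_bool (D4231 i j k l (w l) (w j) (w k) (w i) P Q)) & (ALL P Q. of_bool (D4231 i' j' k' l' (z j') (z i') (z l') (z k') P Q) <= gap w z P Q)"
  proof (rule pattern_conditions[OF w z _ r r' pattern_permutes(3,4) f], fact B)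
   fix y P Q assume y: "perm n y" "ALL v. v \<notin> {i, j, k, l} --> w v = y v" "{w i, w j, w k, w l} = {y i, y j, y k, y l}" "fl {i,j,k,l} y = ?q"
   show "gap w y P Q = of_bool (D4231 i j k l (w l) (w j) (w k) (w i) P Q)" using gap_patterns(2)[OF w y(1) r(2-4) y(2,3) f(1) y(4)] by blast
  next
   fix y P Q assume y: "perm n y" "ALL v. v \<notin> {i', j', k', l'} --> y v = z v" "{y i', y j', y k', y l'} = {z i', z j', z k', z l'}" "fl {i',j',k',l'} y = ?p"
   show "gap y z P Q = of_bool (D4231 i' j' k' l' (z j') (z i') (z l') (z k') P Q)" using gap_patterns(2)[OF y(1) z r'(2-4) y(2-4) f(2)] by simp
  qed
 }
 note C = this
 {
  assume "wit4231 n w z"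
  then obtain i j k l i' j' k' l' a b c d where r: "1 <= i" "i < j" "j < k" "k < l" "l <= n"
   and r': "1 <= i'" "i' < j'" "j' < k'" "k' < l'" "l' <= n" and v: "a < b" "b < c" "c < d"
   and e: "w i = d" "w j = b" "w k = c" "w l = a" and e': "z i' = b" "z j' = a" "z k' = d" "z l' = c"
   and up: "ALL p q. gap w z p q <= of_bool (D4231 i j k l a b c d p q)"
   and low: "ALL p q. of_bool (D4231 i' j' k' l' a b c d p q) <= gap w z p q"
   unfolding wit4231_def by auto
  have f: "fl {i,j,k,l} w = ?p" "fl {i',j',k',l'} z = ?q" 
   unfolding fl4[OF r(2-4) I(1)] fl4[OF r'(2-4) I(2)] e e' using v by auto
  have s: "{w i, w j, w k, w l} = {z i', z j', z k', z l'}" unfolding e e' by auto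
  show "E_pattern n w z ?p ?q" unfolding E_pattern_def
   by (rule ex4I[of _ i j k l], rule ex4I[of _ i' j' k' l'])
    (intro conjI r r' s f; use C[OF r r' f] up low in \<open>simp only: e e' simp_thms\<close>)
 next
  assume "E_pattern n w z ?p ?q"
  then obtain i j k l i' j' k' l' where r: "1 <= i" "i < j" "j < k" "k < l" "l <= n"
   and r': "1 <= i'" "i' < j'" "j' < k'" "k' < l'" "l' <= n" and s: "{w i, w j, w k, w l} = {z i', z j', z k', z l'}"
   and f: "fl {i,j,k,l} w = ?p" "fl {i',j',k',l'} z = ?q"
   and b: "bruhat_le n (unfl n {i,j,k,l} w ?q) z" "bruhat_le n z (unfl n {i',j',k',l'} z ?p)"
    "bruhat_le n (unfl n {i',j',k',l'} z ?p) w" unfolding E_pattern_def by (elim exE conjE)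
  have fw: "w l < w j" "w j < w k" "w k < w i" and fz: "z j' < z i'" "z i' < z l'" "z l' < z k'"
   using f unfolding fl4[OF r(2-4) I(1)] fl4[OF r'(2-4) I(2)] by auto
  have "{w l, w j, w k, w i} = {z j', z i', z l', z k'}" using s by (simp add: insert_commute)
  note e = four_set_sorted[OF this fw fz]
  show "wit4231 n w z" unfolding wit4231_def
   by (rule ex4I[of _ i j k l], rule ex4I[of _ i' j' k' l'], rule ex4I[of _ "w l" "w j" "w k" "w i"])
    (use C[OF r r' f] b r r' fw in \<open>simp only: e simp_thms\<close>)
 }
qed

theorem E_set_iff:
 assumes w: "perm n w" and z: "perm n z"
  and B: "!!u v. perm n u ==> perm n v ==> bruhat_le n u v <-> rle u v"
 shows "z \<in> E_set n w <-> wit4231 n w z | wit3412 n w z"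
proof -
 have "wit3412 n w z <-> E_pattern n w z (one_line [3,4,1,2]) (one_line [1,3,2,4])" by (rule wit3412_iff[OF w z], fact B)
 moreover have "wit4231 n w z <-> E_pattern n w z (one_line [4,2,3,1]) (one_line [2,1,4,3])" by (rule wit4231_iff[OF w z], fact B)
 ultimately show ?thesis unfolding E_pattern_def E_set_def using z
  by (simp only: mem_Collect_eq bex_simps prod.case simp_thms conj_disj_distribL ex_disj_distrib disj_commute)
qed

section \<open>Linear equations\<close>

lemma more_unknowns_than_equations:
 fixes \<alpha> :: "'a => 'b => complex"
 assumes "finite T" "finite S" "card T < card S"
 shows "EX c. (EX s:S. c s ~= 0) & (ALL t:T. (SUM s:S. c s * \<alpha> s t) = 0)"
 using assms
proof (induction T arbitrary: S \<alpha> rule: finite_induct)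
 case empty
 hence "S ~= {}" by auto
 thus ?case by (intro exI[of _ "%_. 1"]) auto
next
 case (insert t0 T)
 show ?case
 proof (cases "ALL s:S. \<alpha> s t0 = 0")
  case True
  have "card T < card S" using insert by simp
  from insert.IH[OF insert.prems(1) this, of \<alpha>] obtain c where
   "EX s:S. c s ~= 0" "ALL t:T. (SUM s:S. c s * \<alpha> s t) = 0" by blast
  moreover have "(SUM s:S. c s * \<alpha> s t0) = 0" using True by simp
  ultimately show ?thesis by (intro exI[of _ c]) simp
 next
  case False
  then obtain s0 where s0: "s0 \<in> S" "\<alpha> s0 t0 ~= 0" by blast
  let ?S = "S - {s0}"
  let ?\<beta> = "%s t. \<alpha> s t - \<alpha> s t0 / \<alpha> s0 t0 * \<alpha> s0 t"
  have "card T < card ?S" using insert s0 by simp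
  with insert.IH[of ?S ?\<beta>] insert.prems obtain c where c: "EX s:?S. c s ~= 0"
   "!!t. t \<in> T ==> (SUM s:?S. c s * ?\<beta> s t) = 0" by auto
  let ?r = "SUM s:?S. c s * \<alpha> s t0"
  let ?c = "c(s0 := - ?r / \<alpha> s0 t0)"
  have sum: "(SUM s:S. ?c s * \<alpha> s t) = - ?r / \<alpha> s0 t0 * \<alpha> s0 t + (SUM s:?S. c s * \<alpha> s t)" for t
   using s0 insert.prems(1) by (subst sum.remove[of S s0]) (auto intro!: sum.cong)
  have "(SUM s:S. ?c s * \<alpha> s t) = 0" if "t \<in> insert t0 T" for t
  proof (cases "t = t0")
   case True thus ?thesis unfolding sum using s0 by simp
  next
   case False
   hence "t \<in> T" using that by simp
   have "(SUM s:?S. c s * ?\<beta> s t) = (SUM s:?S. c s * \<alpha> s t) - ?r / \<alpha> s0 t0 * \<alpha> s0 t"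
    by (simp add: algebra_simps sum_subtractf sum_distrib_left sum_distrib_right sum_divide_distrib)
   thus ?thesis unfolding sum using c(2)[OF \<open>t \<in> T\<close>] by simp
  qed
  moreover have "EX s:S. ?c s ~= 0" using c(1) by auto
  ultimately show ?thesis by blast
 qed
qed

section \<open>Polynomial functions\<close>

lemmas pf = poly_fun.const poly_fun.entry poly_fun.add poly_fun.mult

lemma pf_sum: "(!!i. i \<in> I ==> f i \<in> poly_fun n) ==> (%A. SUM i:I. f i A) \<in> poly_fun n"
 by (induction I rule: infinite_finite_induct) (auto intro: pf)

lemma pf_prod: "(!!i. i \<in> I ==> f i \<in> poly_fun n) ==> (%A. PROD i:I. f i A) \<in> poly_fun n"
 by (induction I rule: infinite_finite_induct) (auto intro: pf)

lemma pf_power: "f \<in> poly_fun n ==> (%A. f A ^ k) \<in> poly_fun n"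
 by (induction k) (auto intro: pf)

lemma pf_det:
 assumes "!!i j. i < k ==> j < k ==> (%A. M A i j) \<in> poly_fun n"
 shows "(%A. det (mat k k (%(i, j). M A i j))) \<in> poly_fun n"
proof -
 have "det (mat k k (%(i, j). M A i j)) = (SUM p | p permutes {0..<k}. signof p * (PROD i = 0..<k. M A i (p i)))" for A
  by (subst det_def'[of _ k]) (auto intro!: sum.cong prod.cong simp: permutes_in_image)
 thus ?thesis
  by (simp only:) (intro pf_sum poly_fun.mult poly_fun.const pf_prod assms; auto simp: permutes_in_image)
qed

lemma pf_subst:
 assumes "F \<in> poly_fun n" "!!i j. i < n ==> j < n ==> (%A. \<Phi> A $$ (i, j)) \<in> poly_fun m"
 shows "(%A. F (\<Phi> A)) \<in> poly_fun m"
 using assms by (induction F) (auto intro: pf)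

subsection \<open>Hilbert basis theorem for algebras of functions\<close>

definition subalg :: "('a => complex) set => bool" where
 "subalg R \<equiv> (ALL c. (%_. c) \<in> R) & (ALL f:R. ALL g:R. (%x. f x + g x) \<in> R) & (ALL f:R. ALL g:R. (%x. f x * g x) \<in> R)"

definition fideal :: "('a => complex) set => ('a => complex) set => bool" where
 "fideal R J \<equiv> J \<subseteq> R & (%_. 0) \<in> J & (ALL f:J. ALL g:J. (%x. f x + g x) \<in> J) & (ALL r:R. ALL f:J. (%x. r x * f x) \<in> J)"

definition fnoeth :: "('a => complex) set => bool" where
 "fnoeth R \<equiv> (ALL J. fideal R J --> (EX S. finite S & S \<subseteq> J & (ALL L. fideal R L --> S \<subseteq> L --> J \<subseteq> L)))"

lemma subalgD: "subalg R ==> (%_. c) \<in> R" "subalg R ==> f \<in> R ==> g \<in> R ==> (%x. f x + g x) \<in> R"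
 "subalg R ==> f \<in> R ==> g \<in> R ==> (%x. f x * g x) \<in> R"
 by (auto simp: subalg_def)

lemma fidealD: "fideal R J ==> f \<in> J ==> f \<in> R" "fideal R J ==> (%_. 0) \<in> J"
 "fideal R J ==> f \<in> J ==> g \<in> J ==> (%x. f x + g x) \<in> J" "fideal R J ==> r \<in> R ==> f \<in> J ==> (%x. r x * f x) \<in> J"
 by (auto simp: fideal_def)

lemma fidealI: "J \<subseteq> R ==> (%_. 0) \<in> J ==> (!!f g. f \<in> J ==> g \<in> J ==> (%x. f x + g x) \<in> J)
  ==> (!!r f. r \<in> R ==> f \<in> J ==> (%x. r x * f x) \<in> J) ==> fideal R J"
 by (auto simp: fideal_def)

lemma fideal_uminus: "subalg R ==> fideal R J ==> f \<in> J ==> (%x. - f x) \<in> J"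
 using fidealD(4)[of R J "%_. -1" f] subalgD(1)[of R "-1"] by simp

lemma fideal_diff: "subalg R ==> fideal R J ==> f \<in> J ==> g \<in> J ==> (%x. f x - g x) \<in> J"
 using fidealD(3)[of R J f "%x. - g x"] fideal_uminus[of R J g] by simp

text \<open>Polynomials of degree at most \<open>k\<close> in \<open>t\<close> with coefficients in \<open>R\<close>, where \<open>a\<close> is the coefficient
 of \<open>t\<^sup>k\<close>. As functions they do not determine their coefficients, so \<open>a\<close> is an argument of the relation.\<close>
definition prep :: "('a => complex) set => ('a => complex) => nat => ('a => complex) => ('a => complex) => bool" where
 "prep R t k a f \<equiv> (EX b. (ALL i. b i \<in> R) & b k = a & f = (%x. SUM i<=k. b i x * t x ^ i))"

definition adjoin :: "('a => complex) set => ('a => complex) => ('a => complex) set" where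
 "adjoin R t = {f. EX k a. prep R t k a f}"

lemma prep_add: "subalg R ==> prep R t k a f ==> prep R t k b g ==> prep R t k (%x. a x + b x) (%x. f x + g x)"
proof -
 assume R: "subalg R" and "prep R t k a f" "prep R t k b g"
 then obtain u v where "ALL i. u i \<in> R" "u k = a" "f = (%x. SUM i<=k. u i x * t x ^ i)"
  "ALL i. v i \<in> R" "v k = b" "g = (%x. SUM i<=k. v i x * t x ^ i)" unfolding prep_def by blast
 thus ?thesis unfolding prep_def using subalgD(2)[OF R]
  by (intro exI[of _ "%i x. u i x + v i x"]) (auto simp: sum.distrib algebra_simps)
qed

lemma prep_scale: "subalg R ==> r \<in> R ==> prep R t k a f ==> prep R t k (%x. r x * a x) (%x. r x * f x)"
proof -
 assume R: "subalg R" "r \<in> R" and "prep R t k a f"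
 then obtain u where "ALL i. u i \<in> R" "u k = a" "f = (%x. SUM i<=k. u i x * t x ^ i)" unfolding prep_def by blast
 thus ?thesis unfolding prep_def using subalgD(3)[OF R(1) R(2)]
  by (intro exI[of _ "%i x. r x * u i x"]) (auto simp: sum_distrib_left mult.assoc)
qed

lemma prep_t: "subalg R ==> prep R t k a f ==> prep R t (Suc k) a (%x. t x * f x)"
proof -
 assume R: "subalg R" and "prep R t k a f"
 then obtain u where u: "ALL i. u i \<in> R" "u k = a" "f = (%x. SUM i<=k. u i x * t x ^ i)" unfolding prep_def by blast
 thus ?thesis unfolding prep_def using subalgD(1)[OF R, of 0]
  by (intro exI[of _ "%i. case i of 0 => (%_. 0) | Suc j => u j"])
   (auto simp: sum.atMost_Suc_shift sum_distrib_left algebra_simps simp del: sum.atMost_Suc split: nat.split)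
qed

lemma prep_t_pow: "subalg R ==> prep R t k a f ==> prep R t (j + k) a (%x. t x ^ j * f x)"
proof (induction j)
 case (Suc j)
 from prep_t[OF Suc.prems(1) Suc.IH[OF Suc.prems]] show ?case by (simp add: mult.assoc)
qed simp

lemma prep_mono: "subalg R ==> prep R t k a f ==> k < l ==> prep R t l (%_. 0) f"
proof -
 assume R: "subalg R" and "prep R t k a f" and kl: "k < l"
 then obtain u where u: "ALL i. u i \<in> R" "u k = a" "f = (%x. SUM i<=k. u i x * t x ^ i)" unfolding prep_def by blast
 have "(SUM i<=k. u i x * t x ^ i) = (SUM i<=l. (if i <= k then u i else (%_. 0)) x * t x ^ i)" for x
  using kl by (intro sum.mono_neutral_cong_left) auto
 thus ?thesis unfolding prep_def using u subalgD(1)[OF R, of 0] kl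
  by (intro exI[of _ "%i. if i <= k then u i else (%_. 0)"]) auto
qed

lemma prep_const: "subalg R ==> a \<in> R ==> prep R t 0 a a"
 unfolding prep_def by (intro exI[of _ "%_. a"]) auto

lemma prep_lower:
 assumes "prep R t (Suc k) (%_. 0) f" shows "EX a. prep R t k a f"
 using assms unfolding prep_def by fastforce

lemma prep_same: assumes "subalg R" "prep R t k a f" "prep R t l b g"
 obtains m a' b' where "prep R t m a' f" "prep R t m b' g"
 using prep_mono[OF assms(1,2), of "Suc (k + l)"] prep_mono[OF assms(1,3), of "Suc (k + l)"] by auto

lemma adjoin_add: "subalg R ==> f \<in> adjoin R t ==> g \<in> adjoin R t ==> (%x. f x + g x) \<in> adjoin R t"
proof -
 assume R: "subalg R" and "f \<in> adjoin R t" "g \<in> adjoin R t"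
 then obtain k a l b where "prep R t k a f" "prep R t l b g" unfolding adjoin_def by blast
 then obtain m a' b' where "prep R t m a' f" "prep R t m b' g" by (rule prep_same[OF R])
 from prep_add[OF R this] show ?thesis unfolding adjoin_def by blast
qed

lemma adjoin_subalg:
 assumes R: "subalg R" shows "subalg (adjoin R t)" "R \<subseteq> adjoin R t" "t \<in> adjoin R t"
proof -
 show sub: "R \<subseteq> adjoin R t" using prep_const[OF R] by (auto simp: adjoin_def)
 have "prep R t (Suc 0) (%_. 1) (%x. t x * 1)" by (rule prep_t[OF R prep_const[OF R subalgD(1)[OF R]]])
 thus "t \<in> adjoin R t" by (auto simp: adjoin_def)
 have mono: "(%x. r x * t x ^ j * f x) \<in> adjoin R t" if h: "f \<in> adjoin R t" "r \<in> R" for f r j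
 proof -
  obtain k a where "prep R t k a f" using h(1) unfolding adjoin_def by blast
  from prep_scale[OF R h(2) prep_t_pow[OF R this]] show ?thesis by (auto simp: adjoin_def mult.assoc)
 qed
 have "(%x. g x * f x) \<in> adjoin R t" if f: "f \<in> adjoin R t" and g: "g \<in> adjoin R t" for f g
 proof -
  obtain k u where u: "ALL i. u i \<in> R" and g: "g = (%x. SUM i<=k. u i x * t x ^ i)" using g by (auto simp: adjoin_def prep_def)
  have "(%x. (SUM i<=k. u i x * t x ^ i) * f x) \<in> adjoin R t"
  proof (induction k)
   case 0 thus ?case using mono[OF f, of "u 0" 0] u by simp
  next
   case (Suc k)
   from adjoin_add[OF R this mono[OF f, of "u (Suc k)" "Suc k"]] u show ?case by (simp add: distrib_right)
  qed
  thus ?thesis using g by simp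
 qed
 thus "subalg (adjoin R t)" unfolding subalg_def using sub subalgD(1)[OF R] adjoin_add[OF R] by blast
qed

text \<open>The classical proof: finitely many elements realize generators of the ideals of leading coefficients in
 each degree up to the stable one, and subtracting multiples of them lowers the degree.\<close>
theorem hilbert_basis:
 assumes R: "subalg R" and N: "fnoeth R"
 shows "fnoeth (adjoin R t)"
 unfolding fnoeth_def
proof (intro allI impI)
 fix J assume J: "fideal (adjoin R t) J"
 note A = adjoin_subalg[OF R, of t]
 define L where "L M k = {a. EX f:M. prep R t k a f}" for M k
 have L_ideal: "fideal R (L M k)" if M: "fideal (adjoin R t) M" for M k
 proof (rule fidealI)
  show "L M k \<subseteq> R" by (auto simp: L_def prep_def)
  have "prep R t k (%_. 0) (%_. 0)" unfolding prep_def using subalgD(1)[OF R, of 0] by (intro exI[of _ "%_ _. 0"]) auto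
  thus "(%_. 0) \<in> L M k" using fidealD(2)[OF M] by (auto simp: L_def)
  show "(%x. f x + g x) \<in> L M k" if "f \<in> L M k" "g \<in> L M k" for f g
   using that prep_add[OF R] fidealD(3)[OF M] unfolding L_def by blast
  show "(%x. r x * f x) \<in> L M k" if "r \<in> R" "f \<in> L M k" for r f
   using that prep_scale[OF R] fidealD(4)[OF M] A(2) unfolding L_def by blast
 qed
 have L_Suc: "L J k \<subseteq> L J (Suc k)" for k
  unfolding L_def using prep_t[OF R] fidealD(4)[OF J A(3)] by blast
 have L_mono: "L J k \<subseteq> L J l" if "k <= l" for k l using that by (induction rule: dec_induct) (use L_Suc in blast)+
 let ?L = "UN k. L J k"
 have "fideal R ?L"
 proof (rule fidealI)
  show "?L \<subseteq> R" using fidealD(1)[OF L_ideal[OF J]] by blast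
  show "(%_. 0) \<in> ?L" using fidealD(2)[OF L_ideal[OF J]] by blast
  show "(%x. f x + g x) \<in> ?L" if h: "f \<in> ?L" "g \<in> ?L" for f g
  proof -
   obtain k l where "f \<in> L J k" "g \<in> L J l" using h by blast
   hence "f \<in> L J (max k l)" "g \<in> L J (max k l)" using L_mono[of k "max k l"] L_mono[of l "max k l"] by auto
   thus ?thesis using fidealD(3)[OF L_ideal[OF J]] by blast
  qed
  show "(%x. r x * f x) \<in> ?L" if "r \<in> R" "f \<in> ?L" for r f using that fidealD(4)[OF L_ideal[OF J]] by blast
 qed
 then obtain S where S: "finite S" "S \<subseteq> ?L" "!!M. fideal R M ==> S \<subseteq> M ==> ?L \<subseteq> M"
  using N unfolding fnoeth_def by meson
 have "EX k0. S \<subseteq> L J k0" using S(1,2)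
 proof (induction S rule: finite_induct)
  case (insert s S)
  then obtain k l where "S \<subseteq> L J k" "s \<in> L J l" by blast
  hence "insert s S \<subseteq> L J (max k l)" using L_mono[of k "max k l"] L_mono[of l "max k l"] by auto
  thus ?case by blast
 qed simp
 then obtain k0 where k0: "S \<subseteq> L J k0" by blast
 have stab: "L J k \<subseteq> L J k0" for k using S(3)[OF L_ideal[OF J] k0] by blast
 have "EX T. finite T & T \<subseteq> L J k & (ALL M. fideal R M --> T \<subseteq> M --> L J k \<subseteq> M)" for k
  using N L_ideal[OF J] unfolding fnoeth_def by blast
 then obtain T where T: "!!k. finite (T k)" "!!k. T k \<subseteq> L J k" "!!k M. fideal R M ==> T k \<subseteq> M ==> L J k \<subseteq> M" by metis
 have "ALL k. ALL a:T k. EX f:J. prep R t k a f" using T(2) unfolding L_def by blast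
 then obtain F where F: "!!k a. a \<in> T k ==> F k a \<in> J & prep R t k a (F k a)" by metis
 define G where "G = (UN k<=k0. F k ` T k)"
 have "finite G" "G \<subseteq> J" unfolding G_def using T(1) F by auto
 moreover have "J \<subseteq> M" if M: "fideal (adjoin R t) M" and GM: "G \<subseteq> M" for M
 proof -
  have MJ: "fideal (adjoin R t) (M \<inter> J)" using M J unfolding fideal_def by blast
  have key: "f \<in> M" if "f \<in> J" "prep R t k a f" for f k a
   using that
  proof (induction k arbitrary: f a rule: less_induct)
   case (less k)
   define k' where "k' = min k k0"
   have "a \<in> L J k" using less.prems by (auto simp: L_def)
   hence "a \<in> L J k'" using stab[of k] by (auto simp: k'_def min_def)
   moreover have "T k' \<subseteq> L (M \<inter> J) k'"
   proof
    fix b assume b: "b \<in> T k'"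
    have "F k' b \<in> G" unfolding G_def using b by (auto simp: k'_def)
    hence "F k' b \<in> M \<inter> J" using GM F[OF b] by blast
    thus "b \<in> L (M \<inter> J) k'" using F[OF b] by (auto simp: L_def)
   qed
   ultimately have "a \<in> L (M \<inter> J) k'" using T(3)[OF L_ideal[OF MJ]] by blast
   then obtain g where g: "g \<in> M" "g \<in> J" "prep R t k' a g" by (auto simp: L_def)
   have tp: "(%x. t x ^ j) \<in> adjoin R t" for j
    using subalgD(1,3)[OF A(1)] A(3) by (induction j) auto
   let ?h = "%x. t x ^ (k - k') * g x"
   have h: "?h \<in> M" "?h \<in> J" using fidealD(4)[OF M tp g(1)] fidealD(4)[OF J tp g(2)] by auto
   have hp: "prep R t k a ?h" using prep_t_pow[OF R g(3), of "k - k'"] by (simp add: k'_def)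
   have "prep R t k (%x. - 1 * a x) (%x. - 1 * ?h x)" by (rule prep_scale[OF R subalgD(1)[OF R] hp])
   from prep_add[OF R less.prems(2) this] have dp: "prep R t k (%_. 0) (%x. f x - ?h x)" by simp
   have dJ: "(%x. f x - ?h x) \<in> J" by (rule fideal_diff[OF A(1) J less.prems(1) h(2)])
   have "(%x. f x - ?h x) \<in> M"
   proof (cases k)
    case 0
    hence "(%x. f x - ?h x) = (%_. 0)" using dp by (auto simp: prep_def)
    thus ?thesis using fidealD(2)[OF M] by simp
   next
    case (Suc l)
    then obtain b where "prep R t l b (%x. f x - ?h x)" using prep_lower dp by blast
    thus ?thesis using less.IH[OF _ dJ] Suc by blast
   qed
   from fidealD(3)[OF M this h(1)] show ?case by simp
  qed
  show ?thesis
  proof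
   fix f assume f: "f \<in> J"
   then obtain k a where "prep R t k a f" using fidealD(1)[OF J f] by (auto simp: adjoin_def)
   thus "f \<in> M" using key f by blast
  qed
 qed
 ultimately show "EX S. finite S & S \<subseteq> J & (ALL L. fideal (adjoin R t) L --> S \<subseteq> L --> J \<subseteq> L)" by blast
qed

lemma fnoeth_consts: "fnoeth {f :: 'a => complex. EX c. f = (%_. c)}"
 unfolding fnoeth_def
proof (intro allI impI)
 fix J :: "('a => complex) set" assume J: "fideal {f. EX c. f = (%_. c)} J"
 show "EX S. finite S & S \<subseteq> J & (ALL L. fideal {f. EX c. f = (%_. c)} L --> S \<subseteq> L --> J \<subseteq> L)"
 proof (cases "J = {%_. 0}")
  case True thus ?thesis by (intro exI[of _ "{}"]) (auto simp: fideal_def)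
 next
  case False
  then obtain f where "f \<in> J" "f ~= (%_. 0)" using fidealD(2)[OF J] by blast
  then obtain c where c: "(%_. c) \<in> J" "c ~= 0" using fidealD(1)[OF J] by blast
  have "J \<subseteq> L" if L: "fideal {f. EX c. f = (%_. c)} L" "(%_. c) \<in> L" for L
  proof
   fix g assume "g \<in> J"
   then obtain d where g: "g = (%_. d)" using fidealD(1)[OF J] by blast
   have "(%x. (%_. d / c) x * (%_. c) x) \<in> L" by (rule fidealD(4)[OF L(1) _ L(2)]) blast
   thus "g \<in> L" using g c by simp
  qed
  thus ?thesis using c by (intro exI[of _ "{%_. c}"]) auto
 qed
qed

fun genalg :: "('a => complex) list => ('a => complex) set" where
 "genalg [] = {f. EX c. f = (%_. c)}"
| "genalg (t # ts) = adjoin (genalg ts) t"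

lemma genalg: "subalg (genalg ts)" "fnoeth (genalg ts)" "set ts \<subseteq> genalg ts"
proof (induction ts)
 case Nil
 show "subalg (genalg [])" by (auto simp: subalg_def)
 show "fnoeth (genalg [])" using fnoeth_consts by simp
next
 case (Cons t ts)
 show "subalg (genalg (t # ts))" "fnoeth (genalg (t # ts))" using adjoin_subalg(1) hilbert_basis Cons by auto
 show "set (t # ts) \<subseteq> genalg (t # ts)" using adjoin_subalg(2,3)[OF Cons(1)] Cons(3) by auto
qed simp

theorem fnoeth_poly_fun: "fnoeth (poly_fun n)"
proof -
 define ts where "ts = map (%(i, j) A. A $$ (i, j) :: complex) (List.product [0..<n] [0..<n])"
 have "f \<in> genalg ts" if "f \<in> poly_fun n" for f
  using that
 proof induction
  case (entry i j)
  hence "(%A. A $$ (i, j)) \<in> set ts" unfolding ts_def by (auto intro!: image_eqI[of _ _ "(i, j)"])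
  thus ?case using genalg(3) by blast
 qed (use subalgD[OF genalg(1)] in blast)+
 moreover have "f \<in> poly_fun n" if "f \<in> genalg us" "set us \<subseteq> poly_fun n" for f us
  using that
 proof (induction us arbitrary: f)
  case Nil thus ?case by (auto intro: pf)
 next
  case (Cons t us)
  then obtain k u where "ALL i. u i \<in> genalg us" "f = (%x. SUM i<=k. u i x * t x ^ i)" by (auto simp: adjoin_def prep_def)
  thus ?case using Cons by (auto intro!: pf_sum poly_fun.mult pf_power)
 qed
 moreover have "set ts \<subseteq> poly_fun n" unfolding ts_def by (auto intro: pf)
 ultimately have "poly_fun n = genalg ts" by blast
 thus ?thesis using genalg(2) by simp
qed

subsection \<open>Bounded degree\<close>

definition expos :: "'v set => nat => ('v => nat) set" where
 "expos V K = PiE V (%_. {..K})"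

definition monom_at :: "(nat \<times> nat) set => (nat \<times> nat => nat) => complex mat => complex" where
 "monom_at V m z = (PROD v:V. z $$ v ^ m v)"

text \<open>On \<open>Z\<close>, the function is a polynomial in the entries at \<open>V\<close> of degree at most \<open>K\<close> in each of them.\<close>
definition bdeg :: "(nat \<times> nat) set => complex mat set => nat => (complex mat => complex) => bool" where
 "bdeg V Z K F \<equiv> (EX \<alpha>. ALL z:Z. F z = (SUM m:expos V K. \<alpha> m * monom_at V m z))"

lemma finite_expos: "finite V ==> finite (expos V K)"
 unfolding expos_def by (intro finite_PiE) auto

lemma card_expos: "finite V ==> card (expos V K) = Suc K ^ card V"
 unfolding expos_def by (simp add: card_PiE)

lemma bdeg_mono:
 assumes V: "finite V" and "K <= K'" "bdeg V Z K F" shows "bdeg V Z K' F"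
proof -
 obtain \<alpha> where a: "ALL z:Z. F z = (SUM m:expos V K. \<alpha> m * monom_at V m z)" using assms by (auto simp: bdeg_def)
 have sub: "expos V K \<subseteq> expos V K'" unfolding expos_def using assms by (intro PiE_mono) auto
 have "(SUM m:expos V K. \<alpha> m * monom_at V m z) = (SUM m:expos V K'. (if m \<in> expos V K then \<alpha> m else 0) * monom_at V m z)" for z
  using sub finite_expos[OF V] by (intro sum.mono_neutral_cong_left) auto
 thus ?thesis using a unfolding bdeg_def by (intro exI[of _ "%m. if m \<in> expos V K then \<alpha> m else 0"]) simp
qed

lemma bdeg_add: "bdeg V Z K F ==> bdeg V Z K G ==> bdeg V Z K (%z. F z + G z)"
proof -
 assume "bdeg V Z K F" "bdeg V Z K G"
 then obtain \<alpha> \<beta> where "ALL z:Z. F z = (SUM m:expos V K. \<alpha> m * monom_at V m z)" "ALL z:Z. G z = (SUM m:expos V K. \<beta> m * monom_at V m z)"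
  by (auto simp: bdeg_def)
 thus ?thesis unfolding bdeg_def by (intro exI[of _ "%m. \<alpha> m + \<beta> m"]) (auto simp: sum.distrib algebra_simps)
qed

lemma bdeg_mult:
 assumes V: "finite V" and F: "bdeg V Z K F" and G: "bdeg V Z K' G"
 shows "bdeg V Z (K + K') (%z. F z * G z)"
proof -
 obtain \<alpha> where a: "!!z. z \<in> Z ==> F z = (SUM m:expos V K. \<alpha> m * monom_at V m z)"
  using F unfolding bdeg_def by blast
 obtain \<beta> where b: "!!z. z \<in> Z ==> G z = (SUM m:expos V K'. \<beta> m * monom_at V m z)"
  using G unfolding bdeg_def by blast
 define pl where "pl = (%(m :: nat \<times> nat => nat, m'). restrict (%v. m v + m' v) V)"
 let ?S = "expos V K \<times> expos V K'"
 have im: "pl ` ?S \<subseteq> expos V (K + K')" unfolding pl_def expos_def by (fastforce simp: PiE_iff intro: add_mono)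
 have mon: "monom_at V (pl (m, m')) z = monom_at V m z * monom_at V m' z" for m m' z
  unfolding monom_at_def pl_def by (simp add: power_add prod.distrib)
 define \<gamma> where "\<gamma> k = (SUM x:{x \<in> ?S. pl x = k}. \<alpha> (fst x) * \<beta> (snd x))" for k
 have "F z * G z = (SUM k:expos V (K + K'). \<gamma> k * monom_at V k z)" if "z \<in> Z" for z
 proof -
  have "F z * G z = (SUM (m, m'):?S. (\<alpha> m * monom_at V m z) * (\<beta> m' * monom_at V m' z))"
   unfolding a[OF that] b[OF that] sum_product sum.cartesian_product ..
  also have "\<dots> = (SUM x:?S. \<alpha> (fst x) * \<beta> (snd x) * monom_at V (pl x) z)"
   by (intro sum.cong) (auto simp: mon)
  also have "\<dots> = (SUM k:expos V (K + K'). SUM x:{x \<in> ?S. pl x = k}. \<alpha> (fst x) * \<beta> (snd x) * monom_at V (pl x) z)"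
   by (rule sum.group[symmetric]) (use im finite_expos[OF V] in auto)
  also have "\<dots> = (SUM k:expos V (K + K'). \<gamma> k * monom_at V k z)"
   unfolding \<gamma>_def sum_distrib_right by (intro sum.cong) auto
  finally show ?thesis .
 qed
 thus ?thesis unfolding bdeg_def by blast
qed

lemma bdeg_const: assumes V: "finite V" shows "bdeg V Z 0 (%_. c)"
proof -
 have "expos V 0 = {restrict (%_. 0) V}" unfolding expos_def by (auto simp: PiE_iff extensional_def fun_eq_iff)
 thus ?thesis unfolding bdeg_def by (intro exI[of _ "%_. c"]) (simp add: monom_at_def)
qed

lemma bdeg_var: assumes V: "finite V" and v: "v \<in> V" shows "bdeg V Z 1 (%z. z $$ v)"
proof -
 let ?m = "restrict (%u. if u = v then 1 else 0 :: nat) V"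
 have m: "?m \<in> expos V 1" unfolding expos_def by auto
 have "monom_at V ?m z = z $$ v" for z
 proof -
  have "monom_at V ?m z = (PROD u:V. if u = v then z $$ u else 1)" unfolding monom_at_def by (intro prod.cong) auto
  thus ?thesis using V v by (simp add: prod.delta)
 qed
 hence "z $$ v = (SUM k:expos V 1. of_bool (k = ?m) * monom_at V k z)" for z
  using m finite_expos[OF V, of 1] by (simp add: of_bool_def if_distrib[of "%c. c * _"] sum.delta cong: if_cong)
 thus ?thesis unfolding bdeg_def by (intro exI[of _ "%k. of_bool (k = ?m)"]) blast
qed

lemma bdeg_power: "finite V ==> bdeg V Z K F ==> bdeg V Z (e * K) (%z. F z ^ e)"
proof (induction e)
 case 0 thus ?case using bdeg_const[of V Z 1] by simp
next
 case (Suc e) thus ?case using bdeg_mult[of V Z K F "e * K"] by simp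
qed

lemma bdeg_poly:
 assumes V: "finite V" and F: "F \<in> poly_fun n"
  and Z: "!!i j. i < n ==> j < n ==> (i, j) \<notin> V ==> EX c. ALL z:Z. z $$ (i, j) = c"
 shows "EX K. bdeg V Z K F"
 using F
proof induction
 case (const c) thus ?case using bdeg_const[OF V] by blast
next
 case (entry i j)
 show ?case
 proof (cases "(i, j) \<in> V")
  case True thus ?thesis using bdeg_var[OF V] by blast
 next
  case False
  then obtain c where c: "ALL z:Z. z $$ (i, j) = c" using Z entry by blast
  have "bdeg V Z 0 (%z. z $$ (i, j))" using bdeg_const[OF V, of Z c] c unfolding bdeg_def by simp
  thus ?thesis by blast
 qed
next
 case (add f g)
 then obtain K K' where "bdeg V Z K f" "bdeg V Z K' g" by blast
 hence "bdeg V Z (max K K') f" "bdeg V Z (max K K') g"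
  using bdeg_mono[OF V max.cobounded1] bdeg_mono[OF V max.cobounded2] by blast+
 thus ?case using bdeg_add by blast
next
 case (mult f g)
 thus ?case using bdeg_mult[OF V] by blast
qed

section \<open>Germs of rational functions at the identity matrix\<close>

definition curve :: "nat => nat \<times> nat => complex => complex mat" where
 "curve n t c = mat n n (%(i, j). if i = j then 1 else if (i, j) = t then c else 0)"

abbreviation low :: "nat => (nat \<times> nat) set" where "low n \<equiv> {(i, j). i < n & j < i}"

lemma finite_low: "finite (low n)"
 by (rule finite_subset[of _ "{..<n} \<times> {..<n}"]) auto

lemma curve_0: "curve n t 0 = 1\<^sub>m n" unfolding curve_def by (intro eq_matI) auto

lemma poly_curve_deriv: "P \<in> poly_fun n ==> EX d. ((%c. P (curve n t c)) has_field_derivative d) (at c0)"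
proof (induction rule: poly_fun.induct)
 case (entry i j)
 thus ?case
  by (cases "i = j"; cases "(i, j) = t") (auto simp: curve_def intro!: exI derivative_eq_intros)
next
 case (add f g)
 thus ?case using DERIV_add by blast
next
 case (mult f g)
 thus ?case using DERIV_mult' by blast
qed (use DERIV_const in blast)

text \<open>Some equation of \<open>Y\<close> has the coordinate \<open>t\<close> as its linear part at the identity matrix.\<close>
definition has_equation :: "nat => complex mat set => nat \<times> nat => bool" where
 "has_equation n Y t \<equiv> (EX F:poly_fun n. (ALL u:Y. F u = 0) &
   (EX a. a ~= 0 & (ALL s:low n. ((%c. F (curve n s c)) has_field_derivative (if s = t then a else 0)) (at 0))))"

locale germs =
 fixes n :: nat and Y :: "complex mat set" and \<iota> :: "complex mat => 'b" and \<kappa> :: "'b => complex mat"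
 assumes one_in_Y: "1\<^sub>m n \<in> Y"
  and kappa_iota: "u \<in> Y ==> \<kappa> (\<iota> u) = u"
  and unipotent: "u \<in> Y ==> i < n ==> j < n ==> i <= j ==> u $$ (i, j) = (if i = j then 1 else 0)"
begin

abbreviation e1 :: "complex mat" where "e1 \<equiv> 1\<^sub>m n"

text \<open>A property holds nearly everywhere if it holds on a principal open neighbourhood of the identity matrix
 in \<open>Y\<close>. The germs are those of functions on an arbitrary set that contains a copy of \<open>Y\<close>.\<close>
definition nearly :: "(complex mat => bool) => bool" where
 "nearly p \<equiv> (EX E:poly_fun n. E e1 ~= 0 & (ALL u:Y. E u ~= 0 --> p u))"

definition A :: "('b => complex) set" where
 "A = {f. EX P:poly_fun n. EX Q:poly_fun n. Q e1 ~= 0 & nearly (%u. Q u ~= 0 & f (\<iota> u) = P u / Q u)}"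

definition I :: "('b => complex) set" where
 "I = {f. nearly (%u. f (\<iota> u) = 0)}"

definition m :: "('b => complex) set" where
 "m = {f \<in> A. f (\<iota> e1) = 0}"

definition pg :: "(complex mat => complex) => 'b => complex" where
 "pg P = (%x. P (\<kappa> x))"

lemma nearly_conj: assumes "nearly p" "nearly q" shows "nearly (%u. p u & q u)"
proof -
 obtain E where E: "E \<in> poly_fun n" "E e1 ~= 0" "ALL u:Y. E u ~= 0 --> p u" using assms(1) nearly_def by auto
 obtain E' where E': "E' \<in> poly_fun n" "E' e1 ~= 0" "ALL u:Y. E' u ~= 0 --> q u" using assms(2) nearly_def by auto
 show ?thesis unfolding nearly_def using E E' by (intro bexI[of _ "%u. E u * E' u"]) (auto intro: pf)
qed

lemma nearly_mono: "nearly p ==> (!!u. u \<in> Y ==> p u ==> q u) ==> nearly q"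
 unfolding nearly_def by blast

lemma nearly_nz: "Q \<in> poly_fun n ==> Q e1 ~= 0 ==> nearly (%u. Q u ~= 0)"
 unfolding nearly_def by blast

lemma nearly_all: "(!!u. u \<in> Y ==> q u) ==> nearly q"
 unfolding nearly_def by (intro bexI[of _ "%u. 1"]) (auto intro: pf)

lemma nearly_at_one: "nearly p ==> p e1"
 unfolding nearly_def using one_in_Y by blast

lemma AE: assumes "f \<in> A"
 obtains P Q where "P \<in> poly_fun n" "Q \<in> poly_fun n" "Q e1 ~= 0" "nearly (%u. Q u ~= 0 & f (\<iota> u) = P u / Q u)"
 using assms unfolding A_def by blast

lemma AI: "P \<in> poly_fun n ==> Q \<in> poly_fun n ==> Q e1 ~= 0 ==> nearly (%u. f (\<iota> u) = P u / Q u) ==> f \<in> A"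
 unfolding A_def using nearly_conj[OF nearly_nz] by blast

lemma I_sub_A: "f \<in> I ==> f \<in> A"
 by (rule AI[of "%_. 0" "%_. 1"]) (auto intro: pf simp: I_def)

lemma pg_A: "P \<in> poly_fun n ==> pg P \<in> A"
 by (rule AI[of P "%_. 1"]) (auto intro: pf nearly_all simp: pg_def kappa_iota)

lemma A_add: assumes "f \<in> A" "g \<in> A" shows "(%x. f x + g x) \<in> A"
proof -
 from assms(1) obtain P Q where f: "P \<in> poly_fun n" "Q \<in> poly_fun n" "Q e1 ~= 0" "nearly (%u. Q u ~= 0 & f (\<iota> u) = P u / Q u)" by (rule AE)
 from assms(2) obtain P' Q' where g: "P' \<in> poly_fun n" "Q' \<in> poly_fun n" "Q' e1 ~= 0" "nearly (%u. Q' u ~= 0 & g (\<iota> u) = P' u / Q' u)" by (rule AE)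
 show ?thesis
  by (rule AI[of "%u. P u * Q' u + P' u * Q u" "%u. Q u * Q' u"])
    (use f g in \<open>auto intro!: pf intro: nearly_mono[OF nearly_conj[OF f(4) g(4)]] simp: field_simps\<close>)
qed

lemma A_mult: assumes "f \<in> A" "g \<in> A" shows "(%x. f x * g x) \<in> A"
proof -
 from assms(1) obtain P Q where f: "P \<in> poly_fun n" "Q \<in> poly_fun n" "Q e1 ~= 0" "nearly (%u. Q u ~= 0 & f (\<iota> u) = P u / Q u)" by (rule AE)
 from assms(2) obtain P' Q' where g: "P' \<in> poly_fun n" "Q' \<in> poly_fun n" "Q' e1 ~= 0" "nearly (%u. Q' u ~= 0 & g (\<iota> u) = P' u / Q' u)" by (rule AE)
 show ?thesis
 proof (rule AI[of "%u. P u * P' u" "%u. Q u * Q' u"])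
  show "nearly (%u. f (\<iota> u) * g (\<iota> u) = P u * P' u / (Q u * Q' u))"
   by (rule nearly_mono[OF nearly_conj[OF f(4) g(4)]]) auto
 qed (use f g in \<open>auto intro!: pf\<close>)
qed

lemma subalg_A: "subalg A"
proof -
 have "(%_. c) \<in> A" for c by (rule AI[of "%_. c" "%_. 1"]) (auto intro: pf nearly_all)
 thus ?thesis unfolding subalg_def using A_add A_mult by blast
qed

lemma A_const: "(%_. c) \<in> A" by (rule subalgD[OF subalg_A])

lemma A_diff: "f \<in> A ==> g \<in> A ==> (%x. f x - g x) \<in> A"
 using A_add[OF _ A_mult[OF A_const[of "-1"]]] by fastforce

lemma fideal_I: "fideal A I"
proof (rule fidealI)
 show "I \<subseteq> A" using I_sub_A by blast
 show "(%_. 0) \<in> I" unfolding I_def by (auto intro: nearly_all)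
 show "(%x. f x + g x) \<in> I" if "f \<in> I" "g \<in> I" for f g
  using nearly_conj[of "%u. f (\<iota> u) = 0" "%u. g (\<iota> u) = 0"] that unfolding I_def by (auto elim: nearly_mono)
 show "(%x. r x * f x) \<in> I" if "r \<in> A" "f \<in> I" for r f
  using that unfolding I_def by (auto elim: nearly_mono)
qed

lemma fideal_m: "fideal A m"
 unfolding m_def using A_add A_mult A_const by (intro fidealI) auto

lemma I_sub_m: "I \<subseteq> m"
 unfolding m_def using I_sub_A nearly_at_one unfolding I_def by fastforce

lemma unit_mod_I:
 assumes "f \<in> A" "f (\<iota> e1) ~= 0"
 obtains g where "g \<in> A" "(%x. g x * f x - 1) \<in> I"
proof -
 from assms(1) obtain P Q where f: "P \<in> poly_fun n" "Q \<in> poly_fun n" "Q e1 ~= 0" "nearly (%u. Q u ~= 0 & f (\<iota> u) = P u / Q u)" by (rule AE)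
 have "P e1 ~= 0" using nearly_at_one[OF f(4)] assms(2) by auto
 note nP = nearly_nz[OF f(1) this]
 have "(%x. inverse (f x)) \<in> A"
  by (rule AI[of Q P]) (use f \<open>P e1 ~= 0\<close> in \<open>auto intro: nearly_mono[OF nearly_conj[OF f(4) nP]]\<close>)
 moreover have "(%x. inverse (f x) * f x - 1) \<in> I"
  unfolding I_def using nearly_conj[OF f(4) nP] by (auto elim!: nearly_mono)
 ultimately show ?thesis by (rule that)
qed

text \<open>A germ that does not vanish at the identity matrix is invertible modulo \<open>I\<close>.\<close>
lemma fideal_full:
 assumes J: "fideal A J" "I \<subseteq> J" and f: "f \<in> J" "f (\<iota> e1) ~= 0" shows "A \<subseteq> J"
proof
 fix h assume h: "h \<in> A"
 have fA: "f \<in> A" using fidealD(1)[OF J(1) f(1)] .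
 obtain g where g: "g \<in> A" "(%x. g x * f x - 1) \<in> I" using unit_mod_I[OF fA f(2)] by blast
 have "(%x. g x * f x) \<in> J" using fidealD(4)[OF J(1) g(1) f(1)] .
 from fideal_diff[OF subalg_A J(1) this] g(2) J(2) have "(%x. g x * f x - (g x * f x - 1)) \<in> J" by blast
 hence "(%x. 1) \<in> J" by simp
 from fidealD(4)[OF J(1) h this] show "h \<in> J" by simp
qed

lemma cancel_unit:
 assumes J: "fideal A J" "I \<subseteq> J" and q: "q \<in> A" "q (\<iota> e1) ~= 0" and f: "f \<in> A" "(%x. q x * f x) \<in> J" shows "f \<in> J"
proof -
 obtain g where g: "g \<in> A" "(%x. g x * q x - 1) \<in> I" using unit_mod_I[OF q] by blast
 have 1: "(%x. g x * (q x * f x)) \<in> J" using fidealD(4)[OF J(1) g(1) f(2)] .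
 have 2: "(%x. f x * (g x * q x - 1)) \<in> J" using fidealD(4)[OF J(1) f(1)] g(2) J(2) by blast
 have "(%x. g x * (q x * f x) - f x * (g x * q x - 1)) \<in> J" using fideal_diff[OF subalg_A J(1) 1 2] .
 moreover have "(%x. g x * (q x * f x) - f x * (g x * q x - 1)) = f" by (auto simp: algebra_simps)
 ultimately show ?thesis by simp
qed

text \<open>Up to a unit, every germ is a polynomial.\<close>
lemma numerator:
 assumes "f \<in> A"
 obtains P Q where "P \<in> poly_fun n" "Q \<in> poly_fun n" "Q e1 ~= 0" "(%x. pg Q x * f x - pg P x) \<in> I"
proof -
 from assms obtain P Q where f: "P \<in> poly_fun n" "Q \<in> poly_fun n" "Q e1 ~= 0" "nearly (%u. Q u ~= 0 & f (\<iota> u) = P u / Q u)" by (rule AE)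
 have "(%x. pg Q x * f x - pg P x) \<in> I"
  unfolding I_def pg_def using nearly_mono[OF f(4)] by (auto simp: kappa_iota)
 with f(1-3) show ?thesis by (rule that)
qed

lemma pg_at_one: "pg P (\<iota> e1) = P e1" unfolding pg_def using kappa_iota[OF one_in_Y] by simp

lemma mem_fideal_poly:
 assumes J: "fideal A J" "I \<subseteq> J" and f: "f \<in> A" "(%x. pg Q x * f x - pg P x) \<in> I" and Q: "Q \<in> poly_fun n" "Q e1 ~= 0" and P: "P \<in> poly_fun n"
 shows "f \<in> J <-> pg P \<in> J"
proof
 assume "f \<in> J"
 hence 1: "(%x. pg Q x * f x) \<in> J" using fidealD(4)[OF J(1) pg_A[OF Q(1)]] by blast
 have "(%x. pg Q x * f x - (pg Q x * f x - pg P x)) \<in> J" using fideal_diff[OF subalg_A J(1) 1] f(2) J(2) by blast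
 thus "pg P \<in> J" by simp
next
 assume 1: "pg P \<in> J"
 have "(%x. (pg Q x * f x - pg P x) + pg P x) \<in> J" using fidealD(3)[OF J(1) _ 1] f(2) J(2) by blast
 hence "(%x. pg Q x * f x) \<in> J" by simp
 thus "f \<in> J" using cancel_unit[OF J pg_A[OF Q(1)] _ f(1)] Q(2) pg_at_one by metis
qed

text \<open>Localization preserves the Noetherian property.\<close>
lemma noetherian_mod_I:
 assumes J: "fideal A J" "I \<subseteq> J"
 shows "EX S. finite S & S \<subseteq> J & (ALL L. fideal A L --> I \<subseteq> L --> S \<subseteq> L --> J \<subseteq> L)"
proof -
 let ?c = "%L. {P \<in> poly_fun n. pg P \<in> L}"
 have c: "fideal (poly_fun n) (?c L)" if L: "fideal A L" for L
 proof (rule fidealI)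
  show "(%_. 0) \<in> ?c L" using fidealD(2)[OF L] by (auto intro: pf simp: pg_def)
  show "(%x. f x + g x) \<in> ?c L" if "f \<in> ?c L" "g \<in> ?c L" for f g
   using fidealD(3)[OF L] that by (fastforce intro: pf simp: pg_def)
  show "(%x. f x * g x) \<in> ?c L" if "f \<in> poly_fun n" "g \<in> ?c L" for f g
   using fidealD(4)[OF L pg_A[OF that(1)]] that by (fastforce intro: pf simp: pg_def)
 qed auto
 from fnoeth_poly_fun[unfolded fnoeth_def, rule_format, OF c[OF J(1)]]
 obtain S where "finite S & S \<subseteq> ?c J & (ALL L. fideal (poly_fun n) L --> S \<subseteq> L --> ?c J \<subseteq> L)" ..
 hence S: "finite S" "S \<subseteq> ?c J" "!!L. fideal (poly_fun n) L ==> S \<subseteq> L ==> ?c J \<subseteq> L"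
  by (simp_all only: )
 have "J \<subseteq> L" if L: "fideal A L" "I \<subseteq> L" "pg ` S \<subseteq> L" for L
 proof
  fix f assume f: "f \<in> J"
  hence fA: "f \<in> A" using fidealD(1)[OF J(1)] by blast
  from fA obtain P Q where P: "P \<in> poly_fun n" "Q \<in> poly_fun n" "Q e1 ~= 0" "(%x. pg Q x * f x - pg P x) \<in> I" by (rule numerator)
  have "pg P \<in> J" using mem_fideal_poly[OF J fA P(4) P(2,3,1)] f by simp
  hence "P \<in> ?c J" using P(1) by simp
  moreover have "S \<subseteq> ?c L" using L(3) S(2) by auto
  ultimately have "P \<in> ?c L" using S(3)[OF c[OF L(1)]] by blast
  thus "f \<in> L" using mem_fideal_poly[OF L(1,2) fA P(4) P(2,3,1)] by simp
 qed
 thus ?thesis using S(1,2) by (intro exI[of _ "pg ` S"]) auto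
qed

section \<open>Generators of the maximal ideal\<close>

definition generates_m :: "('b => complex) set => bool" where
 "generates_m S \<equiv> S \<subseteq> m & (ALL L. fideal A L --> I \<subseteq> L --> S \<subseteq> L --> m \<subseteq> L)"

definition xc :: "nat \<times> nat => 'b => complex" where
 "xc t = pg (%u. u $$ t)"

lemma nearly_curve:
 assumes p: "nearly p" and Y: "!!c. curve n t c \<in> Y"
 shows "\<forall>\<^sub>F c in nhds 0. p (curve n t c)"
proof -
 obtain E where E: "E \<in> poly_fun n" "E e1 ~= 0" "ALL u:Y. E u ~= 0 --> p u" using p nearly_def by auto
 obtain d where "((%c. E (curve n t c)) has_field_derivative d) (at 0)" using poly_curve_deriv[OF E(1)] by blast
 hence "isCont (%c. E (curve n t c)) 0" by (rule DERIV_isCont)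
 hence "((%c. E (curve n t c)) \<longlongrightarrow> E e1) (at 0)"
  using curve_0[of n t] by (simp add: isCont_def)
 from tendsto_imp_eventually_ne[OF this E(2)]
 have "\<forall>\<^sub>F c in nhds 0. E (curve n t c) ~= 0" using E(2) curve_0[of n t] by (simp add: eventually_nhds_conv_at)
 thus ?thesis by eventually_elim (use E(3) Y in blast)
qed

lemma germ_curve_deriv:
 assumes f: "f \<in> A" and Y: "!!c. curve n t c \<in> Y"
 shows "EX d. ((%c. f (\<iota> (curve n t c))) has_field_derivative d) (at 0)"
proof -
 from f obtain P Q where f: "P \<in> poly_fun n" "Q \<in> poly_fun n" "Q e1 ~= 0" "nearly (%u. Q u ~= 0 & f (\<iota> u) = P u / Q u)" by (rule AE)
 obtain p where p: "((%c. P (curve n t c)) has_field_derivative p) (at 0)" using poly_curve_deriv[OF f(1)] by blast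
 obtain q where q: "((%c. Q (curve n t c)) has_field_derivative q) (at 0)" using poly_curve_deriv[OF f(2)] by blast
 have "\<forall>\<^sub>F c in nhds 0. f (\<iota> (curve n t c)) = P (curve n t c) / Q (curve n t c)"
  using nearly_curve[OF f(4) Y] by (auto elim: eventually_mono)
 moreover have "((%c. P (curve n t c) / Q (curve n t c)) has_field_derivative
   (p * Q (curve n t 0) - P (curve n t 0) * q) / (Q (curve n t 0) * Q (curve n t 0))) (at 0)"
  using p q f(3) by (intro DERIV_divide) (auto simp: curve_0)
 ultimately show ?thesis by (auto simp: DERIV_cong_ev)
qed

lemma I_curve_deriv:
 assumes f: "f \<in> I" and Y: "!!c. curve n t c \<in> Y"
 shows "((%c. f (\<iota> (curve n t c))) has_field_derivative 0) (at 0)"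
proof -
 have "\<forall>\<^sub>F c in nhds 0. f (\<iota> (curve n t c)) = 0"
  using nearly_curve[OF _ Y, of "%u. f (\<iota> u) = 0"] f unfolding I_def by auto
 thus ?thesis by (subst DERIV_cong_ev[OF refl _ refl]) auto
qed

text \<open>The derivatives along the curves kill \<open>m\<^sup>2\<close> and are independent on \<open>m\<close>, so there are at least as
 many generators as curves.\<close>
lemma generators_ge:
 assumes K: "K \<subseteq> low n" "!!t c. t \<in> K ==> curve n t c \<in> Y" and S: "finite S" "generates_m S"
 shows "card K <= card S"
proof (rule ccontr)
 assume "~ card K <= card S"
 hence less: "card S < card K" by simp
 have finK: "finite K" using K(1) finite_low finite_subset by blast
 define D where "D t f = (SOME d. ((%c. f (\<iota> (curve n t c))) has_field_derivative d) (at 0))" for t f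
 have D: "((%c. f (\<iota> (curve n t c))) has_field_derivative D t f) (at 0)" if "f \<in> A" "t \<in> K" for t f
  unfolding D_def using someI_ex[OF germ_curve_deriv[OF that(1) K(2)[OF that(2)]]] .
 have Duniq: "D t f = d" if "f \<in> A" "t \<in> K" "((%c. f (\<iota> (curve n t c))) has_field_derivative d) (at 0)" for t f d
  using DERIV_unique[OF D[OF that(1,2)] that(3)] .
 obtain b where b: "EX t:K. b t ~= 0" "ALL s:S. (SUM t:K. b t * D t s) = 0"
  using more_unknowns_than_equations[OF S(1) finK less, of D] by blast
 define L where "L = {f \<in> A. f (\<iota> e1) = 0 & (SUM t:K. b t * D t f) = 0}"
 have "fideal A L"
 proof (rule fidealI)
  show "L \<subseteq> A" unfolding L_def by blast
  have "D t (%_. 0) = 0" if "t \<in> K" for t by (rule Duniq[OF A_const that]) auto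
  thus "(%_. 0) \<in> L" unfolding L_def using A_const by auto
 next
  fix f g assume f: "f \<in> L" and g: "g \<in> L"
  hence A: "f \<in> A" "g \<in> A" unfolding L_def by auto
  have "D t (%x. f x + g x) = D t f + D t g" if "t \<in> K" for t
   by (rule Duniq[OF A_add[OF A] that DERIV_add[OF D[OF A(1) that] D[OF A(2) that]]])
  hence "(SUM t:K. b t * D t (%x. f x + g x)) = (SUM t:K. b t * D t f) + (SUM t:K. b t * D t g)"
   by (simp add: sum.distrib[symmetric] algebra_simps)
  thus "(%x. f x + g x) \<in> L" using f g A_add[OF A] unfolding L_def by auto
 next
  fix r f assume r: "r \<in> A" and f: "f \<in> L"
  hence A: "f \<in> A" and 0: "f (\<iota> e1) = 0" unfolding L_def by auto
  have "D t (%x. r x * f x) = r (\<iota> e1) * D t f" if "t \<in> K" for t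
   by (rule Duniq[OF A_mult[OF r A] that])
     (use DERIV_mult'[OF D[OF r that] D[OF A that]] 0 in \<open>simp add: curve_0\<close>)
  hence "(SUM t:K. b t * D t (%x. r x * f x)) = r (\<iota> e1) * (SUM t:K. b t * D t f)"
   by (simp add: sum_distrib_left algebra_simps)
  thus "(%x. r x * f x) \<in> L" using f A_mult[OF r A] unfolding L_def by auto
 qed
 moreover have "I \<subseteq> L"
 proof
  fix f assume f: "f \<in> I"
  have "D t f = 0" if "t \<in> K" for t
   using Duniq[OF I_sub_A[OF f] that I_curve_deriv[OF f K(2)[OF that]]] .
  thus "f \<in> L" using f I_sub_m unfolding L_def m_def by auto
 qed
 moreover have "S \<subseteq> L" using S(2) b(2) unfolding L_def generates_m_def m_def by auto
 ultimately have mL: "m \<subseteq> L" using S(2) unfolding generates_m_def by blast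
 obtain s where s: "s \<in> K" "b s ~= 0" using b(1) by blast
 obtain i j where ij: "s = (i, j)" "i < n" "j < i" using s(1) K(1) by blast
 have xA: "xc s \<in> A" unfolding xc_def ij using ij by (intro pg_A pf) auto
 have "xc s \<in> m" unfolding m_def using xA ij by (auto simp: xc_def pg_at_one)
 hence "(SUM t:K. b t * D t (xc s)) = 0" using mL unfolding L_def by auto
 moreover have "D t (xc s) = (if t = s then 1 else 0)" if "t \<in> K" for t
 proof (rule Duniq[OF xA that])
  have "xc s (\<iota> (curve n t c)) = (if t = s then c else 0)" for c
   unfolding xc_def pg_def kappa_iota[OF K(2)[OF that]] using ij by (auto simp: curve_def)
  thus "((%c. xc s (\<iota> (curve n t c))) has_field_derivative (if t = s then 1 else 0)) (at 0)" by auto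
 qed
 ultimately have "(SUM t:K. b t * (if t = s then 1 else 0)) = 0" by simp
 hence "b s = 0" using s(1) finK by (simp add: if_distrib sum.delta cong: if_cong)
 with s(2) show False by simp
qed

lemma m_poly:
 assumes L: "fideal A L" "I \<subseteq> L" "!!t. t \<in> low n ==> xc t \<in> L" and P: "P \<in> poly_fun n"
 shows "(%x. pg P x - P e1) \<in> L"
 using P
proof (induction rule: poly_fun.induct)
 case (const c)
 show ?case using fidealD(2)[OF L(1)] by (simp add: pg_def)
next
 case (entry i j)
 show ?case
 proof (cases "j < i")
  case True
  hence "xc (i, j) \<in> L" using L(3) entry by auto
  thus ?thesis using entry True by (simp add: xc_def pg_def)
 next
  case False
  hence "(%x. pg (%A. A $$ (i, j)) x - e1 $$ (i, j)) \<in> I"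
   unfolding I_def using entry unipotent by (auto intro!: nearly_all simp: pg_def kappa_iota)
  thus ?thesis using L(2) by blast
 qed
next
 case (add f g)
 have "(%x. (pg f x - f e1) + (pg g x - g e1)) \<in> L" using fidealD(3)[OF L(1) add.IH] .
 thus ?case by (simp add: pg_def algebra_simps)
next
 case (mult f g)
 have "(%x. pg f x * (pg g x - g e1) + g e1 * (pg f x - f e1)) \<in> L"
  using fidealD(3)[OF L(1) fidealD(4)[OF L(1) pg_A[OF mult.hyps(1)] mult.IH(2)] fidealD(4)[OF L(1) A_const mult.IH(1)]] .
 thus ?case by (simp add: pg_def algebra_simps)
qed

lemma m_from_coordinates:
 assumes L: "fideal A L" "I \<subseteq> L" "!!t. t \<in> low n ==> xc t \<in> L"
 shows "m \<subseteq> L"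
proof
 fix f assume f: "f \<in> m"
 hence fA: "f \<in> A" and f0: "f (\<iota> e1) = 0" unfolding m_def by auto
 from fA obtain P Q where P: "P \<in> poly_fun n" "Q \<in> poly_fun n" "Q e1 ~= 0" "(%x. pg Q x * f x - pg P x) \<in> I" by (rule numerator)
 have "pg P (\<iota> e1) = 0" using P(4) I_sub_m f0 unfolding m_def by fastforce
 hence "P e1 = 0" using pg_at_one by simp
 with m_poly[OF L P(1)] have "pg P \<in> L" by (simp add: pg_def)
 thus "f \<in> L" using mem_fideal_poly[OF L(1,2) fA P(4) P(2,3,1)] by simp
qed

text \<open>Taylor expansion to first order.\<close>
lemma taylor:
 assumes M: "fideal A M" "I \<subseteq> M" "!!f g. f \<in> m ==> g \<in> m ==> (%x. f x * g x) \<in> M" and P: "P \<in> poly_fun n"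
 shows "EX d. (ALL t:low n. ((%c. P (curve n t c)) has_field_derivative d t) (at 0)) &
   (%x. pg P x - P e1 - (SUM t:low n. d t * xc t x)) \<in> M" (is "EX d. ?D P d & ?R P d \<in> M")
 using P
proof (induction rule: poly_fun.induct)
 case (const c)
 show ?case using fidealD(2)[OF M(1)] by (intro exI[of _ "%_. 0"]) (auto simp: pg_def)
next
 case (entry i j)
 have cur: "curve n t c $$ (i, j) = (if (i, j) = t then c else e1 $$ (i, j))" if "t \<in> low n" for t c
  using that entry by (auto simp: curve_def)
 have "((%c. curve n t c $$ (i, j)) has_field_derivative (if (i, j) = t then 1 else 0)) (at 0)" if "t \<in> low n" for t
  unfolding cur[OF that] by auto
 moreover have "(%x. pg (%A. A $$ (i, j)) x - e1 $$ (i, j) - (SUM t:low n. (if (i, j) = t then 1 else 0) * xc t x)) \<in> M"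
 proof (cases "j < i")
  case True
  hence "(i, j) \<in> low n" using entry by simp
  moreover have "(SUM t:low n. (if (i, j) = t then 1 else 0) * xc t x) = (SUM t:low n. if (i, j) = t then xc t x else 0)" for x
   by (intro sum.cong) auto
  ultimately have "(SUM t:low n. (if (i, j) = t then 1 else 0) * xc t x) = xc (i, j) x" for x
   using finite_low by simp
  thus ?thesis using entry True fidealD(2)[OF M(1)] by (simp add: xc_def pg_def)
 next
  case False
  hence "(i, j) \<notin> low n" by simp
  hence 0: "(SUM t:low n. (if (i, j) = t then 1 else 0) * xc t x) = 0" for x
   by (intro sum.neutral) auto
  from False have "(%x. pg (%A. A $$ (i, j)) x - e1 $$ (i, j)) \<in> I"
   unfolding I_def using entry unipotent by (auto intro!: nearly_all simp: pg_def kappa_iota)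
  thus ?thesis using M(2) unfolding 0 by auto
 qed
 ultimately show ?case by (intro exI[of _ "%t. if (i, j) = t then 1 else 0"]) blast
next
 case (add f g)
 then obtain d d' where d: "?D f d" "?R f d \<in> M" and d': "?D g d'" "?R g d' \<in> M" by blast
 have "?D (%A. f A + g A) (%t. d t + d' t)" using d(1) d'(1) DERIV_add by blast
 moreover have "?R (%A. f A + g A) (%t. d t + d' t) \<in> M"
  using fidealD(3)[OF M(1) d(2) d'(2)] by (simp add: pg_def algebra_simps sum.distrib)
 ultimately show ?case by (intro exI[of _ "%t. d t + d' t"]) blast
next
 case (mult f g)
 then obtain d d' where d: "?D f d" "?R f d \<in> M" and d': "?D g d'" "?R g d' \<in> M" by blast
 let ?e = "%t. f e1 * d' t + d t * g e1"
 have "?D (%A. f A * g A) ?e"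
 proof
  fix t assume "t \<in> low n"
  thus "((%c. f (curve n t c) * g (curve n t c)) has_field_derivative ?e t) (at 0)"
   using DERIV_mult'[OF d(1)[rule_format] d'(1)[rule_format], of t t] by (simp only: curve_0)
 qed
 moreover have "?R (%A. f A * g A) ?e \<in> M"
 proof -
  have m: "(%x. pg h x - h e1) \<in> m" if "h \<in> poly_fun n" for h
   unfolding m_def using A_diff[OF pg_A[OF that] A_const] by (simp add: pg_at_one)
  have "(%x. (pg f x - f e1) * (pg g x - g e1)) \<in> M" using M(3)[OF m[OF mult.hyps(1)] m[OF mult.hyps(2)]] .
  from fidealD(3)[OF M(1) this fidealD(3)[OF M(1) fidealD(4)[OF M(1) A_const[of "f e1"] d'(2)] fidealD(4)[OF M(1) A_const[of "g e1"] d(2)]]]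
  have "(%x. (pg f x - f e1) * (pg g x - g e1) + (f e1 * ?R g d' x + g e1 * ?R f d x)) \<in> M" .
  moreover have "(SUM t:low n. ?e t * xc t x) = f e1 * (SUM t:low n. d' t * xc t x) + g e1 * (SUM t:low n. d t * xc t x)" for x
   by (simp add: sum_distrib_left sum.distrib[symmetric] algebra_simps)
  ultimately show ?thesis by (simp add: pg_def algebra_simps)
 qed
 ultimately show ?case by (intro exI[of _ ?e]) blast
qed

lemma fideal_plus:
 assumes L: "fideal A L" and N: "fideal A N" and g: "g \<in> A"
 shows "fideal A {f. EX l:L. EX r:N. f = (%x. l x + r x * g x)}" (is "fideal A ?M") and "L \<subseteq> {f. EX l:L. EX r:N. f = (%x. l x + r x * g x)}"
proof -
 have I: "(%x. l x + r x * g x) \<in> ?M" if "l \<in> L" "r \<in> N" for l r using that by blast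
 show s: "L \<subseteq> ?M" using I[OF _ fidealD(2)[OF N]] by auto
 show "fideal A ?M"
 proof (rule fidealI)
  show "?M \<subseteq> A" using fidealD(1)[OF L] fidealD(1)[OF N] A_add A_mult g by blast
  show "(%_. 0) \<in> ?M" using s fidealD(2)[OF L] by blast
 next
  fix f h assume "f \<in> ?M" "h \<in> ?M"
  then obtain l r l' r' where "l \<in> L" "r \<in> N" "f = (%x. l x + r x * g x)" "l' \<in> L" "r' \<in> N" "h = (%x. l' x + r' x * g x)" by blast
  thus "(%x. f x + h x) \<in> ?M" using I[OF fidealD(3)[OF L, of l l'] fidealD(3)[OF N, of r r']] by (simp add: algebra_simps)
 next
  fix a f assume "a \<in> A" "f \<in> ?M"
  then obtain l r where "a \<in> A" "l \<in> L" "r \<in> N" "f = (%x. l x + r x * g x)" by blast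
  thus "(%x. a x * f x) \<in> ?M" using I[OF fidealD(4)[OF L, of a l] fidealD(4)[OF N, of a r]] by (simp add: algebra_simps)
 qed
qed

text \<open>Nakayama's lemma: coordinates that can be eliminated by an equation of \<open>Y\<close> are superfluous.\<close>
lemma nakayama:
 assumes K: "!!t. t \<in> low n - K ==> has_equation n Y t"
  and L: "fideal A L" "I \<subseteq> L" "!!t. t \<in> low n \<inter> K ==> xc t \<in> L"
 shows "m \<subseteq> L"
 using L
proof (induction "card {t \<in> low n. xc t \<notin> L}" arbitrary: L rule: less_induct)
 case less
 note L = less.prems(1,2)
 show ?case
 proof (cases "EX t:low n. xc t \<notin> L")
  case False
  thus ?thesis using m_from_coordinates[OF L] by blast
 next
  case True
  then obtain t where t: "t \<in> low n" "xc t \<notin> L" by blast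
  hence tK: "t \<in> low n - K" using less.prems(3) by blast
  have xtA: "xc t \<in> A" using t(1) by (auto simp: xc_def intro!: pg_A pf)
  define L' where "L' = {f. EX l:L. EX r:A. f = (%x. l x + r x * xc t x)}"
  have fA: "fideal A A" by (rule fidealI) (auto intro: A_const A_add A_mult)
  note L' = fideal_plus[OF L(1) fA xtA, folded L'_def]
  have LL': "L \<subseteq> L'" and fL': "fideal A L'" by (rule L')+
  have xtL': "xc t \<in> L'" unfolding L'_def
   by (rule CollectI, rule bexI[of _ "%_. 0"], rule bexI[of _ "%_. 1"]) (use fidealD(2)[OF L(1)] A_const[of 1] in simp_all)
  have "{s \<in> low n. xc s \<notin> L'} \<subset> {s \<in> low n. xc s \<notin> L}" using LL' xtL' t by blast
  hence "card {s \<in> low n. xc s \<notin> L'} < card {s \<in> low n. xc s \<notin> L}"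
   using finite_low by (intro psubset_card_mono) auto
  from less.hyps[OF this fL'] have mL': "m \<subseteq> L'" using L(2) LL' less.prems(3) by blast
  define M where "M = {f. EX l:L. EX r:m. f = (%x. l x + r x * xc t x)}"
  note M = fideal_plus[OF L(1) fideal_m xtA, folded M_def]
  have LM: "L \<subseteq> M" and fM: "fideal A M" by (rule M)+
  have mm: "(%x. f x * g x) \<in> M" if f: "f \<in> m" and g: "g \<in> m" for f g
  proof -
   obtain l r where lr: "l \<in> L" "r \<in> A" "g = (%x. l x + r x * xc t x)" using mL' g unfolding L'_def by blast
   have fA: "f \<in> A" using fidealD(1)[OF fideal_m f] .
   have rf: "(%x. r x * f x) \<in> m" using fidealD(4)[OF fideal_m lr(2) f] .
   have "(%x. f x * l x + r x * f x * xc t x) \<in> M" unfolding M_def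
    by (rule CollectI, rule bexI[OF _ fidealD(4)[OF L(1) fA lr(1)]], rule bexI[OF _ rf], rule refl)
   thus ?thesis using lr(3) by (simp add: algebra_simps)
  qed
  obtain F a where F: "F \<in> poly_fun n" "ALL u:Y. F u = 0" and a: "a ~= 0"
   "!!s. s \<in> low n ==> ((%c. F (curve n s c)) has_field_derivative (if s = t then a else 0)) (at 0)"
   using K[OF tK] unfolding has_equation_def by blast
  obtain d where d: "!!s. s \<in> low n ==> ((%c. F (curve n s c)) has_field_derivative d s) (at 0)"
   "(%x. pg F x - F e1 - (SUM s:low n. d s * xc s x)) \<in> M"
   using taylor[OF fM _ mm F(1)] L(2) LM by blast
  have ds: "d s = (if s = t then a else 0)" if "s \<in> low n" for s
   using DERIV_unique[OF d(1) a(2)] that by blast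
  have "(SUM s:low n. d s * xc s x) = (SUM s:low n. if s = t then a * xc t x else 0)" for x
   by (intro sum.cong) (auto simp: ds)
  hence sum: "(SUM s:low n. d s * xc s x) = a * xc t x" for x using t(1) finite_low by simp
  have "F e1 = 0" using F(2) one_in_Y by blast
  with d(2) have 1: "(%x. pg F x - a * xc t x) \<in> M" unfolding sum by simp
  have "pg F \<in> I" unfolding I_def pg_def using F(2) by (auto intro!: nearly_all simp: kappa_iota)
  hence "pg F \<in> M" using L(2) LM by blast
  from fideal_diff[OF subalg_A fM this 1] have "(%x. a * xc t x) \<in> M" by simp
  from fidealD(4)[OF fM A_const[of "inverse a"] this] have "xc t \<in> M" using a(1) by (simp add: mult.assoc[symmetric])
  then obtain l r where lr: "l \<in> L" "r \<in> m" "xc t = (%x. l x + r x * xc t x)" unfolding M_def by blast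
  have rA: "r \<in> A" "r (\<iota> e1) = 0" using lr(2) unfolding m_def by auto
  have "l = (%x. (1 - r x) * xc t x)" using lr(3) by (auto simp: fun_eq_iff algebra_simps)
  hence "(%x. (1 - r x) * xc t x) \<in> L" using lr(1) by simp
  from cancel_unit[OF L A_diff[OF A_const rA(1)] _ xtA this] rA(2) have "xc t \<in> L" by simp
  with t(2) show ?thesis by blast
 qed
qed

lemma generators_le:
 assumes K: "!!t. t \<in> low n - K ==> has_equation n Y t"
  and sub: "K \<subseteq> low n"
 shows "EX S. finite S & generates_m S & card S <= card K"
proof -
 have "finite K" using sub finite_low finite_subset by blast
 moreover have "generates_m (xc ` K)"
  unfolding generates_m_def
 proof (intro conjI allI impI)
  show "xc ` K \<subseteq> m" using sub by (auto simp: m_def xc_def pg_at_one intro!: pg_A pf)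
  show "m \<subseteq> L" if "fideal A L" "I \<subseteq> L" "xc ` K \<subseteq> L" for L
   using nakayama[OF K that(1,2)] that(3) by blast
 qed
 ultimately show ?thesis using card_image_le by blast
qed

end

section \<open>Chains of primes and algebraic dependence\<close>

lemma bdeg_prod:
 assumes "finite V" "finite J" "!!i. i \<in> J ==> bdeg V Z d (F i)"
 shows "bdeg V Z (card J * d) (%z. PROD i:J. F i z)"
 using assms(2,3)
proof (induction J rule: finite_induct)
 case empty
 thus ?case using bdeg_const[OF assms(1)] by simp
next
 case (insert j J)
 thus ?case using bdeg_mult[OF assms(1), of Z d "F j" "card J * d" "%z. PROD i:J. F i z"] by simp
qed

context germs
begin

lemma A_sum: "(!!i. i \<in> J ==> f i \<in> A) ==> (%x. SUM i:J. f i x) \<in> A"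
 by (induction J rule: infinite_finite_induct) (auto intro: A_const A_add)

lemma A_prod: "(!!i. i \<in> J ==> f i \<in> A) ==> (%x. PROD i:J. f i x) \<in> A"
 by (induction J rule: infinite_finite_induct) (auto intro: A_const A_mult)

lemma A_power: "f \<in> A ==> (%x. f x ^ k) \<in> A"
 by (induction k) (auto intro: A_const A_mult)

lemma fideal_sum: "fideal A P ==> (!!i. i \<in> J ==> f i \<in> P) ==> (%x. SUM i:J. f i x) \<in> P"
 by (induction J rule: infinite_finite_induct) (auto intro: fidealD)

definition fprime :: "('b => complex) set => bool" where
 "fprime P \<equiv> fideal A P & I \<subseteq> P & P ~= A &
   (ALL f:A. ALL g:A. (%x. f x * g x) \<in> P --> f \<in> P | g \<in> P)"

lemma fprimeD: assumes "fprime P" shows "fideal A P" "I \<subseteq> P" "P ~= A"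
  "f \<in> A ==> g \<in> A ==> (%x. f x * g x) \<in> P ==> f \<in> P | g \<in> P"
 using assms unfolding fprime_def by auto

lemma fprime_one: assumes "fprime P" "c ~= 0" shows "(%x. c) \<notin> P"
proof
 assume c: "(%x. c) \<in> P"
 have "f \<in> P" if f: "f \<in> A" for f
  using fidealD(4)[OF fprimeD(1)[OF assms(1)] A_mult[OF f A_const[of "inverse c"]] c] assms(2) by (simp add: mult.assoc)
 thus False using fprimeD(1,3)[OF assms(1)] unfolding fideal_def by blast
qed

lemma fprime_power: assumes "fprime P" "g \<in> A" "g \<notin> P" shows "(%x. g x ^ k) \<notin> P"
proof (induction k)
 case 0
 thus ?case using fprime_one[OF assms(1), of 1] by simp
next
 case (Suc k)
 thus ?case using fprimeD(4)[OF assms(1,2) A_power[OF assms(2)], of k] assms(3) by auto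
qed

definition relation :: "nat => ('b => complex) set => (nat => 'b => complex) => (nat => nat) set => ((nat => nat) => complex) => bool" where
 "relation k P f E c \<equiv> finite E & E \<subseteq> PiE {..<k} (%_. UNIV) & E ~= {} & (ALL e:E. c e ~= 0) &
   (%x. SUM e:E. c e * (PROD i<k. f i x ^ e i)) \<in> P"

text \<open>\<open>adep k P\<close>: any \<open>k\<close> germs are algebraically dependent modulo \<open>P\<close>.\<close>
definition adep :: "nat => ('b => complex) set => bool" where
 "adep k P \<equiv> (ALL f. (ALL i<k. f i \<in> A) --> (EX E c. relation k P f E c))"

lemma adepE:
 assumes "adep k P" "!!i. i < k ==> f i \<in> A" obtains E c where "relation k P f E c"
 using assms unfolding adep_def by blast

lemma adep_mono: assumes "adep k P" "P \<subseteq> P'" shows "adep k P'"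
 unfolding adep_def
proof (intro allI impI)
 fix f :: "nat => 'b => complex" assume "ALL i<k. f i \<in> A"
 then obtain E c where "relation k P f E c" using adepE[OF assms(1)] by blast
 hence "relation k P' f E c" using assms(2) unfolding relation_def by blast
 thus "EX E c. relation k P' f E c" by blast
qed

lemma not_adep_0: assumes "fprime P" shows "~ adep 0 P"
proof
 assume "adep 0 P"
 then obtain E c where "relation 0 P (%_ _. 0) E c" by (rule adepE) simp
 note E = this[unfolded relation_def]
 hence "E = {%_. undefined}" by auto
 thus False using E fprime_one[OF assms, of "c (%_. undefined)"] by simp
qed

text \<open>The transcendence degree drops along a strict inclusion of primes.\<close>
lemma adep_step:
 assumes P: "fprime P" and P': "fprime P'" and sub: "P \<subset> P'" and dep: "adep (Suc k) P"
 shows "adep k P'"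
 unfolding adep_def
proof (intro allI impI)
 fix f assume fA: "ALL i<k. f i \<in> A"
 obtain g where g: "g \<in> P'" "g \<notin> P" using sub by blast
 note fP = fprimeD(1)[OF P] and fP' = fprimeD(1)[OF P']
 have gA: "g \<in> A" using fidealD(1)[OF fP' g(1)] .
 let ?f = "%i. if i < k then f i else g"
 obtain E c where "relation (Suc k) P ?f E c" by (rule adepE[OF dep, of ?f]) (use fA gA in auto)
 hence E: "finite E" "E \<subseteq> PiE {..<Suc k} (%_. UNIV)" "E ~= {}" "ALL e:E. c e ~= 0"
  "(%x. SUM e:E. c e * (PROD i<Suc k. ?f i x ^ e i)) \<in> P" unfolding relation_def by blast+
 define \<mu> where "\<mu> = Min ((%e. e k) ` E)"
 have mu: "\<mu> <= e k" if "e \<in> E" for e unfolding \<mu>_def using E(1) that by simp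
 have "\<mu> \<in> (%e. e k) ` E" unfolding \<mu>_def using E(1,3) by (intro Min_in) auto
 then obtain e0 where e0: "e0 \<in> E" "e0 k = \<mu>" by auto
 define p where "p e x = c e * (PROD i<k. f i x ^ e i)" for e x
 have pA: "p e \<in> A" for e unfolding p_def using fA by (auto intro!: A_mult A_const A_prod A_power)
 have eq: "c e * (PROD i<Suc k. ?f i x ^ e i) = g x ^ \<mu> * (p e x * g x ^ (e k - \<mu>))" if "e \<in> E" for e x
 proof -
  have "g x ^ e k = g x ^ \<mu> * g x ^ (e k - \<mu>)" using mu[OF that] by (simp add: power_add[symmetric])
  thus ?thesis unfolding p_def by simp
 qed
 have "(SUM e:E. c e * (PROD i<Suc k. ?f i x ^ e i)) = g x ^ \<mu> * (SUM e:E. p e x * g x ^ (e k - \<mu>))" for x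
  unfolding sum_distrib_left by (rule sum.cong[OF refl eq])
 with E(5) have "(%x. g x ^ \<mu> * (SUM e:E. p e x * g x ^ (e k - \<mu>))) \<in> P" by simp
 moreover have hA: "(%x. SUM e:E. p e x * g x ^ (e k - \<mu>)) \<in> A" by (intro A_sum A_mult pA A_power gA)
 ultimately have "(%x. SUM e:E. p e x * g x ^ (e k - \<mu>)) \<in> P"
  using fprimeD(4)[OF P A_power[OF gA] hA] fprime_power[OF P gA g(2)] by blast
 hence h1: "(%x. SUM e:E. p e x * g x ^ (e k - \<mu>)) \<in> P'" using sub by blast
 let ?E0 = "{e \<in> E. e k = \<mu>}"
 have h2: "(%x. SUM e:E - ?E0. p e x * g x ^ (e k - \<mu>)) \<in> P'"
 proof (rule fideal_sum[OF fP'])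
  fix e assume "e \<in> E - ?E0"
  then obtain j where "e k - \<mu> = Suc j" using mu[of e] by (cases "e k - \<mu>") auto
  thus "(%x. p e x * g x ^ (e k - \<mu>)) \<in> P'"
   using fidealD(4)[OF fP' A_mult[OF pA A_power[OF gA]] g(1), of e j] by (simp add: mult_ac)
 qed
 have "(SUM e:E. p e x * g x ^ (e k - \<mu>)) - (SUM e:E - ?E0. p e x * g x ^ (e k - \<mu>)) = (SUM e:?E0. p e x)" for x
  using sum.subset_diff[of ?E0 E "%e. p e x * g x ^ (e k - \<mu>)"] E(1) by simp
 with fideal_diff[OF subalg_A fP' h1 h2] have h3: "(%x. SUM e:?E0. p e x) \<in> P'" by simp
 let ?r = "%e. restrict e {..<k}"
 have rest_upd: "(?r e)(k := \<mu>) = e" if "e \<in> ?E0" for e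
 proof -
  have "e \<in> extensional {..<Suc k}" "e k = \<mu>" using that E(2) by (auto simp: PiE_def)
  thus ?thesis by (auto simp: fun_eq_iff extensional_def restrict_def)
 qed
 have inj: "inj_on ?r ?E0" by (rule inj_on_inverseI[where g = "%e. e(k := \<mu>)"]) (rule rest_upd)
 let ?c = "%e. c (e(k := \<mu>))"
 have "(SUM e:?r ` ?E0. ?c e * (PROD i<k. f i x ^ e i)) = (SUM e:?E0. p e x)" for x
  unfolding sum.reindex[OF inj] o_def
 proof (rule sum.cong[OF refl])
  fix e assume e: "e \<in> ?E0"
  show "?c (?r e) * (PROD i<k. f i x ^ ?r e i) = p e x" unfolding rest_upd[OF e] p_def by simp
 qed
 with h3 have "(%x. SUM e:?r ` ?E0. ?c e * (PROD i<k. f i x ^ e i)) \<in> P'" by simp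
 moreover have "?c e ~= 0" if "e \<in> ?r ` ?E0" for e
  using that
 proof (rule imageE)
  fix e' assume "e = ?r e'" "e' \<in> ?E0"
  thus ?thesis using E(4) rest_upd[of e'] by simp
 qed
 moreover have "?r ` ?E0 \<subseteq> PiE {..<k} (%_. UNIV)" by (auto simp: PiE_iff extensional_def restrict_def split: if_splits)
 moreover have "?r ` ?E0 ~= {}" using e0 by blast
 ultimately show "EX E c. relation k P' f E c" unfolding relation_def
  using E(1) by (intro exI[of _ "?r ` ?E0"] exI[of _ ?c] conjI ballI) simp_all
qed

lemma prime_chain_le:
 assumes dep: "adep (Suc l) I" and P: "!!i. i <= k ==> fprime (P i)" "!!i. i < k ==> P i \<subset> P (Suc i)"
 shows "k <= l"
proof (rule ccontr)
 assume "~ k <= l"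
 have "adep (Suc l - i) (P i)" if "i <= Suc l" for i
  using that
 proof (induction i)
  case 0
  thus ?case using adep_mono[OF dep] fprimeD(2)[OF P(1)[of 0]] by simp
 next
  case (Suc i)
  hence "adep (Suc (Suc l - Suc i)) (P i)" by (simp add: Suc_diff_le)
  thus ?case using adep_step[OF P(1)[of i] P(1)[of "Suc i"] P(2)[of i]] Suc.prems \<open>~ k <= l\<close> by simp
 qed
 from this[of "Suc l"] show False using not_adep_0[OF P(1)[of "Suc l"]] \<open>~ k <= l\<close> by simp
qed

lemma nearly_ball: "finite J ==> (!!i. i \<in> J ==> nearly (p i)) ==> nearly (%u. ALL i:J. p i u)"
 by (induction J rule: finite_induct) (auto intro: nearly_all nearly_conj)

text \<open>Counting monomials: polynomials of degree at most \<open>N\<close> in \<open>l + 1\<close> rational functions of \<open>l\<close>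
 parameters live, for large \<open>N\<close>, in a space of smaller dimension than their number.\<close>
lemma adep_param:
 assumes V: "finite V"
  and \<delta>: "bdeg V Z d\<delta> \<delta>"
  and pol: "!!F. F \<in> poly_fun n ==> EX a d. bdeg V Z d (%z. \<delta> z ^ a * F (\<psi> z))"
  and dense: "!!F u. F \<in> poly_fun n ==> (!!z. z \<in> Z ==> \<delta> z ~= 0 ==> F (\<psi> z) = 0) ==> u \<in> Y ==> F u = 0"
 shows "adep (Suc (card V)) I"
 unfolding adep_def
proof (intro allI impI)
 let ?l = "card V"
 let ?k = "Suc ?l"
 fix f assume fA: "ALL i<?k. f i \<in> A"
 have "ALL i:{..<?k}. EX PQ. fst PQ \<in> poly_fun n & snd PQ \<in> poly_fun n & nearly (%u. snd PQ u ~= 0 & f i (\<iota> u) = fst PQ u / snd PQ u)"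
 proof
  fix i assume "i \<in> {..<?k}"
  then obtain P Q where "P \<in> poly_fun n" "Q \<in> poly_fun n" "nearly (%u. Q u ~= 0 & f i (\<iota> u) = P u / Q u)" using fA AE[of "f i"] by blast
  thus "EX PQ. fst PQ \<in> poly_fun n & snd PQ \<in> poly_fun n & nearly (%u. snd PQ u ~= 0 & f i (\<iota> u) = fst PQ u / snd PQ u)"
   by (intro exI[of _ "(P, Q)"]) simp
 qed
 from bchoice[OF this] obtain PQ where PQ': "ALL i:{..<?k}. fst (PQ i) \<in> poly_fun n & snd (PQ i) \<in> poly_fun n &
  nearly (%u. snd (PQ i) u ~= 0 & f i (\<iota> u) = fst (PQ i) u / snd (PQ i) u)" ..
 define P Q where "P i = fst (PQ i)" and "Q i = snd (PQ i)" for i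
 have PQ: "P i \<in> poly_fun n" "Q i \<in> poly_fun n" "nearly (%u. Q i u ~= 0 & f i (\<iota> u) = P i u / Q i u)" if "i < ?k" for i
  using PQ'[rule_format, of i] that unfolding P_def Q_def by simp_all
 have com: "EX a d. ALL F:J. bdeg V Z d (%z. \<delta> z ^ a * F (\<psi> z))" if "finite J" "J \<subseteq> poly_fun n" for J
  using that
 proof (induction J rule: finite_induct)
  case empty
  thus ?case by simp
 next
  case (insert F J)
  then obtain a d where ad: "ALL G:J. bdeg V Z d (%z. \<delta> z ^ a * G (\<psi> z))" by auto
  obtain a' d' where ad': "bdeg V Z d' (%z. \<delta> z ^ a' * F (\<psi> z))" using pol insert.prems by blast
  have up: "bdeg V Z (d + d' + (a + a') * d\<delta>) (%z. \<delta> z ^ (b + e) * G (\<psi> z))"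
   if "bdeg V Z D (%z. \<delta> z ^ e * G (\<psi> z))" "D <= d + d'" "b <= a + a'" for D b e G
  proof -
   have "b * d\<delta> + D <= d + d' + (a + a') * d\<delta>" using that(2) mult_le_mono1[OF that(3), of d\<delta>] by linarith
   from bdeg_mono[OF V this bdeg_mult[OF V bdeg_power[OF V \<delta>, of b] that(1)]] show ?thesis by (simp add: power_add mult.assoc)
  qed
  have "bdeg V Z (d + d' + (a + a') * d\<delta>) (%z. \<delta> z ^ (a + a') * G (\<psi> z))" if "G \<in> insert F J" for G
   using that up[OF ad', of a] up[of d a G a'] ad by (auto simp: add.commute)
  thus ?case by blast
 qed
 have "finite (P ` {..<?k} \<union> Q ` {..<?k})" "P ` {..<?k} \<union> Q ` {..<?k} \<subseteq> poly_fun n" using PQ(1,2) by auto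
 from com[OF this] obtain a d where ad: "ALL F:P ` {..<?k} \<union> Q ` {..<?k}. bdeg V Z d (%z. \<delta> z ^ a * F (\<psi> z))" by blast
 have bP: "bdeg V Z d (%z. \<delta> z ^ a * P i (\<psi> z))" and bQ: "bdeg V Z d (%z. \<delta> z ^ a * Q i (\<psi> z))" if "i < ?k" for i
  by (rule bspec[OF ad], rule UnI1, rule imageI, rule lessThan_iff[THEN iffD2, OF that])
   (rule bspec[OF ad], rule UnI2, rule imageI, rule lessThan_iff[THEN iffD2, OF that])
 define N where "N = (?k * d + 1) ^ ?l"
 let ?K = "?k * (N * d)"
 define S where "S = PiE {..<?k} (%_. {..N})"
 have finS: "finite S" unfolding S_def by (intro finite_PiE) auto
 have cardS: "card S = Suc N ^ ?k" unfolding S_def by (simp add: card_PiE)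
 have less: "card (expos V ?K) < card S"
 proof -
  have "?k * (N * d) + 1 <= Suc N * (?k * d + 1)" by (simp add: algebra_simps)
  hence "Suc ?K ^ ?l <= (Suc N * (?k * d + 1)) ^ ?l" by (intro power_mono) auto
  also have "\<dots> = Suc N ^ ?l * N" by (simp only: power_mult_distrib N_def[symmetric])
  also have "\<dots> < Suc N ^ ?l * Suc N" by simp
  finally show ?thesis unfolding cardS card_expos[OF V] by (simp add: mult.commute)
 qed
 define M where "M e u = (PROD i<?k. P i u ^ e i * Q i u ^ (N - e i))" for e u
 have Mpf: "M e \<in> poly_fun n" for e unfolding M_def using PQ(1,2) by (intro pf_prod pf pf_power) auto
 have eN: "e i <= N" if "e \<in> S" "i < ?k" for e i using that unfolding S_def by (auto simp: PiE_def Pi_def)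
 have G: "bdeg V Z ?K (%z. \<delta> z ^ (a * N * ?k) * M e (\<psi> z))" if e: "e \<in> S" for e
 proof -
  have "bdeg V Z (card {..<?k} * (N * d)) (%z. PROD i:{..<?k}. (\<delta> z ^ a * P i (\<psi> z)) ^ e i * (\<delta> z ^ a * Q i (\<psi> z)) ^ (N - e i))"
  proof (rule bdeg_prod[OF V])
   fix i assume i: "i \<in> {..<?k}"
   hence "e i * d + (N - e i) * d = N * d" using eN[OF e] by (simp add: add_mult_distrib[symmetric])
   thus "bdeg V Z (N * d) (%z. (\<delta> z ^ a * P i (\<psi> z)) ^ e i * (\<delta> z ^ a * Q i (\<psi> z)) ^ (N - e i))"
    using bdeg_mult[OF V bdeg_power[OF V bP, of i "e i"] bdeg_power[OF V bQ, of i "N - e i"]] i by simp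
  qed simp
  moreover have "(PROD i:{..<?k}. (\<delta> z ^ a * P i (\<psi> z)) ^ e i * (\<delta> z ^ a * Q i (\<psi> z)) ^ (N - e i)) = \<delta> z ^ (a * N * ?k) * M e (\<psi> z)" for z
  proof -
   have "(PROD i:{..<?k}. (\<delta> z ^ a * P i (\<psi> z)) ^ e i * (\<delta> z ^ a * Q i (\<psi> z)) ^ (N - e i))
    = (PROD i:{..<?k}. \<delta> z ^ (a * N) * (P i (\<psi> z) ^ e i * Q i (\<psi> z) ^ (N - e i)))"
   proof (rule prod.cong[OF refl])
    fix i assume "i \<in> {..<?k}"
    hence "a * N = a * e i + a * (N - e i)" using eN[OF e, of i] by (simp add: add_mult_distrib2[symmetric])
    thus "(\<delta> z ^ a * P i (\<psi> z)) ^ e i * (\<delta> z ^ a * Q i (\<psi> z)) ^ (N - e i) = \<delta> z ^ (a * N) * (P i (\<psi> z) ^ e i * Q i (\<psi> z) ^ (N - e i))"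
     by (simp only: power_mult_distrib power_mult[symmetric] power_add mult_ac)
   qed
   also have "\<dots> = \<delta> z ^ (a * N * ?k) * M e (\<psi> z)" unfolding prod.distrib M_def by (simp only: prod_constant card_lessThan power_mult[symmetric])
   finally show ?thesis .
  qed
  ultimately show ?thesis by simp
 qed
 hence "ALL e:S. EX \<alpha>. ALL z:Z. \<delta> z ^ (a * N * ?k) * M e (\<psi> z) = (SUM t:expos V ?K. \<alpha> t * monom_at V t z)"
  unfolding bdeg_def by blast
 from bchoice[OF this] obtain \<alpha> where
  \<alpha>: "!!e z. e \<in> S ==> z \<in> Z ==> \<delta> z ^ (a * N * ?k) * M e (\<psi> z) = (SUM t:expos V ?K. \<alpha> e t * monom_at V t z)" by blast
 obtain c where c: "EX e:S. c e ~= 0" "!!t. t \<in> expos V ?K ==> (SUM e:S. c e * \<alpha> e t) = 0"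
  using more_unknowns_than_equations[OF finite_expos[OF V] finS less, of \<alpha>] by blast
 define F where "F u = (SUM e:S. c e * M e u)" for u
 have Fpf: "F \<in> poly_fun n" unfolding F_def by (intro pf_sum pf Mpf)
 have F0: "F u = 0" if "u \<in> Y" for u
 proof (rule dense[OF Fpf _ that])
  fix z assume z: "z \<in> Z" "\<delta> z ~= 0"
  have "\<delta> z ^ (a * N * ?k) * F (\<psi> z) = (SUM e:S. c e * (\<delta> z ^ (a * N * ?k) * M e (\<psi> z)))"
   unfolding F_def sum_distrib_left by (simp add: mult_ac)
  also have "\<dots> = (SUM e:S. c e * (SUM t:expos V ?K. \<alpha> e t * monom_at V t z))"
   using \<alpha> z(1) by (intro sum.cong) auto
  also have "\<dots> = (SUM e:S. SUM t:expos V ?K. c e * \<alpha> e t * monom_at V t z)"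
   by (simp add: sum_distrib_left mult.assoc)
  also have "\<dots> = (SUM t:expos V ?K. SUM e:S. c e * \<alpha> e t * monom_at V t z)" by (rule sum.swap)
  also have "\<dots> = (SUM t:expos V ?K. (SUM e:S. c e * \<alpha> e t) * monom_at V t z)" by (simp add: sum_distrib_right)
  also have "\<dots> = 0" using c(2) by (intro sum.neutral) auto
  finally show "F (\<psi> z) = 0" using z(2) by simp
 qed
 let ?E = "{e \<in> S. c e ~= 0}"
 have "nearly (%u. ALL i:{..<?k}. Q i u ~= 0 & f i (\<iota> u) = P i u / Q i u)"
  using PQ(3) by (intro nearly_ball) auto
 hence "nearly (%u. (SUM e:?E. c e * (PROD i<?k. f i (\<iota> u) ^ e i)) = 0)"
 proof (rule nearly_mono)
  fix u assume u: "u \<in> Y" and h: "ALL i:{..<?k}. Q i u ~= 0 & f i (\<iota> u) = P i u / Q i u"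
  have *: "(PROD i<?k. Q i u ^ N) * (PROD i<?k. f i (\<iota> u) ^ e i) = M e u" if e: "e \<in> S" for e
   unfolding M_def prod.distrib[symmetric]
  proof (rule prod.cong[OF refl])
   fix i assume i: "i \<in> {..<?k}"
   hence "Q i u ^ N = Q i u ^ e i * Q i u ^ (N - e i)" using eN[OF e, of i] by (simp add: power_add[symmetric])
   thus "Q i u ^ N * f i (\<iota> u) ^ e i = P i u ^ e i * Q i u ^ (N - e i)"
    using h i by (simp add: power_divide)
  qed
  have "(PROD i<?k. Q i u ^ N) * (SUM e:?E. c e * (PROD i<?k. f i (\<iota> u) ^ e i)) = (SUM e:?E. c e * M e u)"
   unfolding sum_distrib_left by (rule sum.cong[OF refl]) (simp only: mem_Collect_eq *[symmetric] mult_ac)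
  also have "\<dots> = F u" unfolding F_def using finS by (intro sum.mono_neutral_left) auto
  finally have "(PROD i<?k. Q i u ^ N) * (SUM e:?E. c e * (PROD i<?k. f i (\<iota> u) ^ e i)) = 0" using F0[OF u] by simp
  moreover have "(PROD i<?k. Q i u ^ N) ~= 0" using h by (subst prod_zero_iff) auto
  ultimately show "(SUM e:?E. c e * (PROD i<?k. f i (\<iota> u) ^ e i)) = 0" by (simp only: mult_eq_0_iff simp_thms)
 qed
 hence "(%x. SUM e:?E. c e * (PROD i<?k. f i x ^ e i)) \<in> I" unfolding I_def by simp
 moreover have "finite ?E" "?E ~= {}" using finS c(1) by auto
 moreover have "?E \<subseteq> PiE {..<?k} (%_. UNIV)" unfolding S_def by (auto simp: PiE_def)
 ultimately show "EX E c. relation ?k I f E c" unfolding relation_def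
  by (intro exI[of _ ?E] exI[of _ c] conjI) simp_all
qed

definition irred :: "complex mat set => bool" where
 "irred Z \<equiv> Z \<subseteq> Y & e1 \<in> Z & (ALL P:poly_fun n. ALL Q:poly_fun n. (ALL u:Z. P u * Q u = 0) -->
   (ALL u:Z. P u = 0) | (ALL u:Z. Q u = 0))"

definition vanish :: "complex mat set => ('b => complex) set" where
 "vanish Z = {f \<in> A. EX E:poly_fun n. E e1 ~= 0 & (ALL u:Z. E u ~= 0 --> f (\<iota> u) = 0)}"

lemma irredD:
 assumes "irred Z" "P \<in> poly_fun n" "Q \<in> poly_fun n" "!!u. u \<in> Z ==> P u * Q u = 0" "Q e1 ~= 0"
 shows "ALL u:Z. P u = 0"
 using assms unfolding irred_def by metis

lemma fprime_vanish: assumes Z: "irred Z" shows "fprime (vanish Z)"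
 unfolding fprime_def
proof (intro conjI ballI impI)
 have ZY: "Z \<subseteq> Y" "e1 \<in> Z" using Z unfolding irred_def by auto
 show fid: "fideal A (vanish Z)"
 proof (rule fidealI)
  show "(%x. f x + g x) \<in> vanish Z" if f: "f \<in> vanish Z" and g: "g \<in> vanish Z" for f g
  proof -
   obtain E where "f \<in> A" "E \<in> poly_fun n" "E e1 ~= 0" "ALL u:Z. E u ~= 0 --> f (\<iota> u) = 0" using f unfolding vanish_def by blast
   moreover obtain E' where "g \<in> A" "E' \<in> poly_fun n" "E' e1 ~= 0" "ALL u:Z. E' u ~= 0 --> g (\<iota> u) = 0" using g unfolding vanish_def by blast
   ultimately show ?thesis unfolding vanish_def by (auto intro!: A_add bexI[of _ "%u. E u * E' u"] pf)
  qed
  show "(%x. r x * f x) \<in> vanish Z" if "r \<in> A" "f \<in> vanish Z" for r f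
   using that A_mult unfolding vanish_def by auto
  show "(%_. 0) \<in> vanish Z" unfolding vanish_def using A_const by (auto intro!: bexI[of _ "%_. 1"] pf)
 qed (auto simp: vanish_def)
 show "I \<subseteq> vanish Z"
 proof
  fix f assume "f \<in> I"
  thus "f \<in> vanish Z" using I_sub_A ZY unfolding I_def nearly_def vanish_def by blast
 qed
 have "(%_. 1) \<notin> vanish Z" using ZY unfolding vanish_def by auto
 thus "vanish Z ~= A" using A_const by blast
 fix f g assume f: "f \<in> A" and g: "g \<in> A" and fg: "(%x. f x * g x) \<in> vanish Z"
 obtain P Q where P: "P \<in> poly_fun n" "Q \<in> poly_fun n" "Q e1 ~= 0" "nearly (%u. Q u ~= 0 & f (\<iota> u) = P u / Q u)" using f by (rule AE)
 obtain P' Q' where P': "P' \<in> poly_fun n" "Q' \<in> poly_fun n" "Q' e1 ~= 0" "nearly (%u. Q' u ~= 0 & g (\<iota> u) = P' u / Q' u)" using g by (rule AE)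
 obtain E where E: "E \<in> poly_fun n" "E e1 ~= 0" "ALL u:Z. E u ~= 0 --> f (\<iota> u) * g (\<iota> u) = 0" using fg unfolding vanish_def by blast
 obtain H where H: "H \<in> poly_fun n" "H e1 ~= 0" "ALL u:Y. H u ~= 0 --> (Q u ~= 0 & f (\<iota> u) = P u / Q u) & (Q' u ~= 0 & g (\<iota> u) = P' u / Q' u)"
  using nearly_conj[OF P(4) P'(4)] unfolding nearly_def by blast
 have 0: "(P u * P' u) * (E u * H u) = 0" if "u \<in> Z" for u
 proof (cases "E u = 0 | H u = 0")
  case False
  have "u \<in> Y" using that ZY by blast
  thus ?thesis using E(3)[rule_format, OF that] H(3)[rule_format, of u] False by auto
 qed auto
 have "ALL u:Z. P u * P' u = 0"
  by (rule irredD[OF Z pf(4)[OF P(1) P'(1)] pf(4)[OF E(1) H(1)] 0]) (use E(2) H(2) in auto)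
 then consider "ALL u:Z. P u = 0" | "ALL u:Z. P' u = 0" using Z P(1) P'(1) unfolding irred_def by blast
 thus "f \<in> vanish Z | g \<in> vanish Z"
 proof cases
  case 1
  hence "ALL u:Z. H u ~= 0 --> f (\<iota> u) = 0" using H(3) ZY(1) by auto
  thus ?thesis unfolding vanish_def using f H(1,2) by blast
 next
  case 2
  hence "ALL u:Z. H u ~= 0 --> g (\<iota> u) = 0" using H(3) ZY(1) by auto
  thus ?thesis unfolding vanish_def using g H(1,2) by blast
 qed
qed

lemma vanish_strict:
 assumes Z: "irred Z" and Z': "Z' \<subseteq> Z" and F: "F \<in> poly_fun n" "ALL u:Z'. F u = 0" "~ (ALL u:Z. F u = 0)"
 shows "vanish Z \<subset> vanish Z'"
proof
 have ZY: "Z \<subseteq> Y" using Z unfolding irred_def by auto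
 show "vanish Z \<subseteq> vanish Z'" using Z' unfolding vanish_def by blast
 have k: "pg F (\<iota> u) = F u" if "u \<in> Z" for u using kappa_iota that ZY unfolding pg_def by auto
 have "pg F \<in> vanish Z'"
  unfolding vanish_def using pg_A[OF F(1)] F(2) k Z' by (auto intro!: bexI[of _ "%_. 1"] pf)
 moreover have "pg F \<notin> vanish Z"
 proof
  assume "pg F \<in> vanish Z"
  then obtain E where "E \<in> poly_fun n" "E e1 ~= 0" "ALL u:Z. E u ~= 0 --> pg F (\<iota> u) = 0" unfolding vanish_def by blast
  hence "ALL u:Z. F u = 0" using irredD[OF Z F(1), of E] k by fastforce
  with F(3) show False by blast
 qed
 ultimately show "vanish Z ~= vanish Z'" by blast
qed

section \<open>The local ring as a quotient\<close>

definition RA :: "('b => complex) ring" where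
 "RA = \<lparr>carrier = A, monoid.mult = (%f g x. f x * g x), one = (%x. 1), zero = (%x. 0), add = (%f g x. f x + g x)\<rparr>"

lemma RA_sel [simp]: "carrier RA = A" "f \<otimes>\<^bsub>RA\<^esub> g = (%x. f x * g x)" "\<one>\<^bsub>RA\<^esub> = (%x. 1)" "\<zero>\<^bsub>RA\<^esub> = (%x. 0)" "f \<oplus>\<^bsub>RA\<^esub> g = (%x. f x + g x)"
 unfolding RA_def by simp_all

lemma A_uminus: "f \<in> A ==> (%x. - f x) \<in> A"
 using A_mult[OF A_const[of "-1"]] by simp

lemma cring_RA: "cring RA"
proof (rule cringI)
 show "abelian_group RA"
 proof (rule abelian_groupI)
  fix f assume f: "f \<in> carrier RA"
  thus "EX g:carrier RA. g \<oplus>\<^bsub>RA\<^esub> f = \<zero>\<^bsub>RA\<^esub>" by (intro bexI[of _ "%x. - f x"]) (auto intro: A_uminus)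
 qed (auto intro: A_add A_const simp: algebra_simps)
 show "comm_monoid RA"
  by (rule comm_monoidI) (auto intro: A_mult A_const simp: algebra_simps)
qed (auto simp: algebra_simps)

lemma a_inv_RA: assumes "f \<in> A" shows "\<ominus>\<^bsub>RA\<^esub> f = (%x. - f x)"
proof -
 interpret R: cring RA by (rule cring_RA)
 show ?thesis by (rule R.minus_equality) (use assms A_uminus in auto)
qed

lemma ideal_RA: "ideal L RA <-> fideal A L"
proof
 interpret R: cring RA by (rule cring_RA)
 show "fideal A L" if "ideal L RA"
 proof -
  interpret J: ideal L RA by (rule that)
  show ?thesis using J.a_subset J.zero_closed J.a_closed J.I_l_closed by (intro fidealI) auto
 qed
 show "ideal L RA" if f: "fideal A L"
 proof (rule idealI[OF R.ring_axioms])
  show "subgroup L (add_monoid RA)"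
  proof
   show "L \<subseteq> carrier (add_monoid RA)" using fidealD(1)[OF f] by auto
   show "inv\<^bsub>add_monoid RA\<^esub> g \<in> L" if "g \<in> L" for g
    using a_inv_RA[OF fidealD(1)[OF f that]] fideal_uminus[OF subalg_A f that] by (simp add: a_inv_def)
  qed (use fidealD[OF f] in auto)
  show "x \<otimes>\<^bsub>RA\<^esub> a \<in> L" if "a \<in> L" "x \<in> carrier RA" for a x using fidealD(4)[OF f] that by auto
  thus "a \<otimes>\<^bsub>RA\<^esub> x \<in> L" if "a \<in> L" "x \<in> carrier RA" for a x using that by (simp add: mult.commute)
 qed
qed

definition RQ :: "('b => complex) set ring" where "RQ = RA Quot I"

definition cl :: "('b => complex) => ('b => complex) set" where "cl f = I +>\<^bsub>RA\<^esub> f"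

lemma ideal_I: "ideal I RA" using ideal_RA fideal_I by simp

lemma cl_hom: "ring_hom_ring RA RQ cl"
 unfolding RQ_def cl_def[abs_def] by (rule ideal.rcos_ring_hom_ring[OF ideal_I])

lemma cring_RQ: "cring RQ"
 unfolding RQ_def by (rule ideal.quotient_is_cring[OF ideal_I cring_RA])

lemma carrier_RQ: "carrier RQ = cl ` A"
 unfolding RQ_def cl_def FactRing_def A_RCOSETS_def' by auto

lemma cl_carrier: "f \<in> A ==> cl f \<in> carrier RQ" unfolding carrier_RQ by (rule imageI)

lemma carrier_RQE: assumes "a \<in> carrier RQ" obtains f where "f \<in> A" "a = cl f"
 using assms unfolding carrier_RQ by (rule imageE) (rule that)

lemma cl_eq: assumes "f \<in> A" "g \<in> A" shows "cl f = cl g <-> (%x. f x - g x) \<in> I"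
proof -
 interpret R: cring RA by (rule cring_RA)
 have "cl f = cl g <-> f \<ominus>\<^bsub>RA\<^esub> g \<in> I"
  unfolding cl_def using R.quotient_eq_iff_same_a_r_cos[OF ideal_I, of f g] assms by auto
 also have "f \<ominus>\<^bsub>RA\<^esub> g = (%x. f x - g x)" using assms by (simp add: a_minus_def a_inv_RA)
 finally show ?thesis .
qed

lemma cl_mem: assumes L: "fideal A L" "I \<subseteq> L" and f: "f \<in> A" shows "cl f \<in> cl ` L <-> f \<in> L"
proof
 assume "cl f \<in> cl ` L"
 then obtain g where g: "g \<in> L" "cl f = cl g" by blast
 have "(%x. f x - g x) \<in> L" using cl_eq[OF f fidealD(1)[OF L(1) g(1)]] g(2) L(2) by blast
 from fidealD(3)[OF L(1) this g(1)] show "f \<in> L" by simp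
qed blast

lemma ideal_image: assumes "fideal A L" shows "ideal (cl ` L) RQ"
proof -
 interpret R: cring RA by (rule cring_RA)
 show ?thesis unfolding RQ_def cl_def[abs_def] using R.ring_ideal_imp_quot_ideal[OF ideal_I] assms ideal_RA by blast
qed

definition pre :: "('b => complex) set set => ('b => complex) set" where "pre J = {f \<in> A. cl f \<in> J}"

lemma fideal_pre: assumes J: "ideal J RQ" shows "fideal A (pre J)" "I \<subseteq> pre J" "cl ` pre J = J"
proof -
 interpret h: ring_hom_ring RA RQ cl by (rule cl_hom)
 show "fideal A (pre J)" using h.ideal_vimage[OF J] ideal_RA unfolding pre_def RA_sel by blast
 show "I \<subseteq> pre J"
 proof
  fix f assume f: "f \<in> I"
  hence fA: "f \<in> A" by (rule I_sub_A)
  have "cl f = cl (%_. 0)" using cl_eq[OF fA A_const] f by simp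
  also have "\<dots> = \<zero>\<^bsub>RQ\<^esub>" using h.hom_zero by simp
  finally show "f \<in> pre J" using fA additive_subgroup.zero_closed[OF ideal.axioms(1)[OF J]] unfolding pre_def by simp
 qed
 have "J \<subseteq> carrier RQ" using additive_subgroup.a_subset[OF ideal.axioms(1)[OF J]] .
 thus "cl ` pre J = J" unfolding carrier_RQ pre_def by blast
qed

lemma cl_mult: "f \<in> A ==> g \<in> A ==> cl f \<otimes>\<^bsub>RQ\<^esub> cl g = cl (%x. f x * g x)"
 using ring_hom_ring.homh[OF cl_hom] ring_hom_mult[of cl RA RQ f g] by simp

lemma prime_pre: assumes P: "primeideal P RQ" shows "fprime (pre P)"
proof -
 interpret P: primeideal P RQ by (rule P)
 note fp = fideal_pre[OF P.ideal_axioms]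
 show ?thesis
  unfolding fprime_def
 proof (intro conjI ballI impI)
  show "pre P ~= A" using fp(3) P.I_notcarr carrier_RQ by auto
  fix f g assume f: "f \<in> A" "g \<in> A" "(%x. f x * g x) \<in> pre P"
  hence "cl f \<otimes>\<^bsub>RQ\<^esub> cl g \<in> P" using cl_mult unfolding pre_def by simp
  hence "cl f \<in> P | cl g \<in> P" using P.I_prime f cl_carrier by blast
  thus "f \<in> pre P | g \<in> pre P" using f unfolding pre_def by simp
 qed (use fp in auto)
qed

lemma prime_image: assumes L: "fprime L" shows "primeideal (cl ` L) RQ"
proof (rule primeidealI[OF ideal_image[OF fprimeD(1)[OF L]] cring_RQ])
 note mem = cl_mem[OF fprimeD(1,2)[OF L]]
 have "EX f. f \<in> A & f \<notin> L" using fprimeD(1,3)[OF L] unfolding fideal_def by blast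
 thus "carrier RQ ~= cl ` L" using mem cl_carrier by metis
 fix a b assume ab: "a \<in> carrier RQ" "b \<in> carrier RQ" "a \<otimes>\<^bsub>RQ\<^esub> b \<in> cl ` L"
 then obtain f g where fg: "f \<in> A" "g \<in> A" "a = cl f" "b = cl g" by (metis carrier_RQE)
 hence "(%x. f x * g x) \<in> L" using ab(3) mem[OF A_mult[OF fg(1,2)]] by (simp add: cl_mult)
 hence "f \<in> L | g \<in> L" using fprimeD(4)[OF L fg(1,2)] by blast
 thus "a \<in> cl ` L | b \<in> cl ` L" using fg by blast
qed

lemma krull_le: assumes "adep (Suc l) I" shows "krull_dim RQ <= enat l"
 unfolding krull_dim_def
proof (rule Sup_least, elim CollectE exE conjE)
 fix x k P assume x: "x = enat k" and P: "ALL i<=k. primeideal (P i) RQ" "ALL i<k. P i \<subset> P (Suc i)"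
 have "k <= l"
 proof (rule prime_chain_le[OF assms])
  show "fprime (pre (P i))" if "i <= k" for i using prime_pre P(1) that by blast
  show "pre (P i) \<subset> pre (P (Suc i))" if "i < k" for i
  proof -
   have "ideal (P i) RQ" "ideal (P (Suc i)) RQ" using P(1) that primeideal.axioms(1) by (metis Suc_leI less_imp_le)+
   from this[THEN fideal_pre(3)] P(2) that have "pre (P i) ~= pre (P (Suc i))" by (metis psubset_eq)
   moreover have "pre (P i) \<subseteq> pre (P (Suc i))" using P(2) that unfolding pre_def by blast
   ultimately show ?thesis by blast
  qed
 qed
 thus "x <= enat l" using x by simp
qed

lemma krull_ge:
 assumes P: "!!i. i <= l ==> fprime (P i)" "!!i. i < l ==> P i \<subset> P (Suc i)"
 shows "enat l <= krull_dim RQ"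
 unfolding krull_dim_def
proof (rule Sup_upper, rule CollectI, intro exI conjI allI impI)
 show "primeideal (cl ` P i) RQ" if "i <= l" for i using prime_image[OF P(1)[OF that]] .
 show "cl ` P i \<subset> cl ` P (Suc i)" if i: "i < l" for i
 proof -
  obtain f where f: "f \<in> P (Suc i)" "f \<notin> P i" using P(2)[OF i] by blast
  have s: "fprime (P i)" "fprime (P (Suc i))" using P(1) i by auto
  have "f \<in> A" using fidealD(1)[OF fprimeD(1)[OF s(2)] f(1)] .
  hence "cl f \<notin> cl ` P i" using cl_mem[OF fprimeD(1,2)[OF s(1)]] f(2) by blast
  thus ?thesis using f(1) P(2)[OF i] by blast
 qed
qed rule

lemma maximal_image: "maximalideal (cl ` m) RQ"
proof (rule maximalidealI[OF ideal_image[OF fideal_m]])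
 note mem = cl_mem[OF fideal_m I_sub_m]
 have "(%_. 1) \<notin> m" unfolding m_def by simp
 thus "carrier RQ ~= cl ` m" using mem[OF A_const[of 1]] cl_carrier[OF A_const[of 1]] by metis
 fix J assume J: "ideal J RQ" "cl ` m \<subseteq> J" "J \<subseteq> carrier RQ"
 note fp = fideal_pre[OF J(1)]
 show "J = cl ` m | J = carrier RQ"
 proof (cases "EX f:pre J. f (\<iota> e1) ~= 0")
  case True
  hence "A \<subseteq> pre J" using fideal_full[OF fp(1,2)] by blast
  hence "cl ` A \<subseteq> J" using fp(3) by blast
  thus ?thesis using J(3) unfolding carrier_RQ by (intro disjI2 equalityI)
 next
  case False
  hence "pre J \<subseteq> m" unfolding m_def pre_def by blast
  hence "cl ` pre J \<subseteq> cl ` m" by (rule image_mono)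
  thus ?thesis using J(2) unfolding fp(3) by (intro disjI1 equalityI)
 qed
qed

lemma maximal_unique: assumes M: "maximalideal M RQ" shows "M = cl ` m"
proof -
 interpret M: maximalideal M RQ by (rule M)
 interpret m: maximalideal "cl ` m" RQ by (rule maximal_image)
 note fp = fideal_pre[OF M.ideal_axioms]
 have "pre M \<subseteq> m"
 proof (rule ccontr)
  assume "~ pre M \<subseteq> m"
  then obtain f where "f \<in> pre M" "f (\<iota> e1) ~= 0" unfolding m_def pre_def by blast
  hence "A \<subseteq> pre M" using fideal_full[OF fp(1,2)] by blast
  hence "carrier RQ \<subseteq> M" unfolding carrier_RQ using fp(3) by blast
  thus False using M.I_notcarr M.a_subset by blast
 qed
 hence "cl ` pre M \<subseteq> cl ` m" by (rule image_mono)
 hence "M \<subseteq> cl ` m" unfolding fp(3) .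
 thus ?thesis using M.I_maximal[OF m.ideal_axioms] m.a_subset m.I_notcarr by blast
qed

lemma ideal_generated:
 assumes J: "fideal A J" "I \<subseteq> J" and S: "S \<subseteq> J" "!!L. fideal A L ==> I \<subseteq> L ==> S \<subseteq> L ==> J \<subseteq> L"
 shows "cl ` J = Idl\<^bsub>RQ\<^esub> (cl ` S)"
proof
 interpret Q: cring RQ by (rule cring_RQ)
 have c: "cl ` S \<subseteq> carrier RQ" using S(1) fidealD(1)[OF J(1)] cl_carrier by blast
 show "Idl\<^bsub>RQ\<^esub> (cl ` S) \<subseteq> cl ` J" using Q.genideal_minimal[OF ideal_image[OF J(1)]] S(1) by blast
 have i: "ideal (Idl\<^bsub>RQ\<^esub> (cl ` S)) RQ" using Q.genideal_ideal[OF c] .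
 have "S \<subseteq> pre (Idl\<^bsub>RQ\<^esub> (cl ` S))" using Q.genideal_self[OF c] S(1) fidealD(1)[OF J(1)] unfolding pre_def by blast
 from S(2)[OF fideal_pre(1,2)[OF i] this] show "cl ` J \<subseteq> Idl\<^bsub>RQ\<^esub> (cl ` S)" unfolding pre_def by blast
qed

lemma noetherian_RQ: "noetherian_ring RQ"
proof -
 interpret Q: cring RQ by (rule cring_RQ)
 show ?thesis
 proof (rule Q.noetherian_ringI)
  fix J assume J: "ideal J RQ"
  note fp = fideal_pre[OF J]
  obtain S where S: "finite S" "S \<subseteq> pre J" "!!L. fideal A L ==> I \<subseteq> L ==> S \<subseteq> L ==> pre J \<subseteq> L"
   using noetherian_mod_I[OF fp(1,2)] by metis
  have "J = Idl\<^bsub>RQ\<^esub> (cl ` S)" using ideal_generated[OF fp(1,2) S(2,3)] fp(3) by simp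
  moreover have "cl ` S \<subseteq> carrier RQ" using S(2) cl_carrier unfolding pre_def by blast
  ultimately show "\<exists>A\<subseteq>carrier RQ. finite A & J = Idl\<^bsub>RQ\<^esub> A" using S(1) by blast
 qed
qed

lemma generators_pullback:
 assumes S: "S \<subseteq> carrier RQ" "finite S" "cl ` m = Idl\<^bsub>RQ\<^esub> S"
 shows "EX T. finite T & generates_m T & card T <= card S"
proof -
 interpret Q: cring RQ by (rule cring_RQ)
 have "EX f:A. cl f = s" if "s \<in> S" for s
  using subsetD[OF S(1) that] by (rule carrier_RQE) blast
 then obtain r where r: "!!s. s \<in> S ==> r s \<in> A" "!!s. s \<in> S ==> cl (r s) = s" by metis
 have "r s \<in> m" if "s \<in> S" for s
 proof -
  have "s \<in> cl ` m" using subsetD[OF Q.genideal_self[OF S(1)] that] S(3) by simp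
  thus ?thesis using cl_mem[OF fideal_m I_sub_m r(1)[OF that]] r(2)[OF that] by simp
 qed
 moreover have "m \<subseteq> L" if L: "fideal A L" "I \<subseteq> L" "r ` S \<subseteq> L" for L
 proof
  fix f assume f: "f \<in> m"
  have "S \<subseteq> cl ` L" using L(3) r(2) by force
  hence "Idl\<^bsub>RQ\<^esub> S \<subseteq> cl ` L" using Q.genideal_minimal[OF ideal_image[OF L(1)]] by blast
  hence "cl f \<in> cl ` L" using f S(3) by blast
  thus "f \<in> L" using cl_mem[OF L(1,2)] fidealD(1)[OF fideal_m f] by blast
 qed
 ultimately have "generates_m (r ` S)" unfolding generates_m_def by blast
 thus ?thesis using S(2) card_image_le by blast
qed

theorem regular_imp:
 assumes reg: "regular_local_ring RQ" and dep: "adep (Suc l) I"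
  and K: "K \<subseteq> low n" "!!t c. t \<in> K ==> curve n t c \<in> Y"
 shows "card K <= l"
proof -
 obtain M S where M: "maximalideal M RQ" "S \<subseteq> carrier RQ" "finite S" "M = Idl\<^bsub>RQ\<^esub> S" "enat (card S) = krull_dim RQ"
  using reg unfolding regular_local_ring_def by blast
 obtain T where T: "finite T" "generates_m T" "card T <= card S"
  using generators_pullback[OF M(2,3)] M(4) maximal_unique[OF M(1)] by blast
 have "card K <= card T" using generators_ge[OF K T(1,2)] .
 moreover have "card S <= l" using M(5) krull_le[OF dep] by (metis enat_ord_simps(1))
 ultimately show ?thesis using T(3) by simp
qed

theorem regular_if:
 assumes dep: "adep (Suc (card K)) I"
  and P: "!!i. i <= card K ==> fprime (P i)" "!!i. i < card K ==> P i \<subset> P (Suc i)"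
  and K: "K \<subseteq> low n" "!!t c. t \<in> K ==> curve n t c \<in> Y"
  and eqs: "!!t. t \<in> low n - K ==> has_equation n Y t"
 shows "regular_local_ring RQ"
 unfolding regular_local_ring_def
proof (intro conjI)
 show "EX! m. maximalideal m RQ" using maximal_image maximal_unique by blast
 obtain T where T: "finite T" "generates_m T" "card T <= card K" using generators_le[OF eqs K(1)] by blast
 have Tm: "T \<subseteq> m" "!!L. fideal A L ==> I \<subseteq> L ==> T \<subseteq> L ==> m \<subseteq> L" using T(2) unfolding generates_m_def by auto
 have gen: "cl ` m = Idl\<^bsub>RQ\<^esub> (cl ` T)" by (rule ideal_generated[OF fideal_m I_sub_m Tm])
 have sub: "cl ` T \<subseteq> carrier RQ" using Tm(1) fidealD(1)[OF fideal_m] cl_carrier by blast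
 obtain T' where T': "finite T'" "generates_m T'" "card T' <= card (cl ` T)" using generators_pullback[OF sub _ gen] T(1) by blast
 have "card K <= card T'" using generators_ge[OF K T'(1,2)] .
 hence "card (cl ` T) = card K" using T'(3) T(3) card_image_le[OF T(1), of cl] by simp
 moreover have "krull_dim RQ = enat (card K)" using krull_le[OF dep] krull_ge[of "card K" P, OF P] by (metis antisym)
 ultimately show "EX m S. maximalideal m RQ & S \<subseteq> carrier RQ & finite S & m = Idl\<^bsub>RQ\<^esub> S & enat (card S) = krull_dim RQ"
  using maximal_image gen sub T(1) by (intro exI[of _ "cl ` m"] exI[of _ "cl ` T"]) simp
qed (rule cring_RQ noetherian_RQ)+

end

section \<open>Triangular matrices and elimination\<close>

lemma mm:
 assumes "A \<in> carrier_mat n m" "B \<in> carrier_mat m k" "i < n" "j < k"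
 shows "(A * B) $$ (i, j) = (SUM l<m. A $$ (i, l) * B $$ (l, j))"
 using assms by (auto simp: scalar_prod_def atLeast0LessThan intro!: sum.cong)

lemma prod_list_upt: "prod_list (map f [0..<n]) = (PROD i<n. f i)"
 by (simp add: prod.distinct_set_conv_list[symmetric] atLeast0LessThan)

lemma det_upper:
 fixes A :: "complex mat"
 assumes "A \<in> Mat n" "!!i j. i < n ==> j < i ==> A $$ (i, j) = 0"
 shows "det A = (PROD i<n. A $$ (i, i))"
 using det_upper_triangular[of A n] assms by (auto simp: diag_mat_def prod_list_upt upper_triangular_def)

lemma det_lower:
 fixes A :: "complex mat"
 assumes "A \<in> Mat n" "!!i j. j < n ==> i < j ==> A $$ (i, j) = 0"
 shows "det A = (PROD i<n. A $$ (i, i))"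
 using det_lower_triangular[of n A] assms by (auto simp: diag_mat_def prod_list_upt)

lemma det_zero_column:
 fixes A :: "complex mat"
 assumes "A \<in> Mat n" "j < n" "!!i. i < n ==> A $$ (i, j) = 0"
 shows "det A = 0"
 using laplace_expansion_column[OF assms(1,2)] assms(3) by simp

lemma det_zero_row:
 fixes A :: "complex mat"
 assumes "A \<in> Mat n" "i < n" "!!j. j < n ==> A $$ (i, j) = 0"
 shows "det A = 0"
 using laplace_expansion_row[OF assms(1,2)] assms(3) by simp

lemma det_small_rank:
 fixes X Y :: "nat => nat => complex"
 assumes "r < s"
 shows "det (mat s s (%(a, b). SUM l<r. X a l * Y l b)) = 0"
proof -
 let ?X = "mat s s (%(a, l). if l < r then X a l else 0)"
 let ?Y = "mat s s (%(l, b). if l < r then Y l b else 0)"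
 have "mat s s (%(a, b). SUM l<r. X a l * Y l b) = ?X * ?Y"
 proof (rule eq_matI)
  fix a b assume "a < dim_row (?X * ?Y)" "b < dim_col (?X * ?Y)"
  hence ab: "a < s" "b < s" by auto
  have "(?X * ?Y) $$ (a, b) = (SUM l<s. if l < r then X a l * Y l b else 0)"
   using ab by (subst mm[of _ s s _ s]) (auto intro!: sum.cong)
  also have "\<dots> = (SUM l<r. X a l * Y l b)"
   using assms by (subst sum.If_cases) (auto intro!: sum.cong)
  finally show "mat s s (%(a, b). SUM l<r. X a l * Y l b) $$ (a, b) = (?X * ?Y) $$ (a, b)" using ab by simp
 qed auto
 moreover have "det ?X = 0" by (rule det_zero_column[of _ s r]) (use assms in auto)
 moreover have "det (?X * ?Y) = det ?X * det ?Y" by (rule det_mult[of _ s]) auto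
 ultimately show ?thesis by simp
qed

definition lowuni :: "nat => complex mat => bool" where
 "lowuni n u \<equiv> u \<in> Mat n & (ALL i<n. ALL j<n. i <= j --> u $$ (i, j) = (if i = j then 1 else 0))"

definition uppuni :: "nat => complex mat => bool" where
 "uppuni n u \<equiv> u \<in> Mat n & (ALL i<n. ALL j<n. j <= i --> u $$ (i, j) = (if i = j then 1 else 0))"

definition upp :: "nat => complex mat => bool" where
 "upp n t \<equiv> t \<in> Mat n & (ALL i<n. ALL j<i. t $$ (i, j) = 0)"

lemma lowuniD: "lowuni n u ==> u \<in> Mat n" "lowuni n u ==> i < n ==> u $$ (i, i) = 1"
  "lowuni n u ==> j < n ==> i < j ==> u $$ (i, j) = 0"
 unfolding lowuni_def by auto

lemma uppuniD: "uppuni n u ==> u \<in> Mat n" "uppuni n u ==> i < n ==> u $$ (i, i) = 1"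
  "uppuni n u ==> i < n ==> j < i ==> u $$ (i, j) = 0"
 unfolding uppuni_def by auto

lemma uppD: "upp n u ==> u \<in> Mat n" "upp n u ==> i < n ==> j < i ==> u $$ (i, j) = 0"
 unfolding upp_def by auto

lemma uppuni_upp: "uppuni n u ==> upp n u" unfolding uppuni_def upp_def by auto

lemma upp_mult: assumes s: "upp n s" and t: "upp n t"
 shows "upp n (s * t)" "i < n ==> (s * t) $$ (i, i) = s $$ (i, i) * t $$ (i, i)"
proof -
 note c = uppD(1)[OF s] uppD(1)[OF t]
 show "upp n (s * t)"
  unfolding upp_def
 proof (intro conjI allI impI)
  fix i j assume ij: "i < n" "j < i"
  have "s $$ (i, l) * t $$ (l, j) = 0" if "l < n" for l
   using uppD(2)[OF s ij(1), of l] uppD(2)[OF t that, of j] ij by (cases "l < i") auto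
  thus "(s * t) $$ (i, j) = 0" using ij by (subst mm[OF c]) (auto intro!: sum.neutral)
 qed (use c in auto)
 assume i: "i < n"
 have "s $$ (i, l) * t $$ (l, i) = (if l = i then s $$ (i, i) * t $$ (i, i) else 0)" if "l < n" for l
  using uppD(2)[OF s i, of l] uppD(2)[OF t that, of i] by (cases "l < i"; cases "l = i") auto
 hence "(SUM l<n. s $$ (i, l) * t $$ (l, i)) = (SUM l<n. if l = i then s $$ (i, i) * t $$ (i, i) else 0)"
  by (intro sum.cong) auto
 thus "(s * t) $$ (i, i) = s $$ (i, i) * t $$ (i, i)" using i by (subst mm[OF c i i]) simp
qed

lemma uppuni_mult: assumes "uppuni n s" "uppuni n t" shows "uppuni n (s * t)"
proof -
 have "upp n (s * t)" "!!i. i < n ==> (s * t) $$ (i, i) = 1"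
  using upp_mult[OF uppuni_upp[OF assms(1)] uppuni_upp[OF assms(2)]] uppuniD(2)[OF assms(1)] uppuniD(2)[OF assms(2)] by auto
 thus ?thesis unfolding upp_def uppuni_def by (metis le_neq_implies_less)
qed

lemma uppuni_one: "uppuni n (1\<^sub>m n)" and lowuni_one: "lowuni n (1\<^sub>m n)" and upp_one: "upp n (1\<^sub>m n)"
 unfolding uppuni_def lowuni_def upp_def by auto

lemma lowuni_mult: assumes s: "lowuni n s" and t: "lowuni n t" shows "lowuni n (s * t)"
 unfolding lowuni_def
proof (intro conjI allI impI)
 note c = lowuniD(1)[OF s] lowuniD(1)[OF t]
 show "s * t \<in> Mat n" using c by auto
 fix i j assume ij: "i < n" "j < n" "i <= j"
 have "s $$ (i, l) * t $$ (l, j) = (if l = i then (if i = j then 1 else 0) else 0)" if "l < n" for l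
  using lowuniD(3)[OF s that, of i] lowuniD(3)[OF t ij(2), of l] ij lowuniD(2)[OF s ij(1)] lowuniD(2)[OF t ij(2)]
   lowuniD(3)[OF t ij(2), of i]
  by (cases "l < i"; cases "l = i") auto
 hence "(SUM l<n. s $$ (i, l) * t $$ (l, j)) = (SUM l<n. if l = i then (if i = j then 1 else 0) else 0)"
  by (intro sum.cong) auto
 thus "(s * t) $$ (i, j) = (if i = j then 1 else 0)" using ij by (subst mm[OF c ij(1,2)]) simp
qed

lemma uppuni_det: "uppuni n u ==> det u = 1"
 by (subst det_upper[of u n]) (auto dest: uppuniD intro!: prod.neutral)

lemma lowuni_det: "lowuni n u ==> det u = 1"
 by (subst det_lower[of u n]) (auto dest: lowuniD intro!: prod.neutral)

definition SLc :: "nat => complex mat set" where "SLc n = {A \<in> Mat n. det A = 1}"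

lemma SL_carrier: "carrier (SL n) = SLc n" unfolding SL_def SLc_def by simp

lemma borel: "b \<in> borel_subgroup n <-> upp n b & det b = 1"
 unfolding borel_subgroup_def SL_carrier SLc_def upp_def upper_triangular_def by auto

lemma borelD: assumes "b \<in> borel_subgroup n" shows "upp n b" "b \<in> Mat n" "det b = 1" "b \<in> SLc n"
 "i < n ==> b $$ (i, i) ~= 0"
proof -
 show 1: "upp n b" "det b = 1" "b \<in> Mat n" "b \<in> SLc n" using assms unfolding borel upp_def SLc_def by auto
 have "(PROD i<n. b $$ (i, i)) = 1" using det_upper[of b n] 1 unfolding upp_def by simp
 thus "i < n ==> b $$ (i, i) ~= 0" using prod_zero_iff[of "{..<n}" "%i. b $$ (i, i)"] by force
qed

lemma SLc_mult: "A \<in> SLc n ==> B \<in> SLc n ==> A * B \<in> SLc n"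
 unfolding SLc_def by (auto simp: det_mult)

lemma borel_mult: "a \<in> borel_subgroup n ==> b \<in> borel_subgroup n ==> a * b \<in> borel_subgroup n"
 using upp_mult(1)[of n a b] det_mult[of a n b] unfolding borel upp_def by auto

lemma borel_one: "1\<^sub>m n \<in> borel_subgroup n" unfolding borel using upp_one by simp

lemma SLc_inverse:
 assumes "A \<in> SLc n" shows "adj_mat A \<in> SLc n" "A * adj_mat A = 1\<^sub>m n" "adj_mat A * A = 1\<^sub>m n"
proof -
 have A: "A \<in> Mat n" "det A = 1" using assms unfolding SLc_def by auto
 show 1: "A * adj_mat A = 1\<^sub>m n" "adj_mat A * A = 1\<^sub>m n" using adj_mat[OF A(1)] A(2) by auto
 have "det A * det (adj_mat A) = 1" using det_mult[OF A(1) adj_mat(1)[OF A(1)]] 1(1) by simp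
 thus "adj_mat A \<in> SLc n" using A(2) adj_mat(1)[OF A(1)] unfolding SLc_def by simp
qed

lemma borel_inverse: assumes "b \<in> borel_subgroup n" shows "adj_mat b \<in> borel_subgroup n"
proof -
 note B = borelD[OF assms]
 note I = SLc_inverse[OF B(4)]
 have c: "adj_mat b \<in> Mat n" using I(1) unfolding SLc_def by simp
 have "adj_mat b $$ (i, j) = 0" if "j < i" "i < n" for i j
  using that
 proof (induction j rule: less_induct)
  case (less j)
  have "(SUM l<n. adj_mat b $$ (i, l) * b $$ (l, j)) = 0"
   using mm[OF c B(2), of i j] I(3) less.prems by simp
  moreover have "adj_mat b $$ (i, l) * b $$ (l, j) = (if l = j then adj_mat b $$ (i, j) * b $$ (j, j) else 0)" if "l < n" for l
   using less.IH[of l] less.prems uppD(2)[OF B(1) that, of j] by (cases "l < j"; cases "l = j") auto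
  hence "(SUM l<n. adj_mat b $$ (i, l) * b $$ (l, j)) = (SUM l<n. if l = j then adj_mat b $$ (i, j) * b $$ (j, j) else 0)"
   by (intro sum.cong) auto
  ultimately show ?case using B(5)[of j] less.prems by simp
 qed
 thus ?thesis using I(1) c unfolding borel upp_def SLc_def by auto
qed

lemma borel_cancel: assumes "b \<in> borel_subgroup n" "M \<in> Mat n"
 shows "M * b * adj_mat b = M" "adj_mat b * (b * M) = M" "M * adj_mat b * b = M" "b * (adj_mat b * M) = M"
proof -
 note B = borelD[OF assms(1)]
 note I = SLc_inverse[OF B(4)]
 have c: "adj_mat b \<in> Mat n" using I(1) unfolding SLc_def by simp
 show "M * b * adj_mat b = M" using assoc_mult_mat[OF assms(2) B(2) c] I(2) assms(2) by simp
 show "adj_mat b * (b * M) = M" using assoc_mult_mat[OF c B(2) assms(2)] I(3) assms(2) by simp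
 show "M * adj_mat b * b = M" using assoc_mult_mat[OF assms(2) c B(2)] I(3) assms(2) by simp
 show "b * (adj_mat b * M) = M" using assoc_mult_mat[OF B(2) c assms(2)] I(2) assms(2) by simp
qed

subsection \<open>Lower-upper factorization\<close>

definition elim :: "nat => nat => complex mat => complex mat" where
 "elim n c A = mat n n (%(i, j). A $$ (i, j) - (if c < i then A $$ (i, c) / A $$ (c, c) * A $$ (c, j) else 0))"

definition elimR :: "nat => nat => complex mat => complex mat" where
 "elimR n c A = mat n n (%(i, j). if i = j then 1 else if j = c & c < i then A $$ (i, c) / A $$ (c, c) else 0)"

lemma sum_two:
 fixes f :: "nat => complex"
 assumes "i < n" "c < n" "i ~= c" "!!l. l < n ==> l ~= i ==> l ~= c ==> f l = 0"
 shows "(SUM l<n. f l) = f i + f c"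
proof -
 have "(SUM l<n. f l) = (SUM l:{i, c}. f l)" using assms by (intro sum.mono_neutral_right) auto
 thus ?thesis using assms(3) by simp
qed

lemma sum_one:
 fixes f :: "nat => complex"
 assumes "i < n" "!!l. l < n ==> l ~= i ==> f l = 0"
 shows "(SUM l<n. f l) = f i"
proof -
 have "(SUM l<n. f l) = (SUM l:{i}. f l)" using assms by (intro sum.mono_neutral_right) auto
 thus ?thesis by simp
qed

lemma elim_factor:
 assumes A: "A \<in> Mat n" and c: "c < n"
 shows "A = elimR n c A * elim n c A" "lowuni n (elimR n c A)"
proof -
 show "lowuni n (elimR n c A)" unfolding lowuni_def elimR_def by auto
 show "A = elimR n c A * elim n c A"
 proof (rule eq_matI)
  fix i j assume "i < dim_row (elimR n c A * elim n c A)" "j < dim_col (elimR n c A * elim n c A)"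
  hence ij: "i < n" "j < n" unfolding elim_def elimR_def by auto
  have s: "(elimR n c A * elim n c A) $$ (i, j) = (SUM l<n. elimR n c A $$ (i, l) * elim n c A $$ (l, j))"
   using ij by (intro mm) (auto simp: elim_def elimR_def)
  show "A $$ (i, j) = (elimR n c A * elim n c A) $$ (i, j)"
  proof (cases "c < i")
   case True
   have "(SUM l<n. elimR n c A $$ (i, l) * elim n c A $$ (l, j)) = elimR n c A $$ (i, i) * elim n c A $$ (i, j) + elimR n c A $$ (i, c) * elim n c A $$ (c, j)"
    by (rule sum_two) (use ij c True in \<open>auto simp: elimR_def\<close>)
   thus ?thesis unfolding s using ij c True by (simp add: elim_def elimR_def)
  next
   case False
   have "(SUM l<n. elimR n c A $$ (i, l) * elim n c A $$ (l, j)) = elimR n c A $$ (i, i) * elim n c A $$ (i, j)"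
    by (rule sum_one) (use ij c False in \<open>auto simp: elimR_def\<close>)
   thus ?thesis unfolding s using ij c False by (simp add: elim_def elimR_def)
  qed
 qed (use A in \<open>auto simp: elim_def elimR_def\<close>)
qed

definition elimd :: "nat => nat => complex mat => bool" where
 "elimd n c A \<equiv> A \<in> Mat n & (ALL j<c. ALL i<n. j < i --> A $$ (i, j) = 0)"

text \<open>Elimination without pivoting; \<open>\<rho>\<close> records the shape of the multipliers.\<close>
lemma LU_gen:
 assumes tr: "!!i. \<rho> i i" "!!i j k. \<rho> i j ==> \<rho> j k ==> \<rho> i k"
  and inv: "!!A c. Inv A ==> c < n ==> elimd n c A ==> A $$ (c, c) ~= 0 & Inv (elim n c A)"
  and \<rho>: "!!A i j. Inv A ==> i < n ==> j < n ==> A $$ (i, j) ~= 0 ==> \<rho> i j"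
  and A: "Inv A" "A \<in> Mat n"
 shows "EX u t. A = u * t & lowuni n u & upp n t & (ALL i<n. ALL j<n. u $$ (i, j) ~= 0 --> \<rho> i j)"
proof -
 have "EX u t. A = u * t & lowuni n u & elimd n c t & Inv t & (ALL i<n. ALL j<n. u $$ (i, j) ~= 0 --> \<rho> i j)" if "c <= n" for c
  using that
 proof (induction c)
  case 0
  have "A = 1\<^sub>m n * A" using A(2) by simp
  thus ?case using A lowuni_one tr(1) unfolding elimd_def by (intro exI[of _ "1\<^sub>m n"] exI[of _ A]) auto
 next
  case (Suc c)
  then obtain u t where ut: "A = u * t" "lowuni n u" "elimd n c t" "Inv t" "ALL i<n. ALL j<n. u $$ (i, j) ~= 0 --> \<rho> i j"
   by (meson Suc_leD)
  have c: "c < n" using Suc.prems by simp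
  have t: "t \<in> Mat n" using ut(3) unfolding elimd_def by simp
  note f = elim_factor[OF t c]
  note nz = inv[OF ut(4) c ut(3)]
  let ?R = "elimR n c t" and ?T = "elim n c t"
  have Tc: "?T \<in> Mat n" unfolding elim_def by simp
  have "A = u * (?R * ?T)" using ut(1) f(1) by simp
  hence "A = (u * ?R) * ?T" using assoc_mult_mat[OF lowuniD(1)[OF ut(2)] lowuniD(1)[OF f(2)] Tc] by simp
  moreover have "lowuni n (u * ?R)" by (rule lowuni_mult[OF ut(2) f(2)])
  moreover have "elimd n (Suc c) ?T"
   unfolding elimd_def
  proof (intro conjI allI impI)
   fix j i assume ji: "j < Suc c" "i < n" "j < i"
   show "?T $$ (i, j) = 0"
   proof (cases "j = c")
    case True
    thus ?thesis using ji nz c unfolding elim_def by simp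
   next
    case False
    thus ?thesis using ji ut(3) c unfolding elim_def elimd_def by simp
   qed
  qed (rule Tc)
  moreover have "ALL i<n. ALL j<n. (u * ?R) $$ (i, j) ~= 0 --> \<rho> i j"
  proof (intro allI impI)
   fix i j assume ij: "i < n" "j < n" "(u * ?R) $$ (i, j) ~= 0"
   hence "(SUM l<n. u $$ (i, l) * ?R $$ (l, j)) ~= 0" using mm[OF lowuniD(1)[OF ut(2)] lowuniD(1)[OF f(2)] ij(1,2)] by simp
   then obtain l where l: "l < n" "u $$ (i, l) * ?R $$ (l, j) ~= 0" by (meson lessThan_iff sum.neutral)
   have "\<rho> i l" using ut(5) ij(1) l by auto
   moreover have "\<rho> l j" using l ij \<rho>[OF ut(4) l(1) ij(2)] tr(1) unfolding elimR_def by (auto split: if_splits)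
   ultimately show "\<rho> i j" using tr(2) by blast
  qed
  ultimately show ?case using nz by blast
 qed
 then obtain u t where ut: "A = u * t" "lowuni n u" "elimd n n t" "ALL i<n. ALL j<n. u $$ (i, j) ~= 0 --> \<rho> i j"
  by blast
 hence "upp n t" unfolding elimd_def upp_def by auto
 thus ?thesis using ut by blast
qed

definition lead :: "complex mat => nat => complex" where
 "lead M k = det (mat k k (%(a, b). M $$ (a, b)))"

lemma lead_lowuni_mult:
 assumes u: "lowuni n u" and A: "A \<in> Mat n" and k: "k <= n"
 shows "lead (u * A) k = lead A k"
proof -
 let ?r = "%M. mat k k (%(a, b). M $$ (a, b))"
 have "?r (u * A) = ?r u * ?r A"
 proof (rule eq_matI)
  fix a b assume "a < dim_row (?r u * ?r A)" "b < dim_col (?r u * ?r A)"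
  hence ab: "a < k" "b < k" by auto
  have "(u * A) $$ (a, b) = (SUM l<n. u $$ (a, l) * A $$ (l, b))"
   using ab k by (intro mm[OF lowuniD(1)[OF u] A]) auto
  also have "\<dots> = (SUM l<k. u $$ (a, l) * A $$ (l, b))"
   by (rule sum.mono_neutral_right) (use ab k lowuniD(3)[OF u, of _ a] in auto)
  also have "\<dots> = (?r u * ?r A) $$ (a, b)"
   using ab by (subst mm[of _ k k _ k]) auto
  finally show "?r (u * A) $$ (a, b) = (?r u * ?r A) $$ (a, b)" using ab by simp
 qed auto
 moreover have "det (?r u) = 1"
  by (subst det_lower[of _ k]) (use k lowuniD[OF u] in auto)
 moreover have "det (?r u * ?r A) = det (?r u) * det (?r A)" by (rule det_mult[of _ k]) auto
 ultimately show ?thesis unfolding lead_def by simp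
qed

theorem LU:
 assumes A: "A \<in> Mat n" and nz: "!!k. k <= n ==> lead A k ~= 0"
 shows "EX u t. A = u * t & lowuni n u & upp n t"
proof -
 let ?Inv = "%A. A \<in> Mat n & (ALL k<=n. lead A k ~= 0)"
 have inv: "A $$ (c, c) ~= 0 & ?Inv (elim n c A)" if A: "?Inv A" "c < n" "elimd n c A" for A c
 proof
  have "lead A (Suc c) = (PROD i<Suc c. mat (Suc c) (Suc c) (%(a, b). A $$ (a, b)) $$ (i, i))"
   unfolding lead_def by (rule det_upper) (use A in \<open>auto simp: elimd_def\<close>)
  moreover have "lead A (Suc c) ~= 0" using A by auto
  ultimately show "A $$ (c, c) ~= 0" by auto
  have T: "elim n c A \<in> Mat n" unfolding elim_def by simp
  have Ac: "A \<in> Mat n" using A by blast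
  have "lead (elim n c A) k = lead A k" if "k <= n" for k
   using lead_lowuni_mult[OF elim_factor(2)[OF Ac A(2)] T that] elim_factor(1)[OF Ac A(2)] by simp
  thus "?Inv (elim n c A)" using A(1) T by auto
 qed
 show ?thesis using LU_gen[of "%_ _. True" ?Inv n A, OF _ _ inv] A nz by auto
qed

text \<open>A matrix that is triangular for another order of the indices never needs a pivot.\<close>
theorem LU_triangular:
 fixes w :: "nat => nat"
 assumes A: "A \<in> Mat n" and w: "inj w"
  and tri: "!!i j. i < n ==> j < n ==> A $$ (i, j) ~= 0 ==> w i <= w j" and diag: "!!i. i < n ==> A $$ (i, i) ~= 0"
 shows "EX u t. A = u * t & lowuni n u & upp n t & (ALL i<n. ALL j<n. u $$ (i, j) ~= 0 --> w i <= w j)"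
proof -
 let ?Inv = "%A. ALL i<n. A $$ (i, i) ~= 0 & (ALL j<n. A $$ (i, j) ~= 0 --> w i <= w j)"
 have inv: "A $$ (c, c) ~= 0 & ?Inv (elim n c A)" if A: "?Inv A" "c < n" for A c
 proof (intro conjI allI impI)
  show "A $$ (c, c) ~= 0" using A by blast
  fix i assume i: "i < n"
  show "elim n c A $$ (i, i) ~= 0"
  proof (cases "c < i")
   case True
   have "A $$ (i, c) = 0 | A $$ (c, i) = 0" using A i True injD[OF w, of i c] by (metis antisym less_irrefl)
   thus ?thesis using A i True unfolding elim_def by auto
  qed (use A i in \<open>auto simp: elim_def\<close>)
  fix j assume j: "j < n" "elim n c A $$ (i, j) ~= 0"
  hence "A $$ (i, j) ~= 0 | A $$ (i, c) ~= 0 & A $$ (c, j) ~= 0" using i unfolding elim_def by (auto split: if_splits)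
  thus "w i <= w j"
  proof
   assume "A $$ (i, c) ~= 0 & A $$ (c, j) ~= 0"
   hence "w i <= w c" "w c <= w j" using A(1)[rule_format, OF i] A(1)[rule_format, OF A(2)] A(2) j(1) by simp_all
   thus ?thesis by (rule order_trans)
  qed (use A(1)[rule_format, OF i] j(1) in simp)
 qed
 show ?thesis
 proof (rule LU_gen[of "%i j. w i <= w j" ?Inv n A])
  show "A $$ (c, c) ~= 0 & ?Inv (elim n c A)" if "?Inv A" "c < n" "elimd n c A" for A c
   by (rule inv[OF that(1,2)])
  show "w i <= w j" if "?Inv A" "i < n" "j < n" "A $$ (i, j) ~= 0" for A i j
   using that(1)[rule_format, OF that(2)] that(3,4) by simp
  show "?Inv A" using tri diag by simp
 qed (use A in simp_all)
qed

subsection \<open>Bruhat decomposition\<close>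

lemma perm_matrix_carrier: "perm_matrix n w \<in> Mat n"
 unfolding perm_matrix_def by simp

definition pcol :: "(nat => nat) => nat => nat" where "pcol w j = w (Suc j) - 1"

definition psgn :: "(nat => nat) => nat => complex" where
 "psgn w j = (if j = 0 then of_int (sign w) else 1)"

lemma psgn_nz: "psgn w j ~= 0" unfolding psgn_def sign_def by auto

lemma Suc_pcol: assumes "perm n w" "j < n" shows "Suc (pcol w j) = w (Suc j)" "pcol w j < n"
proof -
 have "w (Suc j) \<in> {1..n}" using assms by (subst permutes_in_image[OF assms(1)]) auto
 thus "Suc (pcol w j) = w (Suc j)" "pcol w j < n" unfolding pcol_def by auto
qed

lemma pcol_inj: assumes "perm n w" "i < n" "j < n" "pcol w i = pcol w j" shows "i = j"
proof -
 have "w (Suc i) = w (Suc j)" using Suc_pcol(1)[OF assms(1,2)] Suc_pcol(1)[OF assms(1,3)] assms(4) by simp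
 thus ?thesis using injD[OF permutes_inj[OF assms(1)]] by blast
qed

lemma perm_matrix_entry: assumes "perm n w" "i < n" "j < n"
 shows "perm_matrix n w $$ (i, j) = (if i = pcol w j then psgn w j else 0)"
 unfolding perm_matrix_def psgn_def using assms Suc_pcol(1)[OF assms(1,3)] by auto

lemma pcol_permutes: assumes w: "perm n w" 
 shows "EX p. p permutes {0..<n} & (ALL j<n. p j = pcol w j) & sign p = sign w"
proof -
 let ?f = "%i :: nat. i - 1"
 let ?p = "map_permutation {1..n} ?f w"
 have bij: "bij_betw ?f {1..n} {0..<n}" by (rule bij_betw_byWitness[of _ Suc]) auto
 hence inj: "inj_on ?f {1..n}" by (rule bij_betw_imp_inj_on)
 have "?p permutes {0..<n}" by (rule map_permutation_permutes[OF bij w])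
 moreover have "?p j = pcol w j" if "j < n" for j
  using map_permutation_apply[OF inj, of "Suc j" w] that unfolding pcol_def by simp
 moreover have "sign ?p = sign w" by (rule sign_map_permutation[OF inj w]) simp
 ultimately show ?thesis by blast
qed

lemma perm_matrix_SL: assumes w: "perm n w" shows "perm_matrix n w \<in> SLc n"
proof -
 obtain p where p: "p permutes {0..<n}" "!!j. j < n ==> p j = pcol w j" "sign p = sign w"
  using pcol_permutes[OF w] by blast
 let ?A = "perm_matrix n w"
 have off: "(PROD j<n. ?A $$ (q j, j)) = 0" if q: "q permutes {0..<n}" "q ~= p" for q
 proof -
  obtain j where "q j ~= p j" using q(2) by blast
  moreover from this have j: "j < n" using q(1) p(1) by (metis atLeastLessThan_iff not_less permutes_not_in zero_le)
  moreover have "q j < n" using q(1) j permutes_in_image[OF q(1), of j] by simp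
  ultimately have "?A $$ (q j, j) = 0" using perm_matrix_entry[OF w] p(2) by simp
  thus ?thesis using j by (intro prod_zero) auto
 qed
 have "(SUM q | q permutes {0..<n}. signof q * (PROD j<n. ?A $$ (q j, j))) = (SUM q:{p}. signof q * (PROD j<n. ?A $$ (q j, j)))"
 proof (intro sum.mono_neutral_right)
  show "ALL q:{q. q permutes {0..<n}} - {p}. signof q * (PROD j<n. ?A $$ (q j, j)) = 0" using off by simp
 qed (use p(1) in \<open>simp_all add: finite_permutations\<close>)
 also have "\<dots> = signof p * (PROD j<n. psgn w j)"
 proof -
  have "(PROD j<n. ?A $$ (p j, j)) = (PROD j<n. psgn w j)"
   by (rule prod.cong[OF refl]) (simp add: p(2) Suc_pcol(2)[OF w] perm_matrix_entry[OF w])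
  thus ?thesis by simp
 qed
 also have "(PROD j<n. psgn w j) = (if n = 0 then 1 else of_int (sign w))"
 proof (cases n)
  case (Suc k)
  have "(PROD j<Suc k. psgn w j) = psgn w 0 * (PROD j<k. psgn w (Suc j))" by (rule prod.lessThan_Suc_shift)
  thus ?thesis using Suc by (simp add: psgn_def)
 qed simp
 also have "signof p * (if n = 0 then 1 else of_int (sign w)) = (1 :: complex)"
 proof (cases "n = 0")
  case True
  thus ?thesis using p(1) by (auto simp: sign_id)
 next
  case False
  thus ?thesis using p(3) by (auto simp: sign_def)
 qed
 finally have "det ?A = 1" using det_col[OF perm_matrix_carrier, of n w] by simp
 thus ?thesis using perm_matrix_carrier unfolding SLc_def by simp
qed

text \<open>A matrix with the support of a permutation matrix is that matrix up to a torus element.\<close>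
lemma monomial_factor:
 assumes y: "perm n y" and M: "M \<in> SLc n"
  and supp: "!!i j. i < n ==> j < n ==> M $$ (i, j) ~= 0 ==> i = pcol y j"
 shows "EX D:borel_subgroup n. M = perm_matrix n y * D"
proof -
 let ?D = "mat n n (%(i, j). if i = j then M $$ (pcol y j, j) / psgn y j else 0)"
 have Mc: "M \<in> Mat n" using M unfolding SLc_def by simp
 have eq: "M = perm_matrix n y * ?D"
 proof (rule eq_matI)
  fix i j assume "i < dim_row (perm_matrix n y * ?D)" "j < dim_col (perm_matrix n y * ?D)"
  hence ij: "i < n" "j < n" using perm_matrix_carrier[of n y] by auto
  have "(perm_matrix n y * ?D) $$ (i, j) = (SUM l<n. perm_matrix n y $$ (i, l) * ?D $$ (l, j))"
   by (rule mm[OF perm_matrix_carrier _ ij]) simp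
  also have "\<dots> = perm_matrix n y $$ (i, j) * ?D $$ (j, j)"
   by (rule sum_one) (use ij in auto)
  also have "\<dots> = M $$ (i, j)"
   using perm_matrix_entry[OF y ij] supp[OF ij] ij psgn_nz[of y j] by auto
  finally show "M $$ (i, j) = (perm_matrix n y * ?D) $$ (i, j)" by simp
 qed (use Mc in \<open>auto simp: perm_matrix_def\<close>)
 have "det M = det (perm_matrix n y) * det ?D" by (subst eq, rule det_mult[OF perm_matrix_carrier]) simp
 hence "det ?D = 1" using M perm_matrix_SL[OF y] unfolding SLc_def by simp
 moreover have "upp n ?D" unfolding upp_def by auto
 ultimately have "?D \<in> borel_subgroup n" unfolding borel by (intro conjI)
 with eq show ?thesis by (rule bexI)
qed

definition mono_upto :: "nat => nat => (nat => nat) => complex mat => bool" where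
 "mono_upto n c p A \<equiv> A \<in> Mat n & det A ~= 0 & inj_on p {..<c} & (ALL j<c. p j < n) &
   (ALL j<c. ALL i<n. A $$ (i, j) ~= 0 <-> i = p j)"

text \<open>In each column the lowest entry outside the rows already used becomes the pivot, so row
 operations only go upwards.\<close>
lemma bruhat_step:
 assumes S: "mono_upto n c p A" and c: "c < n"
 shows "EX R C A' r. uppuni n R & uppuni n C & A = R * A' * C & mono_upto n (Suc c) (p(c := r)) A'"
proof -
 have A: "A \<in> Mat n" "det A ~= 0" "inj_on p {..<c}" "!!j. j < c ==> p j < n"
  "!!i j. j < c ==> i < n ==> A $$ (i, j) ~= 0 <-> i = p j"
  using S unfolding mono_upto_def by auto
 define h where "h k = A $$ (p k, c) / A $$ (p k, k)" for k
 define C where "C = mat n n (%(k, j). if k = j then 1 else if j = c & k < c then h k else 0)"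
 define B where "B = mat n n (%(i, j). if j = c then A $$ (i, c) - (SUM k<c. A $$ (i, k) * h k) else A $$ (i, j))"
 have Cu: "uppuni n C" unfolding uppuni_def C_def by auto
 have Bc: "B \<in> Mat n" unfolding B_def by simp
 have BC: "A = B * C"
 proof (rule eq_matI)
  fix i j assume "i < dim_row (B * C)" "j < dim_col (B * C)"
  hence ij: "i < n" "j < n" unfolding B_def C_def by auto
  have "(B * C) $$ (i, j) = (SUM l<n. B $$ (i, l) * C $$ (l, j))" by (rule mm[OF Bc uppuniD(1)[OF Cu] ij])
  also have "\<dots> = A $$ (i, j)"
  proof (cases "j = c")
   case True
   have "(SUM l<n. B $$ (i, l) * C $$ (l, j)) = (SUM l<Suc c. B $$ (i, l) * C $$ (l, j))"
    by (rule sum.mono_neutral_right) (use ij c True in \<open>auto simp: C_def\<close>)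
   also have "\<dots> = (SUM l<c. B $$ (i, l) * C $$ (l, c)) + B $$ (i, c)" using True c by (simp add: C_def)
   also have "(SUM l<c. B $$ (i, l) * C $$ (l, c)) = (SUM k<c. A $$ (i, k) * h k)"
    by (rule sum.cong) (use ij c in \<open>auto simp: B_def C_def\<close>)
   finally show ?thesis using ij c True by (simp add: B_def)
  next
   case False
   have "(SUM l<n. B $$ (i, l) * C $$ (l, j)) = B $$ (i, j) * C $$ (j, j)"
    by (rule sum_one) (use ij False in \<open>auto simp: C_def\<close>)
   thus ?thesis using ij False by (simp add: B_def C_def)
  qed
  finally show "A $$ (i, j) = (B * C) $$ (i, j)" by simp
 qed (use A(1) in \<open>auto simp: B_def C_def\<close>)
 have detB: "det B ~= 0" using A(2) det_mult[OF Bc uppuniD(1)[OF Cu]] BC by auto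
 have "EX i<n. B $$ (i, c) ~= 0" using det_zero_column[OF Bc c] detB by blast
 hence fin: "finite {i. i < n & B $$ (i, c) ~= 0}" "{i. i < n & B $$ (i, c) ~= 0} ~= {}" by auto
 define r where "r = Max {i. i < n & B $$ (i, c) ~= 0}"
 have r: "r < n" "B $$ (r, c) ~= 0" using Max_in[OF fin] unfolding r_def by auto
 have rmax: "B $$ (i, c) = 0" if "i < n" "r < i" for i
  using Max_ge[OF fin(1), of i] that unfolding r_def by fastforce
 have Bp: "B $$ (p k, c) = 0" if k: "k < c" for k
 proof -
  have "(SUM l<c. A $$ (p k, l) * h l) = A $$ (p k, k) * h k"
  proof (rule sum_one[OF k])
   fix l assume "l < c" "l ~= k"
   hence "p k ~= p l" using A(3) k by (metis inj_onD lessThan_iff)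
   thus "A $$ (p k, l) * h l = 0" using A(5)[OF \<open>l < c\<close> A(4)[OF k]] by simp
  qed
  moreover have "A $$ (p k, k) ~= 0" using A(5)[OF k A(4)[OF k]] by simp
  ultimately show ?thesis using A(4)[OF k] c by (simp add: B_def h_def)
 qed
 have rp: "r ~= p k" if "k < c" for k using Bp[OF that] r(2) by auto
 define v where "v i = (if i < r then B $$ (i, c) / B $$ (r, c) else 0)" for i
 define R where "R = mat n n (%(i, j). if i = j then 1 else if j = r then v i else 0)"
 define A' where "A' = mat n n (%(i, j). B $$ (i, j) - v i * B $$ (r, j))"
 have Ru: "uppuni n R" unfolding uppuni_def R_def v_def by auto
 have A'c: "A' \<in> Mat n" unfolding A'_def by simp
 have RA: "B = R * A'"
 proof (rule eq_matI)
  fix i j assume "i < dim_row (R * A')" "j < dim_col (R * A')"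
  hence ij: "i < n" "j < n" unfolding R_def A'_def by auto
  have "(R * A') $$ (i, j) = (SUM l<n. R $$ (i, l) * A' $$ (l, j))" by (rule mm[OF uppuniD(1)[OF Ru] A'c ij])
  also have "\<dots> = B $$ (i, j)"
  proof (cases "i = r")
   case True
   have "(SUM l<n. R $$ (i, l) * A' $$ (l, j)) = R $$ (i, i) * A' $$ (i, j)"
    by (rule sum_one) (use ij True in \<open>auto simp: R_def v_def\<close>)
   thus ?thesis using ij True by (simp add: R_def A'_def v_def)
  next
   case False
   have "(SUM l<n. R $$ (i, l) * A' $$ (l, j)) = R $$ (i, i) * A' $$ (i, j) + R $$ (i, r) * A' $$ (r, j)"
    by (rule sum_two) (use ij r False in \<open>auto simp: R_def\<close>)
   thus ?thesis using ij r False by (simp add: R_def A'_def v_def)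
  qed
  finally show "B $$ (i, j) = (R * A') $$ (i, j)" by simp
 qed (use Bc in \<open>auto simp: R_def A'_def\<close>)
 have detA': "det A' ~= 0" using detB det_mult[OF uppuniD(1)[OF Ru] A'c] RA by auto
 have old: "A' $$ (i, j) = A $$ (i, j)" if "j < c" "i < n" for i j
 proof -
  have "A $$ (r, j) = 0" using A(5)[OF that(1) r(1)] rp[OF that(1)] by simp
  thus ?thesis using that r c by (simp add: A'_def B_def)
 qed
 have new: "A' $$ (i, c) ~= 0 <-> i = r" if "i < n" for i
  using that c r rmax[OF that] by (cases "i < r"; cases "i = r") (auto simp: A'_def v_def)
 have "mono_upto n (Suc c) (p(c := r)) A'"
  unfolding mono_upto_def
 proof (intro conjI allI impI)
  show "inj_on (p(c := r)) {..<Suc c}"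
  proof (rule inj_onI)
   fix a b assume "a \<in> {..<Suc c}" "b \<in> {..<Suc c}" "(p(c := r)) a = (p(c := r)) b"
   thus "a = b" using A(3) rp[of a] rp[of b] by (cases "a = c"; cases "b = c") (auto dest: inj_onD)
  qed
  show "(p(c := r)) j < n" if "j < Suc c" for j using that A(4) r(1) by auto
  show "A' $$ (i, j) ~= 0 <-> i = (p(c := r)) j" if "j < Suc c" "i < n" for i j
   using that old new A(5) by (cases "j = c") auto
 qed (use A'c detA' in auto)
 moreover have "A = R * A' * C" using BC RA by simp
 ultimately show ?thesis using Ru Cu by blast
qed

lemma mono_perm:
 assumes S: "mono_upto n n p M" and M: "M \<in> SLc n"
 shows "EX x. perm n x & (EX D:borel_subgroup n. M = perm_matrix n x * D)"
proof -
 have p: "inj_on p {..<n}" "!!j. j < n ==> p j < n" "!!i j. j < n ==> i < n ==> M $$ (i, j) ~= 0 <-> i = p j"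
  using S unfolding mono_upto_def by auto
 define x where "x i = (if i \<in> {1..n} then Suc (p (i - 1)) else i)" for i
 have "inj_on x {1..n}"
 proof (rule inj_onI)
  fix a b assume ab: "a \<in> {1..n}" "b \<in> {1..n}" "x a = x b"
  hence "p (a - 1) = p (b - 1)" unfolding x_def by simp
  moreover have "a - 1 \<in> {..<n}" "b - 1 \<in> {..<n}" using ab(1,2) by auto
  ultimately have "a - 1 = b - 1" by (rule inj_onD[OF p(1)])
  thus "a = b" using ab by auto
 qed
 moreover have "x ` {1..n} \<subseteq> {1..n}" using p(2) unfolding x_def by (auto simp: Suc_le_eq)
 ultimately have "bij_betw x {1..n} {1..n}" by (simp add: bij_betw_def endo_inj_surj)
 hence x: "perm n x" by (rule bij_imp_permutes) (auto simp: x_def)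
 have "pcol x j = p j" if "j < n" for j using that unfolding pcol_def x_def by simp
 hence "EX D:borel_subgroup n. M = perm_matrix n x * D"
  using p(3) by (intro monomial_factor[OF x M]) auto
 thus ?thesis using x by blast
qed

theorem bruhat_decomposition:
 assumes M: "M \<in> SLc n"
 obtains x b b' where "perm n x" "b \<in> borel_subgroup n" "b' \<in> borel_subgroup n" "M = b * perm_matrix n x * b'"
proof -
 have Mc: "M \<in> Mat n" "det M = 1" using M unfolding SLc_def by auto
 have "EX R C A p. uppuni n R & uppuni n C & M = R * A * C & mono_upto n c p A" if "c <= n" for c
  using that
 proof (induction c)
  case 0
  have "mono_upto n 0 p M" for p unfolding mono_upto_def using Mc by simp
  moreover have "M = 1\<^sub>m n * M * 1\<^sub>m n" using Mc by simp
  ultimately show ?case using uppuni_one by blast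
 next
  case (Suc c)
  from Suc.IH[OF Suc_leD[OF Suc.prems]]
  obtain R C A p where 1: "uppuni n R" "uppuni n C" "M = R * A * C" "mono_upto n c p A" by (elim exE conjE)
  from bruhat_step[OF 1(4) Suc_le_lessD[OF Suc.prems]]
  obtain R' C' A' r where 2: "uppuni n R'" "uppuni n C'" "A = R' * A' * C'" "mono_upto n (Suc c) (p(c := r)) A'" by (elim exE conjE)
  have c: "R \<in> Mat n" "C \<in> Mat n" "R' \<in> Mat n" "C' \<in> Mat n" "A' \<in> Mat n"
   using 1 2 unfolding uppuni_def mono_upto_def by auto
  have "M = R * (R' * A' * C') * C" using 1(3) 2(3) by simp
  also have "\<dots> = (R * R') * A' * (C' * C)" using c by (simp add: assoc_mat)
  finally show ?case using uppuni_mult[OF 1(1) 2(1)] uppuni_mult[OF 2(2) 1(2)] 2(4) by blast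
 qed
 from this[OF order_refl] obtain R C A p where 1: "uppuni n R" "uppuni n C" "M = R * A * C" "mono_upto n n p A" by (elim exE conjE)
 have c: "R \<in> Mat n" "C \<in> Mat n" "A \<in> Mat n"
  using 1 unfolding uppuni_def mono_upto_def by auto
 have "det M = det R * det A * det C" unfolding 1(3) using c by (simp add: det_mult[of _ n])
 hence "det A = 1" using Mc(2) uppuni_det[OF 1(1)] uppuni_det[OF 1(2)] by simp
 hence "A \<in> SLc n" using c(3) unfolding SLc_def by simp
 from mono_perm[OF 1(4) this] obtain x D where x: "perm n x" "D \<in> borel_subgroup n" "A = perm_matrix n x * D" by blast
 have RB: "R \<in> borel_subgroup n" "C \<in> borel_subgroup n"
  using 1(1,2) uppuni_upp uppuni_det unfolding borel by auto
 have "M = R * perm_matrix n x * (D * C)"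
  unfolding 1(3) x(3) using c borelD(2)[OF x(2)] perm_matrix_carrier[of n x] by (simp add: assoc_mat)
 thus ?thesis using that[OF x(1) RB(1) borel_mult[OF x(2) RB(2)]] by blast
qed

section \<open>Schubert conditions and the Bruhat order\<close>

definition mtimes :: "nat => complex mat => complex mat => complex mat" where
 "mtimes n A B = mat n n (%(i, j). SUM l<n. A $$ (i, l) * B $$ (l, j))"

lemma mtimes: "A \<in> Mat n ==> B \<in> Mat n ==> mtimes n A B = A * B"
 by (rule eq_matI) (auto simp: mtimes_def mm[of A n n B n] simp del: index_mult_mat(1))

lemma pf_left: assumes F: "F \<in> poly_fun n" shows "(%M. F (mtimes n A M)) \<in> poly_fun n"
proof (rule pf_subst[OF F])
 fix i j assume ij: "i < n" "j < n"
 have "(%M. SUM l<n. A $$ (i, l) * M $$ (l, j)) \<in> poly_fun n" using ij by (intro pf_sum pf) auto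
 thus "(%M. mtimes n A M $$ (i, j)) \<in> poly_fun n" using ij by (simp add: mtimes_def)
qed

lemma pf_right: assumes F: "F \<in> poly_fun n" shows "(%M. F (mtimes n M A)) \<in> poly_fun n"
proof (rule pf_subst[OF F])
 fix i j assume ij: "i < n" "j < n"
 have "(%M. SUM l<n. M $$ (i, l) * A $$ (l, j)) \<in> poly_fun n" using ij by (intro pf_sum pf) auto
 thus "(%M. mtimes n M A $$ (i, j)) \<in> poly_fun n" using ij by (simp add: mtimes_def)
qed

abbreviation pm :: "nat => (nat => nat) => complex mat" where "pm \<equiv> perm_matrix"
abbreviation Bor :: "nat => complex mat set" where "Bor \<equiv> borel_subgroup"

definition SX :: "nat => (nat => nat) => complex mat set" where
 "SX n w = {M \<in> SLc n. ALL E:poly_fun n. (ALL b:Bor n. ALL b':Bor n. E (b * pm n w * b') = 0) --> E M = 0}"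

lemma SXD: "M \<in> SX n w ==> M \<in> SLc n" "M \<in> SX n w ==> M \<in> Mat n"
  "M \<in> SX n w ==> E \<in> poly_fun n ==> (!!b b'. b \<in> Bor n ==> b' \<in> Bor n ==> E (b * pm n w * b') = 0) ==> E M = 0"
 unfolding SX_def SLc_def by auto

lemma cell_SX: assumes "perm n w" "b \<in> Bor n" "b' \<in> Bor n" shows "b * pm n w * b' \<in> SX n w"
 using assms SLc_mult perm_matrix_SL borelD(4) unfolding SX_def by auto

lemma pm_SX: assumes "perm n w" shows "pm n w \<in> SX n w"
 using cell_SX[OF assms borel_one borel_one] perm_matrix_carrier[of n w] by simp

lemma SX_stable:
 assumes M: "M \<in> SX n w" and a: "a \<in> Bor n" and a': "a' \<in> Bor n"
 shows "a * M * a' \<in> SX n w"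
proof -
 note ac = borelD(2)[OF a] borelD(2)[OF a']
 have "E (a * M * a') = 0" if E: "E \<in> poly_fun n" "!!b b'. b \<in> Bor n ==> b' \<in> Bor n ==> E (b * pm n w * b') = 0" for E
 proof -
  have "E (mtimes n (mtimes n a M) a') = 0"
  proof (rule SXD(3)[OF M])
   show "(%M. E (mtimes n (mtimes n a M) a')) \<in> poly_fun n"
    using pf_left[OF pf_right[OF E(1)]] .
   fix b b' assume b: "b \<in> Bor n" "b' \<in> Bor n"
   note bc = borelD(2)[OF b(1)] borelD(2)[OF b(2)]
   have "mtimes n (mtimes n a (b * pm n w * b')) a' = (a * b) * pm n w * (b' * a')"
    using ac bc perm_matrix_carrier[of n w] by (simp add: mtimes assoc_mat)
   thus "E (mtimes n (mtimes n a (b * pm n w * b')) a') = 0"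
    using E(2)[OF borel_mult[OF a b(1)] borel_mult[OF b(2) a']] by simp
  qed
  thus ?thesis using ac SXD(2)[OF M] by (simp add: mtimes)
 qed
 moreover have "a * M * a' \<in> SLc n" using SLc_mult SXD(1)[OF M] borelD(4)[OF a] borelD(4)[OF a'] by blast
 ultimately show ?thesis unfolding SX_def by blast
qed

lemma SX_right: "M \<in> SX n w ==> a \<in> Bor n ==> M * a \<in> SX n w"
 using SX_stable[OF _ borel_one] SXD(2) by fastforce

lemma SX_left: "M \<in> SX n w ==> a \<in> Bor n ==> a * M \<in> SX n w"
 using SX_stable[OF _ _ borel_one, of M n w a] SXD(2)[of M n w] borelD(2)[of a n] by (metis mult_carrier_mat right_mult_one_mat)

lemma SX_mono: assumes "pm n y \<in> SX n w" shows "SX n y \<subseteq> SX n w"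
proof
 fix M assume M: "M \<in> SX n y"
 have "E M = 0" if E: "E \<in> poly_fun n" "ALL b:Bor n. ALL b':Bor n. E (b * pm n w * b') = 0" for E
  using SXD(3)[OF SX_stable[OF assms] E(1)] E(2) by (intro SXD(3)[OF M E(1)]) blast
 thus "M \<in> SX n w" using SXD(1)[OF M] unfolding SX_def by blast
qed

lemma card_rk:
 assumes w: "perm n w" and p: "p <= n"
 shows "card {l. l < p & q <= pcol w l} = rk w p q"
proof -
 have "bij_betw Suc {l. l < p & q <= pcol w l} {i. i <= p & q < w i}"
 proof (rule bij_betw_byWitness[of _ "%i. i - 1"])
  have w0: "w 0 = 0" using w by (simp add: permutes_def)
  show "ALL a:{i. i <= p & q < w i}. Suc (a - 1) = a" 
  proof
   fix i assume i: "i \<in> {i. i <= p & q < w i}"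
   hence "i ~= 0" using w0 by (cases "i = 0") auto
   thus "Suc (i - 1) = i" by simp
  qed
  show "Suc ` {l. l < p & q <= pcol w l} \<subseteq> {i. i <= p & q < w i}"
  proof (rule image_subsetI)
   fix l assume l: "l \<in> {l. l < p & q <= pcol w l}"
   hence "Suc (pcol w l) = w (Suc l)" using Suc_pcol(1)[OF w] p by simp
   thus "Suc l \<in> {i. i <= p & q < w i}" using l by auto
  qed
  show "(%i. i - 1) ` {i. i <= p & q < w i} \<subseteq> {l. l < p & q <= pcol w l}"
  proof (rule image_subsetI)
   fix i assume i: "i \<in> {i. i <= p & q < w i}"
   hence "i ~= 0" using w0 by (cases "i = 0") auto
   thus "i - 1 \<in> {l. l < p & q <= pcol w l}" using i by (auto simp: pcol_def)
  qed
 qed auto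
 thus ?thesis unfolding rk_def by (rule bij_betw_same_card)
qed

text \<open>On a cell, the submatrix of the first \<open>p\<close> columns and the rows from \<open>q\<close> on factors through
 as many dimensions as \<open>w\<close> has points in that corner.\<close>
lemma minor_cell:
 assumes w: "perm n w" and b: "b \<in> Bor n" "b' \<in> Bor n" and p: "p <= n"
  and s: "rk w p q < s" and \<rho>: "!!a. a < s ==> q <= \<rho> a" "!!a. a < s ==> \<rho> a < n" and \<gamma>: "!!a. a < s ==> \<gamma> a < p"
 shows "det (mat s s (%(a, c). (b * pm n w * b') $$ (\<rho> a, \<gamma> c))) = 0"
proof -
 let ?J = "{l. l < p & q <= pcol w l}" and ?r = "rk w p q"
 note bc = borelD(2)[OF b(1)] borelD(2)[OF b(2)]
 have "finite ?J" by simp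
 then obtain h where h: "bij_betw h {..<?r} ?J"
  using ex_bij_betw_nat_finite[of ?J] card_rk[OF w p, of q] by (metis atLeast0LessThan)
 have entry: "(b * pm n w * b') $$ (\<rho> a, \<gamma> c) = (SUM k<?r. (b $$ (\<rho> a, pcol w (h k)) * psgn w (h k)) * b' $$ (h k, \<gamma> c))" if ac: "a < s" "c < s" for a c
 proof -
  have lt: "\<rho> a < n" "\<gamma> c < n" using \<rho>(2) \<gamma> ac p less_le_trans by blast+
  have P: "(b * pm n w) $$ (\<rho> a, l) = b $$ (\<rho> a, pcol w l) * psgn w l" if l: "l < n" for l
  proof -
   have "(b * pm n w) $$ (\<rho> a, l) = (SUM k<n. b $$ (\<rho> a, k) * pm n w $$ (k, l))"
    by (rule mm[OF bc(1) perm_matrix_carrier lt(1) l])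
   also have "\<dots> = b $$ (\<rho> a, pcol w l) * pm n w $$ (pcol w l, l)"
    by (rule sum_one) (use l Suc_pcol(2)[OF w] perm_matrix_entry[OF w] in auto)
   finally show ?thesis using perm_matrix_entry[OF w Suc_pcol(2)[OF w l] l] by simp
  qed
  have "(b * pm n w * b') $$ (\<rho> a, \<gamma> c) = (SUM l<n. (b * pm n w) $$ (\<rho> a, l) * b' $$ (l, \<gamma> c))"
   by (rule mm[OF mult_carrier_mat[OF bc(1) perm_matrix_carrier] bc(2) lt])
  also have "\<dots> = (SUM l:?J. (b * pm n w) $$ (\<rho> a, l) * b' $$ (l, \<gamma> c))"
  proof (rule sum.mono_neutral_right)
   show "ALL l:{..<n} - ?J. (b * pm n w) $$ (\<rho> a, l) * b' $$ (l, \<gamma> c) = 0"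
   proof
    fix l assume l: "l \<in> {..<n} - ?J"
    show "(b * pm n w) $$ (\<rho> a, l) * b' $$ (l, \<gamma> c) = 0"
    proof (cases "l < p")
     case True
     hence "pcol w l < \<rho> a" using l \<rho>(1)[OF ac(1)] by auto
     thus ?thesis using P l uppD(2)[OF borelD(1)[OF b(1)] lt(1)] by auto
    next
     case False
     hence "\<gamma> c < l" using \<gamma>[OF ac(2)] by simp
     thus ?thesis using l uppD(2)[OF borelD(1)[OF b(2)], of l "\<gamma> c"] by auto
    qed
   qed
  qed (use p in auto)
  also have "\<dots> = (SUM k<?r. (b * pm n w) $$ (\<rho> a, h k) * b' $$ (h k, \<gamma> c))"
   by (rule sum.reindex_bij_betw[OF h, symmetric])
  also have "\<dots> = (SUM k<?r. (b $$ (\<rho> a, pcol w (h k)) * psgn w (h k)) * b' $$ (h k, \<gamma> c))"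
  proof (rule sum.cong[OF refl])
   fix k assume "k \<in> {..<?r}"
   hence "h k \<in> ?J" using h by (auto simp: bij_betw_def)
   thus "(b * pm n w) $$ (\<rho> a, h k) * b' $$ (h k, \<gamma> c) = (b $$ (\<rho> a, pcol w (h k)) * psgn w (h k)) * b' $$ (h k, \<gamma> c)"
    using P[of "h k"] p by simp
  qed
  finally show ?thesis .
 qed
 have "mat s s (%(a, c). (b * pm n w * b') $$ (\<rho> a, \<gamma> c)) = mat s s (%(a, c). SUM k<?r. (b $$ (\<rho> a, pcol w (h k)) * psgn w (h k)) * b' $$ (h k, \<gamma> c))"
  by (rule cong_mat) (use entry in auto)
 thus ?thesis
  using det_small_rank[OF s, of "%a k. b $$ (\<rho> a, pcol w (h k)) * psgn w (h k)" "%k c. b' $$ (h k, \<gamma> c)"] by simp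
qed

lemma pf_minor:
 assumes "!!a. a < s ==> \<rho> a < n" "!!a. a < s ==> \<gamma> a < n"
 shows "(%M. det (mat s s (%(a, c). M $$ (\<rho> a, \<gamma> c)))) \<in> poly_fun n"
 using assms by (intro pf_det pf) auto

lemma minor_SX:
 assumes w: "perm n w" and M: "M \<in> SX n w" and p: "p <= n"
  and s: "rk w p q < s" and \<rho>: "!!a. a < s ==> q <= \<rho> a" "!!a. a < s ==> \<rho> a < n" and \<gamma>: "!!a. a < s ==> \<gamma> a < p"
 shows "det (mat s s (%(a, c). M $$ (\<rho> a, \<gamma> c))) = 0"
proof (rule SXD(3)[OF M])
 show "(%M. det (mat s s (%(a, c). M $$ (\<rho> a, \<gamma> c)))) \<in> poly_fun n"
  using \<rho>(2) \<gamma> p by (intro pf_minor) (auto intro: less_le_trans)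
qed (rule minor_cell[OF w _ _ p s \<rho> \<gamma>])

lemma det_diag:
 fixes d :: "nat => complex"
 shows "det (mat s s (%(a, c). if a = c then d a else 0)) = (PROD a<s. d a)"
 by (subst det_upper[of _ s]) auto

lemma SX_imp_rle:
 assumes y: "perm n y" and w: "perm n w" and M: "pm n y \<in> SX n w"
 shows "rle y w"
proof (rule ccontr)
 assume "~ rle y w"
 then obtain p q where pq: "gap w y p q < 0" unfolding rle_gap by (meson not_le)
 hence p: "p <= n" using gap_out[OF w y, of p q] by force
 let ?J = "{l. l < p & q <= pcol y l}" and ?s = "rk y p q"
 have "finite ?J" by simp
 then obtain h where h: "bij_betw h {..<?s} ?J"
  using ex_bij_betw_nat_finite[of ?J] card_rk[OF y p, of q] by (metis atLeast0LessThan)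
 have hJ: "h a < p" "q <= pcol y (h a)" if "a < ?s" for a using h that by (auto simp: bij_betw_def)
 have hn: "h a < n" if "a < ?s" for a using hJ(1)[OF that] p by simp
 have "det (mat ?s ?s (%(a, c). pm n y $$ (pcol y (h a), h c))) = 0"
  by (rule minor_SX[OF w M p, of q]) (use pq hJ hn Suc_pcol(2)[OF y] in \<open>auto simp: gap_def\<close>)
 moreover have "mat ?s ?s (%(a, c). pm n y $$ (pcol y (h a), h c)) = mat ?s ?s (%(a, c). if a = c then psgn y (h a) else 0)"
 proof (rule cong_mat)
  fix a c assume ac: "a < ?s" "c < ?s"
  have "pcol y (h a) = pcol y (h c) <-> a = c"
   using pcol_inj[OF y hn[OF ac(1)] hn[OF ac(2)]] h ac by (auto simp: bij_betw_def inj_on_def)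
  thus "(case (a, c) of (a, c) => pm n y $$ (pcol y (h a), h c)) = (case (a, c) of (a, c) => if a = c then psgn y (h a) else 0)"
   using perm_matrix_entry[OF y Suc_pcol(2)[OF y hn[OF ac(1)]] hn[OF ac(2)]] by simp
 qed auto
 moreover have "(PROD a<?s. psgn y (h a)) ~= 0" using psgn_nz by (subst prod_zero_iff) auto
 ultimately show False by (simp add: det_diag)
qed

subsection \<open>Curves of transpositions\<close>

lemma curve_mult_left:
 assumes A: "A \<in> Mat n" and r: "r < n" "s < n" "r ~= s" and ij: "i < n" "j < n"
 shows "(curve n (r, s) c * A) $$ (i, j) = A $$ (i, j) + (if i = r then c * A $$ (s, j) else 0)"
proof -
 have "(curve n (r, s) c * A) $$ (i, j) = (SUM l<n. curve n (r, s) c $$ (i, l) * A $$ (l, j))"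
  by (rule mm[OF _ A ij]) (simp add: curve_def)
 also have "\<dots> = (SUM l<n. (if l = i then A $$ (i, j) else 0) + (if l = s then if i = r then c * A $$ (s, j) else 0 else 0))"
  by (rule sum.cong) (use r ij in \<open>auto simp: curve_def\<close>)
 finally show ?thesis using r ij by (simp add: sum.distrib)
qed

lemma curve_mult_right:
 assumes A: "A \<in> Mat n" and r: "r < n" "s < n" "r ~= s" and ij: "i < n" "j < n"
 shows "(A * curve n (r, s) c) $$ (i, j) = A $$ (i, j) + (if j = s then c * A $$ (i, r) else 0)"
proof -
 have "(A * curve n (r, s) c) $$ (i, j) = (SUM l<n. A $$ (i, l) * curve n (r, s) c $$ (l, j))"
  by (rule mm[OF A _ ij]) (simp add: curve_def)
 also have "\<dots> = (SUM l<n. (if l = j then A $$ (i, j) else 0) + (if l = r then if j = s then c * A $$ (i, r) else 0 else 0))"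
  by (rule sum.cong) (use r ij in \<open>auto simp: curve_def\<close>)
 finally show ?thesis using r ij by (simp add: sum.distrib)
qed

lemma curve_carrier: "curve n t c \<in> Mat n" by (simp add: curve_def)

lemma curve_uppuni: "r < s ==> uppuni n (curve n (r, s) c)" unfolding uppuni_def curve_def by auto

lemma curve_lowuni: "s < r ==> lowuni n (curve n (r, s) c)" unfolding lowuni_def curve_def by auto

lemma uppuni_borel: "uppuni n u ==> u \<in> Bor n" using uppuni_upp uppuni_det unfolding borel by auto

lemma lowuni_SL: "lowuni n u ==> u \<in> SLc n" using lowuniD(1) lowuni_det unfolding SLc_def by auto

text \<open>On the curve through a fixed point \<open>x\<close> in the direction of a transposition \<open>t\<close> all other points
 lie in the cell of \<open>xt\<close>, if \<open>xt\<close> is larger.\<close>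
lemma curve_up:
 assumes x: "perm n x" and ij: "j < i" "i < n" and up: "pcol x j < pcol x i" and c: "c ~= 0"
 shows "EX b:Bor n. EX b':Bor n. pm n x * curve n (i, j) c = b * pm n (sw x (Suc j) (Suc i)) * b'"
proof -
 let ?y = "sw x (Suc j) (Suc i)" and ?\<sigma> = "psgn x"
 let ?rj = "pcol x j" and ?ri = "pcol x i"
 have jn: "j < n" using ij by simp
 have y: "perm n ?y" using permutes_sw[OF x] ij by simp
 have py: "pcol ?y k = (if k = j then ?ri else if k = i then ?rj else pcol x k)" for k
  unfolding pcol_def by (auto simp: transpose_def)
 have rn: "?rj < n" "?ri < n" using Suc_pcol(2)[OF x] jn ij by auto
 define N where "N = mat n n (%(a, k). if k = j then (if a = ?ri then c * ?\<sigma> i else 0)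
   else if k = i then (if a = ?rj then - ?\<sigma> j / c else 0) else if a = pcol x k then ?\<sigma> k else 0)"
 have Nc: "N \<in> Mat n" unfolding N_def by simp
 let ?l = "?\<sigma> j / (c * ?\<sigma> i)"
 let ?b1 = "curve n (?rj, ?ri) ?l" and ?b2 = "curve n (j, i) (1 / c)"
 let ?M = "pm n x * curve n (i, j) c"
 have b1: "?b1 \<in> Bor n" and b2: "?b2 \<in> Bor n" using curve_uppuni uppuni_borel up ij(1) by blast+
 have eq: "?M = ?b1 * (N * ?b2)"
 proof (rule eq_matI)
  fix a k assume "a < dim_row (?b1 * (N * ?b2))" "k < dim_col (?b1 * (N * ?b2))"
  hence ak: "a < n" "k < n" by (auto simp: curve_def)
  have R: "(N * ?b2) $$ (a', k) = N $$ (a', k) + (if k = i then 1 / c * N $$ (a', j) else 0)" if "a' < n" for a'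
   using curve_mult_right[OF Nc jn ij(2) _ that ak(2)] ij(1) by simp
  have L: "(?b1 * (N * ?b2)) $$ (a, k) = (N * ?b2) $$ (a, k) + (if a = ?rj then ?l * (N * ?b2) $$ (?ri, k) else 0)"
   using curve_mult_left[OF mult_carrier_mat[OF Nc curve_carrier] rn(1,2) _ ak] up by simp
  have M: "?M $$ (a, k) = pm n x $$ (a, k) + (if k = j then c * pm n x $$ (a, i) else 0)"
   using curve_mult_right[OF perm_matrix_carrier ij(2) jn _ ak] ij(1) by simp
  have pk: "pcol x k = ?ri <-> k = i" "pcol x k = ?rj <-> k = j" using pcol_inj[OF x ak(2) ij(2)] pcol_inj[OF x ak(2) jn] by auto
  have N1: "N $$ (a', k) = (if k = j then (if a' = ?ri then c * ?\<sigma> i else 0)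
   else if k = i then (if a' = ?rj then - ?\<sigma> j / c else 0) else if a' = pcol x k then ?\<sigma> k else 0)" if "a' < n" for a'
   using that ak unfolding N_def by simp
  have N2: "N $$ (a', j) = (if a' = ?ri then c * ?\<sigma> i else 0)" if "a' < n" for a'
   using that jn unfolding N_def by simp
  have X: "pm n x $$ (a, k) = (if a = pcol x k then ?\<sigma> k else 0)" "pm n x $$ (a, i) = (if a = ?ri then ?\<sigma> i else 0)"
   using perm_matrix_entry[OF x ak(1)] ak(2) ij(2) by auto
  show "?M $$ (a, k) = (?b1 * (N * ?b2)) $$ (a, k)"
   unfolding L M R[OF ak(1)] R[OF rn(2)] N1[OF ak(1)] N1[OF rn(2)] N2[OF ak(1)] N2[OF rn(2)] X
   using pk up ij(1) c psgn_nz[of x i] by (auto simp: field_simps)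
 qed (auto simp: curve_def perm_matrix_def)
 have "?M \<in> SLc n" using SLc_mult[OF perm_matrix_SL[OF x] lowuni_SL[OF curve_lowuni[OF ij(1)]]] .
 hence "det (?b1 * (N * ?b2)) = 1" unfolding eq SLc_def by simp
 hence "det N = 1" using Nc b1 b2 by (simp add: det_mult[of _ n] borelD(2,3) curve_carrier)
 hence "N \<in> SLc n" using Nc unfolding SLc_def by simp
 moreover have "a = pcol ?y k" if "a < n" "k < n" "N $$ (a, k) ~= 0" for a k
  using that unfolding py by (auto simp: N_def split: if_splits)
 ultimately obtain D where D: "D \<in> Bor n" "N = pm n ?y * D"
  using monomial_factor[OF y] by metis
 have "?M = ?b1 * pm n ?y * (D * ?b2)"
  unfolding eq D(2) using borelD(2)[OF D(1)] perm_matrix_carrier[of n ?y] curve_carrier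
  by (simp add: assoc_mult_mat[of _ n n  _ n _ n])
 thus ?thesis using b1 borel_mult[OF D(1) b2] by blast
qed

lemma curve_SX:
 assumes x: "perm n x" and y: "sw x (Suc j) (Suc i) permutes {1..n}" and ij: "j < i" "i < n" and up: "pcol x j < pcol x i"
  and w: "pm n (sw x (Suc j) (Suc i)) \<in> SX n w"
 shows "pm n x * curve n (i, j) c \<in> SX n w"
proof -
 let ?y = "sw x (Suc j) (Suc i)"
 have nz: "pm n x * curve n (i, j) c \<in> SX n w" if "c ~= 0" for c
  using curve_up[OF x ij up that] SX_stable[OF w] by auto
 show ?thesis
 proof (cases "c = 0")
  case True
  have "E (pm n x * curve n (i, j) 0) = 0" if E: "E \<in> poly_fun n" "ALL b:Bor n. ALL b':Bor n. E (b * pm n w * b') = 0" for E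
  proof -
   let ?f = "%c. E (mtimes n (pm n x) (curve n (i, j) c))"
   have f: "?f c = E (pm n x * curve n (i, j) c)" for c by (simp add: mtimes perm_matrix_carrier curve_carrier)
   obtain d where "(?f has_field_derivative d) (at 0)" using poly_curve_deriv[OF pf_left[OF E(1)]] by blast
   hence "(?f \<longlongrightarrow> ?f 0) (at 0)" using DERIV_isCont isCont_def by blast
   moreover have "(?f \<longlongrightarrow> 0) (at 0)"
   proof (rule tendsto_eventually)
    have "?f c = 0" if "c ~= 0" for c using SXD(3)[OF nz[OF that] E(1)] E(2) f by auto
    thus "\<forall>\<^sub>F c in at 0. ?f c = 0" by (auto simp: eventually_at_filter)
   qed
   ultimately show ?thesis using f tendsto_unique[OF at_neq_bot, of ?f "?f 0" 0] by simp
  qed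
  moreover have "pm n x * curve n (i, j) c \<in> SLc n"
   using SLc_mult[OF perm_matrix_SL[OF x] lowuni_SL[OF curve_lowuni[OF ij(1)]]] .
  ultimately show ?thesis using True unfolding SX_def by blast
 qed (rule nz)
qed

text \<open>Minors separate closures from permutations that are not below; along an edge, the curve of the
 transposition joins the two fixed points inside the closure of the larger cell.\<close>
theorem rle_iff_SX:
 assumes x: "perm n x" and w: "perm n w"
 shows "pm n x \<in> SX n w <-> rle x w"
proof
 show "pm n x \<in> SX n w ==> rle x w" by (rule SX_imp_rle[OF x w])
 assume "rle x w"
 with x w show "pm n x \<in> SX n w"
 proof (induction rule: bruhat_induct)
  case base
  show ?case by (rule pm_SX[OF w])
 next
  case (step x i j)
  note r = edge_range[OF w step(1,3)]
  have ij: "i < j" "x i < x j" using step(3) unfolding edge_def by auto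
  have "i ~= 0" "j ~= 0" using r by auto
  then obtain a b where ab: "i = Suc a" "j = Suc b" by (meson not0_implies_Suc)
  have le: "a < b" "b < n" using ab ij r by auto
  have "pcol x a < pcol x b" using Suc_pcol(1)[OF step(1)] ab ij(2) le by (metis Suc_less_eq order_less_trans)
  moreover have "sw x (Suc a) (Suc b) permutes {1..n}" using permutes_sw[OF step(1), of i j] r unfolding ab by simp
  moreover have "pm n (sw x (Suc a) (Suc b)) \<in> SX n w" using step(4) unfolding ab .
  ultimately have "pm n x * curve n (b, a) 0 \<in> SX n w"
   using curve_SX[OF step(1) _ le] by blast
  thus ?case using perm_matrix_carrier[of n x] by (simp add: curve_0)
 qed
qed

section \<open>Coordinates on the big cell\<close>

definition mn :: "nat => nat => complex mat => complex" where
 "mn k i M = det (mat (Suc k) (Suc k) (%(a, b). M $$ (if a < k then a else i, b)))"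

definition Dm :: "nat => complex mat => complex" where "Dm n M = (PROD k<n. mn k k M)"

definition kap :: "nat => complex mat => complex mat" where
 "kap n M = mat n n (%(i, k). mn k i M / mn k k M)"

lemma pf_mn: "k < n ==> i < n ==> mn k i \<in> poly_fun n"
 unfolding mn_def[abs_def] by (intro pf_det pf) auto

lemma pf_Dm: "Dm n \<in> poly_fun n"
 unfolding Dm_def[abs_def] by (intro pf_prod pf_mn) auto

lemma mn_right:
 assumes M: "M \<in> Mat n" and t: "upp n t" and ki: "k < n" "i < n"
 shows "mn k i (M * t) = mn k i M * (PROD c<Suc k. t $$ (c, c))"
proof -
 let ?f = "%a. if a < k then a else i"
 let ?A = "mat (Suc k) (Suc k) (%(a, b). M $$ (?f a, b))" and ?T = "mat (Suc k) (Suc k) (%(a, b). t $$ (a, b))"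
 have "mat (Suc k) (Suc k) (%(a, b). (M * t) $$ (?f a, b)) = ?A * ?T"
 proof (rule eq_matI)
  fix a b assume "a < dim_row (?A * ?T)" "b < dim_col (?A * ?T)"
  hence ab: "a < Suc k" "b < Suc k" by auto
  hence lt: "?f a < n" "b < n" using ki by auto
  have "(M * t) $$ (?f a, b) = (SUM l<n. M $$ (?f a, l) * t $$ (l, b))" by (rule mm[OF M uppD(1)[OF t] lt])
  also have "\<dots> = (SUM l<Suc k. M $$ (?f a, l) * t $$ (l, b))"
   by (rule sum.mono_neutral_right) (use ab ki uppD(2)[OF t, of _ b] in auto)
  also have "\<dots> = (?A * ?T) $$ (a, b)"
   using ab by (subst mm[of _ "Suc k" "Suc k" _ "Suc k"]) (auto intro!: sum.cong simp del: sum.lessThan_Suc)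
  finally show "mat (Suc k) (Suc k) (%(a, b). (M * t) $$ (?f a, b)) $$ (a, b) = (?A * ?T) $$ (a, b)" using ab by simp
 qed auto
 moreover have "det (?A * ?T) = det ?A * det ?T" by (rule det_mult[of _ "Suc k"]) auto
 moreover have "det ?T = (PROD c<Suc k. t $$ (c, c))"
  by (subst det_upper[of _ "Suc k"]) (use ki uppD(2)[OF t] in \<open>auto simp del: prod.lessThan_Suc\<close>)
 ultimately show ?thesis unfolding mn_def by simp
qed

lemma mn_lowuni:
 assumes u: "lowuni n u" and ki: "k < n" "i < n"
 shows "mn k i u = u $$ (i, k)"
proof -
 have "mn k i u = (PROD a<Suc k. u $$ (if a < k then a else i, a))"
  unfolding mn_def by (subst det_lower[of _ "Suc k"]) (use ki lowuniD(3)[OF u] in \<open>auto simp del: prod.lessThan_Suc\<close>)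
 thus ?thesis using ki lowuniD(2)[OF u] by simp
qed

lemma borel_prod_nz: "t \<in> Bor n ==> k < n ==> (PROD c<Suc k. t $$ (c, c)) ~= 0"
 using borelD(5)[of t n] by (subst prod_zero_iff) auto

lemma Dm_right: assumes "M \<in> Mat n" "t \<in> Bor n" shows "Dm n (M * t) = 0 <-> Dm n M = 0"
 unfolding Dm_def using mn_right[OF assms(1) borelD(1)[OF assms(2)]] borel_prod_nz[OF assms(2)] by auto

lemma kap_right: assumes "M \<in> Mat n" "t \<in> Bor n" shows "kap n (M * t) = kap n M"
 unfolding kap_def using mn_right[OF assms(1) borelD(1)[OF assms(2)]] borel_prod_nz[OF assms(2)]
 by (intro cong_mat) (auto simp del: prod.lessThan_Suc)

lemma Dm_lowuni: "lowuni n u ==> Dm n u = 1"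
 unfolding Dm_def using mn_lowuni lowuniD(2) by (auto intro: prod.neutral)

lemma kap_lowuni: assumes "lowuni n u" shows "kap n u = u"
 by (rule eq_matI) (use mn_lowuni[OF assms] lowuniD[OF assms] in \<open>auto simp: kap_def\<close>)

text \<open>The quotients of minors in \<open>kap\<close> are those of Cramer's rule for the lower triangular factor.\<close>
lemma big_cell:
 assumes M: "M \<in> SLc n" and D: "Dm n M ~= 0"
 shows "lowuni n (kap n M)" "EX t:Bor n. M = kap n M * t"
proof -
 have Mc: "M \<in> Mat n" using M unfolding SLc_def by simp
 have "lead M k ~= 0" if "k <= n" for k
 proof (cases k)
  case (Suc l)
  have "mn l l M ~= 0" using D Suc that unfolding Dm_def by auto
  moreover have "mn l l M = lead M k" unfolding mn_def lead_def Suc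
   by (intro arg_cong[of _ _ det] cong_mat) (auto simp: less_Suc_eq)
  ultimately show ?thesis by simp
 qed (simp add: lead_def)
 from LU[OF Mc this] obtain u t where ut: "M = u * t" "lowuni n u" "upp n t" by blast
 have "det M = det u * det t" unfolding ut(1) by (rule det_mult[OF lowuniD(1)[OF ut(2)] uppD(1)[OF ut(3)]])
 hence t: "t \<in> Bor n" using M lowuni_det[OF ut(2)] ut(3) unfolding SLc_def borel by simp
 have "kap n M = u" unfolding ut(1) using kap_right[OF lowuniD(1)[OF ut(2)] t] kap_lowuni[OF ut(2)] by simp
 thus "lowuni n (kap n M)" "EX t:Bor n. M = kap n M * t" using ut t by auto
qed

lemma numerator_kap:
 assumes "P \<in> poly_fun n"
 shows "EX N:poly_fun n. EX e. ALL M. Dm n M ~= 0 --> P (kap n M) * Dm n M ^ e = N M"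
 using assms
proof (induction rule: poly_fun.induct)
 case (const c)
 show ?case by (intro bexI[of _ "%_. c"] exI[of _ 0]) (auto intro: pf)
next
 case (entry i k)
 have "kap n M $$ (i, k) * Dm n M ^ 1 = mn k i M * (PROD l:{..<n} - {k}. mn l l M)" if "Dm n M ~= 0" for M
 proof -
  have "Dm n M = mn k k M * (PROD l:{..<n} - {k}. mn l l M)" unfolding Dm_def using entry by (intro prod.remove) auto
  moreover have "mn k k M ~= 0" using that entry unfolding Dm_def by auto
  ultimately show ?thesis using entry by (simp add: kap_def)
 qed
 moreover have "(%M. mn k i M * (PROD l:{..<n} - {k}. mn l l M)) \<in> poly_fun n"
  using entry by (intro pf pf_prod pf_mn) auto
 ultimately show ?case by (intro bexI[of _ "%M. mn k i M * (PROD l:{..<n} - {k}. mn l l M)"] exI[of _ 1] allI impI)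
next
 case (add f g)
 then obtain N e N' e' where N: "N \<in> poly_fun n" "!!M. Dm n M ~= 0 ==> f (kap n M) * Dm n M ^ e = N M"
  and N': "N' \<in> poly_fun n" "!!M. Dm n M ~= 0 ==> g (kap n M) * Dm n M ^ e' = N' M" by blast
 have "(f (kap n M) + g (kap n M)) * Dm n M ^ (e + e') = Dm n M ^ e' * N M + Dm n M ^ e * N' M" if "Dm n M ~= 0" for M
  using N(2)[OF that, symmetric] N'(2)[OF that, symmetric] by (simp add: power_add algebra_simps)
 moreover have "(%M. Dm n M ^ e' * N M + Dm n M ^ e * N' M) \<in> poly_fun n"
  using N(1) N'(1) by (intro pf pf_power pf_Dm)
 ultimately show ?case by (intro bexI[of _ "%M. Dm n M ^ e' * N M + Dm n M ^ e * N' M"] exI[of _ "e + e'"] allI impI)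
next
 case (mult f g)
 then obtain N e N' e' where N: "N \<in> poly_fun n" "!!M. Dm n M ~= 0 ==> f (kap n M) * Dm n M ^ e = N M"
  and N': "N' \<in> poly_fun n" "!!M. Dm n M ~= 0 ==> g (kap n M) * Dm n M ^ e' = N' M" by blast
 have "(f (kap n M) * g (kap n M)) * Dm n M ^ (e + e') = N M * N' M" if "Dm n M ~= 0" for M
  using N(2)[OF that, symmetric] N'(2)[OF that, symmetric] by (simp add: power_add algebra_simps)
 moreover have "(%M. N M * N' M) \<in> poly_fun n" using N(1) N'(1) by (intro pf)
 ultimately show ?case by (intro bexI[of _ "%M. N M * N' M"] exI[of _ "e + e'"] allI impI)
qed

section \<open>Schubert cells as affine spaces\<close>

definition Cs :: "nat => (nat \<times> nat) set => complex mat set" where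
 "Cs n V = {u. lowuni n u & (ALL i j. j < i --> i < n --> (i, j) \<notin> V --> u $$ (i, j) = 0)}"

definition Inv :: "nat => (nat => nat) => (nat \<times> nat) set" where
 "Inv n w = {(i, j). j < i & i < n & pcol w i < pcol w j}"

lemma Cs_one: "1\<^sub>m n \<in> Cs n V" unfolding Cs_def using lowuni_one by auto

lemma Inv_low: "Inv n w \<subseteq> low n" unfolding Inv_def by auto

lemma finite_Inv: "finite (Inv n w)" using Inv_low finite_low finite_subset by blast

lemma card_pairs:
 assumes "!!i j. j < i ==> i < n ==> P i j <-> Q (Suc j) (Suc i)"
 shows "card {(i, j). j < i & i < n & P i j} = card {(k, l). 1 <= k & k < l & l <= n & Q k l}"
proof -
 have "bij_betw (%(i, j). (Suc j, Suc i)) {(i, j). j < i & i < n & P i j} {(k, l). 1 <= k & k < l & l <= n & Q k l}"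
  by (rule bij_betw_byWitness[of _ "%(k, l). (l - 1, k - 1)"]) (auto simp: assms)
 thus ?thesis by (rule bij_betw_same_card)
qed

lemma card_Inv: assumes w: "perm n w" shows "card (Inv n w) = len n w"
 unfolding Inv_def len_def
proof (rule card_pairs)
 fix i j assume "j < i" "i < n"
 thus "pcol w i < pcol w j <-> w (Suc i) < w (Suc j)"
  using Suc_pcol(1)[OF w, of i] Suc_pcol(1)[OF w, of j] by (metis Suc_less_eq order_less_trans)
qed

definition pinvm :: "nat => (nat => nat) => complex mat" where
 "pinvm n x = mat n n (%(j, a). if a = pcol x j then 1 / psgn x j else 0)"

lemma pinvm: assumes x: "perm n x"
 shows "pinvm n x * pm n x = 1\<^sub>m n" "pm n x * pinvm n x = 1\<^sub>m n" "pinvm n x \<in> Mat n" "pinvm n x \<in> SLc n"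
proof -
 show c: "pinvm n x \<in> Mat n" unfolding pinvm_def by simp
 show 1: "pinvm n x * pm n x = 1\<^sub>m n"
 proof (rule eq_matI)
  fix i j assume "i < dim_row (1\<^sub>m n)" "j < dim_col (1\<^sub>m n)"
  hence ij: "i < n" "j < n" by auto
  have "(pinvm n x * pm n x) $$ (i, j) = (SUM l<n. pinvm n x $$ (i, l) * pm n x $$ (l, j))"
   by (rule mm[OF c perm_matrix_carrier ij])
  also have "\<dots> = pinvm n x $$ (i, pcol x j) * pm n x $$ (pcol x j, j)"
   by (rule sum_one) (use ij Suc_pcol(2)[OF x] perm_matrix_entry[OF x] in auto)
  also have "\<dots> = 1\<^sub>m n $$ (i, j)"
   using ij Suc_pcol(2)[OF x ij(2)] perm_matrix_entry[OF x _ ij(2)] pcol_inj[OF x ij] psgn_nz[of x j]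
   by (auto simp: pinvm_def)
  finally show "(pinvm n x * pm n x) $$ (i, j) = 1\<^sub>m n $$ (i, j)" .
 qed (auto simp: pinvm_def perm_matrix_def)
 show "pm n x * pinvm n x = 1\<^sub>m n" by (rule mat_mult_left_right_inverse[OF c perm_matrix_carrier 1])
 have "det (pinvm n x) * det (pm n x) = 1" using det_mult[OF c perm_matrix_carrier[of n x]] 1 by simp
 thus "pinvm n x \<in> SLc n" using perm_matrix_SL[OF x] c unfolding SLc_def by simp
qed

lemma conj_entry:
 assumes x: "perm n x" and A: "A \<in> Mat n" and ij: "i < n" "j < n"
 shows "(pinvm n x * A * pm n x) $$ (i, j) = A $$ (pcol x i, pcol x j) * (psgn x j / psgn x i)"
proof -
 note c = pinvm(3)[OF x]
 have 1: "(pinvm n x * A) $$ (i, l) = A $$ (pcol x i, l) / psgn x i" if "l < n" for l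
 proof -
  have "(pinvm n x * A) $$ (i, l) = (SUM k<n. pinvm n x $$ (i, k) * A $$ (k, l))" by (rule mm[OF c A ij(1) that])
  also have "\<dots> = pinvm n x $$ (i, pcol x i) * A $$ (pcol x i, l)"
   by (rule sum_one) (use ij Suc_pcol(2)[OF x] in \<open>auto simp: pinvm_def\<close>)
  finally show ?thesis using ij Suc_pcol(2)[OF x ij(1)] by (simp add: pinvm_def)
 qed
 have "(pinvm n x * A * pm n x) $$ (i, j) = (SUM l<n. (pinvm n x * A) $$ (i, l) * pm n x $$ (l, j))"
  by (rule mm[OF mult_carrier_mat[OF c A] perm_matrix_carrier ij])
 also have "\<dots> = (pinvm n x * A) $$ (i, pcol x j) * pm n x $$ (pcol x j, j)"
  by (rule sum_one) (use ij Suc_pcol(2)[OF x] perm_matrix_entry[OF x] in auto)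
 also have "\<dots> = A $$ (pcol x i, pcol x j) * (psgn x j / psgn x i)"
  using 1[OF Suc_pcol(2)[OF x ij(2)]] perm_matrix_entry[OF x Suc_pcol(2)[OF x ij(2)] ij(2)] by simp
 finally show ?thesis .
qed

lemma pcol_surj: assumes x: "perm n x" and a: "a < n" obtains i where "i < n" "a = pcol x i"
proof -
 have "pcol x ` {..<n} \<subseteq> {..<n}" using Suc_pcol(2)[OF x] by auto
 moreover have "inj_on (pcol x) {..<n}" using pcol_inj[OF x] by (auto simp: inj_on_def)
 ultimately have "pcol x ` {..<n} = {..<n}" by (simp add: endo_inj_surj)
 thus ?thesis using a that by (metis imageE lessThan_iff)
qed

text \<open>The coordinate space of the inversions of \<open>x\<close> parametrizes the cell of \<open>x\<close>.\<close>
lemma cell_in_B: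
 assumes x: "perm n x" and u: "u \<in> Cs n (Inv n x)"
 shows "EX b:Bor n. pm n x * u = b * pm n x"
proof -
 have lu: "lowuni n u" and uz: "!!i j. j < i ==> i < n ==> (i, j) \<notin> Inv n x ==> u $$ (i, j) = 0"
  using u unfolding Cs_def by auto
 note uc = lowuniD(1)[OF lu] and pc = perm_matrix_carrier[of n x] and ic = pinvm(3)[OF x]
 define b where "b = pm n x * u * pinvm n x"
 have bc: "b \<in> Mat n" unfolding b_def using uc pc ic by simp
 have "b * pm n x = pm n x * u * (pinvm n x * pm n x)" unfolding b_def using uc pc ic by (simp add: assoc_mat)
 hence eq: "b * pm n x = pm n x * u" using uc pc pinvm(1)[OF x] by simp
 have "pinvm n x * b * pm n x = pinvm n x * (b * pm n x)" using bc pc ic by (simp add: assoc_mat)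
 also have "\<dots> = (pinvm n x * pm n x) * u" unfolding eq using uc pc ic by (simp add: assoc_mat)
 finally have cu: "pinvm n x * b * pm n x = u" using uc pinvm(1)[OF x] by simp
 have "upp n b"
  unfolding upp_def
 proof (intro conjI allI impI bc)
  fix a c assume ac: "a < n" "c < a"
  obtain i where i: "i < n" "a = pcol x i" using pcol_surj[OF x ac(1)] .
  obtain j where j: "j < n" "c = pcol x j" using pcol_surj[OF x, of c] ac by auto
  have "u $$ (i, j) = 0"
  proof (cases "i <= j")
   case True
   hence "i < j" using ac i j by (cases "i = j") auto
   thus ?thesis using lowuniD(3)[OF lu j(1)] by simp
  next
   case False
   thus ?thesis using uz[of j i] i j ac unfolding Inv_def by auto
  qed
  thus "b $$ (a, c) = 0" using conj_entry[OF x bc i(1) j(1)] cu i j psgn_nz by simp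
 qed
 moreover have "b \<in> SLc n"
  unfolding b_def using SLc_mult[OF SLc_mult[OF perm_matrix_SL[OF x] lowuni_SL[OF lu]] pinvm(4)[OF x]] .
 ultimately have "b \<in> Bor n" unfolding borel SLc_def by simp
 thus ?thesis using eq by metis
qed

lemma cell_factor:
 assumes w: "perm n w" and b: "b \<in> Bor n"
 shows "EX u:Cs n (Inv n w). EX t:Bor n. b * pm n w = pm n w * u * t"
proof -
 note bc = borelD(2)[OF b] and pc = perm_matrix_carrier[of n w] and ic = pinvm(3)[OF w]
 let ?C = "pinvm n w * b * pm n w" and ?w = "%i. w (Suc i)"
 have Cc: "?C \<in> Mat n" using bc pc ic by simp
 have le: "pcol w i <= pcol w j <-> ?w i <= ?w j" if "i < n" "j < n" for i j
  using Suc_pcol(1)[OF w that(1)] Suc_pcol(1)[OF w that(2)] by (metis Suc_le_mono)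
 have "inj ?w" using permutes_inj[OF w] by (auto simp: inj_def)
 moreover have "?w i <= ?w j" if "i < n" "j < n" "?C $$ (i, j) ~= 0" for i j
  using that conj_entry[OF w bc that(1,2)] uppD(2)[OF borelD(1)[OF b] Suc_pcol(2)[OF w that(1)], of "pcol w j"] le[OF that(1,2)]
  by (cases "pcol w j < pcol w i") auto
 moreover have "?C $$ (i, i) ~= 0" if "i < n" for i
  using conj_entry[OF w bc that that] borelD(5)[OF b Suc_pcol(2)[OF w that]] psgn_nz by simp
 ultimately obtain u t where ut: "?C = u * t" "lowuni n u" "upp n t" "!!i j. i < n ==> j < n ==> u $$ (i, j) ~= 0 ==> ?w i <= ?w j"
  using LU_triangular[OF Cc, of ?w] by blast
 have uC: "u \<in> Cs n (Inv n w)"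
  unfolding Cs_def
 proof (intro CollectI conjI allI impI ut(2))
  fix i j assume ij: "j < i" "i < n" "(i, j) \<notin> Inv n w"
  hence "~ pcol w i < pcol w j" "pcol w i ~= pcol w j" using pcol_inj[OF w, of i j] unfolding Inv_def by auto
  thus "u $$ (i, j) = 0" using ut(4)[of i j] le[of i j] ij by force
 qed
 have "?C \<in> SLc n" using SLc_mult[OF SLc_mult[OF pinvm(4)[OF w] borelD(4)[OF b]] perm_matrix_SL[OF w]] .
 hence "det u * det t = 1" using det_mult[OF lowuniD(1)[OF ut(2)] uppD(1)[OF ut(3)]] ut(1) unfolding SLc_def by simp
 hence t: "t \<in> Bor n" using lowuni_det[OF ut(2)] ut(3) unfolding borel by simp
 have "b * pm n w = (pm n w * pinvm n w) * b * pm n w" using pinvm(2)[OF w] bc by simp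
 also have "\<dots> = pm n w * ?C" using bc pc ic by (simp add: assoc_mat)
 also have "\<dots> = pm n w * u * t" unfolding ut(1) using pc lowuniD(1)[OF ut(2)] uppD(1)[OF ut(3)] by (simp add: assoc_mat)
 finally show ?thesis using uC t by blast
qed

lemma poly_line:
 assumes "F \<in> poly_fun n"
 shows "EX p :: complex poly. ALL s. F (mat n n (%t. (1 - s) * z0 $$ t + s * z1 $$ t)) = poly p s"
 using assms
proof (induction rule: poly_fun.induct)
 case (const c)
 show ?case by (intro exI[of _ "[:c:]"]) simp
next
 case (entry i j)
 thus ?case by (intro exI[of _ "[:z0 $$ (i, j), z1 $$ (i, j) - z0 $$ (i, j):]"]) (simp add: algebra_simps)
next
 case (add f g)
 then obtain p q where "ALL s. f (mat n n (%t. (1 - s) * z0 $$ t + s * z1 $$ t)) = poly p s"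
  "ALL s. g (mat n n (%t. (1 - s) * z0 $$ t + s * z1 $$ t)) = poly q s" by blast
 thus ?case by (intro exI[of _ "p + q"]) simp
next
 case (mult f g)
 then obtain p q where "ALL s. f (mat n n (%t. (1 - s) * z0 $$ t + s * z1 $$ t)) = poly p s"
  "ALL s. g (mat n n (%t. (1 - s) * z0 $$ t + s * z1 $$ t)) = poly q s" by blast
 thus ?case by (intro exI[of _ "p * q"]) simp
qed

text \<open>An affine space is irreducible, since a line through two points is.\<close>
lemma Cs_irreducible:
 assumes F: "F \<in> poly_fun n" and G: "G \<in> poly_fun n" and 0: "!!z. z \<in> Cs n V ==> F z * G z = 0"
 shows "(ALL z:Cs n V. F z = 0) | (ALL z:Cs n V. G z = 0)"
proof (rule ccontr)
 assume "~ ?thesis"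
 then obtain z0 z1 where z: "z0 \<in> Cs n V" "F z0 ~= 0" "z1 \<in> Cs n V" "G z1 ~= 0" by blast
 let ?z = "%s. mat n n (%t. (1 - s) * z0 $$ t + s * z1 $$ t) :: complex mat"
 have zc: "z0 \<in> Mat n" "z1 \<in> Mat n" using z unfolding Cs_def lowuni_def by auto
 obtain p where p: "!!s. F (?z s) = poly p s" using poly_line[OF F] by blast
 obtain q where q: "!!s. G (?z s) = poly q s" using poly_line[OF G] by blast
 have "?z 0 = z0" "?z 1 = z1" using zc by auto
 hence "poly p 0 ~= 0" "poly q 1 ~= 0" using z p[of 0] q[of 1] by auto
 hence "p * q ~= 0" by auto
 moreover have "poly (p * q) s = 0" for s
 proof -
  have "lowuni n (?z s)" using z unfolding Cs_def lowuni_def by (auto simp: algebra_simps)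
  moreover have "?z s $$ (i, j) = 0" if "j < i" "i < n" "(i, j) \<notin> V" for i j
   using z that unfolding Cs_def by auto
  ultimately have "?z s \<in> Cs n V" unfolding Cs_def by blast
  from 0[OF this] show ?thesis unfolding p q by simp
 qed
 ultimately show False using poly_all_0_iff_0 by blast
qed

lemma cell_dense:
 assumes y: "perm n y" and H: "H \<in> poly_fun n" and inv: "!!M b. M \<in> SLc n ==> b \<in> Bor n ==> H M = 0 ==> H (M * b) = 0"
  and 0: "!!z. z \<in> Cs n (Inv n y) ==> H (pm n y * z) = 0" and M: "M \<in> SX n y"
 shows "H M = 0"
proof (rule SXD(3)[OF M H])
 fix b b' assume b: "b \<in> Bor n" "b' \<in> Bor n"
 obtain z t where z: "z \<in> Cs n (Inv n y)" "t \<in> Bor n" "b * pm n y = pm n y * z * t" using cell_factor[OF y b(1)] by blast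
 have zl: "lowuni n z" using z(1) unfolding Cs_def by simp
 have S: "pm n y * z \<in> SLc n" using SLc_mult[OF perm_matrix_SL[OF y] lowuni_SL[OF zl]] .
 have "b * pm n y * b' = (pm n y * z) * (t * b')"
  unfolding z(3) using S borelD(2)[OF z(2)] borelD(2)[OF b(2)] unfolding SLc_def by (simp add: assoc_mult_mat[of _ n n  _ n _ n])
 thus "H (b * pm n y * b') = 0" using inv[OF S borel_mult[OF z(2) b(2)] 0[OF z(1)]] by simp
qed

section \<open>A Schubert variety near a fixed point\<close>

definition Yc :: "nat => (nat => nat) => (nat => nat) => complex mat set" where
 "Yc n x y = {u. lowuni n u & pm n x * u \<in> SX n y}"

lemma YcD: "u \<in> Yc n x y ==> lowuni n u" "u \<in> Yc n x y ==> pm n x * u \<in> SX n y"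
 unfolding Yc_def by auto

lemma one_in_Yc: assumes "perm n x" "perm n y" shows "1\<^sub>m n \<in> Yc n x y <-> rle x y"
 using rle_iff_SX[OF assms] lowuni_one perm_matrix_carrier[of n x] unfolding Yc_def by simp

lemma pinvm_cancel: assumes "perm n x" "A \<in> Mat n"
 shows "pinvm n x * (pm n x * A) = A" "pm n x * (pinvm n x * A) = A"
 using pinvm[OF assms(1)] assms(2) perm_matrix_carrier[of n x]
 by (simp_all add: assoc_mult_mat[of _ n n _ n _ n, symmetric])

lemma chart_point:
 assumes x: "perm n x" and M: "M \<in> SX n y" and D: "Dm n (pinvm n x * M) ~= 0"
 obtains u t where "u \<in> Yc n x y" "t \<in> Bor n" "M = pm n x * u * t" "kap n (pinvm n x * M) = u"
proof -
 have S: "pinvm n x * M \<in> SLc n" using SLc_mult[OF pinvm(4)[OF x] SXD(1)[OF M]] .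
 let ?u = "kap n (pinvm n x * M)"
 from big_cell[OF S D] obtain t where t: "lowuni n ?u" "t \<in> Bor n" "pinvm n x * M = ?u * t" by blast
 note c = lowuniD(1)[OF t(1)] borelD(2)[OF t(2)] perm_matrix_carrier[of n x]
 have "M = pm n x * (?u * t)" using pinvm_cancel(2)[OF x SXD(2)[OF M]] t(3) by simp
 hence M': "M = pm n x * ?u * t" using c by (simp add: assoc_mat)
 have "M * adj_mat t = pm n x * ?u" using borel_cancel(1)[OF t(2), of "pm n x * ?u"] c M' by simp
 hence "pm n x * ?u \<in> SX n y" using SX_right[OF M borel_inverse[OF t(2)]] by simp
 thus ?thesis using that[OF _ t(2) M'] t(1) unfolding Yc_def by simp
qed

text \<open>A function on the group that is stable under the Borel subgroup and whose zeros on the big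
 cell around \<open>x\<close> are those of \<open>F\<close>.\<close>
definition homogenizes where
 "homogenizes n x F H \<equiv> H \<in> poly_fun n & (ALL M:Mat n. H M = 0 <-> Dm n (pinvm n x * M) = 0 | F (kap n (pinvm n x * M)) = 0) &
   (ALL M:SLc n. ALL b:Bor n. H M = 0 --> H (M * b) = 0) & (ALL u. lowuni n u --> (H (pm n x * u) = 0 <-> F u = 0))"

lemma homogenizesD:
 assumes "homogenizes n x F H"
 shows "H \<in> poly_fun n" "!!M. M \<in> Mat n ==> H M = 0 <-> Dm n (pinvm n x * M) = 0 | F (kap n (pinvm n x * M)) = 0"
  "!!M b. M \<in> SLc n ==> b \<in> Bor n ==> H M = 0 ==> H (M * b) = 0" "!!u. lowuni n u ==> H (pm n x * u) = 0 <-> F u = 0"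
 using assms unfolding homogenizes_def by auto

lemma homogenize:
 assumes x: "perm n x" and F: "F \<in> poly_fun n"
 obtains H where "homogenizes n x F H"
proof -
 obtain N e where N: "N \<in> poly_fun n" "ALL M. Dm n M ~= 0 --> F (kap n M) * Dm n M ^ e = N M"
  using numerator_kap[OF F] by blast
 let ?H = "%M. Dm n (mtimes n (pinvm n x) M) * N (mtimes n (pinvm n x) M)"
 have 1: "?H \<in> poly_fun n" using pf_left[OF pf_Dm] pf_left[OF N(1)] by (intro pf)
 have 2: "?H M = 0 <-> Dm n (pinvm n x * M) = 0 | F (kap n (pinvm n x * M)) = 0" if "M \<in> Mat n" for M
  using N(2)[rule_format, of "pinvm n x * M", symmetric] mtimes[OF pinvm(3)[OF x] that]
  by (cases "Dm n (pinvm n x * M) = 0") auto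
 have 3: "?H (M * b) = 0" if M: "M \<in> SLc n" "b \<in> Bor n" "?H M = 0" for M b
 proof -
  have c: "M \<in> Mat n" "b \<in> Mat n" using M(1) borelD(2)[OF M(2)] unfolding SLc_def by auto
  have e: "pinvm n x * (M * b) = pinvm n x * M * b" using c pinvm(3)[OF x] by (simp add: assoc_mat)
  have "pinvm n x * M \<in> Mat n" using c pinvm(3)[OF x] by simp
  note Dm_right[OF this M(2)] kap_right[OF this M(2)]
  thus ?thesis using M(3) unfolding 2[OF c(1)] 2[OF mult_carrier_mat[OF c]] e by simp
 qed
 have 4: "?H (pm n x * u) = 0 <-> F u = 0" if u: "lowuni n u" for u
  using 2[of "pm n x * u"] pinvm_cancel(1)[OF x lowuniD(1)[OF u]] perm_matrix_carrier[of n x] lowuniD(1)[OF u] Dm_lowuni[OF u] kap_lowuni[OF u]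
  by simp
 show ?thesis by (rule that[of ?H]) (unfold homogenizes_def, intro conjI ballI allI impI 1 2 3 4)
qed

lemma Cs_sub: "z \<in> Cs n V ==> lowuni n z" unfolding Cs_def by simp

lemma cell_point: assumes "perm n y" "z \<in> Cs n (Inv n y)" shows "pm n y * z \<in> SX n y"
 using cell_in_B[OF assms] SX_left[OF pm_SX[OF assms(1)]] by auto

text \<open>An affine space is dense in the closure of a cell, up to the Borel subgroup; this brings irreducibility to
 every other fixed point of the closure.\<close>
lemma Yc_irreducible:
 assumes x: "perm n x" and y: "perm n y"
  and P: "P \<in> poly_fun n" and Q: "Q \<in> poly_fun n" and 0: "!!u. u \<in> Yc n x y ==> P u * Q u = 0"
 shows "(ALL u:Yc n x y. P u = 0) | (ALL u:Yc n x y. Q u = 0)"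
proof -
 obtain H K where HK: "homogenizes n x P H" "homogenizes n x Q K" using homogenize[OF x P] homogenize[OF x Q] by metis
 note H = homogenizesD[OF HK(1)] and K = homogenizesD[OF HK(2)]
 have m: "mtimes n (pm n y) z = pm n y * z" if "z \<in> Cs n V" for z V
  using mtimes[OF perm_matrix_carrier lowuniD(1)[OF Cs_sub[OF that]]] .
 have "H (pm n y * z) * K (pm n y * z) = 0" if z: "z \<in> Cs n (Inv n y)" for z
 by (smt (verit, ccfv_threshold) "0" Cs_sub H(2) K(2) cell_point chart_point lowuniD(1) mult_carrier_mat mult_eq_0_iff perm_matrix_carrier x y z)
 hence "(ALL z:Cs n (Inv n y). H (mtimes n (pm n y) z) = 0) | (ALL z:Cs n (Inv n y). K (mtimes n (pm n y) z) = 0)"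
  by (intro Cs_irreducible pf_left H(1) K(1)) (simp add: m)
 moreover have "ALL u:Yc n x y. G u = 0" if "homogenizes n x G L" and 0: "ALL z:Cs n (Inv n y). L (mtimes n (pm n y) z) = 0" for G L
 proof -
  note L = homogenizesD[OF that(1)]
  have Z: "L (pm n y * z) = 0" if "z \<in> Cs n (Inv n y)" for z using m[OF that] bspec[OF 0 that] by simp
  have "L M = 0" if "M \<in> SX n y" for M
   by (rule cell_dense[OF y L(1) _ _ that], rule L(3), assumption+, rule Z)
  thus ?thesis using YcD L(4) by blast
 qed
 ultimately show ?thesis using HK by blast
qed

text \<open>If every equation of the smaller chart held on the larger one, then the larger cell closure would be contained
 in the smaller one, because the part of it over the big cell around \<open>x\<close> is dense.\<close>
lemma Yc_separate:
 assumes x: "perm n x" and y: "perm n y" and y': "perm n y'" and le: "rle x y'" "~ rle y' y"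
 shows "EX F:poly_fun n. (ALL u:Yc n x y. F u = 0) & ~ (ALL u:Yc n x y'. F u = 0)"
proof (rule ccontr)
 assume neg: "~ ?thesis"
 have van: "F u = 0" if "F \<in> poly_fun n" "!!u. u \<in> Yc n x y ==> F u = 0" "u \<in> Yc n x y'" for F u using neg that by blast
 have sub: "pm n x * u \<in> SX n y" if u: "u \<in> Yc n x y'" for u
 proof -
  have "E (pm n x * u) = 0" if E: "E \<in> poly_fun n" "ALL b:Bor n. ALL b':Bor n. E (b * pm n y * b') = 0" for E
  proof -
   have m: "mtimes n (pm n x) v = pm n x * v" if "lowuni n v" for v using mtimes[OF perm_matrix_carrier lowuniD(1)[OF that]] .
   have "E (mtimes n (pm n x) u) = 0"
    using SXD(3)[OF YcD(2) E(1)] E(2) m YcD(1) by (intro van[OF pf_left[OF E(1)] _ u]) simp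
   thus ?thesis using m YcD(1)[OF u] by simp
  qed
  thus ?thesis using SXD(1)[OF YcD(2)[OF u]] unfolding SX_def by blast
 qed
 have "(%_. 1) \<in> poly_fun n" by (rule poly_fun.const)
 then obtain H where "homogenizes n x (%_. 1 :: complex) H" by (rule homogenize[OF x]) blast
 note H = homogenizesD[OF this, simplified]
 have m: "mtimes n (pm n y') z = pm n y' * z" if "z \<in> Cs n V" for z V
  using mtimes[OF perm_matrix_carrier lowuniD(1)[OF Cs_sub[OF that]]] .
 have "E (pm n y') = 0" if E: "E \<in> poly_fun n" "ALL b:Bor n. ALL b':Bor n. E (b * pm n y * b') = 0" for E
 proof -
  have 0: "E (mtimes n (pm n y') z) * H (mtimes n (pm n y') z) = 0" if z: "z \<in> Cs n (Inv n y')" for z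
  proof (cases "H (pm n y' * z) = 0")
   case False
   note S = cell_point[OF y' z]
   obtain u t where ut: "u \<in> Yc n x y'" "t \<in> Bor n" "pm n y' * z = pm n x * u * t"
    using chart_point[OF x S] False H(2)[OF SXD(2)[OF S]] by metis
   have "pm n y' * z \<in> SX n y" unfolding ut(3) by (rule SX_right[OF sub[OF ut(1)] ut(2)])
   thus ?thesis using SXD(3)[of "pm n y' * z" n y E] E m[OF z] by simp
  qed (simp add: m[OF z])
  have "~ (ALL z:Cs n (Inv n y'). H (mtimes n (pm n y') z) = 0)"
  proof
   assume 0: "ALL z:Cs n (Inv n y'). H (mtimes n (pm n y') z) = 0"
   have Z: "H (pm n y' * z) = 0" if "z \<in> Cs n (Inv n y')" for z using m[OF that] bspec[OF 0 that] by simp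
   have "pm n x \<in> SX n y'" using rle_iff_SX[OF x y'] le(1) by blast
   have "H (pm n x) = 0"
    by (rule cell_dense[OF y' H(1) _ _ \<open>pm n x \<in> SX n y'\<close>], rule H(3), assumption+, rule Z)
   thus False using H(4)[OF lowuni_one] perm_matrix_carrier[of n x] by simp
  qed
  hence "E (mtimes n (pm n y') (1\<^sub>m n)) = 0"
   using Cs_irreducible[OF pf_left[OF E(1)] pf_left[OF H(1)] 0] Cs_one by blast
  thus ?thesis using m[OF Cs_one] perm_matrix_carrier[of n y'] by simp
 qed
 hence "pm n y' \<in> SX n y" using perm_matrix_SL[OF y'] unfolding SX_def by blast
 thus False using rle_iff_SX[OF y' y] le(2) by blast
qed

text \<open>If \<open>xt\<close> is not below \<open>w\<close>, one of the minors that vanish on the Schubert variety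
 has the coordinate of \<open>t\<close> as its linear part.\<close>
lemma equation_non_edge:
 assumes x: "perm n x" and w: "perm n w" and le: "rle x w"
  and ij: "j < i" "i < n" and nle: "~ rle (sw x (Suc j) (Suc i)) w"
 shows "has_equation n (Yc n x w) (i, j)"
proof -
 have jn: "j < n" using ij by simp
 note Sp = Suc_pcol[OF x]
 have up: "x (Suc j) < x (Suc i)"
 proof (rule ccontr)
  assume "~ ?thesis"
  hence "rle (sw x (Suc j) (Suc i)) x"
   using rle_sw_down[of "Suc j" "Suc i" x] ij injD[OF permutes_inj[OF x], of "Suc j" "Suc i"] by (metis Suc_less_eq linorder_neqE_nat nat.inject less_irrefl)
  thus False using rle_trans le nle by blast
 qed
 obtain p q where "gap w (sw x (Suc j) (Suc i)) p q < 0" using nle unfolding rle_gap by (meson not_le)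
 moreover have "0 <= gap w x p q" using le unfolding rle_gap by blast
 ultimately have pq: "Suc j <= p" "p < Suc i" "x (Suc j) <= q" "q < x (Suc i)" "gap w x p q = 0"
  using gap_sw[of "Suc j" "Suc i" x w p q] ij up by (auto split: if_splits simp: of_bool_def)
 let ?r = "rk w p q"
 have p: "p <= n" using pq ij by simp
 let ?J = "{l. l < p & q <= pcol x l}"
 have "finite ?J" "card ?J = ?r" using card_rk[OF x p, of q] pq(5) by (auto simp: gap_def)
 then obtain h where h: "bij_betw h {..<?r} ?J" using ex_bij_betw_nat_finite[of ?J] by (metis atLeast0LessThan)
 have hJ: "h a < p" "q <= pcol x (h a)" if "a < ?r" for a using h that by (auto simp: bij_betw_def)
 have hinj: "h a = h b <-> a = b" if "a < ?r" "b < ?r" for a b using h that by (auto simp: bij_betw_def inj_on_def)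
 have hi: "h a ~= i" "h a < n" if "a < ?r" for a using hJ(1)[OF that] pq ij by auto
 have hj: "h a ~= j" if "a < ?r" for a using hJ(2)[OF that] Sp(1)[OF jn] pq(3) by auto
 define \<rho> where "\<rho> a = (if a < ?r then h a else i)" for a
 define \<gamma> where "\<gamma> a = (if a < ?r then h a else j)" for a
 have \<rho>: "\<rho> a < n" and \<gamma>: "\<gamma> a < p" for a using hi hJ ij pq unfolding \<rho>_def \<gamma>_def by auto
 have \<gamma>n: "\<gamma> a < n" for a using \<gamma>[of a] p by simp
 have \<rho>q: "q <= pcol x (\<rho> a)" for a using hJ Sp(1)[OF ij(2)] pq(4) unfolding \<rho>_def by auto
 define F where "F M = det (mat (Suc ?r) (Suc ?r) (%(a, c). mtimes n (pm n x) M $$ (pcol x (\<rho> a), \<gamma> c)))" for M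
 have Fpf: "F \<in> poly_fun n"
  unfolding F_def[abs_def] by (rule pf_left[OF pf_minor]) (use Sp(2)[OF \<rho>] \<gamma>n in auto)
 have F0: "F u = 0" if u: "u \<in> Yc n x w" for u
  unfolding F_def mtimes[OF perm_matrix_carrier lowuniD(1)[OF YcD(1)[OF u]]]
  by (rule minor_SX[OF w YcD(2)[OF u] p, of q]) (use \<rho>q Sp(2)[OF \<rho>] \<gamma> in auto)
 have Fc: "F (curve n s c) = det (mat (Suc ?r) (Suc ?r) (%(a, b). psgn x (\<rho> a) * curve n s c $$ (\<rho> a, \<gamma> b)))" for s c
  unfolding F_def
 proof (intro arg_cong[of _ _ det] cong_mat refl, clarify)
  fix a b
  have "mtimes n (pm n x) (curve n s c) $$ (pcol x (\<rho> a), \<gamma> b) = (SUM l<n. pm n x $$ (pcol x (\<rho> a), l) * curve n s c $$ (l, \<gamma> b))"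
   using Sp(2)[OF \<rho>] \<gamma>n by (simp add: mtimes_def)
  also have "\<dots> = pm n x $$ (pcol x (\<rho> a), \<rho> a) * curve n s c $$ (\<rho> a, \<gamma> b)"
   by (rule sum_one[OF \<rho>]) (use perm_matrix_entry[OF x Sp(2)[OF \<rho>]] pcol_inj[OF x \<rho>] in auto)
  finally show "mtimes n (pm n x) (curve n s c) $$ (pcol x (\<rho> a), \<gamma> b) = psgn x (\<rho> a) * curve n s c $$ (\<rho> a, \<gamma> b)"
   using perm_matrix_entry[OF x Sp(2)[OF \<rho>] \<rho>] by simp
 qed
 let ?a = "(PROD a<?r. psgn x (h a)) * psgn x i"
 have lin: "F (curve n s c) = (if s = (i, j) then ?a else 0) * c" if "s \<in> low n" for s c
 proof (cases "s = (i, j)")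
  case True
  have "F (curve n s c) = det (mat (Suc ?r) (Suc ?r) (%(a, b). if a = b then (if a < ?r then psgn x (h a) else psgn x i * c) else 0))"
   unfolding Fc True using hinj hi hj ij \<rho> \<gamma>n
   by (intro arg_cong[of _ _ det] cong_mat) (auto simp: curve_def \<rho>_def \<gamma>_def)
  thus ?thesis using True by (simp add: det_diag)
 next
  case False
  show ?thesis
  proof (cases "EX b<?r. s = (i, h b)")
   case True
   have "F (curve n s c) = 0"
    unfolding Fc by (rule det_zero_column[of _ "Suc ?r" ?r]) (use True hi hj ij \<open>j < n\<close> in \<open>auto simp: curve_def \<rho>_def \<gamma>_def\<close>)
   thus ?thesis using False by simp
  next
   case notrow: False
   have "F (curve n s c) = 0"
    unfolding Fc by (rule det_zero_row[of _ "Suc ?r" ?r]) (use notrow False hi hj ij \<open>j < n\<close> in \<open>auto simp: curve_def \<rho>_def \<gamma>_def\<close>)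
   thus ?thesis using False by simp
  qed
 qed
 have "((%c. F (curve n s c)) has_field_derivative (if s = (i, j) then ?a else 0)) (at 0)" if "s \<in> low n" for s
  unfolding lin[OF that] by (auto intro!: derivative_eq_intros)
 moreover have "?a ~= 0" using psgn_nz by (simp add: prod_zero_iff)
 ultimately show ?thesis unfolding has_equation_def using Fpf F0 by (intro bexI[of _ F] conjI ballI exI[of _ ?a])
qed

subsection \<open>Covers\<close>

text \<open>Under the transposition, inversions of the larger permutation other than \<open>(i, j)\<close> inject into
 inversions of the smaller one.\<close>
lemma len_cover:
 assumes y: "perm n y" and ij: "i < j" "y i < y j" "1 <= i" "j <= n" and no: "!!k. i < k ==> k < j ==> ~ (y i < y k & y k < y j)"
 shows "len n (sw y i j) <= Suc (len n y)"
proof -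
 let ?t = "transpose i j"
 let ?I = "%y. {(k, l). 1 <= k & k < l & l <= n & y l < y k}"
 let ?f = "%(k, l). if ?t k < ?t l then (?t k, ?t l) else (k, l)"
 have fin: "finite (?I y)" for y :: "nat => nat" by (rule finite_subset[of _ "{..n} \<times> {..n}"]) auto
 have "card (?I (sw y i j) - {(i, j)}) <= card (?I y)"
 proof (rule card_inj_on_le[OF _ _ fin])
  show "inj_on ?f (?I (sw y i j) - {(i, j)})"
  proof (rule inj_on_inverseI[where g = ?f])
   fix kl assume "kl \<in> ?I (sw y i j) - {(i, j)}"
   then obtain k l where "kl = (k, l)" "k < l" by auto
   thus "?f (?f kl) = kl" by (cases "?t k < ?t l") auto
  qed
  show "?f ` (?I (sw y i j) - {(i, j)}) \<subseteq> ?I y"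
  proof (rule image_subsetI)
   fix kl assume "kl \<in> ?I (sw y i j) - {(i, j)}"
   then obtain k l where kl: "1 <= k" "k < l" "l <= n" "(sw y i j) l < (sw y i j) k" "(k, l) ~= (i, j)" "kl = (k, l)" by blast
   have rng: "1 <= ?t k" "?t l <= n" using kl ij by (auto simp: transpose_def)
   show "?f kl \<in> ?I y"
   proof (cases "?t k < ?t l")
    case True
    thus ?thesis using kl rng by simp
   next
    case False
    hence "k = i & l < j | l = j & i < k" using kl ij by (auto simp: transpose_def split: if_splits)
    moreover have "y l ~= y i" "y k ~= y j" if "k = i & l < j | l = j & i < k"
     using that kl injD[OF permutes_inj[OF y], of l i] injD[OF permutes_inj[OF y], of k j] by auto
    ultimately have "y l < y k" using no[of l] no[of k] kl ij by (auto simp: transpose_def split: if_splits)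
    thus ?thesis using False kl by simp
   qed
  qed
 qed
 moreover have "card (?I (sw y i j)) <= Suc (card (?I (sw y i j) - {(i, j)}))"
  using diff_card_le_card_Diff[of "{(i, j)}" "?I (sw y i j)"] by simp
 ultimately show ?thesis unfolding len_def by linarith
qed

lemma edge_sub: assumes "edge w x i j" "i < k" "k < j" "x i < x k" "x k < x j" shows "edge w x i k"
 using assms unfolding edge_def posbox_def by auto

lemma cover_exists:
 assumes y: "perm n y" and w: "perm n w" and le: "rle y w" and ne: "y ~= w"
 shows "EX i j. edge w y i j & len n (sw y i j) <= Suc (len n y)"
proof -
 have ex: "EX d i j. edge w y i j & d = j - i" using rle_edge[OF y w le ne] by metis
 define d where "d = (LEAST d. EX i j. edge w y i j & d = j - i)"
 obtain i j where E: "edge w y i j" "d = j - i" using LeastI_ex[OF ex] unfolding d_def by blast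
 have "~ (y i < y k & y k < y j)" if "i < k" "k < j" for k
 proof
  assume "y i < y k & y k < y j"
  hence "edge w y i k" using edge_sub[OF E(1) that] by blast
  hence "d <= k - i" unfolding d_def by (intro Least_le) blast
  thus False using E(2) that by linarith
 qed
 hence "len n (sw y i j) <= Suc (len n y)" using edge_range[OF w y E(1)] by (intro len_cover[OF y]) auto
 thus ?thesis using E(1) by blast
qed

subsection \<open>Regularity of the local ring\<close>

locale schubert_germs = germs n "Yc n x w" \<iota> \<kappa>
 for n and x w :: "nat => nat" and \<iota> :: "complex mat => 'b" and \<kappa> +
 assumes x: "perm n x" and w: "perm n w" and xw: "rle x w"
begin

lemma dimension_le: "adep (Suc (len n w)) I"
proof -
 let ?V = "Inv n w" and ?g = "%z. mtimes n (pinvm n x) (mtimes n (pm n w) z)"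
 let ?Z = "Cs n ?V"
 have bd: "EX K. bdeg ?V ?Z K F" if "F \<in> poly_fun n" for F
 proof (rule bdeg_poly[OF finite_Inv that])
  fix i j assume ij: "i < n" "j < n" "(i, j) \<notin> ?V"
  show "EX c. ALL z:?Z. z $$ (i, j) = c"
   by (rule exI[of _ "if i = j then 1 else 0"]) (use ij in \<open>cases "i <= j"; auto simp: Cs_def lowuni_def\<close>)
 qed
 have sub: "(%z. F (?g z)) \<in> poly_fun n" if "F \<in> poly_fun n" for F by (rule pf_left[OF pf_left[OF that]])
 obtain K where K: "bdeg ?V ?Z K (%z. Dm n (?g z))" using bd[OF sub[OF pf_Dm]] by blast
 have g: "?g z = pinvm n x * (pm n w * z)" if "z \<in> ?Z" for z
  using lowuniD(1)[OF Cs_sub[OF that]] by (simp add: mtimes perm_matrix_carrier pinvm(3)[OF x] mult_carrier_mat[of _ n n _ n])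
 have "adep (Suc (card ?V)) I"
 proof (rule adep_param[OF finite_Inv K, of "%z. kap n (?g z)"])
  fix F assume F: "F \<in> poly_fun n"
  obtain N e where N: "N \<in> poly_fun n" "ALL M. Dm n M ~= 0 --> F (kap n M) * Dm n M ^ e = N M"
   using numerator_kap[OF F] by blast
  have e: "Dm n M ^ Suc e * F (kap n M) = Dm n M * N M" for M
   using N(2)[rule_format, of M, symmetric] by (cases "Dm n M = 0") auto
  obtain d where "bdeg ?V ?Z d (%z. Dm n (?g z) * N (?g z))" using bd[OF sub[OF pf(4)[OF pf_Dm N(1)]]] by blast
  thus "EX a d. bdeg ?V ?Z d (%z. Dm n (?g z) ^ a * F (kap n (?g z)))"
   by (intro exI[of _ "Suc e"] exI[of _ d]) (simp only: e)
 next
  fix F u assume F: "F \<in> poly_fun n" and 0: "!!z. z \<in> ?Z ==> Dm n (?g z) ~= 0 ==> F (kap n (?g z)) = 0" and u: "u \<in> Yc n x w"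
  obtain H where "homogenizes n x F H" using homogenize[OF x F] by blast
  note H = homogenizesD[OF this]
  have "H (pm n x * u) = 0"
  proof (rule cell_dense[OF w H(1) _ _ YcD(2)[OF u]], rule H(3), assumption+)
   fix z assume z: "z \<in> ?Z"
   show "H (pm n w * z) = 0" using 0[OF z] H(2)[OF SXD(2)[OF cell_point[OF w z]]] unfolding g[OF z] by blast
  qed
  thus "F u = 0" using H(4)[OF YcD(1)[OF u]] by simp
 qed
 thus ?thesis unfolding card_Inv[OF w] .
qed

definition chain_to :: "nat => complex mat set => bool" where
 "chain_to k Z \<equiv> (EX P. (ALL i<=k. fprime (P i)) & (ALL i<k. P i \<subset> P (Suc i)) & P 0 = vanish Z)"

lemma chain_Suc:
 assumes c: "chain_to k Z'" and Z: "irred Z" "vanish Z \<subset> vanish Z'" shows "chain_to (Suc k) Z"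
proof -
 obtain P where P: "ALL i<=k. fprime (P i)" "ALL i<k. P i \<subset> P (Suc i)" "P 0 = vanish Z'" using c unfolding chain_to_def by blast
 let ?P = "case_nat (vanish Z) P"
 have "fprime (?P i)" if "i <= Suc k" for i using that P(1) fprime_vanish[OF Z(1)] by (cases i) auto
 moreover have "?P i \<subset> ?P (Suc i)" if "i < Suc k" for i using that P(2,3) Z(2) by (cases i) auto
 ultimately show ?thesis unfolding chain_to_def by (intro exI[of _ ?P]) simp
qed

lemma irred_Cs: assumes "V \<subseteq> Inv n x" shows "irred (Cs n V)"
 unfolding irred_def
proof (intro conjI ballI impI)
 show "Cs n V \<subseteq> Yc n x w"
 proof
  fix u assume u: "u \<in> Cs n V"
  hence "u \<in> Cs n (Inv n x)" using assms unfolding Cs_def by blast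
  then obtain b where "b \<in> Bor n" "pm n x * u = b * pm n x" using cell_in_B[OF x] by blast
  hence "pm n x * u \<in> SX n w" using SX_left[of "pm n x" n w b] rle_iff_SX[OF x w] xw by simp
  thus "u \<in> Yc n x w" using Cs_sub[OF u] unfolding Yc_def by simp
 qed
qed (use Cs_one Cs_irreducible in auto)

lemma irred_Yc: assumes "perm n y" "rle x y" "rle y w" shows "irred (Yc n x y)"
 unfolding irred_def
proof (intro conjI ballI impI)
 have "SX n y \<subseteq> SX n w" using SX_mono rle_iff_SX[OF assms(1) w] assms(3) by blast
 thus "Yc n x y \<subseteq> Yc n x w" unfolding Yc_def by blast
qed (use one_in_Yc[OF x assms(1)] assms(2) Yc_irreducible[OF x assms(1)] in auto)

lemma chain_cell: assumes "V \<subseteq> Inv n x" shows "chain_to (card V) (Cs n V)"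
proof -
 have "finite V" using assms finite_Inv finite_subset by blast
 thus ?thesis using assms
 proof (induction V rule: finite_induct)
  case empty
  show ?case using fprime_vanish[OF irred_Cs[of "{}"]] unfolding chain_to_def by (intro exI[of _ "%_. vanish (Cs n {})"]) simp
 next
  case (insert v V)
  obtain i j where v: "v = (i, j)" "j < i" "i < n" using insert.prems unfolding Inv_def by blast
  have "vanish (Cs n (insert v V)) \<subset> vanish (Cs n V)"
  proof (rule vanish_strict[OF irred_Cs[OF insert.prems]])
   show "Cs n V \<subseteq> Cs n (insert v V)" unfolding Cs_def by auto
   show "(%u. u $$ (i, j)) \<in> poly_fun n" using v by (intro pf) auto
   show "ALL u:Cs n V. u $$ (i, j) = 0" using v insert.hyps(2) unfolding Cs_def by auto
   have "curve n (i, j) 1 \<in> Cs n (insert v V)" using curve_lowuni[OF v(2)] v unfolding Cs_def by (auto simp: curve_def)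
   thus "~ (ALL u:Cs n (insert v V). u $$ (i, j) = 0)" using v by (force simp: curve_def)
  qed
  thus ?case using chain_Suc[OF insert.IH irred_Cs[OF insert.prems]] insert by simp
 qed
qed

lemma chain_up:
 assumes "perm n y" "rle x y" "rle y w" "chain_to k (Yc n x y)"
 shows "EX k'>=k + (len n w - len n y). chain_to k' (Yc n x w)"
 using assms
proof (induction "depth n w y" arbitrary: y k rule: less_induct)
 case less
 note y = less.prems(1)
 show ?case
 proof (cases "y = w")
  case True
  thus ?thesis using less.prems(4) by auto
 next
  case False
  obtain i j where E: "edge w y i j" "len n (sw y i j) <= Suc (len n y)" using cover_exists[OF y w less.prems(3) False] by blast
  let ?y = "sw y i j"
  have y': "perm n ?y" using edge_permutes[OF w y E(1)] .
  have up: "rle y ?y" "rle ?y w" using edge_sw_le[OF less.prems(3) E(1)] rle_sw_up[of i j y] E(1) unfolding edge_def by auto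
  have xy: "rle x ?y" using rle_trans less.prems(2) up(1) by blast
  have "depth n w ?y < depth n w y" by (rule depth_sw[OF w y E(1)])
  moreover have "~ rle ?y y"
  by (meson E(1) edge_def not_rle_sw_up)
  then obtain F where F: "F \<in> poly_fun n" "ALL u:Yc n x y. F u = 0" "~ (ALL u:Yc n x ?y. F u = 0)"
   using Yc_separate[OF x y y' xy] by blast
  have "SX n y \<subseteq> SX n ?y" using SX_mono rle_iff_SX[OF y y'] up(1) by blast
  hence "Yc n x y \<subseteq> Yc n x ?y" unfolding Yc_def by blast
  hence "chain_to (Suc k) (Yc n x ?y)"
   using chain_Suc[OF less.prems(4) irred_Yc[OF y' xy up(2)]] vanish_strict[OF irred_Yc[OF y' xy up(2)] _ F] by blast
  ultimately obtain k' where "k' >= Suc k + (len n w - len n ?y)" "chain_to k' (Yc n x w)"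
   using less.hyps[OF _ y' xy up(2)] by blast
  thus ?thesis using E(2) by (intro exI[of _ k']) auto
 qed
qed

lemma dimension_ge: "EX k>=len n w. chain_to k (Yc n x w)"
proof -
 have 1: "chain_to (len n x) (Cs n (Inv n x))" using chain_cell[of "Inv n x"] card_Inv[OF x] by simp
 obtain P where P: "ALL i<=len n x. fprime (P i)" "ALL i<len n x. P i \<subset> P (Suc i)" "P 0 = vanish (Cs n (Inv n x))"
  using 1 unfolding chain_to_def by blast
 have "Cs n (Inv n x) \<subseteq> Yc n x x" using cell_point[OF x] Cs_sub unfolding Yc_def by blast
 hence sub: "vanish (Yc n x x) \<subseteq> vanish (Cs n (Inv n x))" unfolding vanish_def by blast
 let ?P = "P(0 := vanish (Yc n x x))"
 have "fprime (?P i)" if "i <= len n x" for i using that P(1) fprime_vanish[OF irred_Yc[OF x rle_refl xw]] by simp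
 moreover have "?P i \<subset> ?P (Suc i)" if "i < len n x" for i using that P(2,3) sub by (cases i) auto
 ultimately have "chain_to (len n x) (Yc n x x)" unfolding chain_to_def by (intro exI[of _ ?P]) simp
 from chain_up[OF x rle_refl xw this] obtain k where "len n x + (len n w - len n x) <= k" "chain_to k (Yc n x w)" by blast
 thus ?thesis by (intro exI[of _ k]) auto
qed

definition tangent :: "(nat \<times> nat) set" where
 "tangent = {(i, j). j < i & i < n & rle (sw x (Suc j) (Suc i)) w}"

lemma card_tangent: "card tangent = ntrans n w x"
 unfolding tangent_def ntrans_def by (rule card_pairs) simp

lemma tangent_curves: assumes "t \<in> tangent" shows "curve n t c \<in> Yc n x w"
proof -
 obtain i j where t: "t = (i, j)" "j < i" "i < n" "rle (sw x (Suc j) (Suc i)) w" using assms unfolding tangent_def by blast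
 have y: "sw x (Suc j) (Suc i) permutes {1..n}" using permutes_sw[OF x] t by simp
 have "pm n x * curve n (i, j) c \<in> SX n w"
 proof (cases "pcol x j < pcol x i")
  case True
  thus ?thesis using curve_SX[OF x y t(2,3) True] rle_iff_SX[OF y w] t(4) by blast
 next
  case False
  hence "(i, j) \<in> Inv n x" using t pcol_inj[OF x, of i j] unfolding Inv_def by force
  hence "curve n (i, j) c \<in> Cs n (Inv n x)" using curve_lowuni[OF t(2)] unfolding Cs_def by (auto simp: curve_def)
  then obtain b where "b \<in> Bor n" "pm n x * curve n (i, j) c = b * pm n x" using cell_in_B[OF x] by blast
  thus ?thesis using SX_left[of "pm n x" n w b] rle_iff_SX[OF x w] xw by simp
 qed
 thus ?thesis using curve_lowuni[OF t(2)] t(1) unfolding Yc_def by simp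
qed

text \<open>The number of tangent directions along curves is in any case the minimal number of generators of the
 maximal ideal, and the Krull dimension is \<open>len n w\<close>.\<close>
theorem regular_iff: "regular_local_ring RQ <-> ~ len n w < ntrans n w x"
proof
 have sub: "tangent \<subseteq> low n" unfolding tangent_def by auto
 show "~ len n w < ntrans n w x" if "regular_local_ring RQ"
  using regular_imp[OF that dimension_le sub tangent_curves] card_tangent by simp
 assume "~ len n w < ntrans n w x"
 hence eq: "card tangent = len n w" using ntrans_ge_len[OF x w xw] card_tangent by simp
 obtain k P where P: "len n w <= k" "ALL i<=k. fprime (P i)" "ALL i<k. P i \<subset> P (Suc i)"
  using dimension_ge unfolding chain_to_def by blast
 show "regular_local_ring RQ"
 proof (rule regular_if[of tangent P])
  show "adep (Suc (card tangent)) I" using dimension_le eq by simp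
  fix t assume "t \<in> low n - tangent"
  then obtain i j where t: "t = (i, j)" "j < i" "i < n" "~ rle (sw x (Suc j) (Suc i)) w" unfolding tangent_def by blast
  show "has_equation n (Yc n x w) t"
   unfolding t(1) by (rule equation_non_edge[OF x w xw t(2-4)])
 qed (use P eq sub tangent_curves in auto)
qed

end

section \<open>Topology of the flag variety\<close>

abbreviation \<pi> :: "nat => complex mat => complex mat set" where "\<pi> n g \<equiv> g <#\<^bsub>SL n\<^esub> Bor n"

abbreviation basic :: "nat => (complex mat => complex) => complex mat set set" where
 "basic n H \<equiv> \<pi> n ` {M \<in> SLc n. H M ~= 0}"

lemma pi_image: "\<pi> n g = (%b. g * b) ` Bor n"
 unfolding l_coset_def SL_def by auto

lemma pi_right: assumes "g \<in> Mat n" "t \<in> Bor n" shows "\<pi> n (g * t) = \<pi> n g"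
proof -
 have sub: "\<pi> n (h * t) \<subseteq> \<pi> n h" if "h \<in> Mat n" "t \<in> Bor n" for h t
  unfolding pi_image using that borelD(2) by (auto simp: assoc_mat intro!: imageI borel_mult)
 have "\<pi> n (g * t * adj_mat t) \<subseteq> \<pi> n (g * t)"
  using assms borelD(2)[OF assms(2)] by (intro sub borel_inverse) auto
 thus ?thesis using sub[OF assms] borel_cancel(1)[OF assms(2,1)] by simp
qed

lemma pi_eq: assumes "g \<in> Mat n" "h \<in> Mat n" "\<pi> n g = \<pi> n h" shows "EX t:Bor n. h = g * t"
proof -
 have "h * 1\<^sub>m n \<in> \<pi> n h" unfolding pi_image using borel_one by blast
 thus ?thesis using assms unfolding assms(3)[symmetric] pi_image by auto
qed

lemma translate_fixed_point: assumes "b \<in> Bor n" shows "b <#\<^bsub>SL n\<^esub> fixed_point n w = \<pi> n (b * pm n w)"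
 unfolding fixed_point_def l_coset_def SL_def using borelD(2)[OF assms] perm_matrix_carrier[of n w] borelD(2)
 by (auto simp: assoc_mat)

lemma SLcD: "M \<in> SLc n ==> M \<in> Mat n" unfolding SLc_def by simp

lemma topspace_zariski: "topspace (zariski_topology n) = Mat n"
proof
 show "topspace (zariski_topology n) \<subseteq> Mat n"
  using openin_topspace[of "zariski_topology n"] unfolding openin_zariski_topology by blast
 have "openin (zariski_topology n) (Mat n)"
  unfolding openin_zariski_topology by (rule exI[of _ "{%_. 1}"]) (auto intro: pf)
 thus "Mat n \<subseteq> topspace (zariski_topology n)" by (rule openin_subset)
qed

abbreviation flag :: "nat => complex mat set topology" where "flag n \<equiv> topo (flag_variety n)"

lemma openin_flag: "openin (flag n) V <-> V \<subseteq> \<pi> n ` SLc n &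
  (\<exists>F\<subseteq>poly_fun n. {M \<in> SLc n. \<pi> n M \<in> V} = {M \<in> SLc n. EX f:F. f M ~= 0})"
proof -
 have top: "topspace (subtopology (zariski_topology n) (SLc n)) = SLc n"
  using topspace_zariski SLcD by (auto simp: topspace_subtopology)
 have "openin (subtopology (zariski_topology n) (SLc n)) U <-> (\<exists>F\<subseteq>poly_fun n. U = {M \<in> SLc n. EX f:F. f M ~= 0})" for U
 proof -
  have e: "{A \<in> Mat n. EX f:F. f A ~= 0} \<inter> SLc n = {M \<in> SLc n. EX f:F. f M ~= 0}" for F :: "(complex mat => complex) set" using SLcD by blast
  thus ?thesis unfolding openin_subtopology openin_zariski_topology 
  by auto
 qed
 thus ?thesis
  unfolding flag_variety_def quotient_space_def sub_space_def matrix_space_def SL_carrier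
  by (simp add: openin_quotient_topology top del: topspace_subtopology)
qed

lemma reg_flag: "g \<in> reg (flag_variety n) V <-> (ALL M:{M \<in> SLc n. \<pi> n M \<in> V}. EX W h. openin (zariski_topology n) W & M \<in> W &
  h \<in> reg (matrix_space n) W & (ALL q:W \<inter> {M \<in> SLc n. \<pi> n M \<in> V}. g (\<pi> n q) = h q))"
proof -
 have t: "topspace (subtopology (zariski_topology n) (SLc n)) = SLc n"
  using topspace_zariski SLcD by (auto simp: topspace_subtopology)
 have m: "topo (matrix_space n) = zariski_topology n" unfolding matrix_space_def by simp
 show ?thesis
  unfolding flag_variety_def quotient_space_def sub_space_def SL_carrier
  by (simp only: fun_space.select_convs mem_Collect_eq o_def t m)
qed

lemma flag_nbhd:
 assumes "openin (flag n) V" "M \<in> SLc n" "\<pi> n M \<in> V"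
 obtains E where "E \<in> poly_fun n" "E M ~= 0" "ALL M:SLc n. E M ~= 0 --> \<pi> n M \<in> V"
proof -
 obtain F where F: "F \<subseteq> poly_fun n" "{M \<in> SLc n. \<pi> n M \<in> V} = {M \<in> SLc n. EX f:F. f M ~= 0}"
  using assms(1) unfolding openin_flag by blast
 obtain f where "f \<in> F" "f M ~= 0" using F(2) assms(2,3) by blast
 thus ?thesis using F by (intro that[of f]) blast+
qed

lemma zariski_nbhd:
 assumes "openin (zariski_topology n) V" "M \<in> V"
 obtains E where "E \<in> poly_fun n" "E M ~= 0" "ALL M:Mat n. E M ~= 0 --> M \<in> V"
proof -
 obtain F where F: "F \<subseteq> poly_fun n" "V = {M \<in> Mat n. EX f:F. f M ~= 0}"
  using assms(1) unfolding openin_zariski_topology by blast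
 obtain f where "f \<in> F" "f M ~= 0" using F(2) assms(2) by blast
 thus ?thesis using F by (intro that[of f]) blast+
qed

lemma flag_openI:
 fixes F :: "(complex mat => complex) set"
 assumes F: "F \<subseteq> poly_fun n" and inv: "!!M t f. M \<in> SLc n ==> t \<in> Bor n ==> f \<in> F ==> f M ~= 0 ==> EX f:F. f (M * t) ~= 0"
 defines "S \<equiv> {M \<in> SLc n. EX f:F. f M ~= 0}"
 shows "openin (flag n) (\<pi> n ` S)" "M \<in> SLc n ==> \<pi> n M \<in> \<pi> n ` S ==> M \<in> S"
proof -
 show mem: "M \<in> S" if M: "M \<in> SLc n" "\<pi> n M \<in> \<pi> n ` S" for M
 proof -
  obtain M' where M': "M' \<in> SLc n" "EX f:F. f M' ~= 0" "\<pi> n M = \<pi> n M'" using M(2) unfolding S_def by blast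
  then obtain t where t: "t \<in> Bor n" "M = M' * t" using pi_eq[OF SLcD SLcD, of M' n M] M(1) by auto
  thus ?thesis using inv[OF M'(1) t(1)] M'(2) M(1) unfolding S_def by blast
 qed
 hence "{M \<in> SLc n. \<pi> n M \<in> \<pi> n ` S} = S" unfolding S_def by blast
 thus "openin (flag n) (\<pi> n ` S)" unfolding openin_flag using F unfolding S_def by blast
qed

text \<open>Modulo the Borel subgroup, Zariski closures of cells and closures in the flag variety agree.\<close>
lemma schubert_iff:
 assumes w: "perm n w" and M: "M \<in> SLc n"
 shows "\<pi> n M \<in> schubert n w <-> M \<in> SX n w"
proof -
 have C: "(%b. b <#\<^bsub>SL n\<^esub> fixed_point n w) ` Bor n = (%b. \<pi> n (b * pm n w)) ` Bor n"
  by (rule image_cong[OF refl translate_fixed_point])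
 have cell: "b * pm n w \<in> SLc n" if "b \<in> Bor n" for b using SLc_mult[OF borelD(4)[OF that] perm_matrix_SL[OF w]] .
 show ?thesis
 proof
  assume cl: "\<pi> n M \<in> schubert n w"
  have "E M = 0" if E: "E \<in> poly_fun n" "ALL b:Bor n. ALL b':Bor n. E (b * pm n w * b') = 0" for E
  proof (rule ccontr)
   assume nz: "E M ~= 0"
   let ?F = "(%a M. E (mtimes n M a)) ` Bor n"
   have F: "?F \<subseteq> poly_fun n" using pf_right[OF E(1)] by blast
   have m: "mtimes n M a = M * a" if "M \<in> SLc n" "a \<in> Bor n" for M a using mtimes[OF SLcD[OF that(1)] borelD(2)[OF that(2)]] .
   have inv: "EX f:?F. f (M * t) ~= 0" if h: "M \<in> SLc n" "t \<in> Bor n" "f \<in> ?F" "f M ~= 0" for M t f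
   proof -
    obtain a where a: "a \<in> Bor n" "E (M * a) ~= 0" using h m by auto
    have a': "adj_mat t * a \<in> Bor n" using borel_mult[OF borel_inverse[OF h(2)] a(1)] .
    have "M * t * (adj_mat t * a) = M * t * adj_mat t * a"
     using assoc_mult_mat[OF SLcD[OF SLc_mult[OF h(1) borelD(4)[OF h(2)]]] borelD(2)[OF borel_inverse[OF h(2)]] borelD(2)[OF a(1)]] by simp
    hence "M * t * (adj_mat t * a) = M * a" using borel_cancel(1)[OF h(2) SLcD[OF h(1)]] by simp
    hence "E (mtimes n (M * t) (adj_mat t * a)) ~= 0" using m[OF SLc_mult[OF h(1) borelD(4)[OF h(2)]] a'] a(2) by simp
    thus ?thesis by (intro bexI[OF _ imageI[OF a']])
   qed
   let ?S = "{M \<in> SLc n. EX f:?F. f M ~= 0}"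
   have "M \<in> ?S" using M nz borel_one m[OF M borel_one] SLcD[OF M] by force
   hence 1: "\<pi> n M \<in> \<pi> n ` ?S & openin (flag n) (\<pi> n ` ?S)" 
    by (intro conjI imageI) (assumption, rule flag_openI(1)[OF F], rule inv)
   have "ALL T. \<pi> n M \<in> T & openin (flag n) T --> (EX y. y \<in> (%b. \<pi> n (b * pm n w)) ` Bor n & y \<in> T)"
    using cl unfolding schubert_def C in_closure_of by (rule conjunct2)
   from this[rule_format, OF 1] obtain y where y: "y \<in> (%b. \<pi> n (b * pm n w)) ` Bor n" "y \<in> \<pi> n ` ?S" by (elim exE conjE)
   from y(1) obtain b where b: "b \<in> Bor n" "\<pi> n (b * pm n w) \<in> \<pi> n ` ?S" by (rule imageE) (use y(2) that in simp)
   have "b * pm n w \<in> ?S" by (rule flag_openI(2)[OF F inv cell[OF b(1)] b(2)])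
   thus False using m[OF cell[OF b(1)]] E(2) b(1) by auto
  qed
  thus "M \<in> SX n w" using M unfolding SX_def by blast
 next
  assume S: "M \<in> SX n w"
  have "EX y. y \<in> (%b. \<pi> n (b * pm n w)) ` Bor n & y \<in> V" if V: "\<pi> n M \<in> V & openin (flag n) V" for V
  proof (rule ccontr)
   assume none: "~ ?thesis"
   obtain E where E: "E \<in> poly_fun n" "E M ~= 0" "ALL M:SLc n. E M ~= 0 --> \<pi> n M \<in> V"
    using flag_nbhd[OF conjunct2[OF V] M conjunct1[OF V]] .
   have "E (b * pm n w * b') = 0" if b: "b \<in> Bor n" "b' \<in> Bor n" for b b'
    using bspec[OF E(3) SLc_mult[OF cell[OF b(1)] borelD(4)[OF b(2)]]] pi_right[OF SLcD[OF cell[OF b(1)]] b(2)] none b(1) by blast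
   thus False using SXD(3)[OF S E(1)] E(2) by blast
  qed
  moreover have "\<pi> n M \<in> topspace (flag n)"
  proof -
   have "openin (flag n) (\<pi> n ` SLc n)"
    unfolding openin_flag using M by (intro conjI exI[of _ "{%_. 1}"]) (auto intro: pf)
   thus ?thesis using M openin_subset by blast
  qed
  ultimately show "\<pi> n M \<in> schubert n w" unfolding schubert_def C in_closure_of by blast
 qed
qed

lemma schubert_points:
 assumes w: "perm n w" and p: "p \<in> schubert n w"
 obtains x b where "perm n x" "rle x w" "b \<in> Bor n" "p = \<pi> n (b * pm n x)"
proof -
 have "p \<in> topspace (flag n)" using p unfolding schubert_def in_closure_of by blast
 then obtain M where M: "M \<in> SLc n" "p = \<pi> n M" using openin_topspace[of "flag n"] unfolding openin_flag by blast
 obtain x b b' where x: "perm n x" "b \<in> Bor n" "b' \<in> Bor n" "M = b * pm n x * b'" using bruhat_decomposition[OF M(1)] .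
 have S: "b * pm n x \<in> SLc n" using SLc_mult[OF borelD(4)[OF x(2)] perm_matrix_SL[OF x(1)]] .
 have e: "p = \<pi> n (b * pm n x)" unfolding M(2) x(4) by (rule pi_right[OF SLcD[OF S] x(3)])
 hence "b * pm n x \<in> SX n w" using schubert_iff[OF w S] p by simp
 from SX_left[OF this borel_inverse[OF x(2)]] have "pm n x \<in> SX n w"
  using borel_cancel(2)[OF x(2) perm_matrix_carrier, of x] by simp
 thus ?thesis using that[OF x(1) _ x(2) e] rle_iff_SX[OF x(1) w] by blast
qed

lemma point_in_schubert:
 assumes "perm n x" "perm n w" "b \<in> Bor n" "rle x w"
 shows "b * pm n x \<in> SLc n" "b * pm n x \<in> SX n w" "\<pi> n (b * pm n x) \<in> schubert n w"
proof -
 show 1: "b * pm n x \<in> SLc n" using SLc_mult[OF borelD(4)[OF assms(3)] perm_matrix_SL[OF assms(1)]] .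
 show "b * pm n x \<in> SX n w" using SX_left rle_iff_SX[OF assms(1,2)] assms(3,4) by blast
 thus "\<pi> n (b * pm n x) \<in> schubert n w" using schubert_iff[OF assms(2) 1] by blast
qed

theorem bruhat_le_iff_rle:
 assumes "perm n v" "perm n w" shows "bruhat_le n v w <-> rle v w"
proof
 have S: "pm n v \<in> SLc n" using perm_matrix_SL[OF assms(1)] .
 assume "bruhat_le n v w"
 hence "\<pi> n (pm n v) \<in> schubert n w" using schubert_iff[OF assms(1) S] pm_SX[OF assms(1)] unfolding bruhat_le_def by blast
 thus "rle v w" using schubert_iff[OF assms(2) S] rle_iff_SX[OF assms] by blast
next
 assume le: "rle v w"
 show "bruhat_le n v w" unfolding bruhat_le_def
 proof
  fix p assume "p \<in> schubert n v"
  then obtain x b where "perm n x" "rle x v" "b \<in> Bor n" "p = \<pi> n (b * pm n x)" by (rule schubert_points[OF assms(1)])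
  thus "p \<in> schubert n w" using point_in_schubert(3)[OF _ assms(2)] rle_trans le by blast
 qed
qed

section \<open>Local rings of Schubert varieties\<close>

locale schubert_point =
 fixes n and w x :: "nat => nat" and b :: "complex mat"
 assumes wp: "perm n w" and xp: "perm n x" and le: "rle x w" and b: "b \<in> Bor n"
begin

definition iot :: "complex mat => complex mat set" where "iot u = \<pi> n (b * pm n x * u)"

definition bk :: "complex mat => complex mat" where "bk M = pinvm n x * (adj_mat b * M)"

definition kp :: "complex mat set => complex mat" where "kp p = kap n (bk (SOME M. M \<in> p))"

abbreviation "pt \<equiv> \<pi> n (b * pm n x)"
abbreviation "SV \<equiv> schubert_variety n w"

lemma carriers: "b \<in> Mat n" "adj_mat b \<in> Mat n" "pinvm n x \<in> Mat n" "pm n x \<in> Mat n"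
 using borelD(2)[OF b] borelD(2)[OF borel_inverse[OF b]] pinvm(3)[OF xp] perm_matrix_carrier by auto

lemma kp: assumes "M \<in> Mat n" shows "kp (\<pi> n M) = kap n (bk M)"
proof -
 have "M * 1\<^sub>m n \<in> \<pi> n M" unfolding pi_image using borel_one by blast
 hence "(SOME M'. M' \<in> \<pi> n M) \<in> \<pi> n M" by (rule someI)
 then obtain t where t: "t \<in> Bor n" "(SOME M'. M' \<in> \<pi> n M) = M * t" unfolding pi_image by blast
 have "bk (M * t) = bk M * t" unfolding bk_def using carriers assms borelD(2)[OF t(1)] by (simp add: assoc_mat)
 thus ?thesis unfolding kp_def t(2) using kap_right[OF _ t(1), of "bk M"] carriers assms unfolding bk_def by simp
qed

lemma back_point: assumes "lowuni n u" shows "bk (b * pm n x * u) = u"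
proof -
 note u = lowuniD(1)[OF assms]
 have "adj_mat b * (b * pm n x * u) = pm n x * u"
  using borel_cancel(2)[OF b, of "pm n x * u"] carriers u by (simp add: assoc_mat)
 thus ?thesis unfolding bk_def using pinvm_cancel(1)[OF xp u] by simp
qed

lemma point_carrier: "lowuni n u ==> b * pm n x * u \<in> SLc n"
 using SLc_mult[OF point_in_schubert(1)[OF xp wp b le] lowuni_SL] .

lemma Yc_SX: "u \<in> Yc n x w ==> b * pm n x * u \<in> SX n w"
 using SX_left[OF YcD(2) b, of u x w] carriers lowuniD(1)[OF YcD(1), of u n x w] by (simp add: assoc_mat)

sublocale schubert_germs n x w iot kp
proof
 show "1\<^sub>m n \<in> Yc n x w" using one_in_Yc[OF xp wp] le by simp
 show "kp (iot u) = u" if "u \<in> Yc n x w" for u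
  unfolding iot_def kp[OF SLcD[OF point_carrier[OF YcD(1)[OF that]]]] back_point[OF YcD(1)[OF that]] by (rule kap_lowuni[OF YcD(1)[OF that]])
 show "u $$ (i, j) = (if i = j then 1 else 0)" if "u \<in> Yc n x w" "i < n" "j < n" "i <= j" for u i j
  using YcD(1)[OF that(1)] that unfolding lowuni_def by blast
qed (rule xp wp le)+

lemma openin_SV: "openin (topo SV) U <-> (EX V. openin (flag n) V & U = V \<inter> schubert n w)"
 unfolding schubert_variety_def sub_space_def by (simp add: openin_subtopology)

lemma pf_back: "F \<in> poly_fun n ==> (%M. F (mtimes n (pinvm n x) (mtimes n (adj_mat b) M))) \<in> poly_fun n"
 by (rule pf_left[OF pf_left])

lemma mt_back: "M \<in> Mat n ==> mtimes n (pinvm n x) (mtimes n (adj_mat b) M) = bk M"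
 unfolding bk_def using carriers by (simp add: mtimes mult_carrier_mat[of _ n n _ n])

text \<open>Basic neighbourhoods: a semi-invariant polynomial cuts out an open set on which a given
 polynomial in the coordinates does not vanish.\<close>
lemma basic_nbhd:
 assumes E: "E \<in> poly_fun n" "E (1\<^sub>m n) ~= 0"
 obtains H where "H \<in> poly_fun n" "openin (flag n) (basic n H)" "pt \<in> basic n H"
  "ALL M:SLc n. \<pi> n M \<in> basic n H --> H M ~= 0"
  "ALL M:Mat n. H M ~= 0 --> Dm n (bk M) ~= 0 & E (kap n (bk M)) ~= 0"
  "ALL p:basic n H \<inter> schubert n w. EX u:Yc n x w. p = iot u & E u ~= 0"
proof -
 obtain K where "homogenizes n x E K" using homogenize[OF xp E(1)] by blast
 note K = homogenizesD[OF this]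
 define H where "H M = K (mtimes n (adj_mat b) M)" for M
 have HK: "H M = K (adj_mat b * M)" if "M \<in> Mat n" for M unfolding H_def using that carriers by (simp add: mtimes)
 have Hpf: "H \<in> poly_fun n" unfolding H_def[abs_def] by (rule pf_left[OF K(1)])
 have SLb: "adj_mat b * M \<in> SLc n" if "M \<in> SLc n" for M using SLc_mult[OF borelD(4)[OF borel_inverse[OF b]] that] .
 have inv: "H (M * t) ~= 0" if h: "M \<in> SLc n" "t \<in> Bor n" "H M ~= 0" for M t
 proof
  note c = SLcD[OF h(1)] borelD(2)[OF h(2)] borelD(2)[OF borel_inverse[OF h(2)]]
  assume "H (M * t) = 0"
  hence "K (adj_mat b * M * t) = 0" using HK[of "M * t"] c carriers by (simp add: assoc_mat)
  hence "K (adj_mat b * M * t * adj_mat t) = 0" using K(3)[OF SLc_mult[OF SLb[OF h(1)] borelD(4)[OF h(2)]] borel_inverse[OF h(2)]] by blast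
  thus False using h(3) HK[OF c(1)] borel_cancel(1)[OF h(2) SLcD[OF SLb[OF h(1)]]] by simp
 qed
 have Hsub: "{H} \<subseteq> poly_fun n" using Hpf by simp
 have inv': "EX f:{H}. f (M * t) ~= 0" if "M \<in> SLc n" "t \<in> Bor n" "f \<in> {H}" "f M ~= 0" for M t f
  using inv[OF that(1,2)] that(3,4) by simp
 have Seq: "{M \<in> SLc n. EX f:{H}. f M ~= 0} = {M \<in> SLc n. H M ~= 0}" by simp
 have O: "openin (flag n) (basic n H)" by (rule flag_openI(1)[of "{H}" n, OF Hsub, unfolded Seq], rule inv')
 have mem: "H M ~= 0" if "M \<in> SLc n" "\<pi> n M \<in> basic n H" for M
 proof -
  have "M \<in> {M \<in> SLc n. H M ~= 0}" by (rule flag_openI(2)[of "{H}" n, OF Hsub, unfolded Seq, OF _ that], rule inv')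
  thus ?thesis by simp
 qed
 have "adj_mat b * (b * pm n x) = pm n x * 1\<^sub>m n" using borel_cancel(2)[OF b, of "pm n x"] carriers by simp
 hence "H (b * pm n x) ~= 0" using HK[of "b * pm n x"] K(4)[OF lowuni_one] E(2) carriers by simp
 hence pt: "pt \<in> basic n H" using point_in_schubert(1)[OF xp wp b le] by blast
 have kap: "Dm n (bk M) ~= 0 & E (kap n (bk M)) ~= 0" if "M \<in> Mat n" "H M ~= 0" for M
  using that K(2)[of "adj_mat b * M"] HK[OF that(1)] carriers unfolding bk_def by simp
 have "EX u:Yc n x w. p = iot u & E u ~= 0" if p: "p \<in> basic n H" "p \<in> schubert n w" for p
 proof -
  obtain M where M: "M \<in> SLc n" "H M ~= 0" "p = \<pi> n M" using p(1) by blast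
  have "M \<in> SX n w" using schubert_iff[OF wp M(1)] p(2) M(3) by simp
  hence S: "adj_mat b * M \<in> SX n w" using SX_left borel_inverse[OF b] by blast
  have k: "Dm n (pinvm n x * (adj_mat b * M)) ~= 0" "E (kap n (pinvm n x * (adj_mat b * M))) ~= 0" using kap[OF SLcD[OF M(1)] M(2)] unfolding bk_def by auto
  obtain u t where ut: "u \<in> Yc n x w" "t \<in> Bor n" "adj_mat b * M = pm n x * u * t" "kap n (pinvm n x * (adj_mat b * M)) = u"
   using chart_point[OF xp S k(1)] .
  note c = lowuniD(1)[OF YcD(1)[OF ut(1)]] borelD(2)[OF ut(2)]
  have "M = b * (adj_mat b * M)" using borel_cancel(4)[OF b SLcD[OF M(1)]] by simp
  also have "\<dots> = b * pm n x * u * t" unfolding ut(3) using c carriers by (simp add: assoc_mat)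
  finally have "p = iot u" unfolding M(3) iot_def using pi_right[OF SLcD[OF point_carrier[OF YcD(1)[OF ut(1)]]] ut(2)] by simp
  thus ?thesis using ut(1,4) k(2) by auto
 qed
 hence pts: "ALL p:basic n H \<inter> schubert n w. EX u:Yc n x w. p = iot u & E u ~= 0" by blast
 show ?thesis by (rule that[OF Hpf O pt _ _ pts]) (intro ballI impI, erule (1) mem, intro ballI impI, erule (1) kap)
qed

lemma nearly_open:
 assumes U: "openin (topo SV) U" "pt \<in> U"
 shows "nearly (%u. iot u \<in> U)"
proof -
 obtain V where V: "openin (flag n) V" "U = V \<inter> schubert n w" using U(1) unfolding openin_SV by blast
 have "pt \<in> V" using U(2) V(2) by blast
 obtain E where E: "E \<in> poly_fun n" "E (b * pm n x) ~= 0" "ALL M:SLc n. E M ~= 0 --> \<pi> n M \<in> V"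
  using flag_nbhd[OF V(1) point_in_schubert(1)[OF xp wp b le] \<open>pt \<in> V\<close>] .
 have m: "mtimes n (b * pm n x) u = b * pm n x * u" if "u \<in> Mat n" for u using carriers that by (simp add: mtimes)
 have "iot u \<in> U" if u: "u \<in> Yc n x w" "E (mtimes n (b * pm n x) u) ~= 0" for u
 proof -
  note S = point_carrier[OF YcD(1)[OF u(1)]]
  have "iot u \<in> V" unfolding iot_def using bspec[OF E(3) S] u(2) m[OF lowuniD(1)[OF YcD(1)[OF u(1)]]] by simp
  moreover have "iot u \<in> schubert n w" unfolding iot_def using schubert_iff[OF wp S] Yc_SX[OF u(1)] by simp
  ultimately show ?thesis using V(2) by blast
 qed
 moreover have "E (mtimes n (b * pm n x) (1\<^sub>m n)) ~= 0" using E(2) m[of "1\<^sub>m n"] carriers by simp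
 ultimately show ?thesis unfolding nearly_def by (intro bexI[OF _ pf_left[OF E(1), of "b * pm n x"]]) blast
qed

text \<open>Unfolds three layers of local extension: from the Schubert variety to the flag variety, to the group, and
 to quotients of polynomials.\<close>
lemma regular_germ: assumes "f \<in> carrier (regular_at SV pt)" shows "f \<in> A"
proof -
 let ?g = "b * pm n x"
 note gS = point_in_schubert(1)[OF xp wp b le]
 obtain U where U: "openin (topo SV) U" "pt \<in> U" "f \<in> reg SV U" using assms unfolding regular_at_def by auto
 have "ALL p:U. EX V g. openin (flag n) V & p \<in> V & g \<in> reg (flag_variety n) V & (ALL q:V \<inter> U. f q = g q)"
  using U(3) unfolding schubert_variety_def sub_space_def by simp
 from bspec[OF this U(2)] obtain V g where V: "openin (flag n) V" "pt \<in> V" "g \<in> reg (flag_variety n) V" "ALL q:V \<inter> U. f q = g q"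
  by (elim exE conjE) (rule that)
 from V(3)[unfolded reg_flag]
 have "EX W h. openin (zariski_topology n) W & ?g \<in> W & h \<in> reg (matrix_space n) W &
    (ALL q:W \<inter> {M \<in> SLc n. \<pi> n M \<in> V}. g (\<pi> n q) = h q)" by (rule bspec) (use gS V(2) in simp)
 then obtain W h where W: "openin (zariski_topology n) W" "?g \<in> W" "h \<in> reg (matrix_space n) W"
  "ALL q:W \<inter> {M \<in> SLc n. \<pi> n M \<in> V}. g (\<pi> n q) = h q"
  by (elim exE conjE) (rule that)
 obtain W' F G where W': "openin (zariski_topology n) W'" "?g \<in> W'" "F \<in> poly_fun n" "G \<in> poly_fun n"
   "ALL M:W' \<inter> W. G M ~= 0 & h M = F M / G M"
 proof -
  have "ALL A:W. EX V f g. openin (zariski_topology n) V & A \<in> V & f \<in> poly_fun n & g \<in> poly_fun n &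
   (ALL M:V \<inter> W. g M ~= 0 & h M = f M / g M)" using W(3) unfolding matrix_space_def by simp
  from bspec[OF this W(2)] show thesis by (elim exE conjE) (rule that)
 qed
 obtain E1 where E1: "E1 \<in> poly_fun n" "E1 ?g ~= 0" "ALL M:SLc n. E1 M ~= 0 --> \<pi> n M \<in> V"
  using flag_nbhd[OF V(1) gS V(2)] .
 obtain E2 where E2: "E2 \<in> poly_fun n" "E2 ?g ~= 0" "ALL M:Mat n. E2 M ~= 0 --> M \<in> W"
  using zariski_nbhd[OF W(1,2)] .
 obtain E3 where E3: "E3 \<in> poly_fun n" "E3 ?g ~= 0" "ALL M:Mat n. E3 M ~= 0 --> M \<in> W'"
  using zariski_nbhd[OF W'(1,2)] .
 let ?t = "mtimes n ?g"
 have m: "?t u = ?g * u" if "u \<in> Mat n" for u using carriers that by (simp add: mtimes)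
 have 1: "?t (1\<^sub>m n) = ?g" using m[of "1\<^sub>m n"] carriers by simp
 have n: "nearly (%u. E (?t u) ~= 0)" if "E \<in> poly_fun n" "E ?g ~= 0" for E
  using nearly_nz[OF pf_left[OF that(1)], of ?g] that(2) 1 by simp
 have "nearly (%u. f (iot u) = F (?t u) / G (?t u))"
 proof (rule nearly_mono[OF nearly_conj[OF nearly_open[OF U(1,2)] nearly_conj[OF n[OF E1(1,2)] nearly_conj[OF n[OF E2(1,2)] n[OF E3(1,2)]]]]])
  fix u assume u: "u \<in> Yc n x w" and h: "iot u \<in> U & E1 (?t u) ~= 0 & E2 (?t u) ~= 0 & E3 (?t u) ~= 0"
  note S = point_carrier[OF YcD(1)[OF u]]
  have t: "?t u = ?g * u" using m lowuniD(1)[OF YcD(1)[OF u]] by blast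
  have "\<pi> n (?g * u) \<in> V" "?g * u \<in> W" "?g * u \<in> W'" using h bspec[OF E1(3) S] bspec[OF E2(3) SLcD[OF S]] bspec[OF E3(3) SLcD[OF S]] unfolding t by auto
  thus "f (iot u) = F (?t u) / G (?t u)"
   using V(4)[rule_format, of "iot u"] W(4)[rule_format, of "?g * u"] W'(5)[rule_format, of "?g * u"] h S unfolding t iot_def by simp
 qed
 moreover have "G (?t (1\<^sub>m n)) ~= 0" unfolding 1 using W'(5)[rule_format, of ?g] W'(2) W(2) by simp
 ultimately show ?thesis using AI[OF pf_left[OF W'(3)] pf_left[OF W'(4)]] by simp
qed

text \<open>Read the fraction in the coordinates of the big cell; the quotient of two polynomials in the matrix
 entries arises by clearing leading minors.\<close>
lemma germ_regular: assumes f: "f \<in> A" shows "f \<in> carrier (regular_at SV pt)"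
proof -
 obtain P Q where P: "P \<in> poly_fun n" "Q \<in> poly_fun n" "Q (1\<^sub>m n) ~= 0" "nearly (%u. Q u ~= 0 & f (iot u) = P u / Q u)" using f by (rule AE)
 obtain E where E: "E \<in> poly_fun n" "E (1\<^sub>m n) ~= 0" "ALL u:Yc n x w. E u ~= 0 --> Q u ~= 0 & f (iot u) = P u / Q u"
  using P(4) unfolding nearly_def by blast
 have EQ: "(%u. E u * Q u) \<in> poly_fun n" "E (1\<^sub>m n) * Q (1\<^sub>m n) ~= 0" using E P by (auto intro: pf)
 obtain H where H: "H \<in> poly_fun n" "openin (flag n) (basic n H)" "pt \<in> basic n H"
  "ALL M:SLc n. \<pi> n M \<in> basic n H --> H M ~= 0"
  "ALL M:Mat n. H M ~= 0 --> Dm n (bk M) ~= 0 & E (kap n (bk M)) * Q (kap n (bk M)) ~= 0"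
  "ALL p:basic n H \<inter> schubert n w. EX u:Yc n x w. p = iot u & E u * Q u ~= 0"
  by (rule basic_nbhd[OF EQ])
 let ?V = "basic n H" and ?W = "{M \<in> Mat n. H M ~= 0}"
 let ?g = "%p. P (kp p) / Q (kp p)" and ?h = "%M. P (kap n (bk M)) / Q (kap n (bk M))"
 have Wo: "openin (zariski_topology n) ?W" unfolding openin_zariski_topology using H(1) by (intro exI[of _ "{H}"]) auto
 obtain N e where N: "N \<in> poly_fun n" "ALL M. Dm n M ~= 0 --> P (kap n M) * Dm n M ^ e = N M" using numerator_kap[OF P(1)] by blast
 obtain N' e' where N': "N' \<in> poly_fun n" "ALL M. Dm n M ~= 0 --> Q (kap n M) * Dm n M ^ e' = N' M" using numerator_kap[OF P(2)] by blast
 let ?s = "%M. mtimes n (pinvm n x) (mtimes n (adj_mat b) M)"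
 let ?F = "%M. N (?s M) * Dm n (?s M) ^ e'" and ?G = "%M. N' (?s M) * Dm n (?s M) ^ e"
 have FG: "?F \<in> poly_fun n" "?G \<in> poly_fun n" using pf_back[OF N(1)] pf_back[OF N'(1)] pf_back[OF pf_Dm] by (auto intro!: pf pf_power)
 have q: "?G M ~= 0 & ?h M = ?F M / ?G M" if M: "M \<in> ?W" for M
 proof -
  have D: "Dm n (bk M) ~= 0" "Q (kap n (bk M)) ~= 0" using H(5)[rule_format, of M] M by auto
  have s: "?s M = bk M" using mt_back M by blast
  have N1: "N (bk M) = P (kap n (bk M)) * Dm n (bk M) ^ e" "N' (bk M) = Q (kap n (bk M)) * Dm n (bk M) ^ e'"
   using N(2) N'(2) D(1) by auto
  show ?thesis unfolding s N1 using D by simp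
 qed
 have "?h \<in> reg (matrix_space n) ?W"
 proof -
  have "EX V f g. openin (zariski_topology n) V & M \<in> V & f \<in> poly_fun n & g \<in> poly_fun n &
   (ALL M:V \<inter> ?W. g M ~= 0 & ?h M = f M / g M)" if M: "M \<in> ?W" for M
   by (rule exI[of _ ?W], rule exI[of _ ?F], rule exI[of _ ?G]) (intro conjI[OF Wo] conjI[OF M] conjI[OF FG(1)] conjI[OF FG(2)] ballI q, blast)
  thus ?thesis unfolding matrix_space_def fun_space.simps by blast
 qed
 have g: "?g \<in> reg (flag_variety n) ?V"
 proof -
  have "EX W h. openin (zariski_topology n) W & M \<in> W & h \<in> reg (matrix_space n) W &
    (ALL q:W \<inter> {M \<in> SLc n. \<pi> n M \<in> ?V}. ?g (\<pi> n q) = h q)" if M: "M \<in> SLc n" "\<pi> n M \<in> ?V" for M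
   using Wo \<open>?h \<in> reg (matrix_space n) ?W\<close> H(4)[rule_format, OF M] SLcD[OF M(1)] kp[OF SLcD]
   by (intro exI[of _ ?W] exI[of _ ?h] conjI ballI) simp_all
  thus ?thesis unfolding reg_flag by simp
 qed
 have fg: "f q = ?g q" if "q \<in> ?V \<inter> schubert n w" for q
 by (metis (no_types, lifting) E(3) H(6) kappa_iota lambda_zero that)
 have "f \<in> reg SV (?V \<inter> schubert n w)"
  unfolding schubert_variety_def sub_space_def using H(2) g fg by (auto intro!: exI[of _ ?V] exI[of _ ?g])
 moreover have "openin (topo SV) (?V \<inter> schubert n w)" unfolding openin_SV using H(2) by blast
 moreover have "pt \<in> ?V \<inter> schubert n w" using H(3) point_in_schubert(3)[OF xp wp b le] by blast
 ultimately show ?thesis unfolding regular_at_def by auto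
qed

lemma carrier_A: "carrier (regular_at SV pt) = A" using regular_germ germ_regular by blast

lemma vanishing_I: "vanishing_at SV pt = I"
proof
 show "vanishing_at SV pt \<subseteq> I"
 proof
  fix f assume "f \<in> vanishing_at SV pt"
  then obtain U where U: "openin (topo SV) U" "pt \<in> U" "ALL x:U. f x = 0" unfolding vanishing_at_def by blast
  have "nearly (%u. f (iot u) = 0)" by (rule nearly_mono[OF nearly_open[OF U(1,2)]]) (use U(3) in blast)
  thus "f \<in> I" unfolding I_def by blast
 qed
 show "I \<subseteq> vanishing_at SV pt"
 proof
  fix f assume f: "f \<in> I"
  obtain E where E: "E \<in> poly_fun n" "E (1\<^sub>m n) ~= 0" "ALL u:Yc n x w. E u ~= 0 --> f (iot u) = 0"
   using f unfolding I_def nearly_def by blast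
  obtain H where H: "H \<in> poly_fun n" "openin (flag n) (basic n H)" "pt \<in> basic n H"
   "ALL M:SLc n. \<pi> n M \<in> basic n H --> H M ~= 0"
   "ALL M:Mat n. H M ~= 0 --> Dm n (bk M) ~= 0 & E (kap n (bk M)) ~= 0"
   "ALL p:basic n H \<inter> schubert n w. EX u:Yc n x w. p = iot u & E u ~= 0"
   by (rule basic_nbhd[OF E(1,2)])
  let ?U = "basic n H \<inter> schubert n w"
  have "openin (topo SV) ?U" unfolding openin_SV using H(2) by blast
  moreover have "pt \<in> ?U" using H(3) point_in_schubert(3)[OF xp wp b le] by blast
  moreover have "f p = 0" if "p \<in> ?U" for p using bspec[OF H(6) that] E(3) by blast
  ultimately show "f \<in> vanishing_at SV pt"
   unfolding vanishing_at_def carrier_A using I_sub_A[OF f] by blast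
 qed
qed

lemma local_ring_RQ: "local_ring SV pt = RQ"
by (metis (mono_tags, lifting) RA_def RQ_def carrier_A local_ring_def partial_object.select_convs(1) regular_at_def vanishing_I)

theorem singular_iff: "pt \<in> singular_locus SV <-> len n w < ntrans n w x"
proof -
 have "pt \<in> topspace (topo SV)"
 proof -
  have "nearly (%u. True)" unfolding nearly_def by (intro bexI[of _ "%_. 1"]) (auto intro: pf)
  have "openin (topo SV) (topspace (flag n) \<inter> schubert n w)" unfolding openin_SV by blast
  moreover have "pt \<in> topspace (flag n) \<inter> schubert n w"
   using point_in_schubert(3)[OF xp wp b le] closure_of_subset_topspace unfolding schubert_def by fast
  ultimately show ?thesis using openin_subset by blast
 qed
 thus ?thesis unfolding singular_locus_def mem_Collect_eq local_ring_RQ using regular_iff by blast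
qed

end

lemma singular_locus_sub: "singular_locus (schubert_variety n w) \<subseteq> schubert n w"
 unfolding singular_locus_def schubert_variety_def sub_space_def by auto

lemma below_maximal:
 assumes E: "finite E" "!!z. z \<in> E ==> perm n z" and z: "z \<in> E"
 shows "EX y:bruhat_maximal n E. rle z y"
proof -
 note B = bruhat_le_iff_rle[OF E(2) E(2)]
 let ?c = "%y. card {a \<in> E. rle y a}"
 have "z \<in> E & rle z z" using z rle_refl by blast
 from ex_has_least_nat[of "%y. y \<in> E & rle z y", OF this, of ?c]
 obtain y where y: "y \<in> E" "rle z y" "!!a. a \<in> E ==> rle z a ==> ?c y <= ?c a" by blast
 have max: "a = y" if a: "a \<in> E" "rle y a" for a
 proof (rule ccontr)
  assume "a ~= y"
  hence "~ rle a y" using rle_antisym[OF E(2)[OF a(1)] E(2)[OF y(1)]] a(2) by blast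
  hence "{b \<in> E. rle a b} \<subset> {b \<in> E. rle y b}" using a(2) rle_trans rle_refl y(1) by blast
  hence "?c a < ?c y" using E(1) by (intro psubset_card_mono) auto
  moreover have "?c y <= ?c a" using y(3)[OF a(1)] rle_trans[OF y(2) a(2)] by blast
  ultimately show False by simp
 qed
 have "y \<in> bruhat_maximal n E" unfolding bruhat_maximal_def using y(1) B max by blast
 thus ?thesis using y(2) by blast
qed

theorem theorem49:
  fixes n :: nat and w :: "nat \<Rightarrow> nat"
  assumes "w permutes {1..n}"
  shows "singular_locus (schubert_variety n w) = (\<Union>x \<in> bruhat_maximal n (E_set n w). schubert n x)"
proof -
 note w = assms
 have perm: "perm n z" if "z \<in> E_set n w" for z using that unfolding E_set_def by blast
 have "E_set n w \<subseteq> {z. perm n z}" using perm by blast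
 hence fin: "finite (E_set n w)" using finite_permutations[of "{1..n}"] finite_subset by blast
 have wit: "z \<in> E_set n w <-> wit4231 n w z | wit3412 n w z" if "perm n z" for z
  by (rule E_set_iff[OF w that bruhat_le_iff_rle])
 have le: "rle z w" if "z \<in> E_set n w" for z
 proof -
  have "EX y. bruhat_le n z y & bruhat_le n y w" using that unfolding E_set_def by blast
  hence "bruhat_le n z w" unfolding bruhat_le_def by blast
  thus ?thesis using bruhat_le_iff_rle[OF perm[OF that] w] by blast
 qed
 have sing: "\<pi> n (b * pm n x) \<in> singular_locus (schubert_variety n w) <-> len n w < ntrans n w x"
  if "perm n x" "rle x w" "b \<in> Bor n" for x b
 proof -
  interpret schubert_point n w x b by unfold_locales (use w that in auto)
  show ?thesis by (rule singular_iff)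
 qed
 show ?thesis
 proof (intro equalityI subsetI)
  fix p assume p: "p \<in> singular_locus (schubert_variety n w)"
  hence "p \<in> schubert n w" using singular_locus_sub by blast
  then obtain x b where x: "perm n x" "rle x w" "b \<in> Bor n" "p = \<pi> n (b * pm n x)" by (rule schubert_points[OF w])
  have "len n w < ntrans n w x" using p sing[OF x(1-3)] x(4) by simp
  then obtain z where z: "perm n z" "rle x z" "wit4231 n w z | wit3412 n w z" using singular_imp_wit[OF x(1) w x(2)] by blast
  obtain y where y: "y \<in> bruhat_maximal n (E_set n w)" "rle z y" using below_maximal[OF fin perm] wit[OF z(1)] z(3) by blast
  have "perm n y" using y(1) perm unfolding bruhat_maximal_def by blast
  hence "p \<in> schubert n y" unfolding x(4) using rle_trans[OF z(2) y(2)] by (intro point_in_schubert(3) x(1,3))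
  thus "p \<in> (\<Union>x \<in> bruhat_maximal n (E_set n w). schubert n x)" using y(1) by blast
 next
  fix p assume "p \<in> (\<Union>x \<in> bruhat_maximal n (E_set n w). schubert n x)"
  then obtain z where z: "z \<in> E_set n w" "p \<in> schubert n z" unfolding bruhat_maximal_def by blast
  note zp = perm[OF z(1)]
  obtain x b where x: "perm n x" "rle x z" "b \<in> Bor n" "p = \<pi> n (b * pm n x)" using z(2) by (rule schubert_points[OF zp])
  have "len n w < ntrans n w z" using wit_imp_singular[OF zp w le[OF z(1)]] wit[OF zp] z(1) by blast
  also have "\<dots> <= ntrans n w x" by (rule ntrans_antimono[OF x(1) zp w x(2) le[OF z(1)]])
  finally show "p \<in> singular_locus (schubert_variety n w)" unfolding x(4) using sing[OF x(1) rle_trans[OF x(2) le[OF z(1)]] x(3)] by simp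
 qed
qed

end
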